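(* Let $\mathcal{K}$ be a 2-category and $T$ a 2-monad on $\mathcal{K}$. The forgetful 2-functor $T\text{-}Alg_p\to\mathcal{K}$ creates PIE limits. For any PIE indexing pair $(\mathcal{A},\Sigma)$ expressing such a limit, the projections $\{\pi_{A_0}\}_{A_0\in\mathcal{A}_0}$ of the lifted limit are strict, and they jointly detect strictness.
   Context: **$T\text{-}Alg_p$.** Objects: strict $T$-algebras $(A,a:TA\to A)$. Arrows $(A,a)\to(B,b)$: (pseudo) morphisms $(f,\overline{f})$, with $f:A\to B$ in $\mathcal{K}$ and $\overline{f}:b\,Tf\Rightarrow f\,a$ an invertible 2-cell, subject to the usual coherence conditions: with $i,m$ the unit and multiplication of $T$, $\overline{f}\,i_A=id_f$ and $\overline{f}\,m_A=(\overline{f}\,Ta)\circ(b\,T\overline{f})$. Composition: $\overline{gf}=(g\,\overline{f})\circ(\overline{g}\,Tf)$. 2-cells $(f,\overline{f})\Rightarrow(g,\overline{g})$: 2-cells $\alpha:f\Rightarrow g$ of $\mathcal{K}$ with $(\alpha\,a)\circ\overline{f}=\overline{g}\circ(b\,T\alpha)$. A morphism is strict if $\overline{f}$ is an identity. A family of morphisms $p_i:L\to A_i$ jointly detects strictness if any morphism $z:Z\to L$ such that all composites $p_iz$ are strict is itself strict. **Indexing pairs.** An indexing pair $(\mathcal{A},\Sigma)$ is a 2-category $\mathcal{A}$ with a family $\Sigma$ of its arrows, closed under composition and containing all identities. It is PIE if, in the 1-subcategory of $\mathcal{A}$ given by all objects of $\mathcal{A}$ and the arrows of $\Sigma$, each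 connected component has an initial object. $\mathcal{A}_0$ denotes the family of these initial objects (one for each component). **$\sigma$-s-limits.** Let $F:\mathcal{A}\to\mathcal{B}$ be a 2-functor and $E\in\mathcal{B}$. A lax cone consists of arrows $\theta_A:E\to FA$ and 2-cells $\theta_f:Ff\,\theta_A\Rightarrow\theta_B$ (for $f:A\to B$) with $\theta_{id_A}=id_{\theta_A}$; $\theta_{gf}=\theta_g\circ Fg\,\theta_f$; and $\theta_f=\theta_g\circ F\gamma\,\theta_A$ for $\gamma:f\Rightarrow g$. A morphism $\alpha:\theta\to\theta'$ is a family $\alpha_A:\theta_A\Rightarrow\theta'_A$ with $\theta'_f\circ Ff\,\alpha_A=\alpha_B\circ\theta_f$. A $\sigma$-s-cone is a lax cone with $\theta_f$ an identity for every $f\in\Sigma$ (full subcategory). The $\sigma$-s-limit of $F$ with respect to $\Sigma$ is a universal $\sigma$-s-cone $\pi$ with vertex $L$: for each $E$, composition with $\pi$ is an isomorphism of categories from $\mathcal{B}(E,L)$ to the category of $\sigma$-s-cones with vertex $E$. The arrows $\pi_A$ are the projections. Op-lax cones, $\sigma$-s-opcones and $\sigma$-s-oplimits are defined analogously with the structural 2-cells reversed ($\theta_f:\theta_B\Rightarrow Ff\,\theta_A$). **PIE limits.** "PIE limit" means indistinctly a $\sigma$-s-limit or $\sigma$-s-oplimit with PIE indexing pair, or a weighted 2-limit $\{W,F\}$ with $W$ a PIE weight, i.e. $W:\mathcal{A}\to\mathcal{C}at$ such that, in the category with objects the pairs $(x,A)$, $A\in\mathcal{A}$, $x\in WA$,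 and arrows $(x,A)\to(y,B)$ the arrows $f:A\to B$ of $\mathcal{A}$ with $Wf(x)=y$, each connected component has an initial object. (Every PIE-weighted limit is a $\sigma$-s-limit, and also a $\sigma$-s-oplimit, with a PIE indexing pair.) **Creation.** The forgetful 2-functor $U:T\text{-}Alg_p\to\mathcal{K}$ creates a type of limits if, for any diagram $\overline{F}$ in $T\text{-}Alg_p$ such that the limit of $U\overline{F}$ of that type exists in $\mathcal{K}$, the limit of $\overline{F}$ of that type exists in $T\text{-}Alg_p$ and is preserved by $U$. The assertions about projections refer to the lifted limit cone (i.e. the limit cone in $\mathcal{K}$ lifts to a limit cone in $T\text{-}Alg_p$ with those properties). *)

theory Defs
  imports "HOL-Library.FuncSet"
begin

section \<open>Categories and 2-categories\<close>

record ('o, 'a) cat =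
  obj :: "'o set"
  arr :: "'a set"
  src :: "'a \<Rightarrow> 'o"
  tgt :: "'a \<Rightarrow> 'o"
  ide :: "'o \<Rightarrow> 'a"
  comp :: "'a \<Rightarrow> 'a \<Rightarrow> 'a"  (infixr "\<cdot>\<index>" 70)

text \<open>
  Composition is written in the order of application: \<open>g \<cdot> f\<close> is \<open>f\<close> followed by \<open>g\<close>.
\<close>

locale category =
  fixes C :: "('o, 'a, 'z) cat_scheme" (structure)
  assumes src_obj: "f \<in> arr C \<Longrightarrow> src C f \<in> obj C"
    and tgt_obj: "f \<in> arr C \<Longrightarrow> tgt C f \<in> obj C"
    and ide_arr: "x \<in> obj C \<Longrightarrow> ide C x \<in> arr C \<and> src C (ide C x) = x \<and> tgt C (ide C x) = x"
    and comp_arr: "\<lbrakk>f \<in> arr C; g \<in> arr C; tgt C f = src C g\<rbrakk>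
      \<Longrightarrow> g \<cdot> f \<in> arr C \<and> src C (g \<cdot> f) = src C f \<and> tgt C (g \<cdot> f) = tgt C g"
    and comp_ide_right: "f \<in> arr C \<Longrightarrow> f \<cdot> ide C (src C f) = f"
    and comp_ide_left: "f \<in> arr C \<Longrightarrow> ide C (tgt C f) \<cdot> f = f"
    and comp_assoc: "\<lbrakk>f \<in> arr C; g \<in> arr C; h \<in> arr C; tgt C f = src C g; tgt C g = src C h\<rbrakk>
      \<Longrightarrow> (h \<cdot> g) \<cdot> f = h \<cdot> (g \<cdot> f)"

definition hom :: "('o, 'a, 'z) cat_scheme \<Rightarrow> 'o \<Rightarrow> 'o \<Rightarrow> 'a set" where
  "hom C x y = {f \<in> arr C. src C f = x \<and> tgt C f = y}"

text \<open>
  In a 2-category, \<open>\<beta> \<bullet> \<alpha>\<close> is the vertical composite of 2-cells (\<open>\<alpha>\<close> first) and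
  \<open>\<beta> \<star> \<alpha>\<close> the horizontal one (\<open>\<alpha>\<close> first), while \<open>vsrc\<close>, \<open>vtgt\<close> are the arrows between which
  a 2-cell goes and \<open>vide f\<close> is the identity 2-cell of \<open>f\<close>.
\<close>

record ('o, 'a, 'c) cat2 = "('o, 'a) cat" +
  cell :: "'c set"
  vsrc :: "'c \<Rightarrow> 'a"
  vtgt :: "'c \<Rightarrow> 'a"
  vide :: "'a \<Rightarrow> 'c"
  vcomp :: "'c \<Rightarrow> 'c \<Rightarrow> 'c"  (infixr "\<bullet>\<index>" 65)
  hcomp :: "'c \<Rightarrow> 'c \<Rightarrow> 'c"  (infixr "\<star>\<index>" 70)

definition cells :: "('o, 'a, 'c) cat2 \<Rightarrow> 'a \<Rightarrow> 'a \<Rightarrow> 'c set" where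
  "cells C f g = {\<alpha> \<in> cell C. vsrc C \<alpha> = f \<and> vtgt C \<alpha> = g}"

locale two_category = category C for C :: "('o, 'a, 'c) cat2" (structure) +
  assumes vsrc_arr: "\<alpha> \<in> cell C \<Longrightarrow> vsrc C \<alpha> \<in> arr C"
    and vtgt_arr: "\<alpha> \<in> cell C \<Longrightarrow> vtgt C \<alpha> \<in> arr C"
    and cell_parallel: "\<alpha> \<in> cell C \<Longrightarrow>
      src C (vtgt C \<alpha>) = src C (vsrc C \<alpha>) \<and> tgt C (vtgt C \<alpha>) = tgt C (vsrc C \<alpha>)"
    and vide_cell: "f \<in> arr C \<Longrightarrow> vide C f \<in> cells C f f"
    and vcomp_cell: "\<lbrakk>\<alpha> \<in> cell C; \<beta> \<in> cell C; vtgt C \<alpha> = vsrc C \<beta>\<rbrakk>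
      \<Longrightarrow> \<beta> \<bullet> \<alpha> \<in> cells C (vsrc C \<alpha>) (vtgt C \<beta>)"
    and vcomp_vide_right: "\<alpha> \<in> cell C \<Longrightarrow> \<alpha> \<bullet> vide C (vsrc C \<alpha>) = \<alpha>"
    and vcomp_vide_left: "\<alpha> \<in> cell C \<Longrightarrow> vide C (vtgt C \<alpha>) \<bullet> \<alpha> = \<alpha>"
    and vcomp_assoc: "\<lbrakk>\<alpha> \<in> cell C; \<beta> \<in> cell C; \<gamma> \<in> cell C; vtgt C \<alpha> = vsrc C \<beta>; vtgt C \<beta> = vsrc C \<gamma>\<rbrakk>
      \<Longrightarrow> (\<gamma> \<bullet> \<beta>) \<bullet> \<alpha> = \<gamma> \<bullet> (\<beta> \<bullet> \<alpha>)"
    and hcomp_cell: "\<lbrakk>\<alpha> \<in> cell C; \<beta> \<in> cell C; tgt C (vsrc C \<alpha>) = src C (vsrc C \<beta>)\<rbrakk>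
      \<Longrightarrow> \<beta> \<star> \<alpha> \<in> cells C (vsrc C \<beta> \<cdot> vsrc C \<alpha>) (vtgt C \<beta> \<cdot> vtgt C \<alpha>)"
    and hcomp_ide_right: "\<alpha> \<in> cell C \<Longrightarrow> \<alpha> \<star> vide C (ide C (src C (vsrc C \<alpha>))) = \<alpha>"
    and hcomp_ide_left: "\<alpha> \<in> cell C \<Longrightarrow> vide C (ide C (tgt C (vsrc C \<alpha>))) \<star> \<alpha> = \<alpha>"
    and hcomp_assoc: "\<lbrakk>\<alpha> \<in> cell C; \<beta> \<in> cell C; \<gamma> \<in> cell C;
        tgt C (vsrc C \<alpha>) = src C (vsrc C \<beta>); tgt C (vsrc C \<beta>) = src C (vsrc C \<gamma>)\<rbrakk>
      \<Longrightarrow> (\<gamma> \<star> \<beta>) \<star> \<alpha> = \<gamma> \<star> (\<beta> \<star> \<alpha>)"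
    and hcomp_vide: "\<lbrakk>f \<in> arr C; g \<in> arr C; tgt C f = src C g\<rbrakk>
      \<Longrightarrow> vide C g \<star> vide C f = vide C (g \<cdot> f)"
    and interchange: "\<lbrakk>\<alpha> \<in> cell C; \<alpha>' \<in> cell C; \<beta> \<in> cell C; \<beta>' \<in> cell C;
        vtgt C \<alpha> = vsrc C \<alpha>'; vtgt C \<beta> = vsrc C \<beta>'; tgt C (vsrc C \<alpha>) = src C (vsrc C \<beta>)\<rbrakk>
      \<Longrightarrow> (\<beta>' \<bullet> \<beta>) \<star> (\<alpha>' \<bullet> \<alpha>) = (\<beta>' \<star> \<alpha>') \<bullet> (\<beta> \<star> \<alpha>)"

abbreviation whisk_l :: "'a \<Rightarrow> ('o, 'a, 'c) cat2 \<Rightarrow> 'c \<Rightarrow> 'c"  ("_ \<rhd>\<^bsub>_\<^esub> _" [75, 0, 75] 75) where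
  "g \<rhd>\<^bsub>C\<^esub> \<alpha> \<equiv> hcomp C (vide C g) \<alpha>"

abbreviation whisk_r :: "'c \<Rightarrow> ('o, 'a, 'c) cat2 \<Rightarrow> 'a \<Rightarrow> 'c"  ("_ \<lhd>\<^bsub>_\<^esub> _" [75, 0, 75] 75) where
  "\<alpha> \<lhd>\<^bsub>C\<^esub> f \<equiv> hcomp C \<alpha> (vide C f)"

definition identity_cell :: "('o, 'a, 'c) cat2 \<Rightarrow> 'c \<Rightarrow> bool" where
  "identity_cell C \<alpha> \<longleftrightarrow> (\<exists>f \<in> arr C. \<alpha> = vide C f)"

definition invertible_cell :: "('o, 'a, 'c) cat2 \<Rightarrow> 'c \<Rightarrow> bool" where
  "invertible_cell C \<alpha> \<longleftrightarrow> \<alpha> \<in> cell C \<and>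
     (\<exists>\<beta> \<in> cells C (vtgt C \<alpha>) (vsrc C \<alpha>).
        \<beta> \<bullet>\<^bsub>C\<^esub> \<alpha> = vide C (vsrc C \<alpha>) \<and> \<alpha> \<bullet>\<^bsub>C\<^esub> \<beta> = vide C (vtgt C \<alpha>))"

definition hom_cat :: "('o, 'a, 'c) cat2 \<Rightarrow> 'o \<Rightarrow> 'o \<Rightarrow> ('a, 'c) cat" where
  "hom_cat C x y =
     \<lparr>obj = hom C x y, arr = {\<alpha> \<in> cell C. vsrc C \<alpha> \<in> hom C x y},
      src = vsrc C, tgt = vtgt C, ide = vide C, comp = vcomp C\<rparr>"


section \<open>Functors and 2-functors\<close>

record ('o, 'a, 'p, 'b) fun1 =
  ob_map :: "'o \<Rightarrow> 'p"
  ar_map :: "'a \<Rightarrow> 'b"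

locale cat_functor =
  C: category C + D: category D
  for C :: "('o, 'a, 'y) cat_scheme" and D :: "('p, 'b, 'z) cat_scheme"
    and F :: "('o, 'a, 'p, 'b, 'w) fun1_scheme" +
  assumes ob_map_obj: "x \<in> obj C \<Longrightarrow> ob_map F x \<in> obj D"
    and ar_map_hom: "f \<in> arr C \<Longrightarrow> ar_map F f \<in> hom D (ob_map F (src C f)) (ob_map F (tgt C f))"
    and ar_map_ide: "x \<in> obj C \<Longrightarrow> ar_map F (ide C x) = ide D (ob_map F x)"
    and ar_map_comp: "\<lbrakk>f \<in> arr C; g \<in> arr C; tgt C f = src C g\<rbrakk>
      \<Longrightarrow> ar_map F (g \<cdot>\<^bsub>C\<^esub> f) = ar_map F g \<cdot>\<^bsub>D\<^esub> ar_map F f"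

definition iso_of_categories ::
  "('o, 'a, 'y) cat_scheme \<Rightarrow> ('p, 'b, 'z) cat_scheme \<Rightarrow> ('o, 'a, 'p, 'b, 'w) fun1_scheme \<Rightarrow> bool" where
  "iso_of_categories C D F \<longleftrightarrow> cat_functor C D F \<and>
     bij_betw (ob_map F) (obj C) (obj D) \<and> bij_betw (ar_map F) (arr C) (arr D)"

record ('o, 'a, 'c, 'p, 'b, 'd) fun2 = "('o, 'a, 'p, 'b) fun1" +
  cell_map :: "'c \<Rightarrow> 'd"

locale two_functor =
  C: two_category C + D: two_category D + cat_functor C D F
  for C :: "('o, 'a, 'c) cat2" and D :: "('p, 'b, 'd) cat2" and F :: "('o, 'a, 'c, 'p, 'b, 'd) fun2" +
  assumes cell_map_cells: "\<alpha> \<in> cell C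
      \<Longrightarrow> cell_map F \<alpha> \<in> cells D (ar_map F (vsrc C \<alpha>)) (ar_map F (vtgt C \<alpha>))"
    and cell_map_vide: "f \<in> arr C \<Longrightarrow> cell_map F (vide C f) = vide D (ar_map F f)"
    and cell_map_vcomp: "\<lbrakk>\<alpha> \<in> cell C; \<beta> \<in> cell C; vtgt C \<alpha> = vsrc C \<beta>\<rbrakk>
      \<Longrightarrow> cell_map F (\<beta> \<bullet>\<^bsub>C\<^esub> \<alpha>) = cell_map F \<beta> \<bullet>\<^bsub>D\<^esub> cell_map F \<alpha>"
    and cell_map_hcomp: "\<lbrakk>\<alpha> \<in> cell C; \<beta> \<in> cell C; tgt C (vsrc C \<alpha>) = src C (vsrc C \<beta>)\<rbrakk>
      \<Longrightarrow> cell_map F (\<beta> \<star>\<^bsub>C\<^esub> \<alpha>) = cell_map F \<beta> \<star>\<^bsub>D\<^esub> cell_map F \<alpha>"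

definition comp_fun2 ::
  "('p, 'b, 'd, 'q, 'e, 'f) fun2 \<Rightarrow> ('o, 'a, 'c, 'p, 'b, 'd) fun2 \<Rightarrow> ('o, 'a, 'c, 'q, 'e, 'f) fun2"
  (infixl "\<circ>\<^sub>2" 55) where
  "G \<circ>\<^sub>2 F = \<lparr>ob_map = ob_map G \<circ> ob_map F, ar_map = ar_map G \<circ> ar_map F,
              cell_map = cell_map G \<circ> cell_map F\<rparr>"

definition id_fun2 :: "('o, 'a, 'c, 'o, 'a, 'c) fun2" where
  "id_fun2 = \<lparr>ob_map = id, ar_map = id, cell_map = id\<rparr>"

locale two_natural =
  F: two_functor C D F + G: two_functor C D G
  for C :: "('o, 'a, 'c) cat2" and D :: "('p, 'b, 'd) cat2"
    and F :: "('o, 'a, 'c, 'p, 'b, 'd) fun2" and G :: "('o, 'a, 'c, 'p, 'b, 'd) fun2"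
    and \<tau> :: "'o \<Rightarrow> 'b" +
  assumes component: "x \<in> obj C \<Longrightarrow> \<tau> x \<in> hom D (ob_map F x) (ob_map G x)"
    and naturality: "f \<in> arr C
      \<Longrightarrow> ar_map G f \<cdot>\<^bsub>D\<^esub> \<tau> (src C f) = \<tau> (tgt C f) \<cdot>\<^bsub>D\<^esub> ar_map F f"
    and naturality2: "\<alpha> \<in> cell C
      \<Longrightarrow> cell_map G \<alpha> \<lhd>\<^bsub>D\<^esub> \<tau> (src C (vsrc C \<alpha>)) = \<tau> (tgt C (vsrc C \<alpha>)) \<rhd>\<^bsub>D\<^esub> cell_map F \<alpha>"


section \<open>The 2-category of categories\<close>

text \<open>
  The categories whose objects and arrows are drawn from fixed types \<open>'x\<close> and \<open>'y\<close> (of arbitrary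
  size).  Functors and transformations are kept extensional, so that they are equal
  as soon as they agree on the objects and arrows of their domain.
\<close>

datatype ('x, 'y) cfun =
  CFun (cf_dom: "('x, 'y) cat") (cf_cod: "('x, 'y) cat") (cf_ob: "'x \<Rightarrow> 'x") (cf_ar: "'y \<Rightarrow> 'y")

datatype ('x, 'y) cnat =
  CNat (cn_src: "('x, 'y) cfun") (cn_tgt: "('x, 'y) cfun") (cn_at: "'x \<Rightarrow> 'y")

definition CAT_arr :: "('x, 'y) cfun set" where
  "CAT_arr = {F. cat_functor (cf_dom F) (cf_cod F) \<lparr>ob_map = cf_ob F, ar_map = cf_ar F\<rparr> \<and>
     cf_ob F \<in> extensional (obj (cf_dom F)) \<and> cf_ar F \<in> extensional (arr (cf_dom F))}"

definition CAT_cell :: "('x, 'y) cnat set" where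
  "CAT_cell = {\<tau>. (let F = cn_src \<tau>; G = cn_tgt \<tau>; C = cf_dom F; D = cf_cod F in
     F \<in> CAT_arr \<and> G \<in> CAT_arr \<and> cf_dom G = C \<and> cf_cod G = D \<and>
     cn_at \<tau> \<in> extensional (obj C) \<and>
     (\<forall>x \<in> obj C. cn_at \<tau> x \<in> hom D (cf_ob F x) (cf_ob G x)) \<and>
     (\<forall>u \<in> arr C. cf_ar G u \<cdot>\<^bsub>D\<^esub> cn_at \<tau> (src C u) = cn_at \<tau> (tgt C u) \<cdot>\<^bsub>D\<^esub> cf_ar F u))}"

definition CAT_comp :: "('x, 'y) cfun \<Rightarrow> ('x, 'y) cfun \<Rightarrow> ('x, 'y) cfun" where
  "CAT_comp G F = CFun (cf_dom F) (cf_cod G)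
     (\<lambda>x \<in> obj (cf_dom F). cf_ob G (cf_ob F x)) (\<lambda>u \<in> arr (cf_dom F). cf_ar G (cf_ar F u))"

definition CAT :: "(('x, 'y) cat, ('x, 'y) cfun, ('x, 'y) cnat) cat2" where
  "CAT =
     \<lparr>obj = {C. category C}, arr = CAT_arr, src = cf_dom, tgt = cf_cod,
      ide = (\<lambda>C. CFun C C (\<lambda>x \<in> obj C. x) (\<lambda>u \<in> arr C. u)),
      comp = CAT_comp,
      cell = CAT_cell, vsrc = cn_src, vtgt = cn_tgt,
      vide = (\<lambda>F. CNat F F (\<lambda>x \<in> obj (cf_dom F). ide (cf_cod F) (cf_ob F x))),
      vcomp = (\<lambda>\<sigma> \<tau>. CNat (cn_src \<tau>) (cn_tgt \<sigma>)
        (\<lambda>x \<in> obj (cf_dom (cn_src \<tau>)). cn_at \<sigma> x \<cdot>\<^bsub>cf_cod (cn_src \<tau>)\<^esub> cn_at \<tau> x)),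
      hcomp = (\<lambda>\<sigma> \<tau>. CNat (CAT_comp (cn_src \<sigma>) (cn_src \<tau>)) (CAT_comp (cn_tgt \<sigma>) (cn_tgt \<tau>))
        (\<lambda>x \<in> obj (cf_dom (cn_src \<tau>)).
           cn_at \<sigma> (cf_ob (cn_tgt \<tau>) x) \<cdot>\<^bsub>cf_cod (cn_src \<sigma>)\<^esub> cf_ar (cn_src \<sigma>) (cn_at \<tau> x)))\<rparr>"


section \<open>Connected components and PIE indexing\<close>

definition connected :: "('o, 'a, 'z) cat_scheme \<Rightarrow> 'o \<Rightarrow> 'o \<Rightarrow> bool" where
  "connected C x y \<longleftrightarrow>
     x \<in> obj C \<and> y \<in> obj C \<and> (\<lambda>u v. hom C u v \<noteq> {} \<or> hom C v u \<noteq> {})\<^sup>*\<^sup>* x y"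

definition initial_in_component :: "('o, 'a, 'z) cat_scheme \<Rightarrow> 'o \<Rightarrow> bool" where
  "initial_in_component C x \<longleftrightarrow>
     x \<in> obj C \<and> (\<forall>y. connected C x y \<longrightarrow> (\<exists>!f. f \<in> hom C x y))"

definition components_have_initial :: "('o, 'a, 'z) cat_scheme \<Rightarrow> bool" where
  "components_have_initial C \<longleftrightarrow>
     (\<forall>x \<in> obj C. \<exists>x\<^sub>0. connected C x x\<^sub>0 \<and> initial_in_component C x\<^sub>0)"

text \<open>
  A choice of one initial object in each connected component.  The choice matters: a component may
  have several initial objects, and strictness of projections is only claimed for the chosen ones.
\<close>

definition initial_choice :: "('o, 'a, 'z) cat_scheme \<Rightarrow> 'o set \<Rightarrow> bool" where
  "initial_choice C I\<^sub>0 \<longleftrightarrow>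
     (\<forall>x \<in> I\<^sub>0. initial_in_component C x) \<and> (\<forall>x \<in> obj C. \<exists>!x\<^sub>0. x\<^sub>0 \<in> I\<^sub>0 \<and> connected C x x\<^sub>0)"

locale indexing_pair = two_category I for I :: "('i, 'j, 'k) cat2" +
  fixes \<Sigma> :: "'j set"
  assumes sub: "\<Sigma> \<subseteq> arr I"
    and ide_mem: "x \<in> obj I \<Longrightarrow> ide I x \<in> \<Sigma>"
    and comp_mem: "\<lbrakk>f \<in> \<Sigma>; g \<in> \<Sigma>; tgt I f = src I g\<rbrakk> \<Longrightarrow> g \<cdot>\<^bsub>I\<^esub> f \<in> \<Sigma>"

definition sigma_subcat :: "('i, 'j, 'k) cat2 \<Rightarrow> 'j set \<Rightarrow> ('i, 'j) cat" where
  "sigma_subcat I \<Sigma> =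
     \<lparr>obj = obj I, arr = \<Sigma>, src = src I, tgt = tgt I, ide = ide I, comp = comp I\<rparr>"

definition PIE_pair :: "('i, 'j, 'k) cat2 \<Rightarrow> 'j set \<Rightarrow> bool" where
  "PIE_pair I \<Sigma> \<longleftrightarrow> indexing_pair I \<Sigma> \<and> components_have_initial (sigma_subcat I \<Sigma>)"

type_synonym ('i, 'j, 'k, 'x, 'y) weight =
  "('i, 'j, 'k, ('x, 'y) cat, ('x, 'y) cfun, ('x, 'y) cnat) fun2"

text \<open>
  The category of elements of a weight \<open>W\<close> with only the arrows \<open>f\<close> such that \<open>Wf(x) = y\<close>: such an
  arrow \<open>(x,A) \<rightarrow> (y,B)\<close> is determined by \<open>x\<close> and \<open>f\<close>, and is encoded as the pair \<open>(x,f)\<close>.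
\<close>

definition elements :: "('i, 'j, 'k) cat2 \<Rightarrow> ('i, 'j, 'k, 'x, 'y) weight \<Rightarrow> ('x \<times> 'i, 'x \<times> 'j) cat" where
  "elements I W =
     \<lparr>obj = {(x, A). A \<in> obj I \<and> x \<in> obj (ob_map W A)},
      arr = {(x, f). f \<in> arr I \<and> x \<in> obj (ob_map W (src I f))},
      src = (\<lambda>(x, f). (x, src I f)),
      tgt = (\<lambda>(x, f). (cf_ob (ar_map W f) x, tgt I f)),
      ide = (\<lambda>(x, A). (x, ide I A)),
      comp = (\<lambda>(y, g) (x, f). (x, g \<cdot>\<^bsub>I\<^esub> f))\<rparr>"

definition PIE_weight :: "('i, 'j, 'k) cat2 \<Rightarrow> ('i, 'j, 'k, 'x, 'y) weight \<Rightarrow> bool" where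
  "PIE_weight I W \<longleftrightarrow> two_functor I CAT W \<and> components_have_initial (elements I W)"


section \<open>$\sigma$-s-limits and $\sigma$-s-oplimits\<close>

text \<open>
  A (lax or op-lax) cone is the pair of its families \<open>\<theta>\<^sub>A\<close> and \<open>\<theta>\<^sub>f\<close>, made extensional so that equality
  of cones is equality of the two families on objects and arrows of the index.
\<close>

type_synonym ('i, 'j, 'a, 'c) cone = "('i \<Rightarrow> 'a) \<times> ('j \<Rightarrow> 'c)"

definition lax_cone ::
  "('i, 'j, 'k) cat2 \<Rightarrow> ('o, 'a, 'c) cat2 \<Rightarrow> ('i, 'j, 'k, 'o, 'a, 'c) fun2 \<Rightarrow> 'o
    \<Rightarrow> ('i, 'j, 'a, 'c) cone \<Rightarrow> bool" where
  "lax_cone I B F E = (\<lambda>(\<theta>, \<theta>').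
     \<theta> \<in> extensional (obj I) \<and> \<theta>' \<in> extensional (arr I) \<and>
     (\<forall>A \<in> obj I. \<theta> A \<in> hom B E (ob_map F A)) \<and>
     (\<forall>f \<in> arr I. \<theta>' f \<in> cells B (ar_map F f \<cdot>\<^bsub>B\<^esub> \<theta> (src I f)) (\<theta> (tgt I f))) \<and>
     (\<forall>A \<in> obj I. \<theta>' (ide I A) = vide B (\<theta> A)) \<and>
     (\<forall>f \<in> arr I. \<forall>g \<in> arr I. tgt I f = src I g \<longrightarrow>
        \<theta>' (g \<cdot>\<^bsub>I\<^esub> f) = \<theta>' g \<bullet>\<^bsub>B\<^esub> (ar_map F g \<rhd>\<^bsub>B\<^esub> \<theta>' f)) \<and>
     (\<forall>\<gamma> \<in> cell I. \<theta>' (vsrc I \<gamma>) =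
        \<theta>' (vtgt I \<gamma>) \<bullet>\<^bsub>B\<^esub> (cell_map F \<gamma> \<lhd>\<^bsub>B\<^esub> \<theta> (src I (vsrc I \<gamma>)))))"

definition lax_cone_mor ::
  "('i, 'j, 'k) cat2 \<Rightarrow> ('o, 'a, 'c) cat2 \<Rightarrow> ('i, 'j, 'k, 'o, 'a, 'c) fun2
    \<Rightarrow> ('i, 'j, 'a, 'c) cone \<Rightarrow> ('i, 'j, 'a, 'c) cone \<Rightarrow> ('i \<Rightarrow> 'c) \<Rightarrow> bool" where
  "lax_cone_mor I B F \<theta> \<theta>' \<alpha> \<longleftrightarrow>
     \<alpha> \<in> extensional (obj I) \<and> (\<forall>A \<in> obj I. \<alpha> A \<in> cells B (fst \<theta> A) (fst \<theta>' A)) \<and>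
     (\<forall>f \<in> arr I. snd \<theta>' f \<bullet>\<^bsub>B\<^esub> (ar_map F f \<rhd>\<^bsub>B\<^esub> \<alpha> (src I f)) = \<alpha> (tgt I f) \<bullet>\<^bsub>B\<^esub> snd \<theta> f)"

definition oplax_cone ::
  "('i, 'j, 'k) cat2 \<Rightarrow> ('o, 'a, 'c) cat2 \<Rightarrow> ('i, 'j, 'k, 'o, 'a, 'c) fun2 \<Rightarrow> 'o
    \<Rightarrow> ('i, 'j, 'a, 'c) cone \<Rightarrow> bool" where
  "oplax_cone I B F E = (\<lambda>(\<theta>, \<theta>').
     \<theta> \<in> extensional (obj I) \<and> \<theta>' \<in> extensional (arr I) \<and>
     (\<forall>A \<in> obj I. \<theta> A \<in> hom B E (ob_map F A)) \<and>
     (\<forall>f \<in> arr I. \<theta>' f \<in> cells B (\<theta> (tgt I f)) (ar_map F f \<cdot>\<^bsub>B\<^esub> \<theta> (src I f))) \<and>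
     (\<forall>A \<in> obj I. \<theta>' (ide I A) = vide B (\<theta> A)) \<and>
     (\<forall>f \<in> arr I. \<forall>g \<in> arr I. tgt I f = src I g \<longrightarrow>
        \<theta>' (g \<cdot>\<^bsub>I\<^esub> f) = (ar_map F g \<rhd>\<^bsub>B\<^esub> \<theta>' f) \<bullet>\<^bsub>B\<^esub> \<theta>' g) \<and>
     (\<forall>\<gamma> \<in> cell I. \<theta>' (vtgt I \<gamma>) =
        (cell_map F \<gamma> \<lhd>\<^bsub>B\<^esub> \<theta> (src I (vsrc I \<gamma>))) \<bullet>\<^bsub>B\<^esub> \<theta>' (vsrc I \<gamma>)))"

definition oplax_cone_mor ::
  "('i, 'j, 'k) cat2 \<Rightarrow> ('o, 'a, 'c) cat2 \<Rightarrow> ('i, 'j, 'k, 'o, 'a, 'c) fun2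
    \<Rightarrow> ('i, 'j, 'a, 'c) cone \<Rightarrow> ('i, 'j, 'a, 'c) cone \<Rightarrow> ('i \<Rightarrow> 'c) \<Rightarrow> bool" where
  "oplax_cone_mor I B F \<theta> \<theta>' \<alpha> \<longleftrightarrow>
     \<alpha> \<in> extensional (obj I) \<and> (\<forall>A \<in> obj I. \<alpha> A \<in> cells B (fst \<theta> A) (fst \<theta>' A)) \<and>
     (\<forall>f \<in> arr I. (ar_map F f \<rhd>\<^bsub>B\<^esub> \<alpha> (src I f)) \<bullet>\<^bsub>B\<^esub> snd \<theta> f = snd \<theta>' f \<bullet>\<^bsub>B\<^esub> \<alpha> (tgt I f))"

definition sigma_cone ::
  "('i, 'j, 'k) cat2 \<Rightarrow> 'j set \<Rightarrow> ('o, 'a, 'c) cat2 \<Rightarrow> ('i, 'j, 'k, 'o, 'a, 'c) fun2 \<Rightarrow> 'o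
    \<Rightarrow> ('i, 'j, 'a, 'c) cone \<Rightarrow> bool" where
  "sigma_cone I \<Sigma> B F E \<theta> \<longleftrightarrow> lax_cone I B F E \<theta> \<and> (\<forall>f \<in> \<Sigma>. identity_cell B (snd \<theta> f))"

definition sigma_opcone ::
  "('i, 'j, 'k) cat2 \<Rightarrow> 'j set \<Rightarrow> ('o, 'a, 'c) cat2 \<Rightarrow> ('i, 'j, 'k, 'o, 'a, 'c) fun2 \<Rightarrow> 'o
    \<Rightarrow> ('i, 'j, 'a, 'c) cone \<Rightarrow> bool" where
  "sigma_opcone I \<Sigma> B F E \<theta> \<longleftrightarrow> oplax_cone I B F E \<theta> \<and> (\<forall>f \<in> \<Sigma>. identity_cell B (snd \<theta> f))"

definition cone_cat ::
  "('i, 'j, 'k) cat2 \<Rightarrow> ('o, 'a, 'c) cat2 \<Rightarrow> (('i, 'j, 'a, 'c) cone \<Rightarrow> bool)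
    \<Rightarrow> (('i, 'j, 'a, 'c) cone \<Rightarrow> ('i, 'j, 'a, 'c) cone \<Rightarrow> ('i \<Rightarrow> 'c) \<Rightarrow> bool)
    \<Rightarrow> (('i, 'j, 'a, 'c) cone,
        ('i, 'j, 'a, 'c) cone \<times> ('i, 'j, 'a, 'c) cone \<times> ('i \<Rightarrow> 'c)) cat" where
  "cone_cat I B cone mor =
     \<lparr>obj = {\<theta>. cone \<theta>},
      arr = {(\<theta>, \<theta>', \<alpha>). cone \<theta> \<and> cone \<theta>' \<and> mor \<theta> \<theta>' \<alpha>},
      src = (\<lambda>(\<theta>, \<theta>', \<alpha>). \<theta>), tgt = (\<lambda>(\<theta>, \<theta>', \<alpha>). \<theta>'),
      ide = (\<lambda>\<theta>. (\<theta>, \<theta>, \<lambda>A \<in> obj I. vide B (fst \<theta> A))),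
      comp = (\<lambda>(_, \<theta>'', \<beta>) (\<theta>, _, \<alpha>). (\<theta>, \<theta>'', \<lambda>A \<in> obj I. \<beta> A \<bullet>\<^bsub>B\<^esub> \<alpha> A))\<rparr>"

definition sigma_cone_cat where
  "sigma_cone_cat I \<Sigma> B F E = cone_cat I B (sigma_cone I \<Sigma> B F E) (lax_cone_mor I B F)"

definition sigma_opcone_cat where
  "sigma_opcone_cat I \<Sigma> B F E = cone_cat I B (sigma_opcone I \<Sigma> B F E) (oplax_cone_mor I B F)"

definition cone_precomp ::
  "('i, 'j, 'k) cat2 \<Rightarrow> ('o, 'a, 'c) cat2 \<Rightarrow> ('i, 'j, 'a, 'c) cone \<Rightarrow> 'a \<Rightarrow> ('i, 'j, 'a, 'c) cone" where
  "cone_precomp I B \<pi> h = (\<lambda>A \<in> obj I. fst \<pi> A \<cdot>\<^bsub>B\<^esub> h, \<lambda>f \<in> arr I. snd \<pi> f \<lhd>\<^bsub>B\<^esub> h)"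

definition cone_precomp_functor ::
  "('i, 'j, 'k) cat2 \<Rightarrow> ('o, 'a, 'c) cat2 \<Rightarrow> ('i, 'j, 'a, 'c) cone
    \<Rightarrow> ('a, 'c, ('i, 'j, 'a, 'c) cone,
        ('i, 'j, 'a, 'c) cone \<times> ('i, 'j, 'a, 'c) cone \<times> ('i \<Rightarrow> 'c)) fun1" where
  "cone_precomp_functor I B \<pi> =
     \<lparr>ob_map = cone_precomp I B \<pi>,
      ar_map = (\<lambda>\<beta>. (cone_precomp I B \<pi> (vsrc B \<beta>), cone_precomp I B \<pi> (vtgt B \<beta>),
                      \<lambda>A \<in> obj I. fst \<pi> A \<rhd>\<^bsub>B\<^esub> \<beta>))\<rparr>"

definition is_sigma_limit ::
  "('i, 'j, 'k) cat2 \<Rightarrow> 'j set \<Rightarrow> ('o, 'a, 'c) cat2 \<Rightarrow> ('i, 'j, 'k, 'o, 'a, 'c) fun2 \<Rightarrow> 'o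
    \<Rightarrow> ('i, 'j, 'a, 'c) cone \<Rightarrow> bool" where
  "is_sigma_limit I \<Sigma> B F L \<pi> \<longleftrightarrow> L \<in> obj B \<and> sigma_cone I \<Sigma> B F L \<pi> \<and>
     (\<forall>E \<in> obj B. iso_of_categories (hom_cat B E L) (sigma_cone_cat I \<Sigma> B F E)
        (cone_precomp_functor I B \<pi>))"

definition is_sigma_oplimit ::
  "('i, 'j, 'k) cat2 \<Rightarrow> 'j set \<Rightarrow> ('o, 'a, 'c) cat2 \<Rightarrow> ('i, 'j, 'k, 'o, 'a, 'c) fun2 \<Rightarrow> 'o
    \<Rightarrow> ('i, 'j, 'a, 'c) cone \<Rightarrow> bool" where
  "is_sigma_oplimit I \<Sigma> B F L \<pi> \<longleftrightarrow> L \<in> obj B \<and> sigma_opcone I \<Sigma> B F L \<pi> \<and>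
     (\<forall>E \<in> obj B. iso_of_categories (hom_cat B E L) (sigma_opcone_cat I \<Sigma> B F E)
        (cone_precomp_functor I B \<pi>))"

definition map_cone ::
  "('i, 'j, 'k) cat2 \<Rightarrow> ('o, 'a, 'c, 'p, 'b, 'd) fun2 \<Rightarrow> ('i, 'j, 'a, 'c) cone
    \<Rightarrow> ('i, 'j, 'b, 'd) cone" where
  "map_cone I U \<pi> = (\<lambda>A \<in> obj I. ar_map U (fst \<pi> A), \<lambda>f \<in> arr I. cell_map U (snd \<pi> f))"


section \<open>Weighted 2-limits\<close>

text \<open>
  A cylinder with vertex \<open>E\<close> is a 2-natural transformation \<open>W \<Rightarrow> B(E, F-)\<close>: its component at \<open>A\<close> is a
  functor \<open>W A \<rightarrow> B(E, F A)\<close>, here split as \<open>\<xi> A x\<close> (an arrow of \<open>B\<close>) on objects \<open>x\<close> and \<open>\<xi>' A u\<close>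
  (a 2-cell of \<open>B\<close>) on arrows \<open>u\<close>.  The functor \<open>B(E, F f)\<close> is composition with \<open>F f\<close>.  Arrows of
  cylinders are modifications.
\<close>

type_synonym ('i, 'x, 'y, 'a, 'c) cyl = "('i \<Rightarrow> 'x \<Rightarrow> 'a) \<times> ('i \<Rightarrow> 'y \<Rightarrow> 'c)"

definition w_ext :: "'i set \<Rightarrow> ('i \<Rightarrow> 'x set) \<Rightarrow> ('i \<Rightarrow> 'x \<Rightarrow> 'a) set" where
  "w_ext S X = {\<xi> \<in> extensional S. \<forall>A \<in> S. \<xi> A \<in> extensional (X A)}"

definition cylinder ::
  "('i, 'j, 'k) cat2 \<Rightarrow> ('i, 'j, 'k, 'x, 'y) weight \<Rightarrow> ('o, 'a, 'c) cat2
    \<Rightarrow> ('i, 'j, 'k, 'o, 'a, 'c) fun2 \<Rightarrow> 'o \<Rightarrow> ('i, 'x, 'y, 'a, 'c) cyl \<Rightarrow> bool" where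
  "cylinder I W B F E = (\<lambda>(\<xi>, \<xi>').
     \<xi> \<in> w_ext (obj I) (\<lambda>A. obj (ob_map W A)) \<and> \<xi>' \<in> w_ext (obj I) (\<lambda>A. arr (ob_map W A)) \<and>
     (\<forall>A \<in> obj I. cat_functor (ob_map W A) (hom_cat B E (ob_map F A)) \<lparr>ob_map = \<xi> A, ar_map = \<xi>' A\<rparr>) \<and>
     (\<forall>f \<in> arr I.
        (\<forall>x \<in> obj (ob_map W (src I f)).
           \<xi> (tgt I f) (cf_ob (ar_map W f) x) = ar_map F f \<cdot>\<^bsub>B\<^esub> \<xi> (src I f) x) \<and>
        (\<forall>u \<in> arr (ob_map W (src I f)).
           \<xi>' (tgt I f) (cf_ar (ar_map W f) u) = ar_map F f \<rhd>\<^bsub>B\<^esub> \<xi>' (src I f) u)) \<and>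
     (\<forall>\<gamma> \<in> cell I. \<forall>x \<in> obj (ob_map W (src I (vsrc I \<gamma>))).
        \<xi>' (tgt I (vsrc I \<gamma>)) (cn_at (cell_map W \<gamma>) x) =
        cell_map F \<gamma> \<lhd>\<^bsub>B\<^esub> \<xi> (src I (vsrc I \<gamma>)) x))"

definition modification ::
  "('i, 'j, 'k) cat2 \<Rightarrow> ('i, 'j, 'k, 'x, 'y) weight \<Rightarrow> ('o, 'a, 'c) cat2
    \<Rightarrow> ('i, 'j, 'k, 'o, 'a, 'c) fun2
    \<Rightarrow> ('i, 'x, 'y, 'a, 'c) cyl \<Rightarrow> ('i, 'x, 'y, 'a, 'c) cyl \<Rightarrow> ('i \<Rightarrow> 'x \<Rightarrow> 'c) \<Rightarrow> bool" where
  "modification I W B F \<xi> \<zeta> \<mu> \<longleftrightarrow>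
     \<mu> \<in> w_ext (obj I) (\<lambda>A. obj (ob_map W A)) \<and>
     (\<forall>A \<in> obj I. \<forall>x \<in> obj (ob_map W A). \<mu> A x \<in> cells B (fst \<xi> A x) (fst \<zeta> A x)) \<and>
     (\<forall>A \<in> obj I. \<forall>u \<in> arr (ob_map W A).
        snd \<zeta> A u \<bullet>\<^bsub>B\<^esub> \<mu> A (src (ob_map W A) u) = \<mu> A (tgt (ob_map W A) u) \<bullet>\<^bsub>B\<^esub> snd \<xi> A u) \<and>
     (\<forall>f \<in> arr I. \<forall>x \<in> obj (ob_map W (src I f)).
        \<mu> (tgt I f) (cf_ob (ar_map W f) x) = ar_map F f \<rhd>\<^bsub>B\<^esub> \<mu> (src I f) x)"

definition cylinder_cat ::
  "('i, 'j, 'k) cat2 \<Rightarrow> ('i, 'j, 'k, 'x, 'y) weight \<Rightarrow> ('o, 'a, 'c) cat2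
    \<Rightarrow> ('i, 'j, 'k, 'o, 'a, 'c) fun2 \<Rightarrow> 'o
    \<Rightarrow> (('i, 'x, 'y, 'a, 'c) cyl,
        ('i, 'x, 'y, 'a, 'c) cyl \<times> ('i, 'x, 'y, 'a, 'c) cyl \<times> ('i \<Rightarrow> 'x \<Rightarrow> 'c)) cat" where
  "cylinder_cat I W B F E =
     \<lparr>obj = {\<xi>. cylinder I W B F E \<xi>},
      arr = {(\<xi>, \<zeta>, \<mu>). cylinder I W B F E \<xi> \<and> cylinder I W B F E \<zeta> \<and> modification I W B F \<xi> \<zeta> \<mu>},
      src = (\<lambda>(\<xi>, \<zeta>, \<mu>). \<xi>), tgt = (\<lambda>(\<xi>, \<zeta>, \<mu>). \<zeta>),
      ide = (\<lambda>\<xi>. (\<xi>, \<xi>, \<lambda>A \<in> obj I. \<lambda>x \<in> obj (ob_map W A). vide B (fst \<xi> A x))),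
      comp = (\<lambda>(_, \<zeta>, \<nu>) (\<xi>, _, \<mu>).
        (\<xi>, \<zeta>, \<lambda>A \<in> obj I. \<lambda>x \<in> obj (ob_map W A). \<nu> A x \<bullet>\<^bsub>B\<^esub> \<mu> A x))\<rparr>"

definition cyl_precomp ::
  "('i, 'j, 'k) cat2 \<Rightarrow> ('i, 'j, 'k, 'x, 'y) weight \<Rightarrow> ('o, 'a, 'c) cat2
    \<Rightarrow> ('i, 'x, 'y, 'a, 'c) cyl \<Rightarrow> 'a \<Rightarrow> ('i, 'x, 'y, 'a, 'c) cyl" where
  "cyl_precomp I W B \<xi> h =
     (\<lambda>A \<in> obj I. \<lambda>x \<in> obj (ob_map W A). fst \<xi> A x \<cdot>\<^bsub>B\<^esub> h,
      \<lambda>A \<in> obj I. \<lambda>u \<in> arr (ob_map W A). snd \<xi> A u \<lhd>\<^bsub>B\<^esub> h)"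

definition cyl_precomp_functor ::
  "('i, 'j, 'k) cat2 \<Rightarrow> ('i, 'j, 'k, 'x, 'y) weight \<Rightarrow> ('o, 'a, 'c) cat2
    \<Rightarrow> ('i, 'x, 'y, 'a, 'c) cyl
    \<Rightarrow> ('a, 'c, ('i, 'x, 'y, 'a, 'c) cyl,
        ('i, 'x, 'y, 'a, 'c) cyl \<times> ('i, 'x, 'y, 'a, 'c) cyl \<times> ('i \<Rightarrow> 'x \<Rightarrow> 'c)) fun1" where
  "cyl_precomp_functor I W B \<xi> =
     \<lparr>ob_map = cyl_precomp I W B \<xi>,
      ar_map = (\<lambda>\<beta>. (cyl_precomp I W B \<xi> (vsrc B \<beta>), cyl_precomp I W B \<xi> (vtgt B \<beta>),
                      \<lambda>A \<in> obj I. \<lambda>x \<in> obj (ob_map W A). fst \<xi> A x \<rhd>\<^bsub>B\<^esub> \<beta>))\<rparr>"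

definition is_weighted_limit ::
  "('i, 'j, 'k) cat2 \<Rightarrow> ('i, 'j, 'k, 'x, 'y) weight \<Rightarrow> ('o, 'a, 'c) cat2
    \<Rightarrow> ('i, 'j, 'k, 'o, 'a, 'c) fun2 \<Rightarrow> 'o \<Rightarrow> ('i, 'x, 'y, 'a, 'c) cyl \<Rightarrow> bool" where
  "is_weighted_limit I W B F L \<xi> \<longleftrightarrow> L \<in> obj B \<and> cylinder I W B F L \<xi> \<and>
     (\<forall>E \<in> obj B. iso_of_categories (hom_cat B E L) (cylinder_cat I W B F E)
        (cyl_precomp_functor I W B \<xi>))"

definition map_cyl ::
  "('i, 'j, 'k) cat2 \<Rightarrow> ('i, 'j, 'k, 'x, 'y) weight \<Rightarrow> ('o, 'a, 'c, 'p, 'b, 'd) fun2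
    \<Rightarrow> ('i, 'x, 'y, 'a, 'c) cyl \<Rightarrow> ('i, 'x, 'y, 'b, 'd) cyl" where
  "map_cyl I W U \<xi> =
     (\<lambda>A \<in> obj I. \<lambda>x \<in> obj (ob_map W A). ar_map U (fst \<xi> A x),
      \<lambda>A \<in> obj I. \<lambda>u \<in> arr (ob_map W A). cell_map U (snd \<xi> A u))"


section \<open>Creation of limits\<close>

text \<open>
  \<open>creates I B U limB limC map_lim\<close>: the 2-functor \<open>U\<close> with domain \<open>B\<close> creates limits of a given type, of
  diagrams indexed by \<open>I\<close>.  Here \<open>limB F L \<pi>\<close> means that \<open>\<pi>\<close> is a universal cone (or cylinder) with vertex
  \<open>L\<close> for \<open>F\<close> in \<open>B\<close>, \<open>limC\<close> is the same notion in the codomain of \<open>U\<close>, and \<open>map_lim\<close> is the action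
  of \<open>U\<close> on cones.
\<close>

definition creates ::
  "('i, 'j, 'k) cat2 \<Rightarrow> ('o, 'a, 'c) cat2 \<Rightarrow> ('o, 'a, 'c, 'p, 'b, 'd) fun2
    \<Rightarrow> (('i, 'j, 'k, 'o, 'a, 'c) fun2 \<Rightarrow> 'o \<Rightarrow> 'u \<Rightarrow> bool)
    \<Rightarrow> (('i, 'j, 'k, 'p, 'b, 'd) fun2 \<Rightarrow> 'p \<Rightarrow> 'v \<Rightarrow> bool) \<Rightarrow> ('u \<Rightarrow> 'v) \<Rightarrow> bool" where
  "creates I B U limB limC map_lim \<longleftrightarrow>
     (\<forall>F. two_functor I B F \<and> (\<exists>L \<pi>. limC (U \<circ>\<^sub>2 F) L \<pi>) \<longrightarrow>
        (\<exists>L \<pi>. limB F L \<pi>) \<and>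
        (\<forall>L \<pi>. limB F L \<pi> \<longrightarrow> limC (U \<circ>\<^sub>2 F) (ob_map U L) (map_lim \<pi>)))"


section \<open>2-monads and their algebras\<close>

locale two_monad =
  two_natural K K id_fun2 T i + mult: two_natural K K "T \<circ>\<^sub>2 T" T m
  for K :: "('o, 'a, 'c) cat2" and T :: "('o, 'a, 'c, 'o, 'a, 'c) fun2"
    and i :: "'o \<Rightarrow> 'a" and m :: "'o \<Rightarrow> 'a" +
  assumes unit_left: "x \<in> obj K \<Longrightarrow> m x \<cdot>\<^bsub>K\<^esub> i (ob_map T x) = ide K (ob_map T x)"
    and unit_right: "x \<in> obj K \<Longrightarrow> m x \<cdot>\<^bsub>K\<^esub> ar_map T (i x) = ide K (ob_map T x)"
    and mult_assoc: "x \<in> obj K \<Longrightarrow> m x \<cdot>\<^bsub>K\<^esub> m (ob_map T x) = m x \<cdot>\<^bsub>K\<^esub> ar_map T (m x)"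

definition strict_alg ::
  "('o, 'a, 'c) cat2 \<Rightarrow> ('o, 'a, 'c, 'o, 'a, 'c) fun2 \<Rightarrow> ('o \<Rightarrow> 'a) \<Rightarrow> ('o \<Rightarrow> 'a) \<Rightarrow> ('o \<times> 'a) set" where
  "strict_alg K T i m = {(A, a). A \<in> obj K \<and> a \<in> hom K (ob_map T A) A \<and>
     a \<cdot>\<^bsub>K\<^esub> i A = ide K A \<and> a \<cdot>\<^bsub>K\<^esub> m A = a \<cdot>\<^bsub>K\<^esub> ar_map T a}"

text \<open>
  A pseudo morphism \<open>(f, f_bar)\<close> carries its domain and codomain algebras, and a 2-cell its
  source and target morphisms.
\<close>

datatype ('o, 'a, 'c) psmor =
  PsMor (ps_dom: "'o \<times> 'a") (ps_cod: "'o \<times> 'a") (ps_arr: 'a) (ps_cell: 'c)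

datatype ('o, 'a, 'c) algcell =
  AlgCell (ac_src: "('o, 'a, 'c) psmor") (ac_tgt: "('o, 'a, 'c) psmor") (ac_cell: 'c)

definition ps_mor ::
  "('o, 'a, 'c) cat2 \<Rightarrow> ('o, 'a, 'c, 'o, 'a, 'c) fun2 \<Rightarrow> ('o \<Rightarrow> 'a) \<Rightarrow> ('o \<Rightarrow> 'a)
    \<Rightarrow> ('o, 'a, 'c) psmor set" where
  "ps_mor K T i m = {PsMor (A, a) (B, b) f f' | A a B b f f'.
     (A, a) \<in> strict_alg K T i m \<and> (B, b) \<in> strict_alg K T i m \<and> f \<in> hom K A B \<and>
     f' \<in> cells K (b \<cdot>\<^bsub>K\<^esub> ar_map T f) (f \<cdot>\<^bsub>K\<^esub> a) \<and> invertible_cell K f' \<and>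
     f' \<lhd>\<^bsub>K\<^esub> i A = vide K f \<and>
     f' \<lhd>\<^bsub>K\<^esub> m A = (f' \<lhd>\<^bsub>K\<^esub> ar_map T a) \<bullet>\<^bsub>K\<^esub> (b \<rhd>\<^bsub>K\<^esub> cell_map T f')}"

definition ps_comp ::
  "('o, 'a, 'c) cat2 \<Rightarrow> ('o, 'a, 'c, 'o, 'a, 'c) fun2
    \<Rightarrow> ('o, 'a, 'c) psmor \<Rightarrow> ('o, 'a, 'c) psmor \<Rightarrow> ('o, 'a, 'c) psmor" where
  "ps_comp K T g f = PsMor (ps_dom f) (ps_cod g) (ps_arr g \<cdot>\<^bsub>K\<^esub> ps_arr f)
     ((ps_arr g \<rhd>\<^bsub>K\<^esub> ps_cell f) \<bullet>\<^bsub>K\<^esub> (ps_cell g \<lhd>\<^bsub>K\<^esub> ar_map T (ps_arr f)))"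

definition alg_cell ::
  "('o, 'a, 'c) cat2 \<Rightarrow> ('o, 'a, 'c, 'o, 'a, 'c) fun2 \<Rightarrow> ('o \<Rightarrow> 'a) \<Rightarrow> ('o \<Rightarrow> 'a)
    \<Rightarrow> ('o, 'a, 'c) algcell set" where
  "alg_cell K T i m = {AlgCell f g \<alpha> | f g \<alpha>.
     f \<in> ps_mor K T i m \<and> g \<in> ps_mor K T i m \<and> ps_dom g = ps_dom f \<and> ps_cod g = ps_cod f \<and>
     \<alpha> \<in> cells K (ps_arr f) (ps_arr g) \<and>
     (\<alpha> \<lhd>\<^bsub>K\<^esub> snd (ps_dom f)) \<bullet>\<^bsub>K\<^esub> ps_cell f = ps_cell g \<bullet>\<^bsub>K\<^esub> (snd (ps_cod f) \<rhd>\<^bsub>K\<^esub> cell_map T \<alpha>)}"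

definition TAlg ::
  "('o, 'a, 'c) cat2 \<Rightarrow> ('o, 'a, 'c, 'o, 'a, 'c) fun2 \<Rightarrow> ('o \<Rightarrow> 'a) \<Rightarrow> ('o \<Rightarrow> 'a)
    \<Rightarrow> ('o \<times> 'a, ('o, 'a, 'c) psmor, ('o, 'a, 'c) algcell) cat2" where
  "TAlg K T i m =
     \<lparr>obj = strict_alg K T i m, arr = ps_mor K T i m, src = ps_dom, tgt = ps_cod,
      ide = (\<lambda>(A, a). PsMor (A, a) (A, a) (ide K A) (vide K a)),
      comp = ps_comp K T,
      cell = alg_cell K T i m, vsrc = ac_src, vtgt = ac_tgt,
      vide = (\<lambda>f. AlgCell f f (vide K (ps_arr f))),
      vcomp = (\<lambda>\<beta> \<alpha>. AlgCell (ac_src \<alpha>) (ac_tgt \<beta>) (ac_cell \<beta> \<bullet>\<^bsub>K\<^esub> ac_cell \<alpha>)),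
      hcomp = (\<lambda>\<beta> \<alpha>. AlgCell (ps_comp K T (ac_src \<beta>) (ac_src \<alpha>)) (ps_comp K T (ac_tgt \<beta>) (ac_tgt \<alpha>))
                 (ac_cell \<beta> \<star>\<^bsub>K\<^esub> ac_cell \<alpha>))\<rparr>"

definition forget :: "('o \<times> 'a, ('o, 'a, 'c) psmor, ('o, 'a, 'c) algcell, 'o, 'a, 'c) fun2" where
  "forget = \<lparr>ob_map = fst, ar_map = ps_arr, cell_map = ac_cell\<rparr>"

definition strict_mor :: "('o, 'a, 'c) cat2 \<Rightarrow> ('o, 'a, 'c) psmor \<Rightarrow> bool" where
  "strict_mor K f \<longleftrightarrow> identity_cell K (ps_cell f)"

definition jointly_detect_strictness ::
  "('o, 'a, 'c) cat2 \<Rightarrow> ('o, 'a, 'c, 'o, 'a, 'c) fun2 \<Rightarrow> ('o \<Rightarrow> 'a) \<Rightarrow> ('o \<Rightarrow> 'a)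
    \<Rightarrow> 'o \<times> 'a \<Rightarrow> 's set \<Rightarrow> ('s \<Rightarrow> ('o, 'a, 'c) psmor) \<Rightarrow> bool" where
  "jointly_detect_strictness K T i m L S p \<longleftrightarrow>
     (\<forall>z \<in> arr (TAlg K T i m). tgt (TAlg K T i m) z = L \<and>
        (\<forall>s \<in> S. strict_mor K (p s \<cdot>\<^bsub>TAlg K T i m\<^esub> z)) \<longrightarrow> strict_mor K z)"

end

theory Submission
  imports Defs
begin

text \<open>
  Let \<open>\<pi>\<close> be the limit cone in \<open>K\<close>, with vertex \<open>L\<close>, of a diagram of algebras \<open>(A, a)\<close>.  The arrows
  \<open>a \<cdot> T \<pi>\<^sub>A\<close> form a lax cone with vertex \<open>T L\<close>; its 2-cells at the arrows of \<open>\<Sigma>\<close> are built from the structure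
  2-cells of pseudo morphisms, so they are invertible but not identities.  The PIE condition says that such a cone is
  isomorphic to a \<open>\<sigma>\<close>-cone, by a unique isomorphism that is the identity at the chosen initial objects
  (transport along the arrows out of these objects).  The arrow \<open>l : T L \<rightarrow> L\<close> induced by that \<open>\<sigma>\<close>-cone is the
  algebra structure, and the isomorphism makes the projections pseudo morphisms, strict at the initial objects.  The
  algebra axioms, the coherence of the projections and the detection of strictness all follow from the uniqueness of
  the isomorphism, and the universal property in algebras from the one in \<open>K\<close>.
\<close>

section \<open>Whiskering and invertible 2-cells\<close>

text \<open>The obstacle is strictness. An arbitrary isomorphism from a \<open>\<sigma>\<close>-cone
  to the lifted cone would in general give only a pseudo-algebra on \<open>L\<close>, with axioms up
  to isomorphism. Requiring identities at the chosen initial objects leaves no freedom, so two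
  arrows into \<open>L\<close> obtained from the same cone are equal and not just isomorphic. Each
  equation is proved by presenting its two sides as straightenings of one cone: \<open>\<pi>\<close>
  itself for the unit axiom, the lifted cone restricted along the multiplication for associativity,
  and the limit cone restricted along \<open>h \<cdot> a\<close> for the detection of strictness at
  a morphism \<open>(h, h')\<close> with domain \<open>(E, a)\<close>. As uniqueness covers the
  isomorphism too, each comparison also yields an equation of 2-cells; for the two algebra axioms
  this is the coherence of the projections.

  The argument is run once, for families of arrows and 2-cells presented by nodes, edges and
  equations. The shape of the index enters only through \<open>rectifiable\<close>, which is
  verified separately for lax cones, op-lax cones and cylinders.\<close>

no_notation whisk_l ("_ \<rhd>\<^bsub>_\<^esub> _" [75, 0, 75] 75)
no_notation whisk_r ("_ \<lhd>\<^bsub>_\<^esub> _" [75, 0, 75] 75)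

abbreviation whisker_l :: "('o, 'a, 'c) cat2 \<Rightarrow> 'a \<Rightarrow> 'c \<Rightarrow> 'c"  ("_ \<rhd>\<index> _" [75, 75] 75) where
  "whisker_l C g \<alpha> \<equiv> hcomp C (vide C g) \<alpha>"

abbreviation whisker_r :: "('o, 'a, 'c) cat2 \<Rightarrow> 'c \<Rightarrow> 'a \<Rightarrow> 'c"  ("_ \<lhd>\<index> _" [75, 75] 75) where
  "whisker_r C \<alpha> f \<equiv> hcomp C \<alpha> (vide C f)"

lemma hom_iff: "f \<in> hom C x y \<longleftrightarrow> f \<in> arr C \<and> src C f = x \<and> tgt C f = y"
  by (auto simp: hom_def)

lemma cells_iff: "\<alpha> \<in> cells C f g \<longleftrightarrow> \<alpha> \<in> cell C \<and> vsrc C \<alpha> = f \<and> vtgt C \<alpha> = g"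
  by (auto simp: cells_def)

text \<open>Inverses are unique (\<open>vinv_unique\<close>), so the choice is harmless; a total
  operation can be used in pointwise definitions such as \<open>lift'\<close>.\<close>

definition vinv :: "('o, 'a, 'c) cat2 \<Rightarrow> 'c \<Rightarrow> 'c" where
  "vinv C \<alpha> = (SOME \<beta>. \<beta> \<in> cells C (vtgt C \<alpha>) (vsrc C \<alpha>) \<and>
     \<beta> \<bullet>\<^bsub>C\<^esub> \<alpha> = vide C (vsrc C \<alpha>) \<and> \<alpha> \<bullet>\<^bsub>C\<^esub> \<beta> = vide C (vtgt C \<alpha>))"

context two_category
begin

lemma comp_typing:
  assumes "f \<in> arr C" "g \<in> arr C" "tgt C f = src C g"
  shows "g \<cdot> f \<in> arr C" "src C (g \<cdot> f) = src C f" "tgt C (g \<cdot> f) = tgt C g"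
  using comp_arr[OF assms] by auto

lemma ide_typing:
  assumes "x \<in> obj C"
  shows "ide C x \<in> arr C" "src C (ide C x) = x" "tgt C (ide C x) = x"
  using ide_arr[OF assms] by auto

lemma vide_typing:
  assumes "f \<in> arr C"
  shows "vide C f \<in> cell C" "vsrc C (vide C f) = f" "vtgt C (vide C f) = f"
  using vide_cell[OF assms] by (auto simp: cells_iff)

lemma vcomp_typing:
  assumes "\<alpha> \<in> cell C" "\<beta> \<in> cell C" "vtgt C \<alpha> = vsrc C \<beta>"
  shows "\<beta> \<bullet> \<alpha> \<in> cell C" "vsrc C (\<beta> \<bullet> \<alpha>) = vsrc C \<alpha>" "vtgt C (\<beta> \<bullet> \<alpha>) = vtgt C \<beta>"
  using vcomp_cell[OF assms] by (auto simp: cells_iff)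

lemma hcomp_typing:
  assumes "\<alpha> \<in> cell C" "\<beta> \<in> cell C" "tgt C (vsrc C \<alpha>) = src C (vsrc C \<beta>)"
  shows "\<beta> \<star> \<alpha> \<in> cell C" "vsrc C (\<beta> \<star> \<alpha>) = vsrc C \<beta> \<cdot> vsrc C \<alpha>"
    "vtgt C (\<beta> \<star> \<alpha>) = vtgt C \<beta> \<cdot> vtgt C \<alpha>"
  using hcomp_cell[OF assms] by (auto simp: cells_iff)

lemma cell_parallel_typing:
  assumes "\<alpha> \<in> cell C"
  shows "src C (vtgt C \<alpha>) = src C (vsrc C \<alpha>)" "tgt C (vtgt C \<alpha>) = tgt C (vsrc C \<alpha>)"
  using cell_parallel[OF assms] by auto

lemma ide_cancel:
  "\<lbrakk>f \<in> arr C; x = src C f\<rbrakk> \<Longrightarrow> f \<cdot> ide C x = f"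
  "\<lbrakk>f \<in> arr C; y = tgt C f\<rbrakk> \<Longrightarrow> ide C y \<cdot> f = f"
  by (simp_all add: comp_ide_left comp_ide_right)

lemma vide_cancel:
  "\<lbrakk>\<alpha> \<in> cell C; f = vsrc C \<alpha>\<rbrakk> \<Longrightarrow> \<alpha> \<bullet> vide C f = \<alpha>"
  "\<lbrakk>\<alpha> \<in> cell C; g = vtgt C \<alpha>\<rbrakk> \<Longrightarrow> vide C g \<bullet> \<alpha> = \<alpha>"
  by (simp_all add: vcomp_vide_left vcomp_vide_right)

lemma hide_cancel:
  "\<lbrakk>\<alpha> \<in> cell C; x = src C (vsrc C \<alpha>)\<rbrakk> \<Longrightarrow> \<alpha> \<star> vide C (ide C x) = \<alpha>"
  "\<lbrakk>\<alpha> \<in> cell C; y = tgt C (vsrc C \<alpha>)\<rbrakk> \<Longrightarrow> vide C (ide C y) \<star> \<alpha> = \<alpha>"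
  by (simp_all add: hcomp_ide_left hcomp_ide_right)

lemma whisk_l_comp:
  "\<lbrakk>\<alpha> \<in> cell C; g \<in> arr C; h \<in> arr C; tgt C (vsrc C \<alpha>) = src C g; tgt C g = src C h\<rbrakk>
   \<Longrightarrow> vide C h \<star> (vide C g \<star> \<alpha>) = vide C (h \<cdot> g) \<star> \<alpha>"
  by (simp add: hcomp_assoc[symmetric] vide_typing hcomp_vide)

lemma whisk_r_comp:
  "\<lbrakk>\<alpha> \<in> cell C; g \<in> arr C; h \<in> arr C; tgt C h = src C g; tgt C g = src C (vsrc C \<alpha>)\<rbrakk>
   \<Longrightarrow> (\<alpha> \<star> vide C g) \<star> vide C h = \<alpha> \<star> vide C (g \<cdot> h)"
  by (simp add: hcomp_assoc vide_typing hcomp_vide)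

lemma whisk_lr:
  "\<lbrakk>\<alpha> \<in> cell C; g \<in> arr C; f \<in> arr C; tgt C f = src C (vsrc C \<alpha>); tgt C (vsrc C \<alpha>) = src C g\<rbrakk>
   \<Longrightarrow> (vide C g \<star> \<alpha>) \<star> vide C f = vide C g \<star> (\<alpha> \<star> vide C f)"
  by (simp add: hcomp_assoc vide_typing)

lemma whisk_l_vcomp:
  "\<lbrakk>\<alpha> \<in> cell C; \<beta> \<in> cell C; vtgt C \<alpha> = vsrc C \<beta>; g \<in> arr C; tgt C (vsrc C \<alpha>) = src C g\<rbrakk>
   \<Longrightarrow> vide C g \<star> (\<beta> \<bullet> \<alpha>) = (vide C g \<star> \<beta>) \<bullet> (vide C g \<star> \<alpha>)"
  using interchange[of \<alpha> \<beta> "vide C g" "vide C g"] by (simp add: vide_typing vide_cancel)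

lemma whisk_r_vcomp:
  "\<lbrakk>\<alpha> \<in> cell C; \<beta> \<in> cell C; vtgt C \<alpha> = vsrc C \<beta>; f \<in> arr C; tgt C f = src C (vsrc C \<alpha>)\<rbrakk>
   \<Longrightarrow> (\<beta> \<bullet> \<alpha>) \<star> vide C f = (\<beta> \<star> vide C f) \<bullet> (\<alpha> \<star> vide C f)"
  using interchange[of "vide C f" "vide C f" \<alpha> \<beta>] by (simp add: vide_typing vide_cancel)

text \<open>Both sides are the horizontal composite \<open>\<beta> \<star> \<alpha>\<close>, split
  with identity cells in the two possible orders. Later it slides a 2-cell past, for instance, the
  structure cell of a pseudo morphism or the 2-cell of a cone at an edge.\<close>

lemma whisk_interchange:
  assumes "\<alpha> \<in> cell C" "\<beta> \<in> cell C" "tgt C (vsrc C \<alpha>) = src C (vsrc C \<beta>)"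
  shows "(\<beta> \<star> vide C (vtgt C \<alpha>)) \<bullet> (vide C (vsrc C \<beta>) \<star> \<alpha>)
       = (vide C (vtgt C \<beta>) \<star> \<alpha>) \<bullet> (\<beta> \<star> vide C (vsrc C \<alpha>))"
proof -
  note i = vsrc_arr vtgt_arr vide_typing vide_cancel cell_parallel_typing
  have "(\<beta> \<star> vide C (vtgt C \<alpha>)) \<bullet> (vide C (vsrc C \<beta>) \<star> \<alpha>) = \<beta> \<star> \<alpha>"
    using interchange[of \<alpha> "vide C (vtgt C \<alpha>)" "vide C (vsrc C \<beta>)" \<beta>] assms by (simp add: i)
  also have "\<dots> = (vide C (vtgt C \<beta>) \<star> \<alpha>) \<bullet> (\<beta> \<star> vide C (vsrc C \<alpha>))"
    using interchange[of "vide C (vsrc C \<alpha>)" \<alpha> \<beta> "vide C (vtgt C \<beta>)"] assms by (simp add: i)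
  finally show ?thesis .
qed

text \<open>As rewrite rules these lead to a normal form: composites associate to the right,
  whiskering distributes over vertical composition, and nested whiskers merge into one arrow on each
  side. The initial segment \<open>calc(1-17)\<close> consists of typing facts only and serves where
  normalisation would undo a step.\<close>

lemmas calc = comp_typing ide_typing vide_typing vcomp_typing hcomp_typing
  vsrc_arr vtgt_arr src_obj tgt_obj cell_parallel_typing
  ide_cancel vide_cancel hide_cancel comp_assoc vcomp_assoc hcomp_vide
  whisk_l_comp whisk_r_comp whisk_lr whisk_l_vcomp whisk_r_vcomp

lemma vinv:
  assumes "invertible_cell C \<alpha>"
  shows "vinv C \<alpha> \<in> cell C" "vsrc C (vinv C \<alpha>) = vtgt C \<alpha>" "vtgt C (vinv C \<alpha>) = vsrc C \<alpha>"
    "vinv C \<alpha> \<bullet> \<alpha> = vide C (vsrc C \<alpha>)" "\<alpha> \<bullet> vinv C \<alpha> = vide C (vtgt C \<alpha>)"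
proof -
  let ?P = "\<lambda>\<beta>. \<beta> \<in> cells C (vtgt C \<alpha>) (vsrc C \<alpha>) \<and>
     \<beta> \<bullet> \<alpha> = vide C (vsrc C \<alpha>) \<and> \<alpha> \<bullet> \<beta> = vide C (vtgt C \<alpha>)"
  have "\<exists>\<beta>. ?P \<beta>" using assms unfolding invertible_cell_def by auto
  then have "?P (vinv C \<alpha>)" unfolding vinv_def by (rule someI_ex[where P = ?P])
  then show "vinv C \<alpha> \<in> cell C" "vsrc C (vinv C \<alpha>) = vtgt C \<alpha>" "vtgt C (vinv C \<alpha>) = vsrc C \<alpha>"
    "vinv C \<alpha> \<bullet> \<alpha> = vide C (vsrc C \<alpha>)" "\<alpha> \<bullet> vinv C \<alpha> = vide C (vtgt C \<alpha>)"
    by (auto simp: cells_iff)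
qed

lemma invertibleI:
  assumes "\<alpha> \<in> cell C" "\<beta> \<in> cell C" "vsrc C \<beta> = vtgt C \<alpha>" "vtgt C \<beta> = vsrc C \<alpha>"
    "\<beta> \<bullet> \<alpha> = vide C (vsrc C \<alpha>)" "\<alpha> \<bullet> \<beta> = vide C (vtgt C \<alpha>)"
  shows "invertible_cell C \<alpha>"
  using assms unfolding invertible_cell_def by (auto simp: cells_iff intro!: bexI[of _ \<beta>])

lemma invertible_in_cell: "invertible_cell C \<alpha> \<Longrightarrow> \<alpha> \<in> cell C"
  by (simp add: invertible_cell_def)

lemma vinv_cancel:
  assumes "invertible_cell C \<alpha>" "\<beta> \<in> cell C"
  shows "vtgt C \<beta> = vsrc C \<alpha> \<Longrightarrow> vinv C \<alpha> \<bullet> \<alpha> \<bullet> \<beta> = \<beta>"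
    "vtgt C \<beta> = vtgt C \<alpha> \<Longrightarrow> \<alpha> \<bullet> vinv C \<alpha> \<bullet> \<beta> = \<beta>"
  using assms vinv[OF assms(1)] invertible_in_cell[OF assms(1)]
  by (simp_all add: vcomp_assoc[symmetric] vide_cancel)

lemma invertible_vinv: "invertible_cell C \<alpha> \<Longrightarrow> invertible_cell C (vinv C \<alpha>)"
  using vinv[of \<alpha>] invertible_in_cell[of \<alpha>] by (intro invertibleI[of _ \<alpha>]) auto

lemma invertible_vide: "f \<in> arr C \<Longrightarrow> invertible_cell C (vide C f)"
  by (intro invertibleI[of _ "vide C f"]) (auto simp: calc)

lemma invertible_vcomp:
  assumes "invertible_cell C \<alpha>" "invertible_cell C \<beta>" "vtgt C \<alpha> = vsrc C \<beta>"
  shows "invertible_cell C (\<beta> \<bullet> \<alpha>)"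
  using assms vinv[OF assms(1)] vinv[OF assms(2)] invertible_in_cell[of \<alpha>] invertible_in_cell[of \<beta>]
  by (intro invertibleI[of _ "vinv C \<alpha> \<bullet> vinv C \<beta>"]) (simp_all add: calc vinv_cancel)

lemma invertible_whisk_l:
  assumes "invertible_cell C \<alpha>" "g \<in> arr C" "tgt C (vsrc C \<alpha>) = src C g"
  shows "invertible_cell C (vide C g \<star> \<alpha>)"
proof -
  note v = vinv[OF assms(1)] and c = invertible_in_cell[OF assms(1)]
  have "(vide C g \<star> vinv C \<alpha>) \<bullet> (vide C g \<star> \<alpha>) = vide C (g \<cdot> vsrc C \<alpha>)"
    "(vide C g \<star> \<alpha>) \<bullet> (vide C g \<star> vinv C \<alpha>) = vide C (g \<cdot> vtgt C \<alpha>)"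
    using v c assms by (simp_all add: calc whisk_l_vcomp[symmetric] del: whisk_l_vcomp)
  then show ?thesis
    using v c assms by (intro invertibleI[of _ "vide C g \<star> vinv C \<alpha>"]) (simp_all add: calc)
qed

lemma invertible_whisk_r:
  assumes "invertible_cell C \<alpha>" "f \<in> arr C" "tgt C f = src C (vsrc C \<alpha>)"
  shows "invertible_cell C (\<alpha> \<star> vide C f)"
proof -
  note v = vinv[OF assms(1)] and c = invertible_in_cell[OF assms(1)]
  have "(vinv C \<alpha> \<star> vide C f) \<bullet> (\<alpha> \<star> vide C f) = vide C (vsrc C \<alpha> \<cdot> f)"
    "(\<alpha> \<star> vide C f) \<bullet> (vinv C \<alpha> \<star> vide C f) = vide C (vtgt C \<alpha> \<cdot> f)"
    using v c assms by (simp_all add: calc whisk_r_vcomp[symmetric] del: whisk_r_vcomp)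
  then show ?thesis
    using v c assms by (intro invertibleI[of _ "vinv C \<alpha> \<star> vide C f"]) (simp_all add: calc)
qed

lemma cancel_right:
  assumes "invertible_cell C \<gamma>" "\<alpha> \<in> cell C" "\<beta> \<in> cell C" "vsrc C \<alpha> = vtgt C \<gamma>" "vsrc C \<beta> = vtgt C \<gamma>"
    "\<alpha> \<bullet> \<gamma> = \<beta> \<bullet> \<gamma>"
  shows "\<alpha> = \<beta>"
proof -
  note v = vinv[OF assms(1)] and c = invertible_in_cell[OF assms(1)]
  have "\<alpha> = (\<alpha> \<bullet> \<gamma>) \<bullet> vinv C \<gamma>" using assms(2,4) v c by (simp add: calc)
  also have "\<dots> = \<beta>" unfolding assms(6) using assms(3,5) v c by (simp add: calc)
  finally show ?thesis .
qed

lemma cancel_left: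
  assumes "invertible_cell C \<gamma>" "\<alpha> \<in> cell C" "\<beta> \<in> cell C" "vtgt C \<alpha> = vsrc C \<gamma>" "vtgt C \<beta> = vsrc C \<gamma>"
    "\<gamma> \<bullet> \<alpha> = \<gamma> \<bullet> \<beta>"
  shows "\<alpha> = \<beta>"
  using vinv_cancel(1)[OF assms(1,2,4)] vinv_cancel(1)[OF assms(1,3,5)] assms(6) by metis

lemma vinv_unique:
  assumes "invertible_cell C \<alpha>" "\<beta> \<in> cell C" "vtgt C \<beta> = vsrc C \<alpha>" "vsrc C \<beta> = vtgt C \<alpha>"
    "\<alpha> \<bullet> \<beta> = vide C (vtgt C \<alpha>)"
  shows "\<beta> = vinv C \<alpha>"
  by (rule cancel_left[OF assms(1)]) (simp_all add: assms vinv[OF assms(1)])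

lemma vinv_vide: "f \<in> arr C \<Longrightarrow> vinv C (vide C f) = vide C f"
  by (rule vinv_unique[symmetric]) (auto simp: calc invertible_vide)

lemma identity_cell_iff:
  "\<alpha> \<in> cell C \<Longrightarrow> identity_cell C \<alpha> \<longleftrightarrow> \<alpha> = vide C (vsrc C \<alpha>)"
  unfolding identity_cell_def using vsrc_arr vide_typing(2) by metis

lemma identity_cell_iff':
  "\<alpha> \<in> cell C \<Longrightarrow> identity_cell C \<alpha> \<longleftrightarrow> \<alpha> = vide C (vtgt C \<alpha>)"
  unfolding identity_cell_def using vtgt_arr vide_typing(3) by metis

end

section \<open>Generalised cones and straightening\<close>

text \<open>
  Lax cones, op-lax cones and cylinders are all families of arrows \<open>\<theta> n\<close> at nodes and of 2-cells
  \<open>\<theta>' e : P e \<cdot> \<theta> (s e) \<Rightarrow> Q e \<cdot> \<theta> (t e)\<close> at edges, subject to equations \<open>x' \<bullet> x = y' \<bullet> y\<close> between composites of two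
  whiskered cells, one for each \<open>(x, x', y, y')\<close> in \<open>eqns\<close>.  A side with fewer factors is padded with identity cells.
\<close>

datatype ('n, 'e, 'a, 'c) step = Edge 'a 'e | Cell 'c 'n

record ('n, 'e, 'o, 'a, 'c) diag =
  nodes :: "'n set"
  edges :: "'e set"
  ob :: "'n \<Rightarrow> 'o"
  es :: "'e \<Rightarrow> 'n"
  et :: "'e \<Rightarrow> 'n"
  eP :: "'e \<Rightarrow> 'a"
  eQ :: "'e \<Rightarrow> 'a"
  strict :: "'e set"
  eqns :: "(('n, 'e, 'a, 'c) step \<times> ('n, 'e, 'a, 'c) step
    \<times> ('n, 'e, 'a, 'c) step \<times> ('n, 'e, 'a, 'c) step) set"

text \<open>An end of a step is a pair \<open>(R, n)\<close> that stands for the arrow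
  \<open>R \<cdot> \<theta> n\<close>. Leaving the cone out makes the typing of an equation a
  property of the diagram alone.\<close>

fun step_src :: "('o, 'a, 'c) cat2 \<Rightarrow> ('n, 'e, 'o, 'a, 'c) diag \<Rightarrow> ('n, 'e, 'a, 'c) step \<Rightarrow> 'a \<times> 'n" where
  "step_src B G (Edge R e) = (R \<cdot>\<^bsub>B\<^esub> eP G e, es G e)"
| "step_src B G (Cell \<gamma> n) = (vsrc B \<gamma>, n)"

fun step_tgt :: "('o, 'a, 'c) cat2 \<Rightarrow> ('n, 'e, 'o, 'a, 'c) diag \<Rightarrow> ('n, 'e, 'a, 'c) step \<Rightarrow> 'a \<times> 'n" where
  "step_tgt B G (Edge R e) = (R \<cdot>\<^bsub>B\<^esub> eQ G e, et G e)"
| "step_tgt B G (Cell \<gamma> n) = (vtgt B \<gamma>, n)"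

fun step_ok :: "('o, 'a, 'c) cat2 \<Rightarrow> ('n, 'e, 'o, 'a, 'c) diag \<Rightarrow> ('n, 'e, 'a, 'c) step \<Rightarrow> bool" where
  "step_ok B G (Edge R e) \<longleftrightarrow> e \<in> edges G \<and> R \<in> arr B \<and> src B R = tgt B (eP G e)"
| "step_ok B G (Cell \<gamma> n) \<longleftrightarrow> n \<in> nodes G \<and> \<gamma> \<in> cell B \<and> src B (vsrc B \<gamma>) = ob G n"

fun step_val :: "('o, 'a, 'c) cat2 \<Rightarrow> ('n \<Rightarrow> 'a) \<Rightarrow> ('e \<Rightarrow> 'c) \<Rightarrow> ('n, 'e, 'a, 'c) step \<Rightarrow> 'c" where
  "step_val B \<theta> \<theta>' (Edge R e) = R \<rhd>\<^bsub>B\<^esub> \<theta>' e"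
| "step_val B \<theta> \<theta>' (Cell \<gamma> n) = \<gamma> \<lhd>\<^bsub>B\<^esub> \<theta> n"

definition eqn_ok :: "('o, 'a, 'c) cat2 \<Rightarrow> ('n, 'e, 'o, 'a, 'c) diag
    \<Rightarrow> ('n, 'e, 'a, 'c) step \<times> ('n, 'e, 'a, 'c) step \<times> ('n, 'e, 'a, 'c) step \<times> ('n, 'e, 'a, 'c) step \<Rightarrow> bool" where
  "eqn_ok B G = (\<lambda>(x, x', y, y'). step_ok B G x \<and> step_ok B G x' \<and> step_ok B G y \<and> step_ok B G y' \<and>
     step_tgt B G x = step_src B G x' \<and> step_tgt B G y = step_src B G y' \<and>
     step_src B G x = step_src B G y \<and> step_tgt B G x' = step_tgt B G y')"

definition eqn_holds :: "('o, 'a, 'c) cat2 \<Rightarrow> ('n \<Rightarrow> 'a) \<Rightarrow> ('e \<Rightarrow> 'c)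
    \<Rightarrow> ('n, 'e, 'a, 'c) step \<times> ('n, 'e, 'a, 'c) step \<times> ('n, 'e, 'a, 'c) step \<times> ('n, 'e, 'a, 'c) step \<Rightarrow> bool" where
  "eqn_holds B \<theta> \<theta>' = (\<lambda>(x, x', y, y').
     step_val B \<theta> \<theta>' x' \<bullet>\<^bsub>B\<^esub> step_val B \<theta> \<theta>' x = step_val B \<theta> \<theta>' y' \<bullet>\<^bsub>B\<^esub> step_val B \<theta> \<theta>' y)"

definition diag_ok :: "('o, 'a, 'c) cat2 \<Rightarrow> ('n, 'e, 'o, 'a, 'c) diag \<Rightarrow> bool" where
  "diag_ok B G \<longleftrightarrow> (\<forall>n \<in> nodes G. ob G n \<in> obj B) \<and>
     (\<forall>e \<in> edges G. es G e \<in> nodes G \<and> et G e \<in> nodes G \<and>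
        eP G e \<in> arr B \<and> src B (eP G e) = ob G (es G e) \<and>
        eQ G e \<in> arr B \<and> src B (eQ G e) = ob G (et G e) \<and> tgt B (eQ G e) = tgt B (eP G e)) \<and>
     strict G \<subseteq> edges G \<and> (\<forall>q \<in> eqns G. eqn_ok B G q)"

definition precone :: "('o, 'a, 'c) cat2 \<Rightarrow> ('n, 'e, 'o, 'a, 'c) diag \<Rightarrow> 'o \<Rightarrow> ('n \<Rightarrow> 'a) \<Rightarrow> ('e \<Rightarrow> 'c) \<Rightarrow> bool" where
  "precone B G E \<theta> \<theta>' \<longleftrightarrow> E \<in> obj B \<and>
     (\<forall>n \<in> nodes G. \<theta> n \<in> arr B \<and> src B (\<theta> n) = E \<and> tgt B (\<theta> n) = ob G n) \<and>
     (\<forall>e \<in> edges G. \<theta>' e \<in> cell B \<and> vsrc B (\<theta>' e) = eP G e \<cdot>\<^bsub>B\<^esub> \<theta> (es G e) \<and>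
        vtgt B (\<theta>' e) = eQ G e \<cdot>\<^bsub>B\<^esub> \<theta> (et G e))"

definition gcone :: "('o, 'a, 'c) cat2 \<Rightarrow> ('n, 'e, 'o, 'a, 'c) diag \<Rightarrow> 'o \<Rightarrow> ('n \<Rightarrow> 'a) \<Rightarrow> ('e \<Rightarrow> 'c) \<Rightarrow> bool" where
  "gcone B G E \<theta> \<theta>' \<longleftrightarrow> precone B G E \<theta> \<theta>' \<and> (\<forall>q \<in> eqns G. eqn_holds B \<theta> \<theta>' q)"

text \<open>Kept apart from \<open>gcone\<close> because the 2-monad preserves the equations
  (\<open>lift_gcone\<close>) but turns the identities at strict edges into 2-cells that are merely
  invertible (\<open>lift'_invertible\<close>).\<close>

definition scone :: "('o, 'a, 'c) cat2 \<Rightarrow> ('n, 'e, 'o, 'a, 'c) diag \<Rightarrow> 'o \<Rightarrow> ('n \<Rightarrow> 'a) \<Rightarrow> ('e \<Rightarrow> 'c) \<Rightarrow> bool" where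
  "scone B G E \<theta> \<theta>' \<longleftrightarrow> gcone B G E \<theta> \<theta>' \<and> (\<forall>e \<in> strict G. identity_cell B (\<theta>' e))"

definition gmor :: "('o, 'a, 'c) cat2 \<Rightarrow> ('n, 'e, 'o, 'a, 'c) diag
    \<Rightarrow> ('n \<Rightarrow> 'a) \<Rightarrow> ('e \<Rightarrow> 'c) \<Rightarrow> ('n \<Rightarrow> 'a) \<Rightarrow> ('e \<Rightarrow> 'c) \<Rightarrow> ('n \<Rightarrow> 'c) \<Rightarrow> bool" where
  "gmor B G \<theta> \<theta>' \<phi> \<phi>' \<alpha> \<longleftrightarrow>
     (\<forall>n \<in> nodes G. \<alpha> n \<in> cell B \<and> vsrc B (\<alpha> n) = \<theta> n \<and> vtgt B (\<alpha> n) = \<phi> n) \<and>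
     (\<forall>e \<in> edges G. \<phi>' e \<bullet>\<^bsub>B\<^esub> (eP G e \<rhd>\<^bsub>B\<^esub> \<alpha> (es G e)) = (eQ G e \<rhd>\<^bsub>B\<^esub> \<alpha> (et G e)) \<bullet>\<^bsub>B\<^esub> \<theta>' e)"

text \<open>The isomorphism of categories in a limit is unfolded into four clauses: existence and
  uniqueness of the factorisation of a cone, then of a morphism of cones. No encoding of cones as
  extensional functions is involved; \<open>iso_iff_glim\<close> supplies the comparison.\<close>

definition glim :: "('o, 'a, 'c) cat2 \<Rightarrow> ('n, 'e, 'o, 'a, 'c) diag \<Rightarrow> 'o \<Rightarrow> ('n \<Rightarrow> 'a) \<Rightarrow> ('e \<Rightarrow> 'c) \<Rightarrow> bool" where
  "glim B G L \<pi> \<pi>' \<longleftrightarrow> L \<in> obj B \<and> scone B G L \<pi> \<pi>' \<and>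
     (\<forall>E \<theta> \<theta>'. scone B G E \<theta> \<theta>' \<longrightarrow>
        (\<exists>h \<in> hom B E L. (\<forall>n \<in> nodes G. \<pi> n \<cdot>\<^bsub>B\<^esub> h = \<theta> n) \<and> (\<forall>e \<in> edges G. \<pi>' e \<lhd>\<^bsub>B\<^esub> h = \<theta>' e))) \<and>
     (\<forall>E. \<forall>h \<in> hom B E L. \<forall>k \<in> hom B E L.
        (\<forall>n \<in> nodes G. \<pi> n \<cdot>\<^bsub>B\<^esub> h = \<pi> n \<cdot>\<^bsub>B\<^esub> k) \<and> (\<forall>e \<in> edges G. \<pi>' e \<lhd>\<^bsub>B\<^esub> h = \<pi>' e \<lhd>\<^bsub>B\<^esub> k) \<longrightarrow> h = k) \<and>
     (\<forall>E \<alpha>. \<forall>h \<in> hom B E L. \<forall>k \<in> hom B E L.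
        gmor B G (\<lambda>n. \<pi> n \<cdot>\<^bsub>B\<^esub> h) (\<lambda>e. \<pi>' e \<lhd>\<^bsub>B\<^esub> h) (\<lambda>n. \<pi> n \<cdot>\<^bsub>B\<^esub> k) (\<lambda>e. \<pi>' e \<lhd>\<^bsub>B\<^esub> k) \<alpha> \<longrightarrow>
        (\<exists>\<beta> \<in> cells B h k. \<forall>n \<in> nodes G. \<pi> n \<rhd>\<^bsub>B\<^esub> \<beta> = \<alpha> n)) \<and>
     (\<forall>E. \<forall>h \<in> hom B E L. \<forall>k \<in> hom B E L. \<forall>\<beta> \<in> cells B h k. \<forall>\<beta>' \<in> cells B h k.
        (\<forall>n \<in> nodes G. \<pi> n \<rhd>\<^bsub>B\<^esub> \<beta> = \<pi> n \<rhd>\<^bsub>B\<^esub> \<beta>') \<longrightarrow> \<beta> = \<beta>')"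

text \<open>
  The equation at a strict edge \<open>e\<close> says that transporting the cone \<open>\<phi>\<close> along \<open>\<kappa>\<close> turns \<open>\<phi>' e\<close> into an identity.
\<close>

definition straightening :: "('o, 'a, 'c) cat2 \<Rightarrow> ('n, 'e, 'o, 'a, 'c) diag \<Rightarrow> 'n set
    \<Rightarrow> ('n \<Rightarrow> 'a) \<Rightarrow> ('e \<Rightarrow> 'c) \<Rightarrow> ('n \<Rightarrow> 'c) \<Rightarrow> bool" where
  "straightening B G N\<^sub>0 \<phi> \<phi>' \<kappa> \<longleftrightarrow>
     (\<forall>n \<in> nodes G. invertible_cell B (\<kappa> n) \<and> vtgt B (\<kappa> n) = \<phi> n) \<and>
     (\<forall>n \<in> N\<^sub>0. \<kappa> n = vide B (\<phi> n)) \<and>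
     (\<forall>e \<in> strict G. \<phi>' e \<bullet>\<^bsub>B\<^esub> (eP G e \<rhd>\<^bsub>B\<^esub> \<kappa> (es G e)) = eQ G e \<rhd>\<^bsub>B\<^esub> \<kappa> (et G e))"

text \<open>The form in which the PIE condition enters the lifting argument, with
  \<open>N\<^sub>0\<close> for the chosen initial objects. Its hypothesis on strict edges is the
  property that lifted cones have.\<close>

definition rectifiable :: "('o, 'a, 'c) cat2 \<Rightarrow> ('n, 'e, 'o, 'a, 'c) diag \<Rightarrow> 'n set \<Rightarrow> bool" where
  "rectifiable B G N\<^sub>0 \<longleftrightarrow> N\<^sub>0 \<subseteq> nodes G \<and>
     (\<forall>E \<phi> \<phi>'. gcone B G E \<phi> \<phi>' \<and> (\<forall>e \<in> strict G. invertible_cell B (\<phi>' e)) \<longrightarrow>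
        (\<exists>\<kappa>. straightening B G N\<^sub>0 \<phi> \<phi>' \<kappa>) \<and>
        (\<forall>\<kappa> \<kappa>'. straightening B G N\<^sub>0 \<phi> \<phi>' \<kappa> \<and> straightening B G N\<^sub>0 \<phi> \<phi>' \<kappa>' \<longrightarrow> (\<forall>n \<in> nodes G. \<kappa> n = \<kappa>' n)))"

section \<open>Typing, restriction and transport of generalised cones\<close>

locale diagram = two_category B for B :: "('o, 'a, 'c) cat2" (structure) +
  fixes G :: "('n, 'e, 'o, 'a, 'c) diag"
  assumes ok: "diag_ok B G"
begin

lemma ob_typing: "n \<in> nodes G \<Longrightarrow> ob G n \<in> obj B"
  using ok by (auto simp: diag_ok_def)

lemma edge_typing:
  assumes "e \<in> edges G"
  shows "es G e \<in> nodes G" "et G e \<in> nodes G" "eP G e \<in> arr B" "eQ G e \<in> arr B"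
    "src B (eP G e) = ob G (es G e)" "src B (eQ G e) = ob G (et G e)" "tgt B (eQ G e) = tgt B (eP G e)"
  using ok assms by (auto simp: diag_ok_def)

lemma strict_edge: "e \<in> strict G \<Longrightarrow> e \<in> edges G"
  using ok by (auto simp: diag_ok_def)

lemma precone_typing:
  assumes "precone B G E \<theta> \<theta>'"
  shows "E \<in> obj B"
    "\<And>n. n \<in> nodes G \<Longrightarrow> \<theta> n \<in> arr B" "\<And>n. n \<in> nodes G \<Longrightarrow> src B (\<theta> n) = E"
    "\<And>n. n \<in> nodes G \<Longrightarrow> tgt B (\<theta> n) = ob G n"
    "\<And>e. e \<in> edges G \<Longrightarrow> \<theta>' e \<in> cell B"
    "\<And>e. e \<in> edges G \<Longrightarrow> vsrc B (\<theta>' e) = eP G e \<cdot> \<theta> (es G e)"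
    "\<And>e. e \<in> edges G \<Longrightarrow> vtgt B (\<theta>' e) = eQ G e \<cdot> \<theta> (et G e)"
  using assms by (auto simp: precone_def)

lemma gmor_typing:
  assumes "gmor B G \<theta> \<theta>' \<phi> \<phi>' \<alpha>" "n \<in> nodes G"
  shows "\<alpha> n \<in> cell B" "vsrc B (\<alpha> n) = \<theta> n" "vtgt B (\<alpha> n) = \<phi> n"
  using assms by (auto simp: gmor_def)

lemma gmor_nat:
  assumes "gmor B G \<theta> \<theta>' \<phi> \<phi>' \<alpha>" "e \<in> edges G"
  shows "\<phi>' e \<bullet> (eP G e \<rhd> \<alpha> (es G e)) = (eQ G e \<rhd> \<alpha> (et G e)) \<bullet> \<theta>' e"
  using assms by (auto simp: gmor_def)

lemma gcone_precone: "gcone B G E \<theta> \<theta>' \<Longrightarrow> precone B G E \<theta> \<theta>'"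
  by (simp add: gcone_def)

lemma scone_gcone: "scone B G E \<theta> \<theta>' \<Longrightarrow> gcone B G E \<theta> \<theta>'"
  by (simp add: scone_def)

lemma scone_precone: "scone B G E \<theta> \<theta>' \<Longrightarrow> precone B G E \<theta> \<theta>'"
  by (simp add: scone_def gcone_def)

lemma step_src_typing:
  assumes "step_ok B G x"
  shows "fst (step_src B G x) \<in> arr B" "snd (step_src B G x) \<in> nodes G"
    "src B (fst (step_src B G x)) = ob G (snd (step_src B G x))"
    "fst (step_tgt B G x) \<in> arr B" "snd (step_tgt B G x) \<in> nodes G"
    "src B (fst (step_tgt B G x)) = ob G (snd (step_tgt B G x))"
    "tgt B (fst (step_tgt B G x)) = tgt B (fst (step_src B G x))"
  using assms by (cases x; auto simp: edge_typing calc)+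

lemma step_val_typing:
  assumes "step_ok B G x" "precone B G E \<theta> \<theta>'"
  shows "step_val B \<theta> \<theta>' x \<in> cell B"
    "vsrc B (step_val B \<theta> \<theta>' x) = fst (step_src B G x) \<cdot> \<theta> (snd (step_src B G x))"
    "vtgt B (step_val B \<theta> \<theta>' x) = fst (step_tgt B G x) \<cdot> \<theta> (snd (step_tgt B G x))"
  using assms(1) precone_typing[OF assms(2)]
  by (cases x; auto simp: edge_typing calc)+

lemma step_val_precomp:
  assumes "step_ok B G x" "precone B G E \<theta> \<theta>'" "h \<in> arr B" "tgt B h = E"
  shows "step_val B (\<lambda>n. \<theta> n \<cdot> h) (\<lambda>e. \<theta>' e \<lhd> h) x = step_val B \<theta> \<theta>' x \<lhd> h"
  using assms(1,3,4) precone_typing[OF assms(2)]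
  by (cases x; auto simp: edge_typing calc)+

lemma precone_precomp:
  assumes "precone B G E \<theta> \<theta>'" "h \<in> arr B" "tgt B h = E"
  shows "precone B G (src B h) (\<lambda>n. \<theta> n \<cdot> h) (\<lambda>e. \<theta>' e \<lhd> h)"
  using assms(2,3) precone_typing[OF assms(1)]
  by (auto simp: precone_def calc edge_typing)

lemma gcone_precomp:
  assumes "gcone B G E \<theta> \<theta>'" "h \<in> arr B" "tgt B h = E"
  shows "gcone B G (src B h) (\<lambda>n. \<theta> n \<cdot> h) (\<lambda>e. \<theta>' e \<lhd> h)"
proof -
  note p = gcone_precone[OF assms(1)]
  have "eqn_holds B (\<lambda>n. \<theta> n \<cdot> h) (\<lambda>e. \<theta>' e \<lhd> h) q" if q: "q \<in> eqns G" for q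
  proof -
    obtain x x' y y' where qe: "q = (x, x', y, y')" by (cases q) auto
    have okq: "step_ok B G x" "step_ok B G x'" "step_ok B G y" "step_ok B G y'"
      "step_tgt B G x = step_src B G x'" "step_tgt B G y = step_src B G y'"
      using ok q unfolding diag_ok_def eqn_ok_def qe by auto
    have "eqn_holds B \<theta> \<theta>' q" using assms(1) q by (auto simp: gcone_def)
    then have "(step_val B \<theta> \<theta>' x' \<bullet> step_val B \<theta> \<theta>' x) \<lhd> h = (step_val B \<theta> \<theta>' y' \<bullet> step_val B \<theta> \<theta>' y) \<lhd> h"
      by (simp add: eqn_holds_def qe)
    then show ?thesis
      using okq assms(2,3) precone_typing[OF p]
      by (simp add: eqn_holds_def qe step_val_precomp[OF _ p] step_val_typing[OF _ p] whisk_r_vcomp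
          step_src_typing calc(1-3))
  qed
  then show ?thesis using precone_precomp[OF p assms(2,3)] by (simp add: gcone_def)
qed

lemma identity_whisk_r:
  "\<lbrakk>identity_cell B \<alpha>; \<alpha> \<in> cell B; h \<in> arr B; tgt B h = src B (vsrc B \<alpha>)\<rbrakk> \<Longrightarrow> identity_cell B (\<alpha> \<lhd> h)"
  unfolding identity_cell_def by (auto simp: calc)

lemma scone_precomp:
  assumes "scone B G E \<theta> \<theta>'" "h \<in> arr B" "tgt B h = E"
  shows "scone B G (src B h) (\<lambda>n. \<theta> n \<cdot> h) (\<lambda>e. \<theta>' e \<lhd> h)"
  using assms gcone_precomp[OF scone_gcone[OF assms(1)] assms(2,3)] precone_typing[OF scone_precone[OF assms(1)]]
  by (auto simp: scone_def strict_edge edge_typing calc(1-3) intro!: identity_whisk_r)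

lemma strict_invertible:
  assumes "scone B G E \<theta> \<theta>'" "e \<in> strict G"
  shows "invertible_cell B (\<theta>' e)"
proof -
  have "identity_cell B (\<theta>' e)" using assms by (simp add: scone_def)
  then show ?thesis unfolding identity_cell_def using invertible_vide by auto
qed

text \<open>For an edge this is the naturality of \<open>\<alpha>\<close> whiskered by
  \<open>R\<close>; for a 2-cell of the diagram it is interchange.\<close>

lemma step_val_nat:
  assumes "step_ok B G x" "gmor B G \<theta> \<theta>' \<phi> \<phi>' \<alpha>" "precone B G E \<theta> \<theta>'" "precone B G E \<phi> \<phi>'"
  shows "step_val B \<phi> \<phi>' x \<bullet> (fst (step_src B G x) \<rhd> \<alpha> (snd (step_src B G x)))
       = (fst (step_tgt B G x) \<rhd> \<alpha> (snd (step_tgt B G x))) \<bullet> step_val B \<theta> \<theta>' x"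
proof (cases x)
  case (Edge R e)
  then have e: "e \<in> edges G" and R: "R \<in> arr B" "src B R = tgt B (eP G e)" using assms by auto
  note t = edge_typing[OF e] precone_typing[OF assms(3)] precone_typing[OF assms(4)] gmor_typing[OF assms(2)]
  have "(R \<rhd> \<phi>' e) \<bullet> (R \<rhd> (eP G e \<rhd> \<alpha> (es G e))) = R \<rhd> (\<phi>' e \<bullet> (eP G e \<rhd> \<alpha> (es G e)))"
    by (rule whisk_l_vcomp[symmetric]) (simp_all add: t R e calc)
  also have "\<dots> = R \<rhd> ((eQ G e \<rhd> \<alpha> (et G e)) \<bullet> \<theta>' e)"
    by (simp add: gmor_nat[OF assms(2) e])
  finally show ?thesis using Edge by (simp add: t R e calc)
next
  case (Cell \<gamma> n)
  then show ?thesis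
    using assms whisk_interchange[of "\<alpha> n" \<gamma>] precone_typing[OF assms(3)] gmor_typing[OF assms(2), of n]
    by simp
qed

text \<open>Followed by the whiskering of \<open>\<kappa>\<close> at their common target, the two
  composites in \<open>\<theta>\<close> become the two composites in \<open>\<phi>\<close> preceded
  by the whiskering of \<open>\<kappa>\<close> at their common source. The latter two agree, and the
  whiskering at the target is invertible and cancels.\<close>

lemma eqn_transport:
  assumes "eqn_ok B G q" "gmor B G \<theta> \<theta>' \<phi> \<phi>' \<kappa>" "precone B G E \<theta> \<theta>'" "precone B G E \<phi> \<phi>'"
    and inv: "\<And>n. n \<in> nodes G \<Longrightarrow> invertible_cell B (\<kappa> n)"
    and "eqn_holds B \<phi> \<phi>' q"
  shows "eqn_holds B \<theta> \<theta>' q"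
proof -
  obtain x x' y y' where qe: "q = (x, x', y, y')" by (cases q) auto
  have okq: "step_ok B G x" "step_ok B G x'" "step_ok B G y" "step_ok B G y'"
      "step_tgt B G x = step_src B G x'" "step_tgt B G y = step_src B G y'"
      "step_src B G x = step_src B G y" "step_tgt B G x' = step_tgt B G y'"
    using assms(1) unfolding eqn_ok_def qe by auto
  note t = precone_typing[OF assms(3)] precone_typing[OF assms(4)] gmor_typing[OF assms(2)]
    step_val_typing[OF _ assms(3)] step_val_typing[OF _ assms(4)] step_src_typing calc(1-17)
  have two: "(fst (step_tgt B G b) \<rhd> \<kappa> (snd (step_tgt B G b))) \<bullet> (step_val B \<theta> \<theta>' b \<bullet> step_val B \<theta> \<theta>' a)
    = (step_val B \<phi> \<phi>' b \<bullet> step_val B \<phi> \<phi>' a) \<bullet> (fst (step_src B G a) \<rhd> \<kappa> (snd (step_src B G a)))"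
    if ab: "step_ok B G a" "step_ok B G b" "step_tgt B G a = step_src B G b" for a b
  proof -
    have "(fst (step_tgt B G b) \<rhd> \<kappa> (snd (step_tgt B G b))) \<bullet> (step_val B \<theta> \<theta>' b \<bullet> step_val B \<theta> \<theta>' a)
      = ((fst (step_tgt B G b) \<rhd> \<kappa> (snd (step_tgt B G b))) \<bullet> step_val B \<theta> \<theta>' b) \<bullet> step_val B \<theta> \<theta>' a"
      using ab by (subst vcomp_assoc) (simp_all add: t)
    also have "\<dots> = (step_val B \<phi> \<phi>' b \<bullet> (fst (step_src B G b) \<rhd> \<kappa> (snd (step_src B G b)))) \<bullet> step_val B \<theta> \<theta>' a"
      by (simp add: step_val_nat[OF ab(2) assms(2-4)])
    also have "\<dots> = step_val B \<phi> \<phi>' b \<bullet> ((fst (step_tgt B G a) \<rhd> \<kappa> (snd (step_tgt B G a))) \<bullet> step_val B \<theta> \<theta>' a)"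
      using ab by (subst vcomp_assoc) (simp_all add: t)
    also have "\<dots> = step_val B \<phi> \<phi>' b \<bullet> (step_val B \<phi> \<phi>' a \<bullet> (fst (step_src B G a) \<rhd> \<kappa> (snd (step_src B G a))))"
      by (simp add: step_val_nat[OF ab(1) assms(2-4)])
    also have "\<dots> = (step_val B \<phi> \<phi>' b \<bullet> step_val B \<phi> \<phi>' a) \<bullet> (fst (step_src B G a) \<rhd> \<kappa> (snd (step_src B G a)))"
      using ab by (subst vcomp_assoc) (simp_all add: t)
    finally show ?thesis .
  qed
  have "step_val B \<theta> \<theta>' x' \<bullet> step_val B \<theta> \<theta>' x = step_val B \<theta> \<theta>' y' \<bullet> step_val B \<theta> \<theta>' y"
  proof (rule cancel_left)
    show "invertible_cell B (fst (step_tgt B G x') \<rhd> \<kappa> (snd (step_tgt B G x')))"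
      using okq by (intro invertible_whisk_l inv) (simp_all add: t)
    show "(fst (step_tgt B G x') \<rhd> \<kappa> (snd (step_tgt B G x'))) \<bullet> step_val B \<theta> \<theta>' x' \<bullet> step_val B \<theta> \<theta>' x =
      (fst (step_tgt B G x') \<rhd> \<kappa> (snd (step_tgt B G x'))) \<bullet> step_val B \<theta> \<theta>' y' \<bullet> step_val B \<theta> \<theta>' y"
      using two[of x x'] two[of y y'] okq assms(6) by (simp add: eqn_holds_def qe)
  qed (use okq in \<open>simp_all add: t\<close>)
  then show ?thesis by (simp add: eqn_holds_def qe)
qed

lemma gmor_vcomp:
  assumes "gmor B G \<theta> \<theta>' \<phi> \<phi>' \<alpha>" "gmor B G \<phi> \<phi>' \<psi> \<psi>' \<beta>"
    "precone B G E \<theta> \<theta>'" "precone B G E \<phi> \<phi>'" "precone B G E \<psi> \<psi>'"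
  shows "gmor B G \<theta> \<theta>' \<psi> \<psi>' (\<lambda>n. \<beta> n \<bullet> \<alpha> n)"
proof -
  note t = precone_typing[OF assms(3)] precone_typing[OF assms(4)] precone_typing[OF assms(5)]
    gmor_typing[OF assms(1)] gmor_typing[OF assms(2)] edge_typing
  have "\<psi>' e \<bullet> (eP G e \<rhd> (\<beta> (es G e) \<bullet> \<alpha> (es G e))) = (eQ G e \<rhd> (\<beta> (et G e) \<bullet> \<alpha> (et G e))) \<bullet> \<theta>' e"
    if e: "e \<in> edges G" for e
  proof -
    have "\<psi>' e \<bullet> (eP G e \<rhd> (\<beta> (es G e) \<bullet> \<alpha> (es G e)))
      = (\<psi>' e \<bullet> (eP G e \<rhd> \<beta> (es G e))) \<bullet> (eP G e \<rhd> \<alpha> (es G e))"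
      using e by (simp add: t calc)
    also have "\<dots> = (eQ G e \<rhd> \<beta> (et G e)) \<bullet> \<phi>' e \<bullet> (eP G e \<rhd> \<alpha> (es G e))"
      unfolding gmor_nat[OF assms(2) e] using e by (simp add: t calc)
    also have "\<dots> = (eQ G e \<rhd> (\<beta> (et G e) \<bullet> \<alpha> (et G e))) \<bullet> \<theta>' e"
      unfolding gmor_nat[OF assms(1) e] using e by (simp add: t calc)
    finally show ?thesis .
  qed
  then show ?thesis unfolding gmor_def by (auto simp: t calc)
qed

lemma gmor_inverse:
  assumes "gmor B G \<theta> \<theta>' \<phi> \<phi>' \<alpha>" "precone B G E \<theta> \<theta>'" "precone B G E \<phi> \<phi>'"
    and inv: "\<And>n. n \<in> nodes G \<Longrightarrow> invertible_cell B (\<alpha> n)"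
  shows "gmor B G \<phi> \<phi>' \<theta> \<theta>' (\<lambda>n. vinv B (\<alpha> n))"
proof -
  note t = precone_typing[OF assms(2)] precone_typing[OF assms(3)]
    gmor_typing[OF assms(1)] edge_typing vinv[OF inv]
  have "\<theta>' e \<bullet> (eP G e \<rhd> vinv B (\<alpha> (es G e))) = (eQ G e \<rhd> vinv B (\<alpha> (et G e))) \<bullet> \<phi>' e"
    if e: "e \<in> edges G" for e
  proof (rule cancel_left)
    show "invertible_cell B (eQ G e \<rhd> \<alpha> (et G e))"
      using e by (intro invertible_whisk_l inv) (simp_all add: t)
    have "(eQ G e \<rhd> \<alpha> (et G e)) \<bullet> \<theta>' e \<bullet> (eP G e \<rhd> vinv B (\<alpha> (es G e)))
       = (\<phi>' e \<bullet> (eP G e \<rhd> \<alpha> (es G e))) \<bullet> (eP G e \<rhd> vinv B (\<alpha> (es G e)))"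
      unfolding gmor_nat[OF assms(1) e] using e by (simp add: t calc)
    \<comment> \<open>Only the typing facts \<open>vinv(1-3)\<close> are supplied here and in the
      mirror step below, so that the composite of a cell with its inverse survives the
      simplification.\<close>
    also have "\<dots> = \<phi>' e \<bullet> (eP G e \<rhd> (\<alpha> (es G e) \<bullet> vinv B (\<alpha> (es G e))))"
      using e by (simp add: t(1-17) edge_typing calc vinv(1-3)[OF inv])
    also have "\<dots> = (eQ G e \<rhd> (\<alpha> (et G e) \<bullet> vinv B (\<alpha> (et G e)))) \<bullet> \<phi>' e"
      using e by (simp add: t calc)
    also have "\<dots> = (eQ G e \<rhd> \<alpha> (et G e)) \<bullet> (eQ G e \<rhd> vinv B (\<alpha> (et G e))) \<bullet> \<phi>' e"
      using e by (simp add: t(1-17) edge_typing calc vinv(1-3)[OF inv])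
    finally show "(eQ G e \<rhd> \<alpha> (et G e)) \<bullet> \<theta>' e \<bullet> (eP G e \<rhd> vinv B (\<alpha> (es G e)))
      = (eQ G e \<rhd> \<alpha> (et G e)) \<bullet> (eQ G e \<rhd> vinv B (\<alpha> (et G e))) \<bullet> \<phi>' e" .
  qed (use e in \<open>simp_all add: t calc\<close>)
  then show ?thesis unfolding gmor_def by (auto simp: t)
qed

lemma gmor_precomp:
  assumes "gmor B G \<theta> \<theta>' \<phi> \<phi>' \<alpha>" "precone B G E \<theta> \<theta>'" "precone B G E \<phi> \<phi>'" "h \<in> arr B" "tgt B h = E"
  shows "gmor B G (\<lambda>n. \<theta> n \<cdot> h) (\<lambda>e. \<theta>' e \<lhd> h) (\<lambda>n. \<phi> n \<cdot> h) (\<lambda>e. \<phi>' e \<lhd> h) (\<lambda>n. \<alpha> n \<lhd> h)"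
proof -
  note t = precone_typing[OF assms(2)] precone_typing[OF assms(3)] gmor_typing[OF assms(1)] edge_typing assms(4,5)
  have "(\<phi>' e \<lhd> h) \<bullet> (eP G e \<rhd> (\<alpha> (es G e) \<lhd> h)) = (eQ G e \<rhd> (\<alpha> (et G e) \<lhd> h)) \<bullet> (\<theta>' e \<lhd> h)"
    if e: "e \<in> edges G" for e
  proof -
    have "(\<phi>' e \<bullet> (eP G e \<rhd> \<alpha> (es G e))) \<lhd> h = ((eQ G e \<rhd> \<alpha> (et G e)) \<bullet> \<theta>' e) \<lhd> h"
      by (simp add: gmor_nat[OF assms(1) e])
    then show ?thesis using e by (simp add: t calc)
  qed
  then show ?thesis unfolding gmor_def by (auto simp: t calc)
qed

text \<open>Naturality at an edge \<open>e\<close> is the interchange of \<open>\<beta>\<close> with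
  \<open>\<theta>' e\<close>.\<close>

lemma gmor_whisk:
  assumes "precone B G E \<theta> \<theta>'" "\<beta> \<in> cell B" "tgt B (vsrc B \<beta>) = E"
  shows "gmor B G (\<lambda>n. \<theta> n \<cdot> vsrc B \<beta>) (\<lambda>e. \<theta>' e \<lhd> vsrc B \<beta>)
    (\<lambda>n. \<theta> n \<cdot> vtgt B \<beta>) (\<lambda>e. \<theta>' e \<lhd> vtgt B \<beta>) (\<lambda>n. \<theta> n \<rhd> \<beta>)"
proof -
  note t = precone_typing[OF assms(1)] edge_typing assms(2,3)
  have "(\<theta>' e \<lhd> vtgt B \<beta>) \<bullet> (eP G e \<rhd> (\<theta> (es G e) \<rhd> \<beta>))
      = (eQ G e \<rhd> (\<theta> (et G e) \<rhd> \<beta>)) \<bullet> (\<theta>' e \<lhd> vsrc B \<beta>)" if e: "e \<in> edges G" for e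
    using whisk_interchange[of \<beta> "\<theta>' e"] e by (simp add: t calc)
  then show ?thesis unfolding gmor_def by (auto simp: t calc)
qed

lemma gmor_vide:
  assumes "precone B G E \<theta> \<theta>'"
  shows "gmor B G \<theta> \<theta>' \<theta> \<theta>' (\<lambda>n. vide B (\<theta> n))"
  using precone_typing[OF assms] by (auto simp: gmor_def calc edge_typing)

lemma gmor_cong:
  assumes "gmor B G \<theta> \<theta>' \<phi> \<phi>' \<alpha>"
    "\<And>n. n \<in> nodes G \<Longrightarrow> \<theta> n = \<theta>1 n" "\<And>e. e \<in> edges G \<Longrightarrow> \<theta>' e = \<theta>1' e"
    "\<And>n. n \<in> nodes G \<Longrightarrow> \<phi> n = \<phi>1 n" "\<And>e. e \<in> edges G \<Longrightarrow> \<phi>' e = \<phi>1' e"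
    "\<And>n. n \<in> nodes G \<Longrightarrow> \<alpha> n = \<alpha>1 n"
  shows "gmor B G \<theta>1 \<theta>1' \<phi>1 \<phi>1' \<alpha>1"
  using assms unfolding gmor_def by (auto simp: edge_typing)

lemma step_val_cong:
  assumes "step_ok B G x" "\<And>n. n \<in> nodes G \<Longrightarrow> \<theta> n = \<theta>1 n" "\<And>e. e \<in> edges G \<Longrightarrow> \<theta>' e = \<theta>1' e"
  shows "step_val B \<theta>1 \<theta>1' x = step_val B \<theta> \<theta>' x"
  using assms by (cases x) auto

lemma gcone_cong:
  assumes "gcone B G E \<theta> \<theta>'" "\<And>n. n \<in> nodes G \<Longrightarrow> \<theta> n = \<theta>1 n" "\<And>e. e \<in> edges G \<Longrightarrow> \<theta>' e = \<theta>1' e"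
  shows "gcone B G E \<theta>1 \<theta>1'"
proof -
  have "precone B G E \<theta>1 \<theta>1'" using gcone_precone[OF assms(1)] assms(2,3)
    by (auto simp: precone_def edge_typing)
  moreover have "eqn_holds B \<theta>1 \<theta>1' q" if "q \<in> eqns G" for q
    using that assms ok step_val_cong[OF _ assms(2,3)]
    by (auto simp: gcone_def diag_ok_def eqn_holds_def eqn_ok_def split: prod.splits)
  ultimately show ?thesis by (simp add: gcone_def)
qed

lemma scone_cong:
  assumes "scone B G E \<theta> \<theta>'" "\<And>n. n \<in> nodes G \<Longrightarrow> \<theta> n = \<theta>1 n" "\<And>e. e \<in> edges G \<Longrightarrow> \<theta>' e = \<theta>1' e"
  shows "scone B G E \<theta>1 \<theta>1'"
  using gcone_cong[OF scone_gcone[OF assms(1)] assms(2,3)] assms(1,3)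
  by (auto simp: scone_def strict_edge)

lemma gcone_transport:
  assumes "gcone B G E \<phi> \<phi>'" "precone B G E \<theta> \<theta>'" "gmor B G \<theta> \<theta>' \<phi> \<phi>' \<kappa>"
    and "\<And>n. n \<in> nodes G \<Longrightarrow> invertible_cell B (\<kappa> n)"
  shows "gcone B G E \<theta> \<theta>'"
  unfolding gcone_def
proof (intro conjI ballI)
  fix q assume "q \<in> eqns G"
  then show "eqn_holds B \<theta> \<theta>' q"
    using ok assms(1) eqn_transport[OF _ assms(3,2) gcone_precone[OF assms(1)] assms(4)]
    by (auto simp: diag_ok_def gcone_def)
qed (rule assms)


section \<open>Straightening a cone, and its uniqueness\<close>

lemma straightening_typing:
  assumes "straightening B G N\<^sub>0 \<phi> \<phi>' \<kappa>" "n \<in> nodes G"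
  shows "\<kappa> n \<in> cell B" "vtgt B (\<kappa> n) = \<phi> n" "invertible_cell B (\<kappa> n)"
  using assms invertible_in_cell by (auto simp: straightening_def)

text \<open>Conjugation by \<open>\<kappa>\<close> transports the whole cone to the domains of the
  cells \<open>\<kappa> n\<close>. At a strict edge the equation of a straightening makes the
  conjugated 2-cell an inverse composed with the cell that it inverts, hence an identity.\<close>

lemma straighten:
  assumes \<phi>: "gcone B G E \<phi> \<phi>'" and \<kappa>: "straightening B G N\<^sub>0 \<phi> \<phi>' \<kappa>"
  defines "\<theta> \<equiv> \<lambda>n. vsrc B (\<kappa> n)"
    and "\<theta>' \<equiv> \<lambda>e. vinv B (eQ G e \<rhd> \<kappa> (et G e)) \<bullet> \<phi>' e \<bullet> (eP G e \<rhd> \<kappa> (es G e))"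
  shows "scone B G E \<theta> \<theta>'" "gmor B G \<theta> \<theta>' \<phi> \<phi>' \<kappa>"
proof -
  note p = gcone_precone[OF \<phi>]
  note t = precone_typing[OF p] edge_typing straightening_typing[OF \<kappa>]
  have s: "src B (vsrc B (\<kappa> n)) = E \<and> tgt B (vsrc B (\<kappa> n)) = ob G n" if "n \<in> nodes G" for n
    using t that cell_parallel_typing[of "\<kappa> n"] by simp
  have inv: "invertible_cell B (eQ G e \<rhd> \<kappa> (et G e))" if "e \<in> edges G" for e
    using that by (intro invertible_whisk_l) (simp_all add: t s)
  note u = t s vinv[OF inv] calc vinv_cancel[OF inv]
  have pc: "precone B G E \<theta> \<theta>'"
    unfolding precone_def \<theta>_def \<theta>'_def by (auto simp: u)
  show m: "gmor B G \<theta> \<theta>' \<phi> \<phi>' \<kappa>"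
    unfolding gmor_def \<theta>_def \<theta>'_def by (auto simp: u)
  have "gcone B G E \<theta> \<theta>'"
    by (rule gcone_transport[OF \<phi> pc m]) (rule t)
  moreover have "identity_cell B (\<theta>' e)" if e: "e \<in> strict G" for e
  proof -
    have "\<theta>' e = vinv B (eQ G e \<rhd> \<kappa> (et G e)) \<bullet> (eQ G e \<rhd> \<kappa> (et G e))"
      using \<kappa> e by (simp add: \<theta>'_def straightening_def)
    then show ?thesis using strict_edge[OF e] by (auto simp: u identity_cell_def)
  qed
  ultimately show "scone B G E \<theta> \<theta>'" by (simp add: scone_def)
qed

text \<open>Converse of \<open>straighten\<close>: the 2-cell of a strict cone at a strict edge is
  an identity and drops out of the naturality square of \<open>\<kappa>\<close>, which leaves the
  equation of a straightening.\<close>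

lemma straightening_gmor:
  assumes "scone B G E \<theta> \<theta>'" "gmor B G \<theta> \<theta>' \<phi> \<phi>' \<kappa>" "precone B G E \<phi> \<phi>'"
    and "\<And>n. n \<in> nodes G \<Longrightarrow> invertible_cell B (\<kappa> n)" "\<And>n. n \<in> N\<^sub>0 \<Longrightarrow> \<kappa> n = vide B (\<phi> n)"
  shows "straightening B G N\<^sub>0 \<phi> \<phi>' \<kappa>"
proof -
  note t = precone_typing[OF scone_precone[OF assms(1)]] edge_typing gmor_typing[OF assms(2)] strict_edge
  have "\<phi>' e \<bullet> (eP G e \<rhd> \<kappa> (es G e)) = eQ G e \<rhd> \<kappa> (et G e)" if e: "e \<in> strict G" for e
  proof -
    have i: "\<theta>' e = vide B (eQ G e \<cdot> \<theta> (et G e))"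
      using assms(1) e identity_cell_iff'[of "\<theta>' e"] by (simp add: t scone_def)
    show ?thesis unfolding gmor_nat[OF assms(2) strict_edge[OF e]] i
      using e by (simp add: t calc)
  qed
  then show ?thesis using assms by (auto simp: straightening_def gmor_typing)
qed

text \<open>The source of the algebra axioms, of the coherence of the projections and of the
  detection of strictness. Both isomorphisms are straightenings of \<open>\<phi>\<close>, so they
  agree; their domains are then the same arrows, and the 2-cells at edges agree because naturality
  expresses them through \<open>\<phi>'\<close> and the common invertible
  \<open>\<kappa>\<close>.\<close>

lemma straightening_unique:
  assumes rect: "rectifiable B G N\<^sub>0"
    and \<phi>: "gcone B G E \<phi> \<phi>'" "\<And>e. e \<in> strict G \<Longrightarrow> invertible_cell B (\<phi>' e)"
    and 1: "scone B G E \<theta>\<^sub>1 \<theta>\<^sub>1'" "gmor B G \<theta>\<^sub>1 \<theta>\<^sub>1' \<phi> \<phi>' \<kappa>\<^sub>1" "\<And>n. n \<in> nodes G \<Longrightarrow> invertible_cell B (\<kappa>\<^sub>1 n)"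
      "\<And>n. n \<in> N\<^sub>0 \<Longrightarrow> \<kappa>\<^sub>1 n = vide B (\<phi> n)"
    and 2: "scone B G E \<theta>\<^sub>2 \<theta>\<^sub>2'" "gmor B G \<theta>\<^sub>2 \<theta>\<^sub>2' \<phi> \<phi>' \<kappa>\<^sub>2" "\<And>n. n \<in> nodes G \<Longrightarrow> invertible_cell B (\<kappa>\<^sub>2 n)"
      "\<And>n. n \<in> N\<^sub>0 \<Longrightarrow> \<kappa>\<^sub>2 n = vide B (\<phi> n)"
  shows "n \<in> nodes G \<Longrightarrow> \<kappa>\<^sub>1 n = \<kappa>\<^sub>2 n" "n \<in> nodes G \<Longrightarrow> \<theta>\<^sub>1 n = \<theta>\<^sub>2 n" "e \<in> edges G \<Longrightarrow> \<theta>\<^sub>1' e = \<theta>\<^sub>2' e"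
proof -
  note p = gcone_precone[OF \<phi>(1)]
  note t = precone_typing[OF scone_precone[OF 1(1)]] precone_typing[OF scone_precone[OF 2(1)]]
    edge_typing gmor_typing[OF 1(2)]
  have \<kappa>: "\<kappa>\<^sub>1 n = \<kappa>\<^sub>2 n" if "n \<in> nodes G" for n
    using rect \<phi> that straightening_gmor[OF 1(1,2) p 1(3,4)] straightening_gmor[OF 2(1,2) p 2(3,4)]
    unfolding rectifiable_def by blast
  have \<theta>: "\<theta>\<^sub>1 n = \<theta>\<^sub>2 n" if "n \<in> nodes G" for n
    using gmor_typing(2)[OF 1(2) that] gmor_typing(2)[OF 2(2) that] \<kappa>[OF that] by simp
  show "n \<in> nodes G \<Longrightarrow> \<kappa>\<^sub>1 n = \<kappa>\<^sub>2 n" "n \<in> nodes G \<Longrightarrow> \<theta>\<^sub>1 n = \<theta>\<^sub>2 n" by (fact \<kappa>, fact \<theta>)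
  show "\<theta>\<^sub>1' e = \<theta>\<^sub>2' e" if e: "e \<in> edges G"
  proof (rule cancel_left)
    show "invertible_cell B (eQ G e \<rhd> \<kappa>\<^sub>1 (et G e))"
      using e 1(3) by (intro invertible_whisk_l) (simp_all add: t)
    show "(eQ G e \<rhd> \<kappa>\<^sub>1 (et G e)) \<bullet> \<theta>\<^sub>1' e = (eQ G e \<rhd> \<kappa>\<^sub>1 (et G e)) \<bullet> \<theta>\<^sub>2' e"
      using gmor_nat[OF 1(2) e] gmor_nat[OF 2(2) e] e by (simp add: edge_typing \<kappa>)
  qed (use e in \<open>simp_all add: t calc \<theta>[symmetric]\<close>)
qed

text \<open>
  The next two lemmas differ in the direction of the cells \<open>\<phi>' (z n)\<close> that relate \<open>n\<close> to its initial object \<open>r n\<close>: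
  towards \<open>n\<close> for lax cones, where \<open>\<kappa> n = \<phi>' (z n)\<close>, and away from \<open>n\<close> for op-lax ones, where \<open>\<kappa> n\<close> is its inverse.
\<close>

lemma rectifiable_forward:
  assumes N: "N\<^sub>0 \<subseteq> nodes G"
    and z: "\<And>n. n \<in> nodes G \<Longrightarrow> r n \<in> N\<^sub>0 \<and> z n \<in> strict G \<and> es G (z n) = r n \<and> et G (z n) = n \<and> eQ G (z n) = ide B (ob G n)"
    and comp: "\<And>E \<phi> \<phi>' e. \<lbrakk>gcone B G E \<phi> \<phi>'; e \<in> strict G\<rbrakk>
      \<Longrightarrow> \<phi>' e \<bullet> (eP G e \<rhd> \<phi>' (z (es G e))) = eQ G e \<rhd> \<phi>' (z (et G e))"
    and unit: "\<And>E \<phi> \<phi>' n. \<lbrakk>gcone B G E \<phi> \<phi>'; n \<in> N\<^sub>0\<rbrakk> \<Longrightarrow> \<phi>' (z n) = vide B (\<phi> n)"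
  shows "rectifiable B G N\<^sub>0"
  unfolding rectifiable_def
proof (intro conjI allI impI ballI)
  fix E \<phi> \<phi>' assume "gcone B G E \<phi> \<phi>' \<and> (\<forall>e \<in> strict G. invertible_cell B (\<phi>' e))"
  then have \<phi>: "gcone B G E \<phi> \<phi>'" and inv: "\<And>e. e \<in> strict G \<Longrightarrow> invertible_cell B (\<phi>' e)" by auto
  note t = precone_typing[OF gcone_precone[OF \<phi>]] edge_typing strict_edge z ob_typing
  have "straightening B G N\<^sub>0 \<phi> \<phi>' (\<lambda>n. \<phi>' (z n))"
    using comp[OF \<phi>] unit[OF \<phi>] inv by (auto simp: straightening_def t calc)
  then show "\<exists>\<kappa>. straightening B G N\<^sub>0 \<phi> \<phi>' \<kappa>" by blast
  \<comment> \<open>The strict edge \<open>z n\<close> starts at \<open>r n\<close>, where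
    \<open>\<kappa>\<close> is an identity, so its equation determines
    \<open>\<kappa> n\<close>.\<close>
  have "\<kappa> n = \<phi>' (z n)" if \<kappa>: "straightening B G N\<^sub>0 \<phi> \<phi>' \<kappa>" and n: "n \<in> nodes G" for \<kappa> n
  proof -
    have "\<kappa> (r n) = vide B (\<phi> (r n))" using \<kappa> z[OF n] by (simp add: straightening_def)
    moreover have "r n \<in> nodes G" using z[OF n] N by auto
    moreover have "\<phi>' (z n) \<bullet> (eP G (z n) \<rhd> \<kappa> (es G (z n))) = eQ G (z n) \<rhd> \<kappa> (et G (z n))"
      using \<kappa> z[OF n] by (auto simp: straightening_def)
    moreover have "tgt B (vsrc B (\<kappa> n)) = ob G n"
      using straightening_typing[OF \<kappa> n] cell_parallel_typing[of "\<kappa> n"] n by (simp add: t)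
    ultimately show ?thesis
      using n straightening_typing[OF \<kappa> n] edge_typing(5,7)[OF strict_edge[of "z n"]] by (simp add: t calc)
  qed
  then show "\<kappa> n = \<kappa>' n" if "straightening B G N\<^sub>0 \<phi> \<phi>' \<kappa> \<and> straightening B G N\<^sub>0 \<phi> \<phi>' \<kappa>'" "n \<in> nodes G" for \<kappa> \<kappa>' n
    using that by metis
qed (rule N)

lemma rectifiable_backward:
  assumes N: "N\<^sub>0 \<subseteq> nodes G"
    and z: "\<And>n. n \<in> nodes G \<Longrightarrow> r n \<in> N\<^sub>0 \<and> z n \<in> strict G \<and> es G (z n) = n \<and> et G (z n) = r n \<and> eP G (z n) = ide B (ob G n)"
    and comp: "\<And>E \<phi> \<phi>' e. \<lbrakk>gcone B G E \<phi> \<phi>'; e \<in> strict G\<rbrakk>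
      \<Longrightarrow> (eQ G e \<rhd> \<phi>' (z (et G e))) \<bullet> \<phi>' e = eP G e \<rhd> \<phi>' (z (es G e))"
    and unit: "\<And>E \<phi> \<phi>' n. \<lbrakk>gcone B G E \<phi> \<phi>'; n \<in> N\<^sub>0\<rbrakk> \<Longrightarrow> \<phi>' (z n) = vide B (\<phi> n)"
  shows "rectifiable B G N\<^sub>0"
  unfolding rectifiable_def
proof (intro conjI allI impI ballI)
  fix E \<phi> \<phi>' assume "gcone B G E \<phi> \<phi>' \<and> (\<forall>e \<in> strict G. invertible_cell B (\<phi>' e))"
  then have \<phi>: "gcone B G E \<phi> \<phi>'" and inv: "\<And>e. e \<in> strict G \<Longrightarrow> invertible_cell B (\<phi>' e)" by auto
  note t = precone_typing[OF gcone_precone[OF \<phi>]] edge_typing strict_edge z ob_typing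
  have vz: "vsrc B (\<phi>' (z n)) = \<phi> n" "tgt B (vtgt B (\<phi>' (z n))) = ob G n" "src B (vtgt B (\<phi>' (z n))) = E"
    if n: "n \<in> nodes G" for n
  proof -
    show "vsrc B (\<phi>' (z n)) = \<phi> n" using n by (simp add: t calc)
    then show "tgt B (vtgt B (\<phi>' (z n))) = ob G n" "src B (vtgt B (\<phi>' (z n))) = E"
      using n cell_parallel_typing[of "\<phi>' (z n)"] by (simp_all add: t)
  qed
  \<comment> \<open>The assumption \<open>comp\<close> is this equation with the inverses moved to
    the other sides; composition with the invertible cell at the target node passes from one to the
    other.\<close>
  have tr: "\<phi>' e \<bullet> (eP G e \<rhd> vinv B (\<phi>' (z (es G e)))) = eQ G e \<rhd> vinv B (\<phi>' (z (et G e)))"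
    if e: "e \<in> strict G" for e
  proof -
    let ?a = "\<phi>' (z (es G e))" and ?b = "\<phi>' (z (et G e))"
    note ed = edge_typing[OF strict_edge[OF e]]
    have i: "invertible_cell B ?a" "invertible_cell B ?b" using ed z inv by auto
    note v = vinv[OF i(1)] vinv[OF i(2)] vz[OF ed(1)] vz[OF ed(2)] invertible_in_cell[OF i(1)] invertible_in_cell[OF i(2)]
    have c: "(eQ G e \<rhd> ?b) \<bullet> \<phi>' e = eP G e \<rhd> ?a" by (rule comp[OF \<phi> e])
    \<comment> \<open>Comparing the codomains of the two sides of \<open>c\<close> gives an equality
      of arrows, without which the composites below could not be typed.\<close>
    have "vtgt B ((eQ G e \<rhd> ?b) \<bullet> \<phi>' e) = vtgt B (eP G e \<rhd> ?a)" by (simp add: c)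
    then have eq: "eQ G e \<cdot> vtgt B ?b = eP G e \<cdot> vtgt B ?a"
      using precone_typing[OF gcone_precone[OF \<phi>]] strict_edge[OF e] ed v by (simp add: calc)
    show ?thesis
    proof (rule cancel_left)
      show "invertible_cell B (eQ G e \<rhd> ?b)"
        using ed i(2) v precone_typing[OF gcone_precone[OF \<phi>]] by (intro invertible_whisk_l) simp_all
      have "(eQ G e \<rhd> ?b) \<bullet> \<phi>' e \<bullet> (eP G e \<rhd> vinv B ?a)
        = ((eQ G e \<rhd> ?b) \<bullet> \<phi>' e) \<bullet> (eP G e \<rhd> vinv B ?a)"
        using precone_typing[OF gcone_precone[OF \<phi>]] strict_edge[OF e] ed v by (subst vcomp_assoc) (simp_all add: calc)
      also have "\<dots> = eP G e \<rhd> (?a \<bullet> vinv B ?a)"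
        unfolding c using ed v precone_typing[OF gcone_precone[OF \<phi>]] by (subst whisk_l_vcomp) simp_all
      also have "\<dots> = vide B (eQ G e \<cdot> vtgt B ?b)"
        using ed v by (simp add: eq calc)
      also have "\<dots> = eQ G e \<rhd> (?b \<bullet> vinv B ?b)"
        using ed v by (simp add: calc)
      also have "\<dots> = (eQ G e \<rhd> ?b) \<bullet> (eQ G e \<rhd> vinv B ?b)"
        using ed v precone_typing[OF gcone_precone[OF \<phi>]] by (subst whisk_l_vcomp) simp_all
      finally show "(eQ G e \<rhd> ?b) \<bullet> \<phi>' e \<bullet> (eP G e \<rhd> vinv B ?a) = (eQ G e \<rhd> ?b) \<bullet> (eQ G e \<rhd> vinv B ?b)" .
    qed (use precone_typing[OF gcone_precone[OF \<phi>]] strict_edge[OF e] ed v eq in \<open>simp_all add: calc\<close>)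
  qed
  have "straightening B G N\<^sub>0 \<phi> \<phi>' (\<lambda>n. vinv B (\<phi>' (z n)))"
    unfolding straightening_def
  proof (intro conjI ballI)
    show "invertible_cell B (vinv B (\<phi>' (z n)))" "vtgt B (vinv B (\<phi>' (z n))) = \<phi> n" if "n \<in> nodes G" for n
      using that z inv by (auto intro: invertible_vinv simp: vinv vz)
    show "vinv B (\<phi>' (z n)) = vide B (\<phi> n)" if "n \<in> N\<^sub>0" for n
      using that N by (auto simp: unit[OF \<phi>] vinv_vide t)
  qed (rule tr)
  then show "\<exists>\<kappa>. straightening B G N\<^sub>0 \<phi> \<phi>' \<kappa>" by blast
  have "\<kappa> n = vinv B (\<phi>' (z n))" if \<kappa>: "straightening B G N\<^sub>0 \<phi> \<phi>' \<kappa>" and n: "n \<in> nodes G" for \<kappa> n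
  proof (rule vinv_unique)
    note k = straightening_typing[OF \<kappa> n]
    have rn: "r n \<in> nodes G" using z[OF n] N by auto
    have kr: "\<kappa> (r n) = vide B (\<phi> (r n))" using \<kappa> z[OF n] by (simp add: straightening_def)
    have tk: "tgt B (vsrc B (\<kappa> n)) = ob G n"
      using k cell_parallel_typing[of "\<kappa> n"] n by (simp add: t)
    have "\<phi>' (z n) \<bullet> (eP G (z n) \<rhd> \<kappa> (es G (z n))) = eQ G (z n) \<rhd> \<kappa> (et G (z n))"
      using \<kappa> z[OF n] by (auto simp: straightening_def)
    then have eq: "\<phi>' (z n) \<bullet> \<kappa> n = vide B (eQ G (z n) \<cdot> \<phi> (r n))"
      using n rn k tk kr edge_typing(4,6)[OF strict_edge[of "z n"]] by (simp add: t calc)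
    then show "\<phi>' (z n) \<bullet> \<kappa> n = vide B (vtgt B (\<phi>' (z n)))"
      using n by (simp add: t)
    \<comment> \<open>A straightening prescribes only the codomain of \<open>\<kappa> n\<close>. Its
      domain is read off from this composite, which is an identity cell.\<close>
    have "vsrc B (\<phi>' (z n) \<bullet> \<kappa> n) = eQ G (z n) \<cdot> \<phi> (r n)"
      unfolding eq using n rn edge_typing(4,6)[OF strict_edge[of "z n"]] by (simp add: t calc)
    then show "vsrc B (\<kappa> n) = vtgt B (\<phi>' (z n))"
      using n k vz[OF n] by (simp add: t calc)
  qed (use n inv z straightening_typing[OF \<kappa> n] vz in auto)
  then show "\<kappa> n = \<kappa>' n" if "straightening B G N\<^sub>0 \<phi> \<phi>' \<kappa> \<and> straightening B G N\<^sub>0 \<phi> \<phi>' \<kappa>'" "n \<in> nodes G" for \<kappa> \<kappa>' n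
    using that by metis
qed (rule N)

section \<open>Elimination rules for the universal property\<close>

lemma glim_scone: "glim B G L \<pi> \<pi>' \<Longrightarrow> scone B G L \<pi> \<pi>'"
  by (simp add: glim_def)

lemma glim_obtain_arr:
  assumes "glim B G L \<pi> \<pi>'" "scone B G E \<theta> \<theta>'"
  obtains h where "h \<in> arr B" "src B h = E" "tgt B h = L" "\<And>n. n \<in> nodes G \<Longrightarrow> \<pi> n \<cdot> h = \<theta> n"
    "\<And>e. e \<in> edges G \<Longrightarrow> \<pi>' e \<lhd> h = \<theta>' e"
proof -
  have "\<exists>h \<in> hom B E L. (\<forall>n \<in> nodes G. \<pi> n \<cdot> h = \<theta> n) \<and> (\<forall>e \<in> edges G. \<pi>' e \<lhd> h = \<theta>' e)"
    using assms(1)[unfolded glim_def, THEN conjunct2, THEN conjunct2, THEN conjunct1] assms(2) by simp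
  then obtain h where "h \<in> hom B E L" "\<forall>n \<in> nodes G. \<pi> n \<cdot> h = \<theta> n" "\<forall>e \<in> edges G. \<pi>' e \<lhd> h = \<theta>' e"
    by auto
  then show ?thesis by (intro that[of h]) (auto simp: hom_iff)
qed

lemma glim_arr_eqI:
  assumes "glim B G L \<pi> \<pi>'" "h \<in> arr B" "k \<in> arr B" "src B h = src B k" "tgt B h = L" "tgt B k = L"
    "\<And>n. n \<in> nodes G \<Longrightarrow> \<pi> n \<cdot> h = \<pi> n \<cdot> k" "\<And>e. e \<in> edges G \<Longrightarrow> \<pi>' e \<lhd> h = \<pi>' e \<lhd> k"
  shows "h = k"
  using assms(1)[unfolded glim_def, THEN conjunct2, THEN conjunct2, THEN conjunct2, THEN conjunct1] assms(2-)
  by (simp add: hom_iff)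

lemma glim_obtain_cell:
  assumes "glim B G L \<pi> \<pi>'" "h \<in> arr B" "k \<in> arr B" "src B h = src B k" "tgt B h = L" "tgt B k = L"
    "gmor B G (\<lambda>n. \<pi> n \<cdot> h) (\<lambda>e. \<pi>' e \<lhd> h) (\<lambda>n. \<pi> n \<cdot> k) (\<lambda>e. \<pi>' e \<lhd> k) \<alpha>"
  obtains \<beta> where "\<beta> \<in> cell B" "vsrc B \<beta> = h" "vtgt B \<beta> = k" "\<And>n. n \<in> nodes G \<Longrightarrow> \<pi> n \<rhd> \<beta> = \<alpha> n"
proof -
  have "\<exists>\<beta> \<in> cells B h k. \<forall>n \<in> nodes G. \<pi> n \<rhd> \<beta> = \<alpha> n"
    using assms(1)[unfolded glim_def, THEN conjunct2, THEN conjunct2, THEN conjunct2, THEN conjunct2, THEN conjunct1]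
      assms(2-) by (simp add: hom_iff)
  then obtain \<beta> where "\<beta> \<in> cells B h k" "\<forall>n \<in> nodes G. \<pi> n \<rhd> \<beta> = \<alpha> n" by auto
  then show ?thesis by (intro that[of \<beta>]) (auto simp: cells_iff)
qed

lemma glim_cell_eqI:
  assumes "glim B G L \<pi> \<pi>'" "\<beta> \<in> cell B" "\<gamma> \<in> cell B" "vsrc B \<beta> = vsrc B \<gamma>" "vtgt B \<beta> = vtgt B \<gamma>"
    "tgt B (vsrc B \<beta>) = L" "\<And>n. n \<in> nodes G \<Longrightarrow> \<pi> n \<rhd> \<beta> = \<pi> n \<rhd> \<gamma>"
  shows "\<beta> = \<gamma>"
proof -
  have "vsrc B \<beta> \<in> hom B (src B (vsrc B \<beta>)) L" "vtgt B \<beta> \<in> hom B (src B (vsrc B \<beta>)) L"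
    "\<beta> \<in> cells B (vsrc B \<beta>) (vtgt B \<beta>)" "\<gamma> \<in> cells B (vsrc B \<beta>) (vtgt B \<beta>)"
    using assms(2-6) cell_parallel_typing[OF assms(2)] by (auto simp: hom_iff cells_iff vsrc_arr vtgt_arr simp del: cell_parallel_typing)
  then show ?thesis using assms(1)[unfolded glim_def, THEN conjunct2, THEN conjunct2, THEN conjunct2, THEN conjunct2, THEN conjunct2]
      assms(7) by blast
qed

text \<open>The inverses of the whiskered cells form a morphism of cones, so they come from a 2-cell
  \<open>\<gamma>\<close>. That \<open>\<gamma>\<close> inverts \<open>\<beta>\<close> is checked
  after whiskering with the projections.\<close>

lemma glim_cell_invertible:
  assumes lim: "glim B G L \<pi> \<pi>'" and \<beta>: "\<beta> \<in> cell B" "tgt B (vsrc B \<beta>) = L"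
    and inv: "\<And>n. n \<in> nodes G \<Longrightarrow> invertible_cell B (\<pi> n \<rhd> \<beta>)"
  shows "invertible_cell B \<beta>"
proof -
  note s = glim_scone[OF lim]
  note p = scone_precone[OF s]
  note t = precone_typing[OF p] \<beta> vsrc_arr[OF \<beta>(1)] vtgt_arr[OF \<beta>(1)] cell_parallel_typing[OF \<beta>(1)]
  have m: "gmor B G (\<lambda>n. \<pi> n \<cdot> vtgt B \<beta>) (\<lambda>e. \<pi>' e \<lhd> vtgt B \<beta>) (\<lambda>n. \<pi> n \<cdot> vsrc B \<beta>) (\<lambda>e. \<pi>' e \<lhd> vsrc B \<beta>)
     (\<lambda>n. vinv B (\<pi> n \<rhd> \<beta>))"
    using precone_precomp[OF p, of "vsrc B \<beta>"] precone_precomp[OF p, of "vtgt B \<beta>"]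
    by (intro gmor_inverse[OF gmor_whisk[OF p]] inv) (simp_all add: t)
  obtain \<gamma> where \<gamma>: "\<gamma> \<in> cell B" "vsrc B \<gamma> = vtgt B \<beta>" "vtgt B \<gamma> = vsrc B \<beta>"
      "\<And>n. n \<in> nodes G \<Longrightarrow> \<pi> n \<rhd> \<gamma> = vinv B (\<pi> n \<rhd> \<beta>)"
    by (rule glim_obtain_cell[OF lim _ _ _ _ _ m]) (simp_all add: t)
  show ?thesis
  proof (rule invertibleI[of _ \<gamma>])
    show "\<gamma> \<bullet> \<beta> = vide B (vsrc B \<beta>)"
      by (rule glim_cell_eqI[OF lim]) (simp_all add: t \<gamma> calc(1-17) hcomp_vide whisk_l_vcomp vinv[OF inv])
    show "\<beta> \<bullet> \<gamma> = vide B (vtgt B \<beta>)"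
      by (rule glim_cell_eqI[OF lim]) (simp_all add: t \<gamma> calc(1-17) hcomp_vide whisk_l_vcomp vinv[OF inv])
  qed (simp_all add: t \<gamma>)
qed

end

section \<open>Algebras, pseudo morphisms and the action of the 2-monad on cones\<close>

definition dimage :: "('o, 'a, 'c, 'p, 'b, 'd) fun2 \<Rightarrow> ('n, 'e, 'o, 'a, 'c) diag \<Rightarrow> ('n, 'e, 'p, 'b, 'd) diag" where
  "dimage U G = \<lparr>nodes = nodes G, edges = edges G, ob = ob_map U \<circ> ob G, es = es G, et = et G,
     eP = ar_map U \<circ> eP G, eQ = ar_map U \<circ> eQ G, strict = strict G,
     eqns = (\<lambda>(x, x', y, y'). (map_step id id (ar_map U) (cell_map U) x, map_step id id (ar_map U) (cell_map U) x',
       map_step id id (ar_map U) (cell_map U) y, map_step id id (ar_map U) (cell_map U) y')) ` eqns G\<rparr>"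

lemma dimage_simps [simp]:
  "nodes (dimage U G) = nodes G" "edges (dimage U G) = edges G" "ob (dimage U G) n = ob_map U (ob G n)"
  "es (dimage U G) = es G" "et (dimage U G) = et G" "eP (dimage U G) e = ar_map U (eP G e)"
  "eQ (dimage U G) e = ar_map U (eQ G e)" "strict (dimage U G) = strict G"
  by (simp_all add: dimage_def)

lemma TAlg_simps [simp]:
  "obj (TAlg K T i m) = strict_alg K T i m" "arr (TAlg K T i m) = ps_mor K T i m"
  "src (TAlg K T i m) = ps_dom" "tgt (TAlg K T i m) = ps_cod"
  "comp (TAlg K T i m) = ps_comp K T" "cell (TAlg K T i m) = alg_cell K T i m"
  "vsrc (TAlg K T i m) = ac_src" "vtgt (TAlg K T i m) = ac_tgt"
  "vide (TAlg K T i m) f = AlgCell f f (vide K (ps_arr f))"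
  "vcomp (TAlg K T i m) \<beta> \<alpha> = AlgCell (ac_src \<alpha>) (ac_tgt \<beta>) (ac_cell \<beta> \<bullet>\<^bsub>K\<^esub> ac_cell \<alpha>)"
  "hcomp (TAlg K T i m) \<beta> \<alpha> = AlgCell (ps_comp K T (ac_src \<beta>) (ac_src \<alpha>)) (ps_comp K T (ac_tgt \<beta>) (ac_tgt \<alpha>))
                 (ac_cell \<beta> \<star>\<^bsub>K\<^esub> ac_cell \<alpha>)"
  by (simp_all add: TAlg_def)

lemma forget_simps [simp]: "ob_map forget = fst" "ar_map forget = ps_arr" "cell_map forget = ac_cell"
  by (simp_all add: forget_def)

lemma ps_comp_simps [simp]:
  "ps_dom (ps_comp K T g f) = ps_dom f" "ps_cod (ps_comp K T g f) = ps_cod g"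
  "ps_arr (ps_comp K T g f) = ps_arr g \<cdot>\<^bsub>K\<^esub> ps_arr f"
  "ps_cell (ps_comp K T g f) = (ps_arr g \<rhd>\<^bsub>K\<^esub> ps_cell f) \<bullet>\<^bsub>K\<^esub> (ps_cell g \<lhd>\<^bsub>K\<^esub> ar_map T (ps_arr f))"
  by (simp_all add: ps_comp_def)

section \<open>Typing and equational facts about the 2-monad, its algebras and their
  morphisms\<close>

locale algebras = two_category K for K :: "('o, 'a, 'c) cat2" (structure) +
  fixes T :: "('o, 'a, 'c, 'o, 'a, 'c) fun2" and i m :: "'o \<Rightarrow> 'a"
  assumes monad: "two_monad K T i m"
begin

abbreviation Alg where "Alg \<equiv> TAlg K T i m"
abbreviation T0 where "T0 \<equiv> ob_map T"
abbreviation T1 where "T1 \<equiv> ar_map T"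
abbreviation T2 where "T2 \<equiv> cell_map T"

lemma T_functor: "two_functor K K T"
  using monad unfolding two_monad_def two_natural_def by blast

lemma T_typing:
  "x \<in> obj K \<Longrightarrow> T0 x \<in> obj K"
  "f \<in> arr K \<Longrightarrow> T1 f \<in> arr K" "f \<in> arr K \<Longrightarrow> src K (T1 f) = T0 (src K f)"
  "f \<in> arr K \<Longrightarrow> tgt K (T1 f) = T0 (tgt K f)"
  "\<alpha> \<in> cell K \<Longrightarrow> T2 \<alpha> \<in> cell K" "\<alpha> \<in> cell K \<Longrightarrow> vsrc K (T2 \<alpha>) = T1 (vsrc K \<alpha>)"
  "\<alpha> \<in> cell K \<Longrightarrow> vtgt K (T2 \<alpha>) = T1 (vtgt K \<alpha>)"
  using T_functor
  by (auto simp: two_functor_def cat_functor_def cat_functor_axioms_def two_functor_axioms_def hom_iff cells_iff)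

lemma T_pres:
  "x \<in> obj K \<Longrightarrow> T1 (ide K x) = ide K (T0 x)"
  "\<lbrakk>f \<in> arr K; g \<in> arr K; tgt K f = src K g\<rbrakk> \<Longrightarrow> T1 (g \<cdot> f) = T1 g \<cdot> T1 f"
  "f \<in> arr K \<Longrightarrow> T2 (vide K f) = vide K (T1 f)"
  "\<lbrakk>\<alpha> \<in> cell K; \<beta> \<in> cell K; vtgt K \<alpha> = vsrc K \<beta>\<rbrakk> \<Longrightarrow> T2 (\<beta> \<bullet> \<alpha>) = T2 \<beta> \<bullet> T2 \<alpha>"
  "\<lbrakk>\<alpha> \<in> cell K; \<beta> \<in> cell K; tgt K (vsrc K \<alpha>) = src K (vsrc K \<beta>)\<rbrakk> \<Longrightarrow> T2 (\<beta> \<star> \<alpha>) = T2 \<beta> \<star> T2 \<alpha>"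
  using T_functor by (auto simp: two_functor_def cat_functor_def cat_functor_axioms_def two_functor_axioms_def)

lemma T_invertible: "invertible_cell K \<alpha> \<Longrightarrow> invertible_cell K (T2 \<alpha>)"
  using vinv[of \<alpha>] invertible_in_cell[of \<alpha>]
  by (intro invertibleI[of _ "T2 (vinv K \<alpha>)"]) (simp_all add: T_typing T_pres(4)[symmetric] T_pres(3) calc)

lemma unit_typing:
  "x \<in> obj K \<Longrightarrow> i x \<in> arr K" "x \<in> obj K \<Longrightarrow> src K (i x) = x" "x \<in> obj K \<Longrightarrow> tgt K (i x) = T0 x"
  using monad by (auto simp: two_monad_def two_natural_def two_natural_axioms_def id_fun2_def hom_iff)

lemma mult_typing:
  "x \<in> obj K \<Longrightarrow> m x \<in> arr K" "x \<in> obj K \<Longrightarrow> src K (m x) = T0 (T0 x)" "x \<in> obj K \<Longrightarrow> tgt K (m x) = T0 x"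
  using monad by (auto simp: two_monad_def two_natural_def two_natural_axioms_def comp_fun2_def hom_iff)

lemma unit_nat:
  "\<lbrakk>f \<in> arr K; x = src K f\<rbrakk> \<Longrightarrow> T1 f \<cdot> i x = i (tgt K f) \<cdot> f"
  "\<lbrakk>\<alpha> \<in> cell K; x = src K (vsrc K \<alpha>)\<rbrakk> \<Longrightarrow> T2 \<alpha> \<lhd> i x = i (tgt K (vsrc K \<alpha>)) \<rhd> \<alpha>"
  using monad by (auto simp: two_monad_def two_natural_def two_natural_axioms_def id_fun2_def)

lemma mult_nat:
  "\<lbrakk>f \<in> arr K; x = src K f\<rbrakk> \<Longrightarrow> T1 f \<cdot> m x = m (tgt K f) \<cdot> T1 (T1 f)"
  "\<lbrakk>\<alpha> \<in> cell K; x = src K (vsrc K \<alpha>)\<rbrakk> \<Longrightarrow> T2 \<alpha> \<lhd> m x = m (tgt K (vsrc K \<alpha>)) \<rhd> T2 (T2 \<alpha>)"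
  using monad by (auto simp: two_monad_def two_natural_def two_natural_axioms_def comp_fun2_def)

text \<open>In right-associated composites the redex of \<open>unit_nat\<close> is followed by a
  further arrow \<open>k\<close>, so simplification needs this second form. The same device gives
  \<open>mult_nat'\<close>, \<open>alg_laws\<close> and \<open>ps_laws\<close>.\<close>

lemma unit_nat':
  "\<lbrakk>f \<in> arr K; x = src K f; k \<in> arr K; tgt K k = x\<rbrakk> \<Longrightarrow> T1 f \<cdot> (i x \<cdot> k) = i (tgt K f) \<cdot> (f \<cdot> k)"
  "\<lbrakk>\<alpha> \<in> cell K; x = src K (vsrc K \<alpha>); k \<in> arr K; tgt K k = x\<rbrakk>
    \<Longrightarrow> T2 \<alpha> \<lhd> (i x \<cdot> k) = i (tgt K (vsrc K \<alpha>)) \<rhd> (\<alpha> \<lhd> k)"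
proof -
  assume f: "f \<in> arr K" "x = src K f" "k \<in> arr K" "tgt K k = x"
  have "T1 f \<cdot> (i x \<cdot> k) = (T1 f \<cdot> i x) \<cdot> k" using f by (simp add: T_typing unit_typing calc)
  then show "T1 f \<cdot> (i x \<cdot> k) = i (tgt K f) \<cdot> (f \<cdot> k)" using f by (simp add: unit_nat T_typing unit_typing calc)
next
  assume f: "\<alpha> \<in> cell K" "x = src K (vsrc K \<alpha>)" "k \<in> arr K" "tgt K k = x"
  have "T2 \<alpha> \<lhd> (i x \<cdot> k) = (T2 \<alpha> \<lhd> i x) \<lhd> k" using f by (simp add: T_typing unit_typing calc)
  then show "T2 \<alpha> \<lhd> (i x \<cdot> k) = i (tgt K (vsrc K \<alpha>)) \<rhd> (\<alpha> \<lhd> k)"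
    using f by (simp add: unit_nat T_typing unit_typing calc)
qed

lemma mult_nat':
  "\<lbrakk>f \<in> arr K; x = src K f; k \<in> arr K; tgt K k = T0 (T0 x)\<rbrakk> \<Longrightarrow> T1 f \<cdot> (m x \<cdot> k) = m (tgt K f) \<cdot> (T1 (T1 f) \<cdot> k)"
  "\<lbrakk>\<alpha> \<in> cell K; x = src K (vsrc K \<alpha>); k \<in> arr K; tgt K k = T0 (T0 x)\<rbrakk>
    \<Longrightarrow> T2 \<alpha> \<lhd> (m x \<cdot> k) = m (tgt K (vsrc K \<alpha>)) \<rhd> (T2 (T2 \<alpha>) \<lhd> k)"
proof -
  assume f: "f \<in> arr K" "x = src K f" "k \<in> arr K" "tgt K k = T0 (T0 x)"
  have "T1 f \<cdot> (m x \<cdot> k) = (T1 f \<cdot> m x) \<cdot> k" using f by (simp add: T_typing mult_typing calc)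
  then show "T1 f \<cdot> (m x \<cdot> k) = m (tgt K f) \<cdot> (T1 (T1 f) \<cdot> k)" using f by (simp add: mult_nat T_typing mult_typing calc)
next
  assume f: "\<alpha> \<in> cell K" "x = src K (vsrc K \<alpha>)" "k \<in> arr K" "tgt K k = T0 (T0 x)"
  have "T2 \<alpha> \<lhd> (m x \<cdot> k) = (T2 \<alpha> \<lhd> m x) \<lhd> k" using f by (simp add: T_typing mult_typing calc)
  then show "T2 \<alpha> \<lhd> (m x \<cdot> k) = m (tgt K (vsrc K \<alpha>)) \<rhd> (T2 (T2 \<alpha>) \<lhd> k)"
    using f by (simp add: mult_nat T_typing mult_typing calc)
qed

lemma alg_typing:
  assumes "A \<in> strict_alg K T i m"
  shows "fst A \<in> obj K" "snd A \<in> arr K" "src K (snd A) = T0 (fst A)" "tgt K (snd A) = fst A"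
    "snd A \<cdot> i (fst A) = ide K (fst A)" "snd A \<cdot> m (fst A) = snd A \<cdot> T1 (snd A)"
  using assms by (auto simp: strict_alg_def hom_iff)

lemma alg_laws:
  assumes A: "A \<in> strict_alg K T i m" and k: "k \<in> arr K"
  shows "tgt K k = fst A \<Longrightarrow> snd A \<cdot> (i (fst A) \<cdot> k) = k"
    "tgt K k = T0 (T0 (fst A)) \<Longrightarrow> snd A \<cdot> (m (fst A) \<cdot> k) = snd A \<cdot> (T1 (snd A) \<cdot> k)"
proof -
  note t = alg_typing[OF A] unit_typing mult_typing T_typing
  show "snd A \<cdot> (i (fst A) \<cdot> k) = k" if "tgt K k = fst A"
    using comp_assoc[of k "i (fst A)" "snd A"] that k by (simp add: t ide_cancel)
  show "snd A \<cdot> (m (fst A) \<cdot> k) = snd A \<cdot> (T1 (snd A) \<cdot> k)" if "tgt K k = T0 (T0 (fst A))"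
    using comp_assoc[of k "m (fst A)" "snd A"] comp_assoc[of k "T1 (snd A)" "snd A"] that k
    by (simp add: t)
qed

lemma ps_mor_iff:
  "R \<in> ps_mor K T i m \<longleftrightarrow> ps_dom R \<in> strict_alg K T i m \<and> ps_cod R \<in> strict_alg K T i m \<and>
    ps_arr R \<in> arr K \<and> src K (ps_arr R) = fst (ps_dom R) \<and> tgt K (ps_arr R) = fst (ps_cod R) \<and>
    ps_cell R \<in> cell K \<and> vsrc K (ps_cell R) = snd (ps_cod R) \<cdot> T1 (ps_arr R) \<and>
    vtgt K (ps_cell R) = ps_arr R \<cdot> snd (ps_dom R) \<and> invertible_cell K (ps_cell R) \<and>
    ps_cell R \<lhd> i (fst (ps_dom R)) = vide K (ps_arr R) \<and>
    ps_cell R \<lhd> m (fst (ps_dom R)) =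
      (ps_cell R \<lhd> T1 (snd (ps_dom R))) \<bullet> (snd (ps_cod R) \<rhd> T2 (ps_cell R))"
  by (cases R) (auto simp: ps_mor_def hom_iff cells_iff)

lemma ps_typing:
  assumes "R \<in> ps_mor K T i m"
  shows "ps_dom R \<in> strict_alg K T i m" "ps_cod R \<in> strict_alg K T i m"
    "ps_arr R \<in> arr K" "src K (ps_arr R) = fst (ps_dom R)" "tgt K (ps_arr R) = fst (ps_cod R)"
    "ps_cell R \<in> cell K" "vsrc K (ps_cell R) = snd (ps_cod R) \<cdot> T1 (ps_arr R)"
    "vtgt K (ps_cell R) = ps_arr R \<cdot> snd (ps_dom R)" "invertible_cell K (ps_cell R)"
    "ps_cell R \<lhd> i (fst (ps_dom R)) = vide K (ps_arr R)"
    "ps_cell R \<lhd> m (fst (ps_dom R)) =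
      (ps_cell R \<lhd> T1 (snd (ps_dom R))) \<bullet> (snd (ps_cod R) \<rhd> T2 (ps_cell R))"
  using assms by (auto simp: ps_mor_iff)

lemma ps_laws:
  assumes R: "R \<in> ps_mor K T i m" and k: "k \<in> arr K"
  shows "tgt K k = fst (ps_dom R) \<Longrightarrow> ps_cell R \<lhd> (i (fst (ps_dom R)) \<cdot> k) = vide K (ps_arr R \<cdot> k)"
    "tgt K k = T0 (T0 (fst (ps_dom R))) \<Longrightarrow> ps_cell R \<lhd> (m (fst (ps_dom R)) \<cdot> k) =
      (ps_cell R \<lhd> (T1 (snd (ps_dom R)) \<cdot> k)) \<bullet> (snd (ps_cod R) \<rhd> (T2 (ps_cell R) \<lhd> k))"
proof -
  note a = ps_typing(1,2)[OF R]
  note t = ps_typing(3-8)[OF R] alg_typing[OF a(1)] alg_typing[OF a(2)] T_typing unit_typing mult_typing T_pres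
  show "ps_cell R \<lhd> (i (fst (ps_dom R)) \<cdot> k) = vide K (ps_arr R \<cdot> k)" if "tgt K k = fst (ps_dom R)"
    using that k whisk_r_comp[of "ps_cell R" "i (fst (ps_dom R))" k, symmetric]
    by (simp add: t ps_typing(10)[OF R] calc(1-3) hcomp_vide)
  show "ps_cell R \<lhd> (m (fst (ps_dom R)) \<cdot> k) =
      (ps_cell R \<lhd> (T1 (snd (ps_dom R)) \<cdot> k)) \<bullet> (snd (ps_cod R) \<rhd> (T2 (ps_cell R) \<lhd> k))"
    if "tgt K k = T0 (T0 (fst (ps_dom R)))"
    using that k whisk_r_comp[of "ps_cell R" "m (fst (ps_dom R))" k, symmetric]
    by (simp add: t ps_typing(11)[OF R] calc)
qed

lemma alg_cell_iff:
  "\<gamma> \<in> alg_cell K T i m \<longleftrightarrow> ac_src \<gamma> \<in> ps_mor K T i m \<and> ac_tgt \<gamma> \<in> ps_mor K T i m \<and>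
    ps_dom (ac_tgt \<gamma>) = ps_dom (ac_src \<gamma>) \<and> ps_cod (ac_tgt \<gamma>) = ps_cod (ac_src \<gamma>) \<and>
    ac_cell \<gamma> \<in> cell K \<and> vsrc K (ac_cell \<gamma>) = ps_arr (ac_src \<gamma>) \<and> vtgt K (ac_cell \<gamma>) = ps_arr (ac_tgt \<gamma>) \<and>
    (ac_cell \<gamma> \<lhd> snd (ps_dom (ac_src \<gamma>))) \<bullet> ps_cell (ac_src \<gamma>)
      = ps_cell (ac_tgt \<gamma>) \<bullet> (snd (ps_cod (ac_src \<gamma>)) \<rhd> T2 (ac_cell \<gamma>))"
  by (cases \<gamma>) (auto simp: alg_cell_def cells_iff)

lemma alg_cell_typing:
  assumes "\<gamma> \<in> alg_cell K T i m"
  shows "ac_src \<gamma> \<in> ps_mor K T i m" "ac_tgt \<gamma> \<in> ps_mor K T i m"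
    "ps_dom (ac_tgt \<gamma>) = ps_dom (ac_src \<gamma>)" "ps_cod (ac_tgt \<gamma>) = ps_cod (ac_src \<gamma>)"
    "ac_cell \<gamma> \<in> cell K" "vsrc K (ac_cell \<gamma>) = ps_arr (ac_src \<gamma>)" "vtgt K (ac_cell \<gamma>) = ps_arr (ac_tgt \<gamma>)"
    "(ac_cell \<gamma> \<lhd> snd (ps_dom (ac_src \<gamma>))) \<bullet> ps_cell (ac_src \<gamma>)
      = ps_cell (ac_tgt \<gamma>) \<bullet> (snd (ps_cod (ac_src \<gamma>)) \<rhd> T2 (ac_cell \<gamma>))"
  using assms by (auto simp: alg_cell_iff)

end

text \<open>
  That algebras form a 2-category is part of this assumption on the diagram, as it is part of \<open>two_functor I Alg F\<close>.
\<close>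

locale alg_diagram = algebras K T i m + TA: diagram "TAlg K T i m" G
  for K :: "('o, 'a, 'c) cat2" (structure) and T i m
    and G :: "('n, 'e, 'o \<times> 'a, ('o, 'a, 'c) psmor, ('o, 'a, 'c) algcell) diag"
begin

abbreviation "UG \<equiv> dimage forget G"

abbreviation "proj_step \<equiv> map_step id id ps_arr ac_cell"

lemma step_ok_proj: "step_ok Alg G x \<Longrightarrow> step_ok K UG (proj_step x)"
  by (cases x) (auto simp: ps_typing alg_cell_typing TA.edge_typing[simplified])

lemma step_src_proj: "step_ok Alg G x \<Longrightarrow>
    step_src K UG (proj_step x) = (ps_arr (fst (step_src Alg G x)), snd (step_src Alg G x))"
  "step_ok Alg G x \<Longrightarrow>
    step_tgt K UG (proj_step x) = (ps_arr (fst (step_tgt Alg G x)), snd (step_tgt Alg G x))"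
  by (cases x; auto simp: alg_cell_typing)+

lemma diag_ok_proj: "diag_ok K UG"
proof -
  have "eqn_ok K UG q" if "q \<in> eqns UG" for q
  proof -
    obtain x x' y y' where e: "(x, x', y, y') \<in> eqns G"
      and q: "q = (proj_step x, proj_step x', proj_step y, proj_step y')"
      using \<open>q \<in> eqns UG\<close> by (auto simp: dimage_def)
    then have "eqn_ok Alg G (x, x', y, y')" using TA.ok by (auto simp: diag_ok_def)
    then show ?thesis by (auto simp: eqn_ok_def q step_ok_proj step_src_proj)
  qed
  then show ?thesis
    using TA.ob_typing TA.edge_typing[simplified]
    by (auto simp: diag_ok_def alg_typing ps_typing TA.strict_edge)
qed

sublocale UG: diagram K UG
  by unfold_locales (rule diag_ok_proj)

text \<open>Structure arrows of the algebra at a node and, for \<open>dx\<close>, of the algebra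
  that is the common codomain of the two pseudo morphisms at an edge. The structure cells of these
  two morphisms are abbreviated \<open>cP\<close> and \<open>cQ\<close> below.\<close>

definition dn where "dn n = snd (ob G n)"
definition dx where "dx e = snd (ps_cod (eP G e))"

lemma dn_alg: "n \<in> nodes G \<Longrightarrow> ob G n \<in> strict_alg K T i m"
  using TA.ob_typing by simp

lemma dn_typing:
  assumes "n \<in> nodes G"
  shows "fst (ob G n) \<in> obj K" "dn n \<in> arr K" "src K (dn n) = T0 (fst (ob G n))" "tgt K (dn n) = fst (ob G n)"
    "dn n \<cdot> i (fst (ob G n)) = ide K (fst (ob G n))" "dn n \<cdot> m (fst (ob G n)) = dn n \<cdot> T1 (dn n)"
    "\<lbrakk>k \<in> arr K; tgt K k = fst (ob G n)\<rbrakk> \<Longrightarrow> dn n \<cdot> (i (fst (ob G n)) \<cdot> k) = k"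
    "\<lbrakk>k \<in> arr K; tgt K k = T0 (T0 (fst (ob G n)))\<rbrakk>
      \<Longrightarrow> dn n \<cdot> (m (fst (ob G n)) \<cdot> k) = dn n \<cdot> (T1 (dn n) \<cdot> k)"
  using alg_typing[OF dn_alg[OF assms]] alg_laws[OF dn_alg[OF assms]] by (simp_all add: dn_def)

abbreviation "xo e \<equiv> fst (ps_cod (eP G e))"
abbreviation "pP e \<equiv> ps_arr (eP G e)"
abbreviation "pQ e \<equiv> ps_arr (eQ G e)"
abbreviation "cP e \<equiv> ps_cell (eP G e)"
abbreviation "cQ e \<equiv> ps_cell (eQ G e)"

lemma edge_ps:
  assumes "e \<in> edges G"
  shows "eP G e \<in> ps_mor K T i m" "eQ G e \<in> ps_mor K T i m" "ps_dom (eP G e) = ob G (es G e)"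
    "ps_dom (eQ G e) = ob G (et G e)" "ps_cod (eQ G e) = ps_cod (eP G e)"
  using TA.edge_typing[OF assms] by simp_all

lemma e_typing:
  assumes e: "e \<in> edges G"
  shows "es G e \<in> nodes G" "et G e \<in> nodes G"
    "pP e \<in> arr K" "src K (pP e) = fst (ob G (es G e))" "tgt K (pP e) = xo e"
    "pQ e \<in> arr K" "src K (pQ e) = fst (ob G (et G e))" "tgt K (pQ e) = xo e"
    "dx e \<in> arr K" "src K (dx e) = T0 (xo e)" "tgt K (dx e) = xo e" "xo e \<in> obj K"
    "cP e \<in> cell K" "vsrc K (cP e) = dx e \<cdot> T1 (pP e)" "vtgt K (cP e) = pP e \<cdot> dn (es G e)" "invertible_cell K (cP e)"
    "cQ e \<in> cell K" "vsrc K (cQ e) = dx e \<cdot> T1 (pQ e)" "vtgt K (cQ e) = pQ e \<cdot> dn (et G e)" "invertible_cell K (cQ e)"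
  using TA.edge_typing(1,2)[OF e] ps_typing[OF edge_ps(1)[OF e]] ps_typing[OF edge_ps(2)[OF e]]
    alg_typing[OF ps_typing(2)[OF edge_ps(1)[OF e]]]
  by (simp_all add: edge_ps(3-5)[OF e] dx_def dn_def)

lemma e_laws:
  assumes e: "e \<in> edges G"
  shows "dx e \<cdot> i (xo e) = ide K (xo e)" "dx e \<cdot> m (xo e) = dx e \<cdot> T1 (dx e)"
    "\<lbrakk>k \<in> arr K; tgt K k = xo e\<rbrakk> \<Longrightarrow> dx e \<cdot> (i (xo e) \<cdot> k) = k"
    "\<lbrakk>k \<in> arr K; tgt K k = T0 (T0 (xo e))\<rbrakk> \<Longrightarrow> dx e \<cdot> (m (xo e) \<cdot> k) = dx e \<cdot> (T1 (dx e) \<cdot> k)"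
    "\<lbrakk>k \<in> arr K; tgt K k = fst (ob G (es G e))\<rbrakk>
      \<Longrightarrow> cP e \<lhd> (i (fst (ob G (es G e))) \<cdot> k) = vide K (pP e \<cdot> k)"
    "\<lbrakk>k \<in> arr K; tgt K k = fst (ob G (et G e))\<rbrakk>
      \<Longrightarrow> cQ e \<lhd> (i (fst (ob G (et G e))) \<cdot> k) = vide K (pQ e \<cdot> k)"
    "\<lbrakk>k \<in> arr K; tgt K k = T0 (T0 (fst (ob G (es G e))))\<rbrakk> \<Longrightarrow> cP e \<lhd> (m (fst (ob G (es G e))) \<cdot> k) =
      (cP e \<lhd> (T1 (dn (es G e)) \<cdot> k)) \<bullet> (dx e \<rhd> (T2 (cP e) \<lhd> k))"
    "\<lbrakk>k \<in> arr K; tgt K k = T0 (T0 (fst (ob G (et G e))))\<rbrakk> \<Longrightarrow> cQ e \<lhd> (m (fst (ob G (et G e))) \<cdot> k) =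
      (cQ e \<lhd> (T1 (dn (et G e)) \<cdot> k)) \<bullet> (dx e \<rhd> (T2 (cQ e) \<lhd> k))"
  using alg_typing[OF ps_typing(2)[OF edge_ps(1)[OF e]]] alg_laws[OF ps_typing(2)[OF edge_ps(1)[OF e]]]
    ps_laws[OF edge_ps(1)[OF e]] ps_laws[OF edge_ps(2)[OF e]]
  by (simp_all add: edge_ps(3-5)[OF e] dx_def dn_def)

section \<open>The action of the 2-monad on cones of algebras\<close>

definition lift :: "('n \<Rightarrow> 'a) \<Rightarrow> 'n \<Rightarrow> 'a" where
  "lift \<theta> n = dn n \<cdot> T1 (\<theta> n)"

text \<open>The 2-cell \<open>T2 (\<theta>' e)\<close> lives over \<open>dx e\<close>; the structure
  cells of the two pseudo morphisms at \<open>e\<close> carry its ends to \<open>pP e\<close> and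
  \<open>pQ e\<close> composed with the lifted arrows. The one at the source is traversed backwards,
  which requires it to be invertible.\<close>

definition lift' :: "('n \<Rightarrow> 'a) \<Rightarrow> ('e \<Rightarrow> 'c) \<Rightarrow> 'e \<Rightarrow> 'c" where
  "lift' \<theta> \<theta>' e = (cQ e \<lhd> T1 (\<theta> (et G e))) \<bullet> (dx e \<rhd> T2 (\<theta>' e)) \<bullet> vinv K (cP e \<lhd> T1 (\<theta> (es G e)))"

lemmas cone_typing = UG.precone_typing[simplified]

context
  fixes E \<theta> \<theta>'
  assumes p: "precone K UG E \<theta> \<theta>'"
begin

lemma cP_lift_invertible: "e \<in> edges G \<Longrightarrow> invertible_cell K (cP e \<lhd> T1 (\<theta> (es G e)))"
  using cone_typing[OF p] by (intro invertible_whisk_r) (simp_all add: e_typing dn_typing T_typing calc)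

lemma lift_typing:
  "n \<in> nodes G \<Longrightarrow> lift \<theta> n \<in> arr K" "n \<in> nodes G \<Longrightarrow> src K (lift \<theta> n) = T0 E"
  "n \<in> nodes G \<Longrightarrow> tgt K (lift \<theta> n) = fst (ob G n)"
  using cone_typing[OF p] by (simp_all add: lift_def dn_typing T_typing calc)

lemma lift'_typing:
  assumes "e \<in> edges G"
  shows "lift' \<theta> \<theta>' e \<in> cell K" "vsrc K (lift' \<theta> \<theta>' e) = pP e \<cdot> lift \<theta> (es G e)"
    "vtgt K (lift' \<theta> \<theta>' e) = pQ e \<cdot> lift \<theta> (et G e)"
  using assms cone_typing[OF p] vinv(1-3)[OF cP_lift_invertible[OF assms]]
  by (simp_all add: lift'_def lift_def e_typing dn_typing T_typing T_pres calc)

lemma lift_precone: "precone K UG (T0 E) (lift \<theta>) (lift' \<theta> \<theta>')"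
  unfolding precone_def using lift_typing lift'_typing cone_typing[OF p] by (simp add: T_typing)

lemma lift'_eq:
  assumes "e \<in> edges G"
  shows "lift' \<theta> \<theta>' e \<bullet> (cP e \<lhd> T1 (\<theta> (es G e))) = (cQ e \<lhd> T1 (\<theta> (et G e))) \<bullet> (dx e \<rhd> T2 (\<theta>' e))"
  using assms cone_typing[OF p] vinv[OF cP_lift_invertible[OF assms]]
  by (simp add: lift'_def lift_def e_typing dn_typing T_typing T_pres calc)

text \<open>Together with \<open>lift'_eq\<close> this characterises the lifted 2-cell without an
  inverse, which keeps later computations within the normal form of \<open>calc\<close>.\<close>

lemma lift'_unique:
  assumes "e \<in> edges G" "\<alpha> \<in> cell K" "vsrc K \<alpha> = pP e \<cdot> lift \<theta> (es G e)"
    "\<alpha> \<bullet> (cP e \<lhd> T1 (\<theta> (es G e))) = (cQ e \<lhd> T1 (\<theta> (et G e))) \<bullet> (dx e \<rhd> T2 (\<theta>' e))"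
  shows "lift' \<theta> \<theta>' e = \<alpha>"
  by (rule cancel_right[OF cP_lift_invertible[OF assms(1)]])
    (use assms lift'_eq[OF assms(1)] lift'_typing[OF assms(1)] cone_typing[OF p]
      in \<open>simp_all add: lift_def e_typing dn_typing T_typing calc\<close>)

end


lemma lift'_invertible:
  assumes p: "precone K UG E \<theta> \<theta>'" and e: "e \<in> edges G" "invertible_cell K (\<theta>' e)"
  shows "invertible_cell K (lift' \<theta> \<theta>' e)"
proof -
  note t = cone_typing[OF p] e_typing dn_typing T_typing T_pres e calc
  note v = vinv(1-3)[OF cP_lift_invertible[OF p e(1)]]
  show ?thesis unfolding lift'_def
    by (intro invertible_vcomp invertible_whisk_l invertible_whisk_r T_invertible e
        e_typing(20)[OF e(1)] invertible_vinv cP_lift_invertible[OF p e(1)]) (simp_all add: t v)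
qed

text \<open>Once \<open>cP e\<close> is composed on the right, interchange moves the cells
  \<open>T2 (\<alpha> n)\<close> past \<open>cP e\<close> and \<open>cQ e\<close>. What remains
  between them is the image under the 2-monad of the naturality square of
  \<open>\<alpha>\<close>.\<close>

lemma lift_gmor:
  assumes p: "precone K UG E \<theta> \<theta>'" "precone K UG E \<phi> \<phi>'" and a: "gmor K UG \<theta> \<theta>' \<phi> \<phi>' \<alpha>"
  shows "gmor K UG (lift \<theta>) (lift' \<theta> \<theta>') (lift \<phi>) (lift' \<phi> \<phi>') (\<lambda>n. dn n \<rhd> T2 (\<alpha> n))"
proof -
  note t = cone_typing[OF p(1)] cone_typing[OF p(2)] UG.gmor_typing[OF a, simplified] e_typing dn_typing T_typing T_pres
    lift_typing[OF p(1)] lift_typing[OF p(2)] lift'_typing[OF p(1)] lift'_typing[OF p(2)] lift_def calc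
  have "lift' \<phi> \<phi>' e \<bullet> (pP e \<rhd> (dn (es G e) \<rhd> T2 (\<alpha> (es G e))))
      = (pQ e \<rhd> (dn (et G e) \<rhd> T2 (\<alpha> (et G e)))) \<bullet> lift' \<theta> \<theta>' e" if e: "e \<in> edges G" for e
  proof (rule cancel_right[OF cP_lift_invertible[OF p(1) e]])
    let ?s = "es G e" and ?t = "et G e"
    have "(lift' \<phi> \<phi>' e \<bullet> (pP e \<rhd> (dn ?s \<rhd> T2 (\<alpha> ?s)))) \<bullet> (cP e \<lhd> T1 (\<theta> ?s))
       = lift' \<phi> \<phi>' e \<bullet> ((pP e \<cdot> dn ?s) \<rhd> T2 (\<alpha> ?s) \<bullet> (cP e \<lhd> T1 (\<theta> ?s)))"
      using e by (simp add: t)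
    also have "(pP e \<cdot> dn ?s) \<rhd> T2 (\<alpha> ?s) \<bullet> (cP e \<lhd> T1 (\<theta> ?s))
       = (cP e \<lhd> T1 (\<phi> ?s)) \<bullet> ((dx e \<cdot> T1 (pP e)) \<rhd> T2 (\<alpha> ?s))"
      using e whisk_interchange[of "T2 (\<alpha> ?s)" "cP e"] by (simp add: t)
    also have "lift' \<phi> \<phi>' e \<bullet> (cP e \<lhd> T1 (\<phi> ?s)) \<bullet> ((dx e \<cdot> T1 (pP e)) \<rhd> T2 (\<alpha> ?s))
       = (lift' \<phi> \<phi>' e \<bullet> (cP e \<lhd> T1 (\<phi> ?s))) \<bullet> ((dx e \<cdot> T1 (pP e)) \<rhd> T2 (\<alpha> ?s))"
      using e by (simp add: t)
    also have "\<dots> = (cQ e \<lhd> T1 (\<phi> ?t)) \<bullet> (dx e \<rhd> T2 (\<phi>' e \<bullet> (pP e \<rhd> \<alpha> ?s)))"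
      unfolding lift'_eq[OF p(2) e] using e by (simp add: t)
    also have "\<phi>' e \<bullet> (pP e \<rhd> \<alpha> ?s) = (pQ e \<rhd> \<alpha> ?t) \<bullet> \<theta>' e"
      using UG.gmor_nat[OF a, of e] e by simp
    also have "(cQ e \<lhd> T1 (\<phi> ?t)) \<bullet> (dx e \<rhd> T2 ((pQ e \<rhd> \<alpha> ?t) \<bullet> \<theta>' e))
       = ((cQ e \<lhd> T1 (\<phi> ?t)) \<bullet> ((dx e \<cdot> T1 (pQ e)) \<rhd> T2 (\<alpha> ?t))) \<bullet> (dx e \<rhd> T2 (\<theta>' e))"
      using e by (simp add: t)
    also have "(cQ e \<lhd> T1 (\<phi> ?t)) \<bullet> ((dx e \<cdot> T1 (pQ e)) \<rhd> T2 (\<alpha> ?t))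
       = (pQ e \<cdot> dn ?t) \<rhd> T2 (\<alpha> ?t) \<bullet> (cQ e \<lhd> T1 (\<theta> ?t))"
      using e whisk_interchange[of "T2 (\<alpha> ?t)" "cQ e"] by (simp add: t)
    also have "((pQ e \<cdot> dn ?t) \<rhd> T2 (\<alpha> ?t) \<bullet> (cQ e \<lhd> T1 (\<theta> ?t))) \<bullet> (dx e \<rhd> T2 (\<theta>' e))
       = ((pQ e \<cdot> dn ?t) \<rhd> T2 (\<alpha> ?t)) \<bullet> ((cQ e \<lhd> T1 (\<theta> ?t)) \<bullet> (dx e \<rhd> T2 (\<theta>' e)))"
      using e by (simp add: t)
    also have "\<dots> = ((pQ e \<rhd> (dn ?t \<rhd> T2 (\<alpha> ?t))) \<bullet> lift' \<theta> \<theta>' e) \<bullet> (cP e \<lhd> T1 (\<theta> ?s))"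
      unfolding lift'_eq[OF p(1) e, symmetric] using e by (simp add: t)
    finally show "(lift' \<phi> \<phi>' e \<bullet> (pP e \<rhd> (dn ?s \<rhd> T2 (\<alpha> ?s)))) \<bullet> (cP e \<lhd> T1 (\<theta> ?s))
      = ((pQ e \<rhd> (dn ?t \<rhd> T2 (\<alpha> ?t))) \<bullet> lift' \<theta> \<theta>' e) \<bullet> (cP e \<lhd> T1 (\<theta> ?s))" .
  qed (use e in \<open>simp_all add: t\<close>)
  then show ?thesis unfolding gmor_def by (auto simp: t)
qed

lemma lift_precomp:
  assumes p: "precone K UG E \<theta> \<theta>'" and h: "h \<in> arr K" "tgt K h = E"
  shows "n \<in> nodes G \<Longrightarrow> lift (\<lambda>n. \<theta> n \<cdot> h) n = lift \<theta> n \<cdot> T1 h"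
    "e \<in> edges G \<Longrightarrow> lift' (\<lambda>n. \<theta> n \<cdot> h) (\<lambda>e. \<theta>' e \<lhd> h) e = lift' \<theta> \<theta>' e \<lhd> T1 h"
proof -
  note t = cone_typing[OF p] e_typing dn_typing T_typing T_pres h
    lift_typing[OF p] lift'_typing[OF p] calc
  show "n \<in> nodes G \<Longrightarrow> lift (\<lambda>n. \<theta> n \<cdot> h) n = lift \<theta> n \<cdot> T1 h"
    by (simp add: lift_def t)
  show "lift' (\<lambda>n. \<theta> n \<cdot> h) (\<lambda>e. \<theta>' e \<lhd> h) e = lift' \<theta> \<theta>' e \<lhd> T1 h" if e: "e \<in> edges G"
  proof (rule lift'_unique[OF UG.precone_precomp[OF p h] e])
    have "(lift' \<theta> \<theta>' e \<bullet> (cP e \<lhd> T1 (\<theta> (es G e)))) \<lhd> T1 h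
      = ((cQ e \<lhd> T1 (\<theta> (et G e))) \<bullet> (dx e \<rhd> T2 (\<theta>' e))) \<lhd> T1 h"
      by (simp add: lift'_eq[OF p e])
    then show "(lift' \<theta> \<theta>' e \<lhd> T1 h) \<bullet> (cP e \<lhd> T1 (\<theta> (es G e) \<cdot> h))
      = (cQ e \<lhd> T1 (\<theta> (et G e) \<cdot> h)) \<bullet> (dx e \<rhd> T2 (\<theta>' e \<lhd> h))"
      using e by (simp add: t lift_def)
  qed (use e in \<open>simp_all add: t lift_def\<close>)
qed

text \<open>At a node this is the naturality of \<open>i\<close> and the unit axiom of an algebra.
  At an edge the unit axiom of pseudo morphisms makes both structure cells in
  \<open>lift'_eq\<close> identities after whiskering with \<open>i E\<close>.\<close>

lemma lift_unit:
  assumes p: "precone K UG E \<theta> \<theta>'"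
  shows "n \<in> nodes G \<Longrightarrow> lift \<theta> n \<cdot> i E = \<theta> n"
    "e \<in> edges G \<Longrightarrow> lift' \<theta> \<theta>' e \<lhd> i E = \<theta>' e"
proof -
  note t = cone_typing[OF p] e_typing dn_typing T_typing T_pres unit_typing
    lift_typing[OF p] lift'_typing[OF p] calc unit_nat unit_nat' e_laws
  have n: "n \<in> nodes G \<Longrightarrow> lift \<theta> n \<cdot> i E = \<theta> n" for n
    by (simp add: lift_def t)
  then show "n \<in> nodes G \<Longrightarrow> lift \<theta> n \<cdot> i E = \<theta> n" .
  show "lift' \<theta> \<theta>' e \<lhd> i E = \<theta>' e" if e: "e \<in> edges G"
  proof -
    have "(lift' \<theta> \<theta>' e \<bullet> (cP e \<lhd> T1 (\<theta> (es G e)))) \<lhd> i E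
      = ((cQ e \<lhd> T1 (\<theta> (et G e))) \<bullet> (dx e \<rhd> T2 (\<theta>' e))) \<lhd> i E"
      by (simp add: lift'_eq[OF p e])
    then show ?thesis using e by (simp add: t lift_def)
  qed
qed

text \<open>The multiplication counterpart of \<open>lift_unit\<close>: associativity of the
  algebras at nodes, and coherence of pseudo morphisms with \<open>m\<close> at edges.\<close>

lemma lift_mult:
  assumes p: "precone K UG E \<theta> \<theta>'"
  shows "n \<in> nodes G \<Longrightarrow> lift (lift \<theta>) n = lift \<theta> n \<cdot> m E"
    "e \<in> edges G \<Longrightarrow> lift' (lift \<theta>) (lift' \<theta> \<theta>') e = lift' \<theta> \<theta>' e \<lhd> m E"
proof -
  note p' = lift_precone[OF p]
  note t = cone_typing[OF p] e_typing dn_typing T_typing T_pres mult_typing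
    lift_typing[OF p] lift'_typing[OF p] lift_def calc
  note mm = mult_nat mult_nat' e_laws
  show "n \<in> nodes G \<Longrightarrow> lift (lift \<theta>) n = lift \<theta> n \<cdot> m E"
    by (simp add: t mm)
  show "lift' (lift \<theta>) (lift' \<theta> \<theta>') e = lift' \<theta> \<theta>' e \<lhd> m E" if e: "e \<in> edges G"
  proof (rule lift'_unique[OF p' e])
    let ?s = "es G e" and ?t = "et G e"
    \<comment> \<open>Chosen so that \<open>cP e\<close> whiskered with
      \<open>T1 (lift \<theta> ?s)\<close>, preceded by \<open>?c\<close>, is \<open>cP e\<close>
      whiskered with the multiplication, by coherence of the pseudo morphism. Then
      \<open>lift'_eq\<close> whiskered with \<open>m E\<close> applies.\<close>
    let ?c = "dx e \<rhd> (T2 (cP e) \<lhd> T1 (T1 (\<theta> ?s)))"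
    show "(lift' \<theta> \<theta>' e \<lhd> m E) \<bullet> (cP e \<lhd> T1 (lift \<theta> ?s))
      = (cQ e \<lhd> T1 (lift \<theta> ?t)) \<bullet> (dx e \<rhd> T2 (lift' \<theta> \<theta>' e))"
    proof (rule cancel_right[of ?c])
      show "invertible_cell K ?c" using e
        by (intro invertible_whisk_l invertible_whisk_r T_invertible e_typing) (simp_all add: t)
      have "((lift' \<theta> \<theta>' e \<lhd> m E) \<bullet> (cP e \<lhd> T1 (lift \<theta> ?s))) \<bullet> ?c
        = (lift' \<theta> \<theta>' e \<bullet> (cP e \<lhd> T1 (\<theta> ?s))) \<lhd> m E"
        using e by (simp add: t mm)
      also have "\<dots> = (cQ e \<lhd> T1 (lift \<theta> ?t)) \<bullet> (dx e \<rhd> T2 ((cQ e \<lhd> T1 (\<theta> ?t)) \<bullet> (dx e \<rhd> T2 (\<theta>' e))))"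
        unfolding lift'_eq[OF p e] using e by (simp add: t mm)
      also have "\<dots> = ((cQ e \<lhd> T1 (lift \<theta> ?t)) \<bullet> (dx e \<rhd> T2 (lift' \<theta> \<theta>' e))) \<bullet> ?c"
        unfolding lift'_eq[OF p e, symmetric] using e by (simp add: t)
      finally show "((lift' \<theta> \<theta>' e \<lhd> m E) \<bullet> (cP e \<lhd> T1 (lift \<theta> ?s))) \<bullet> ?c
        = ((cQ e \<lhd> T1 (lift \<theta> ?t)) \<bullet> (dx e \<rhd> T2 (lift' \<theta> \<theta>' e))) \<bullet> ?c" .
    qed (use e in \<open>simp_all add: t mm\<close>)
  qed (use e in \<open>simp_all add: t mm\<close>)
qed

text \<open>Extends \<open>lift'_eq\<close> from edges to the whiskered cells that occur in
  equations. For an edge whiskered by a pseudo morphism \<open>S\<close>, interchange moves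
  \<open>T2 (\<theta>' e)\<close> past the structure cell of \<open>S\<close>; for a 2-cell of
  algebras it is the compatibility condition of that 2-cell.\<close>

lemma step_val_lift:
  assumes p: "precone K UG E \<theta> \<theta>'" and x: "step_ok Alg G x"
    and R: "step_src Alg G x = (R, n)" and R': "step_tgt Alg G x = (R', n')"
  shows "step_val K (lift \<theta>) (lift' \<theta> \<theta>') (proj_step x) \<bullet> (ps_cell R \<lhd> T1 (\<theta> n))
    = (ps_cell R' \<lhd> T1 (\<theta> n')) \<bullet> (snd (ps_cod R) \<rhd> T2 (step_val K \<theta> \<theta>' (proj_step x)))"
proof (cases x)
  case (Edge S e)
  then have e: "e \<in> edges G" and S: "S \<in> ps_mor K T i m" "ps_dom S = ps_cod (eP G e)" using x by simp_all
  let ?s = "es G e" and ?t = "et G e"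
  let ?c = "snd (ps_cod S)"
  have Sx: "snd (ps_dom S) = dx e" "fst (ps_dom S) = xo e" using S by (simp_all add: dx_def)
  note t = cone_typing[OF p] e_typing dn_typing T_typing T_pres
    lift_typing[OF p] lift'_typing[OF p] lift_def calc ps_typing(3-8)[OF S(1)] Sx alg_typing[OF ps_typing(2)[OF S(1)]]
  have Re: "R = ps_comp K T S (eP G e)" "n = ?s" "R' = ps_comp K T S (eQ G e)" "n' = ?t"
    using R R' Edge by auto
  have "step_val K (lift \<theta>) (lift' \<theta> \<theta>') (proj_step x) \<bullet> (ps_cell R \<lhd> T1 (\<theta> n))
    = (ps_arr S \<rhd> (lift' \<theta> \<theta>' e \<bullet> (cP e \<lhd> T1 (\<theta> ?s)))) \<bullet> (ps_cell S \<lhd> T1 (pP e \<cdot> \<theta> ?s))"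
    using e by (simp add: Re Edge t)
  also have "\<dots> = (ps_arr S \<rhd> (cQ e \<lhd> T1 (\<theta> ?t))) \<bullet> 
      (((ps_arr S \<cdot> dx e) \<rhd> T2 (\<theta>' e)) \<bullet> (ps_cell S \<lhd> T1 (pP e \<cdot> \<theta> ?s)))"
    unfolding lift'_eq[OF p e] using e by (simp add: t)
  also have "((ps_arr S \<cdot> dx e) \<rhd> T2 (\<theta>' e)) \<bullet> (ps_cell S \<lhd> T1 (pP e \<cdot> \<theta> ?s))
     = (ps_cell S \<lhd> T1 (pQ e \<cdot> \<theta> ?t)) \<bullet> ((?c \<cdot> T1 (ps_arr S)) \<rhd> T2 (\<theta>' e))"
    using whisk_interchange[of "T2 (\<theta>' e)" "ps_cell S"] e by (simp add: t)
  also have "(ps_arr S \<rhd> (cQ e \<lhd> T1 (\<theta> ?t))) \<bullet> (ps_cell S \<lhd> T1 (pQ e \<cdot> \<theta> ?t)) \<bullet> ((?c \<cdot> T1 (ps_arr S)) \<rhd> T2 (\<theta>' e))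
     = (ps_cell R' \<lhd> T1 (\<theta> n')) \<bullet> (snd (ps_cod R) \<rhd> T2 (step_val K \<theta> \<theta>' (proj_step x)))"
    using e by (simp add: Re Edge t)
  finally show ?thesis .
next
  case (Cell \<gamma> k)
  then have k: "k \<in> nodes G" and g: "\<gamma> \<in> alg_cell K T i m" "ps_dom (ac_src \<gamma>) = ob G k" using x by simp_all
  have d: "snd (ps_dom (ac_src \<gamma>)) = dn k" "fst (ps_dom (ac_src \<gamma>)) = fst (ob G k)" by (simp_all add: g dn_def)
  note s = ps_typing[OF alg_cell_typing(1)[OF g(1)]] ps_typing[OF alg_cell_typing(2)[OF g(1)]]
  note t = cone_typing[OF p] dn_typing T_typing T_pres
    lift_typing[OF p] lift'_typing[OF p] lift_def calc ps_typing(3-8)[OF alg_cell_typing(1)[OF g(1)]]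
    ps_typing(3-8)[OF alg_cell_typing(2)[OF g(1)]] alg_typing(1-4)[OF s(2)]
    alg_cell_typing(3-7)[OF g(1)] d
  have Re: "R = ac_src \<gamma>" "n = k" "R' = ac_tgt \<gamma>" "n' = k" using R R' Cell by auto
  have "((ac_cell \<gamma> \<lhd> snd (ps_dom (ac_src \<gamma>))) \<bullet> ps_cell (ac_src \<gamma>)) \<lhd> T1 (\<theta> k)
      = (ps_cell (ac_tgt \<gamma>) \<bullet> (snd (ps_cod (ac_src \<gamma>)) \<rhd> T2 (ac_cell \<gamma>))) \<lhd> T1 (\<theta> k)"
    by (simp only: alg_cell_typing(8)[OF g(1)])
  then show ?thesis using k by (simp add: Re Cell t)
qed

text \<open>Both sides of an equation run between the same pseudo morphisms \<open>R\<close> and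
  \<open>R'\<close>. After precomposition with the invertible structure cell of \<open>R\<close>,
  each becomes the structure cell of \<open>R'\<close> after the image under the 2-monad of the
  corresponding composite in the original cone.\<close>

lemma lift_gcone:
  assumes c: "gcone K UG E \<theta> \<theta>'"
  shows "gcone K UG (T0 E) (lift \<theta>) (lift' \<theta> \<theta>')"
proof -
  note p = UG.gcone_precone[OF c]
  note p' = lift_precone[OF p]
  have "eqn_holds K (lift \<theta>) (lift' \<theta> \<theta>') q" if "q \<in> eqns UG" for q
  proof -
    obtain x x' y y' where e: "(x, x', y, y') \<in> eqns G"
      and q: "q = (proj_step x, proj_step x', proj_step y, proj_step y')"
      using \<open>q \<in> eqns UG\<close> by (auto simp: dimage_def)
    have eok: "eqn_ok Alg G (x, x', y, y')" using TA.ok e by (auto simp: diag_ok_def)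
    then have okq: "step_ok Alg G x" "step_ok Alg G x'" "step_ok Alg G y" "step_ok Alg G y'"
      and "step_tgt Alg G x = step_src Alg G x'"
      "step_tgt Alg G y = step_src Alg G y'"
      "step_src Alg G x = step_src Alg G y"
      "step_tgt Alg G x' = step_tgt Alg G y'"
      by (auto simp: eqn_ok_def)
    moreover obtain R n R1 n1 R2 n2 R' n' where "step_src Alg G x = (R, n)"
      "step_tgt Alg G x = (R1, n1)" "step_tgt Alg G y = (R2, n2)"
      "step_tgt Alg G x' = (R', n')" by (metis surj_pair)
    ultimately have st: "step_src Alg G x = (R, n)" "step_tgt Alg G x = (R1, n1)"
      "step_src Alg G x' = (R1, n1)" "step_tgt Alg G x' = (R', n')"
      "step_src Alg G y = (R, n)" "step_tgt Alg G y = (R2, n2)"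
      "step_src Alg G y' = (R2, n2)" "step_tgt Alg G y' = (R', n')" by auto
    let ?v = "\<lambda>x. step_val K \<theta> \<theta>' (proj_step x)" and ?w = "\<lambda>x. step_val K (lift \<theta>) (lift' \<theta> \<theta>') (proj_step x)"
    \<comment> \<open>Two squares of \<open>step_val_lift\<close> pasted together. The right-hand
      side depends on the steps only through \<open>?v b \<bullet> ?v a\<close>, on which the two
      sides of the equation agree.\<close>
    have two: "(?w b \<bullet> ?w a) \<bullet> (ps_cell R \<lhd> T1 (\<theta> n))
      = (ps_cell R' \<lhd> T1 (\<theta> n')) \<bullet> (snd (ps_cod R) \<rhd> T2 (?v b \<bullet> ?v a)) \<and>
      ?w b \<bullet> ?w a \<in> cell K \<and> vsrc K (?w b \<bullet> ?w a) = ps_arr R \<cdot> lift \<theta> n \<and>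
      invertible_cell K (ps_cell R \<lhd> T1 (\<theta> n)) \<and> vtgt K (ps_cell R \<lhd> T1 (\<theta> n)) = ps_arr R \<cdot> lift \<theta> n"
      if ab: "step_ok Alg G a" "step_ok Alg G b" "step_src Alg G a = (R, n)"
        "step_tgt Alg G a = (S, k)" "step_src Alg G b = (S, k)"
        "step_tgt Alg G b = (R', n')" for a b S k
    proof -
      note sa = TA.step_src_typing[OF ab(1), unfolded ab(3,4), simplified]
      note sb = TA.step_src_typing[OF ab(2), unfolded ab(5,6), simplified]
      note va = UG.step_val_typing[OF step_ok_proj[OF ab(1)] p, simplified step_src_proj[OF ab(1)] ab fst_conv snd_conv]
        UG.step_val_typing[OF step_ok_proj[OF ab(1)] p', simplified step_src_proj[OF ab(1)] ab fst_conv snd_conv]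
      note vb = UG.step_val_typing[OF step_ok_proj[OF ab(2)] p, simplified step_src_proj[OF ab(2)] ab fst_conv snd_conv]
        UG.step_val_typing[OF step_ok_proj[OF ab(2)] p', simplified step_src_proj[OF ab(2)] ab fst_conv snd_conv]
      note R = ps_typing(3-9)[OF sa(1)] ps_typing(3-9)[OF sa(4)] ps_typing(3-9)[OF sb(4)]
      have dd: "snd (ob G n) = dn n" for n by (simp add: dn_def)
      note t = R sa sb va vb cone_typing[OF p] lift_typing[OF p] dn_typing T_typing T_pres alg_typing(1-4)[OF ps_typing(2)[OF sa(1)]] dd calc
      have "(?w b \<bullet> ?w a) \<bullet> (ps_cell R \<lhd> T1 (\<theta> n)) = ?w b \<bullet> ?w a \<bullet> (ps_cell R \<lhd> T1 (\<theta> n))"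
        by (simp add: t lift_def)
      also have "?w a \<bullet> (ps_cell R \<lhd> T1 (\<theta> n)) = (ps_cell S \<lhd> T1 (\<theta> k)) \<bullet> (snd (ps_cod R) \<rhd> T2 (?v a))"
        by (rule step_val_lift[OF p ab(1,3,4)])
      also have "?w b \<bullet> (ps_cell S \<lhd> T1 (\<theta> k)) \<bullet> (snd (ps_cod R) \<rhd> T2 (?v a))
         = (?w b \<bullet> (ps_cell S \<lhd> T1 (\<theta> k))) \<bullet> (snd (ps_cod R) \<rhd> T2 (?v a))"
        by (simp add: t lift_def)
      also have "?w b \<bullet> (ps_cell S \<lhd> T1 (\<theta> k)) = (ps_cell R' \<lhd> T1 (\<theta> n')) \<bullet> (snd (ps_cod R) \<rhd> T2 (?v b))"
        using step_val_lift[OF p ab(2,5,6)] by (simp add: sa)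
      also have "((ps_cell R' \<lhd> T1 (\<theta> n')) \<bullet> (snd (ps_cod R) \<rhd> T2 (?v b))) \<bullet> (snd (ps_cod R) \<rhd> T2 (?v a))
         = (ps_cell R' \<lhd> T1 (\<theta> n')) \<bullet> (snd (ps_cod R) \<rhd> T2 (?v b \<bullet> ?v a))"
        by (simp add: t)
      finally have eq: "(?w b \<bullet> ?w a) \<bullet> (ps_cell R \<lhd> T1 (\<theta> n))
         = (ps_cell R' \<lhd> T1 (\<theta> n')) \<bullet> (snd (ps_cod R) \<rhd> T2 (?v b \<bullet> ?v a))" .
      have inv: "invertible_cell K (ps_cell R \<lhd> T1 (\<theta> n))"
        by (intro invertible_whisk_r R) (simp_all add: t)
      show ?thesis
        by (intro conjI eq inv) (simp_all add: t lift_def[of \<theta> n])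
    qed
    have v: "?v x' \<bullet> ?v x = ?v y' \<bullet> ?v y"
      using c \<open>q \<in> eqns UG\<close> by (auto simp: gcone_def eqn_holds_def q)
    note X = two[OF okq(1,2) st(1-4)] and Y = two[OF okq(3,4) st(5-8)]
    have "?w x' \<bullet> ?w x = ?w y' \<bullet> ?w y"
      by (rule cancel_right[of "ps_cell R \<lhd> T1 (\<theta> n)"]) (use X Y v in auto)
    then show ?thesis by (simp add: eqn_holds_def q)
  qed
  then show ?thesis using p' by (simp add: gcone_def)
qed

end

section \<open>The lifted limit\<close>

lemma psmor_eqI:
  "\<lbrakk>ps_dom f = ps_dom g; ps_cod f = ps_cod g; ps_arr f = ps_arr g; ps_cell f = ps_cell g\<rbrakk> \<Longrightarrow> f = g"
  by (cases f; cases g) auto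

lemma algcell_eqI:
  "\<lbrakk>ac_src f = ac_src g; ac_tgt f = ac_tgt g; ac_cell f = ac_cell g\<rbrakk> \<Longrightarrow> f = g"
  by (cases f; cases g) auto

section \<open>Cones of algebras compared with their underlying cones\<close>

context alg_diagram
begin

lemma step_val_proj:
  "ac_cell (step_val Alg \<psi> \<psi>' x) = step_val K (\<lambda>n. ps_arr (\<psi> n)) (\<lambda>e. ac_cell (\<psi>' e)) (proj_step x)"
  by (cases x) auto

lemma precone_proj:
  assumes "precone Alg G A \<psi> \<psi>'"
  shows "precone K UG (fst A) (\<lambda>n. ps_arr (\<psi> n)) (\<lambda>e. ac_cell (\<psi>' e))"
  using TA.precone_typing[OF assms] ps_typing alg_cell_typing alg_typing TA.edge_typing
  by (auto simp: precone_def)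

text \<open>A 2-cell of algebras is determined by its ends and its underlying 2-cell, and the ends
  of the two composites agree by typing.\<close>

lemma eqn_holds_proj:
  assumes p: "precone Alg G A \<psi> \<psi>'" and q: "(x, x', y, y') \<in> eqns G"
  shows "eqn_holds Alg \<psi> \<psi>' (x, x', y, y') \<longleftrightarrow>
    eqn_holds K (\<lambda>n. ps_arr (\<psi> n)) (\<lambda>e. ac_cell (\<psi>' e)) (proj_step x, proj_step x', proj_step y, proj_step y')"
proof -
  have "eqn_ok Alg G (x, x', y, y')" using TA.ok q by (auto simp: diag_ok_def)
  then show ?thesis
    using TA.step_val_typing(2,3)[OF _ p]
    by (auto simp: eqn_ok_def eqn_holds_def step_val_proj intro!: algcell_eqI)
qed

text \<open>For the converse direction: if the underlying 2-cell is an identity, the compatibility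
  condition of a 2-cell of algebras reduces to equality of the two structure cells, so source and
  target are the same pseudo morphism.\<close>

lemma identity_cell_proj:
  assumes "\<gamma> \<in> alg_cell K T i m"
  shows "identity_cell Alg \<gamma> \<longleftrightarrow> identity_cell K (ac_cell \<gamma>)"
proof
  assume "identity_cell Alg \<gamma>"
  then show "identity_cell K (ac_cell \<gamma>)" by (auto simp: identity_cell_def ps_typing)
next
  assume i: "identity_cell K (ac_cell \<gamma>)"
  note g = alg_cell_typing[OF assms]
  note s = ps_typing(3-8)[OF g(1)] ps_typing(3-8)[OF g(2)] alg_typing(1-4)[OF ps_typing(1)[OF g(1)]]
    alg_typing(1-4)[OF ps_typing(2)[OF g(1)]]
  have v: "ac_cell \<gamma> = vide K (ps_arr (ac_src \<gamma>))" "ac_cell \<gamma> = vide K (ps_arr (ac_tgt \<gamma>))"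
    using i identity_cell_iff[OF g(5)] identity_cell_iff'[OF g(5)] g(6,7) by simp_all
  have a: "ps_arr (ac_tgt \<gamma>) = ps_arr (ac_src \<gamma>)"
    using v s(1) vide_typing(2)[OF s(1)] vide_typing(2)[of "ps_arr (ac_tgt \<gamma>)"] ps_typing(3)[OF g(2)] by simp
  have "ps_cell (ac_src \<gamma>) = ps_cell (ac_tgt \<gamma>)"
    using g(8) unfolding v(1) using s g(3,4) a by (simp add: calc T_typing T_pres)
  then have "ac_tgt \<gamma> = ac_src \<gamma>" using a g(3,4) by (intro psmor_eqI) simp_all
  then have "\<gamma> = AlgCell (ac_src \<gamma>) (ac_src \<gamma>) (vide K (ps_arr (ac_src \<gamma>)))"
    using v by (intro algcell_eqI) simp_all
  then show "identity_cell Alg \<gamma>" using g(1) by (auto simp: identity_cell_def)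
qed

lemma scone_proj_iff:
  assumes p: "precone Alg G A \<psi> \<psi>'"
  shows "scone Alg G A \<psi> \<psi>' \<longleftrightarrow> scone K UG (fst A) (\<lambda>n. ps_arr (\<psi> n)) (\<lambda>e. ac_cell (\<psi>' e))"
proof -
  have "(\<forall>q \<in> eqns G. eqn_holds Alg \<psi> \<psi>' q) \<longleftrightarrow>
    (\<forall>q \<in> eqns UG. eqn_holds K (\<lambda>n. ps_arr (\<psi> n)) (\<lambda>e. ac_cell (\<psi>' e)) q)"
    using eqn_holds_proj[OF p] by (auto simp: dimage_def)
  moreover have "identity_cell Alg (\<psi>' e) \<longleftrightarrow> identity_cell K (ac_cell (\<psi>' e))" if "e \<in> strict G" for e
    using TA.precone_typing(5)[OF p, of e] TA.strict_edge[OF that] identity_cell_proj by simp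
  ultimately show ?thesis using p precone_proj[OF p] by (auto simp: scone_def gcone_def)
qed

lemma scone_proj:
  "scone Alg G A \<psi> \<psi>' \<Longrightarrow> scone K UG (fst A) (\<lambda>n. ps_arr (\<psi> n)) (\<lambda>e. ac_cell (\<psi>' e))"
  using scone_proj_iff TA.scone_precone by blast

text \<open>Naturality of the structure cells of the legs is the compatibility condition of the
  2-cells \<open>\<psi>' e\<close>, once the composite structure cells in it are expanded and
  \<open>lift'_eq\<close> replaces the part over \<open>dx e\<close>.\<close>

lemma structure_gmor:
  assumes p: "precone Alg G A \<psi> \<psi>'"
  defines "\<theta> \<equiv> \<lambda>n. ps_arr (\<psi> n)" and "\<theta>' \<equiv> \<lambda>e. ac_cell (\<psi>' e)"
  shows "gmor K UG (lift \<theta>) (lift' \<theta> \<theta>') (\<lambda>n. \<theta> n \<cdot> snd A) (\<lambda>e. \<theta>' e \<lhd> snd A) (\<lambda>n. ps_cell (\<psi> n))"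
proof -
  note tp = TA.precone_typing[OF p, simplified]
  note pK = precone_proj[OF p, folded \<theta>_def \<theta>'_def]
  have ps: "\<theta> n \<in> arr K" "src K (\<theta> n) = fst A" "tgt K (\<theta> n) = fst (ob G n)" "ps_cell (\<psi> n) \<in> cell K"
    "vsrc K (ps_cell (\<psi> n)) = dn n \<cdot> T1 (\<theta> n)" "vtgt K (ps_cell (\<psi> n)) = \<theta> n \<cdot> snd A" if "n \<in> nodes G" for n
    using ps_typing[OF tp(2)[OF that]] tp(3,4)[OF that] by (simp_all add: \<theta>_def dn_def)
  note A = alg_typing[OF tp(1)]
  note t = ps A(1-4) cone_typing(5-7)[OF pK] e_typing dn_typing(1-4) T_typing T_pres
    lift_typing[OF pK] lift'_typing[OF pK] calc
  have "(\<theta>' e \<lhd> snd A) \<bullet> (pP e \<rhd> ps_cell (\<psi> (es G e))) = (pQ e \<rhd> ps_cell (\<psi> (et G e))) \<bullet> lift' \<theta> \<theta>' e"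
    if e: "e \<in> edges G" for e
  proof (rule cancel_right[OF cP_lift_invertible[OF pK e]])
    let ?s = "es G e" and ?t = "et G e"
    have ac: "ac_src (\<psi>' e) = ps_comp K T (eP G e) (\<psi> ?s)" "ac_tgt (\<psi>' e) = ps_comp K T (eQ G e) (\<psi> ?t)"
      "\<psi>' e \<in> alg_cell K T i m" using tp(5-7)[OF e] by simp_all
    have "((\<theta>' e \<lhd> snd A) \<bullet> (pP e \<rhd> ps_cell (\<psi> ?s))) \<bullet> (cP e \<lhd> T1 (\<theta> ?s))
       = (\<theta>' e \<lhd> snd A) \<bullet> ((pP e \<rhd> ps_cell (\<psi> ?s)) \<bullet> (cP e \<lhd> T1 (\<theta> ?s)))"
      using e by (simp add: t lift_def)
    also have "\<dots> = ((pQ e \<rhd> ps_cell (\<psi> ?t)) \<bullet> (cQ e \<lhd> T1 (\<theta> ?t))) \<bullet> (dx e \<rhd> T2 (\<theta>' e))"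
      using alg_cell_typing(8)[OF ac(3)] e by (simp add: ac tp(3)[OF e_typing(1)] edge_ps \<theta>_def \<theta>'_def dx_def)
    also have "\<dots> = (pQ e \<rhd> ps_cell (\<psi> ?t)) \<bullet> ((cQ e \<lhd> T1 (\<theta> ?t)) \<bullet> (dx e \<rhd> T2 (\<theta>' e)))"
      using e by (simp add: t lift_def)
    also have "\<dots> = ((pQ e \<rhd> ps_cell (\<psi> ?t)) \<bullet> lift' \<theta> \<theta>' e) \<bullet> (cP e \<lhd> T1 (\<theta> ?s))"
      unfolding lift'_eq[OF pK e, symmetric] using e by (simp add: t lift_def)
    finally show "((\<theta>' e \<lhd> snd A) \<bullet> (pP e \<rhd> ps_cell (\<psi> ?s))) \<bullet> (cP e \<lhd> T1 (\<theta> ?s))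
      = ((pQ e \<rhd> ps_cell (\<psi> ?t)) \<bullet> lift' \<theta> \<theta>' e) \<bullet> (cP e \<lhd> T1 (\<theta> ?s))" .
  qed (use e in \<open>simp_all add: t lift_def\<close>)
  then show ?thesis unfolding gmor_def by (auto simp: t lift_def)
qed

end

section \<open>The algebra structure on the limit\<close>

locale lifted_limit = alg_diagram K T i m G for K :: "('o, 'a, 'c) cat2" (structure) and T i m
    and G :: "('n, 'e, 'o \<times> 'a, ('o, 'a, 'c) psmor, ('o, 'a, 'c) algcell) diag" +
  fixes N\<^sub>0 :: "'n set" and L :: 'o and \<pi> :: "'n \<Rightarrow> 'a" and \<pi>' :: "'e \<Rightarrow> 'c"
  assumes rect: "rectifiable K (dimage forget G) N\<^sub>0" and lim: "glim K (dimage forget G) L \<pi> \<pi>'"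
begin

lemma N0_nodes: "n \<in> N\<^sub>0 \<Longrightarrow> n \<in> nodes G"
  using rect by (auto simp: rectifiable_def)

lemma limit_scone: "scone K UG L \<pi> \<pi>'"
  by (rule UG.glim_scone[OF lim])

lemma limit_precone: "precone K UG L \<pi> \<pi>'"
  by (rule UG.scone_precone[OF limit_scone])

lemmas pi_typing = cone_typing[OF limit_precone]

lemma lifted_strict_invertible: "e \<in> strict G \<Longrightarrow> invertible_cell K (lift' \<pi> \<pi>' e)"
  using lift'_invertible[OF limit_precone TA.strict_edge] UG.strict_invertible[OF limit_scone] by simp

definition kap where "kap = (SOME \<kappa>. straightening K UG N\<^sub>0 (lift \<pi>) (lift' \<pi> \<pi>') \<kappa>)"

lemma lifted_gcone: "gcone K UG (T0 L) (lift \<pi>) (lift' \<pi> \<pi>')"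
  by (rule lift_gcone[OF UG.scone_gcone[OF limit_scone]])

lemma kap_straightening: "straightening K UG N\<^sub>0 (lift \<pi>) (lift' \<pi> \<pi>') kap"
proof -
  have "\<exists>\<kappa>. straightening K UG N\<^sub>0 (lift \<pi>) (lift' \<pi> \<pi>') \<kappa>"
    using rect lifted_gcone lifted_strict_invertible unfolding rectifiable_def by auto
  then show ?thesis unfolding kap_def by (rule someI_ex)
qed

definition l_prop where "l_prop l \<longleftrightarrow> l \<in> arr K \<and> src K l = T0 L \<and> tgt K l = L \<and>
  (\<forall>n \<in> nodes G. \<pi> n \<cdot> l = vsrc K (kap n)) \<and> gmor K UG (\<lambda>n. \<pi> n \<cdot> l) (\<lambda>e. \<pi>' e \<lhd> l) (lift \<pi>) (lift' \<pi> \<pi>') kap"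

definition l where "l = (SOME l. l_prop l)"

text \<open>The arrow is the factorisation through the limit of the strict cone that
  \<open>straighten\<close> produces from \<open>kap\<close>.\<close>

lemma l_prop: "l_prop l"
proof -
  note st = UG.straighten[OF lifted_gcone kap_straightening]
  obtain l' where l': "l' \<in> arr K" "src K l' = T0 L" "tgt K l' = L" "\<And>n. n \<in> nodes UG \<Longrightarrow> \<pi> n \<cdot> l' = vsrc K (kap n)"
    "\<And>e. e \<in> edges UG \<Longrightarrow> \<pi>' e \<lhd> l' = vinv K (eQ UG e \<rhd> kap (et UG e)) \<bullet> lift' \<pi> \<pi>' e \<bullet> (eP UG e \<rhd> kap (es UG e))"
    by (rule UG.glim_obtain_arr[OF lim st(1)]) (rule that)
  have "gmor K UG (\<lambda>n. \<pi> n \<cdot> l') (\<lambda>e. \<pi>' e \<lhd> l') (lift \<pi>) (lift' \<pi> \<pi>') kap"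
    by (rule UG.gmor_cong[OF st(2)]) (simp_all add: l'[simplified])
  with l' have "l_prop l'" by (simp add: l_prop_def)
  then show ?thesis unfolding l_def by (rule someI)
qed

lemmas l_spec = l_prop[unfolded l_prop_def]

lemma l_typing: "l \<in> arr K" "src K l = T0 L" "tgt K l = L"
  using l_spec by auto

lemma kap_gmor: "gmor K UG (\<lambda>n. \<pi> n \<cdot> l) (\<lambda>e. \<pi>' e \<lhd> l) (lift \<pi>) (lift' \<pi> \<pi>') kap"
  using l_spec by simp

lemma kap_typing:
  assumes "n \<in> nodes G"
  shows "kap n \<in> cell K" "vsrc K (kap n) = \<pi> n \<cdot> l" "vtgt K (kap n) = dn n \<cdot> T1 (\<pi> n)" "invertible_cell K (kap n)"
  using UG.straightening_typing[OF kap_straightening, simplified, OF assms] l_spec assms by (simp_all add: lift_def)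

lemma kap_N0: "n \<in> N\<^sub>0 \<Longrightarrow> kap n = vide K (dn n \<cdot> T1 (\<pi> n))"
  using kap_straightening by (simp add: straightening_def lift_def)

lemma limit_l_scone: "scone K UG (T0 L) (\<lambda>n. \<pi> n \<cdot> l) (\<lambda>e. \<pi>' e \<lhd> l)"
  using UG.scone_precomp[OF limit_scone l_typing(1,3)] by (simp add: l_typing)

lemma L_obj: "L \<in> obj K"
  using lim by (simp add: glim_def)

lemmas tys = pi_typing kap_typing l_typing L_obj e_typing dn_typing T_typing unit_typing mult_typing T_pres

text \<open>By \<open>lift_unit\<close> the lifted cone restricted along \<open>i L\<close> is
  \<open>\<pi>\<close>. Hence \<open>\<pi>\<close> is straightened both by the restriction of
  \<open>kap\<close> along \<open>i L\<close> and by its own identities; uniqueness identifies the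
  cones, which gives the axiom, and the isomorphisms, which gives the unit coherence of the
  projections.\<close>

lemma l_unit: "l \<cdot> i L = ide K L" "n \<in> nodes G \<Longrightarrow> kap n \<lhd> i L = vide K (\<pi> n)"
proof -
  have iL: "i L \<in> arr K" "tgt K (i L) = T0 L" "src K (i L) = L" by (simp_all add: tys)
  note s = UG.scone_precomp[OF limit_l_scone iL(1,2), unfolded iL(3)]
  have g: "gmor K UG (\<lambda>n. (\<pi> n \<cdot> l) \<cdot> i L) (\<lambda>e. (\<pi>' e \<lhd> l) \<lhd> i L) \<pi> \<pi>' (\<lambda>n. kap n \<lhd> i L)"
    by (rule UG.gmor_cong[OF UG.gmor_precomp[OF kap_gmor UG.scone_precone[OF limit_l_scone] lift_precone[OF limit_precone] iL(1,2)]])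
      (simp_all add: lift_unit[OF limit_precone])
  have inv: "invertible_cell K (kap n \<lhd> i L)" if "n \<in> nodes UG" for n
    using that by (intro invertible_whisk_r) (simp_all add: tys calc)
  have z: "kap n \<lhd> i L = vide K (\<pi> n)" if "n \<in> N\<^sub>0" for n
    using that N0_nodes by (simp add: kap_N0 tys calc unit_nat unit_nat')
  have iv: "invertible_cell K (vide K (\<pi> n))" if "n \<in> nodes UG" for n
    using that by (intro invertible_vide) (simp add: tys)
  note u = UG.straightening_unique[OF rect UG.scone_gcone[OF limit_scone] UG.strict_invertible[OF limit_scone]
      s g inv z limit_scone UG.gmor_vide[OF limit_precone] iv refl, simplified]
  show "n \<in> nodes G \<Longrightarrow> kap n \<lhd> i L = vide K (\<pi> n)"
    by (rule u(1))
  have "\<pi> n \<cdot> (l \<cdot> i L) = \<pi> n \<cdot> ide K L" if n: "n \<in> nodes G" for n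
  proof -
    have "(\<pi> n \<cdot> l) \<cdot> i L = \<pi> n" by (rule u(2)[OF n])
    then show ?thesis using n by (simp add: tys calc)
  qed
  moreover have "\<pi>' e \<lhd> (l \<cdot> i L) = \<pi>' e \<lhd> ide K L" if e: "e \<in> edges G" for e
  proof -
    have "(\<pi>' e \<lhd> l) \<lhd> i L = \<pi>' e" by (rule u(3)[OF e])
    then show ?thesis using e by (simp add: tys calc)
  qed
  ultimately show "l \<cdot> i L = ide K L"
    by - (rule UG.glim_arr_eqI[OF lim], simp_all add: tys calc(1-6))
qed

text \<open>Two straightenings of the lifted cone restricted along \<open>m L\<close>: the
  restriction of \<open>kap\<close>, and \<open>kap\<close> restricted along \<open>T1 l\<close>
  followed by the lift of \<open>kap\<close>. The cones agree, which is associativity, and so do the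
  isomorphisms.\<close>

lemma l_mult: "l \<cdot> m L = l \<cdot> T1 l"
  "n \<in> nodes G \<Longrightarrow> kap n \<lhd> m L = (dn n \<rhd> T2 (kap n)) \<bullet> (kap n \<lhd> T1 l)"
proof -
  have mL: "m L \<in> arr K" "tgt K (m L) = T0 L" "src K (m L) = T0 (T0 L)" by (simp_all add: tys)
  have Tl: "T1 l \<in> arr K" "tgt K (T1 l) = T0 L" "src K (T1 l) = T0 (T0 L)" by (simp_all add: tys)
  note pl = UG.scone_precone[OF limit_l_scone] and pf = lift_precone[OF limit_precone]
  note \<phi> = UG.gcone_precomp[OF lifted_gcone mL(1,2), unfolded mL(3)]
  have \<phi>_inv: "invertible_cell K (lift' \<pi> \<pi>' e \<lhd> m L)" if "e \<in> strict UG" for e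
    using that lifted_strict_invertible TA.strict_edge
    by (intro invertible_whisk_r) (simp_all add: tys calc lift'_typing[OF limit_precone] lift_typing[OF limit_precone])
  note s1 = UG.scone_precomp[OF limit_l_scone mL(1,2), unfolded mL(3)]
  note g1 = UG.gmor_precomp[OF kap_gmor pl pf mL(1,2)]
  have i1: "invertible_cell K (kap n \<lhd> m L)" if "n \<in> nodes UG" for n
    using that by (intro invertible_whisk_r) (simp_all add: tys calc)
  have z1: "kap n \<lhd> m L = vide K (lift \<pi> n \<cdot> m L)" if "n \<in> N\<^sub>0" for n
    using that N0_nodes by (simp add: kap_N0 tys calc lift_def)
  note s2 = UG.scone_precomp[OF limit_l_scone Tl(1,2), unfolded Tl(3)]
  note ga = UG.gmor_precomp[OF kap_gmor pl pf Tl(1,2)]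
  \<comment> \<open>The lift of the morphism \<open>kap\<close>: its source is lifted along
    \<open>T1 l\<close> by \<open>lift_precomp\<close>, and its target, a cone lifted twice, is
    restricted along \<open>m L\<close> by \<open>lift_mult\<close>.\<close>
  have gb: "gmor K UG (\<lambda>n. lift \<pi> n \<cdot> T1 l) (\<lambda>e. lift' \<pi> \<pi>' e \<lhd> T1 l) (\<lambda>n. lift \<pi> n \<cdot> m L) (\<lambda>e. lift' \<pi> \<pi>' e \<lhd> m L)
     (\<lambda>n. dn n \<rhd> T2 (kap n))"
    by (rule UG.gmor_cong[OF lift_gmor[OF pl pf kap_gmor]])
      (simp_all add: lift_precomp[OF limit_precone l_typing(1,3)] lift_mult[OF limit_precone])
  note g2 = UG.gmor_vcomp[OF ga gb UG.precone_precomp[OF pl Tl(1,2), unfolded Tl(3)]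
      UG.precone_precomp[OF pf Tl(1,2), unfolded Tl(3)] UG.precone_precomp[OF pf mL(1,2), unfolded mL(3)]]
  have i2: "invertible_cell K ((dn n \<rhd> T2 (kap n)) \<bullet> (kap n \<lhd> T1 l))" if "n \<in> nodes UG" for n
    using that by (intro invertible_vcomp invertible_whisk_r invertible_whisk_l T_invertible) (simp_all add: tys calc)
  \<comment> \<open>At an initial object \<open>kap n\<close> is an identity, so its two ends are
    the same arrow. Applying \<open>T1\<close> to that equality matches the ends of the two identity
    cells composed here.\<close>
  have z2: "(dn n \<rhd> T2 (kap n)) \<bullet> (kap n \<lhd> T1 l) = vide K (lift \<pi> n \<cdot> m L)" if n: "n \<in> N\<^sub>0" for n
  proof -
    note nn = N0_nodes[OF n]
    have v: "\<pi> n \<cdot> l = dn n \<cdot> T1 (\<pi> n)"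
      using kap_typing(2)[OF nn] kap_N0[OF n] nn by (simp add: tys(1-5) tys calc)
    have "T1 (\<pi> n) \<cdot> T1 l = T1 (dn n \<cdot> T1 (\<pi> n))" using arg_cong[OF v, of T1] nn by (simp add: tys)
    then show ?thesis using nn by (simp add: kap_N0[OF n] tys calc lift_def mult_nat mult_nat')
  qed
  note u = UG.straightening_unique[OF rect \<phi> \<phi>_inv s1 g1 i1 z1 s2 g2 i2 z2, simplified]
  show "n \<in> nodes G \<Longrightarrow> kap n \<lhd> m L = (dn n \<rhd> T2 (kap n)) \<bullet> (kap n \<lhd> T1 l)"
    by (rule u(1))
  have "\<pi> n \<cdot> (l \<cdot> m L) = \<pi> n \<cdot> (l \<cdot> T1 l)" if n: "n \<in> nodes G" for n
    using u(2)[OF n] n by (simp add: tys calc)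
  moreover have "\<pi>' e \<lhd> (l \<cdot> m L) = \<pi>' e \<lhd> (l \<cdot> T1 l)" if e: "e \<in> edges G" for e
    using u(3)[OF e] e by (simp add: tys calc)
  ultimately show "l \<cdot> m L = l \<cdot> T1 l"
    by - (rule UG.glim_arr_eqI[OF lim], simp_all add: tys calc(1-6))
qed

section \<open>The projections as pseudo morphisms and their universal property\<close>

abbreviation "LA \<equiv> (L, l)"

lemma lifted_alg: "LA \<in> strict_alg K T i m"
  using l_unit(1) l_mult(1) by (simp add: strict_alg_def hom_iff tys)

text \<open>The cell \<open>kap n\<close> runs from \<open>\<pi> n \<cdot> l\<close> to
  \<open>dn n \<cdot> T1 (\<pi> n)\<close>, and a structure cell of a pseudo morphism runs the other
  way; hence the inverse.\<close>

definition p where "p n = PsMor LA (ob G n) (\<pi> n) (vinv K (kap n))"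

definition p' where "p' e = AlgCell (ps_comp K T (eP G e) (p (es G e))) (ps_comp K T (eQ G e) (p (et G e))) (\<pi>' e)"

lemma p_simps [simp]: "ps_dom (p n) = LA" "ps_cod (p n) = ob G n" "ps_arr (p n) = \<pi> n" "ps_cell (p n) = vinv K (kap n)"
  "ac_cell (p' e) = \<pi>' e" "ac_src (p' e) = ps_comp K T (eP G e) (p (es G e))"
  "ac_tgt (p' e) = ps_comp K T (eQ G e) (p (et G e))"
  by (simp_all add: p_def p'_def)

lemma vkap_typing:
  assumes "n \<in> nodes G"
  shows "vinv K (kap n) \<in> cell K" "vsrc K (vinv K (kap n)) = dn n \<cdot> T1 (\<pi> n)" "vtgt K (vinv K (kap n)) = \<pi> n \<cdot> l"
    "invertible_cell K (vinv K (kap n))"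
  using vinv[OF kap_typing(4)[OF assms]] kap_typing[OF assms] by (auto intro: invertible_vinv)

text \<open>The two coherence conditions are the second halves of \<open>l_unit\<close> and
  \<open>l_mult\<close> with \<open>kap\<close> replaced by its inverse.\<close>

lemma p_mor:
  assumes n: "n \<in> nodes G"
  shows "p n \<in> ps_mor K T i m"
proof -
  note t = vkap_typing tys calc
  have u: "vinv K (kap n) \<lhd> i L = vide K (\<pi> n)"
  proof -
    have "(kap n \<bullet> vinv K (kap n)) \<lhd> i L = vide K (\<pi> n)"
      using n by (simp add: vinv(5)[OF kap_typing(4)[OF n]] t unit_nat unit_nat')
    moreover have "(kap n \<bullet> vinv K (kap n)) \<lhd> i L = (kap n \<lhd> i L) \<bullet> (vinv K (kap n) \<lhd> i L)"
      using n by (simp add: t)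
    ultimately show ?thesis using n by (simp add: l_unit t unit_nat unit_nat')
  qed
  have "vinv K (kap n) \<lhd> m L = (vinv K (kap n) \<lhd> T1 l) \<bullet> (dn n \<rhd> T2 (vinv K (kap n)))"
  proof (rule cancel_left[of "kap n \<lhd> m L"])
    show "invertible_cell K (kap n \<lhd> m L)" using n by (intro invertible_whisk_r) (simp_all add: t)
    have "(kap n \<lhd> m L) \<bullet> (vinv K (kap n) \<lhd> m L) = (kap n \<bullet> vinv K (kap n)) \<lhd> m L"
      using n by (simp add: t)
    also have "\<dots> = dn n \<rhd> T2 (kap n \<bullet> vinv K (kap n))"
      using n by (simp add: vinv(5)[OF kap_typing(4)[OF n]] t mult_nat mult_nat')
    \<comment> \<open>An identity cell is inserted in the middle in order to be rewritten as
      \<open>kap n\<close> after its inverse, whiskered with \<open>T1 l\<close>. Regrouping then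
      exposes the right-hand side of \<open>l_mult\<close>.\<close>
    also have "\<dots> = (dn n \<rhd> T2 (kap n)) \<bullet> vide K (dn n \<cdot> T1 (\<pi> n) \<cdot> T1 l) \<bullet> (dn n \<rhd> T2 (vinv K (kap n)))"
      using n by (simp add: t)
    also have "vide K (dn n \<cdot> T1 (\<pi> n) \<cdot> T1 l) = (kap n \<bullet> vinv K (kap n)) \<lhd> T1 l"
      using n by (simp add: vinv(5)[OF kap_typing(4)[OF n]] t)
    also have "(dn n \<rhd> T2 (kap n)) \<bullet> ((kap n \<bullet> vinv K (kap n)) \<lhd> T1 l) \<bullet> (dn n \<rhd> T2 (vinv K (kap n)))
      = ((dn n \<rhd> T2 (kap n)) \<bullet> (kap n \<lhd> T1 l)) \<bullet> (vinv K (kap n) \<lhd> T1 l) \<bullet> (dn n \<rhd> T2 (vinv K (kap n)))"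
      using n by (simp add: t)
    finally show "(kap n \<lhd> m L) \<bullet> (vinv K (kap n) \<lhd> m L)
      = (kap n \<lhd> m L) \<bullet> (vinv K (kap n) \<lhd> T1 l) \<bullet> (dn n \<rhd> T2 (vinv K (kap n)))"
      unfolding l_mult(2)[OF n] .
  qed (use n in \<open>simp_all add: t mult_nat mult_nat' l_mult\<close>)
  then show ?thesis
    using u n lifted_alg dn_alg[OF n] by (simp add: ps_mor_iff t dn_def[symmetric])
qed

text \<open>The compatibility condition combines naturality of the inverse of \<open>kap\<close> at
  \<open>e\<close> with \<open>lift'_eq\<close> for the limit cone.\<close>

lemma p'_cell:
  assumes e: "e \<in> edges G"
  shows "p' e \<in> alg_cell K T i m"
proof -
  let ?s = "es G e" and ?t = "et G e"
  note t = vkap_typing tys calc lift_typing[OF limit_precone] lift'_typing[OF limit_precone] lift_def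
  have ps: "ps_comp K T (eP G e) (p ?s) \<in> ps_mor K T i m" "ps_comp K T (eQ G e) (p ?t) \<in> ps_mor K T i m"
    using TA.comp_typing(1)[of "p ?s" "eP G e"] TA.comp_typing(1)[of "p ?t" "eQ G e"] e edge_ps[OF e] p_mor
    by (simp_all add: tys)
  note g = UG.gmor_inverse[OF kap_gmor UG.scone_precone[OF limit_l_scone] lift_precone[OF limit_precone] kap_typing(4), simplified]
  have "(\<pi>' e \<lhd> l) \<bullet> (pP e \<rhd> vinv K (kap ?s)) \<bullet> (cP e \<lhd> T1 (\<pi> ?s))
    = ((\<pi>' e \<lhd> l) \<bullet> (pP e \<rhd> vinv K (kap ?s))) \<bullet> (cP e \<lhd> T1 (\<pi> ?s))"
    using e by (simp add: t)
  also have "\<dots> = (pQ e \<rhd> vinv K (kap ?t)) \<bullet> (lift' \<pi> \<pi>' e \<bullet> (cP e \<lhd> T1 (\<pi> ?s)))"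
    using UG.gmor_nat[OF g, of e] e by (simp add: t)
  also have "\<dots> = ((pQ e \<rhd> vinv K (kap ?t)) \<bullet> (cQ e \<lhd> T1 (\<pi> ?t))) \<bullet> (dx e \<rhd> T2 (\<pi>' e))"
    unfolding lift'_eq[OF limit_precone e] using e by (simp add: t)
  finally have "(\<pi>' e \<lhd> l) \<bullet> (pP e \<rhd> vinv K (kap ?s)) \<bullet> (cP e \<lhd> T1 (\<pi> ?s))
    = ((pQ e \<rhd> vinv K (kap ?t)) \<bullet> (cQ e \<lhd> T1 (\<pi> ?t))) \<bullet> (dx e \<rhd> T2 (\<pi>' e))" .
  then show ?thesis using ps e by (simp add: alg_cell_iff edge_ps tys dx_def)
qed

lemma lifted_precone: "precone Alg G LA p p'"
  using lifted_alg p_mor p'_cell by (simp add: precone_def)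

lemma lifted_scone: "scone Alg G LA p p'"
  using limit_scone by (simp add: scone_proj_iff[OF lifted_precone])


text \<open>Cancelling \<open>kap\<close> turns the structure cell of a composite with a projection
  into a whiskering by \<open>\<pi> n\<close>, to which the universal property in \<open>K\<close>
  applies.\<close>

lemma p_comp_kap:
  assumes n: "n \<in> nodes G" and h: "h \<in> ps_mor K T i m" "ps_cod h = LA"
  shows "ps_cell (ps_comp K T (p n) h) \<bullet> (kap n \<lhd> T1 (ps_arr h)) = \<pi> n \<rhd> ps_cell h"
proof -
  note t = vkap_typing tys calc ps_typing(3-8)[OF h(1)] alg_typing(1-4)[OF ps_typing(1)[OF h(1)]] h(2)
  have "ps_cell (ps_comp K T (p n) h) \<bullet> (kap n \<lhd> T1 (ps_arr h))
    = (\<pi> n \<rhd> ps_cell h) \<bullet> ((vinv K (kap n) \<bullet> kap n) \<lhd> T1 (ps_arr h))"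
    using n by (simp add: t)
  also have "\<dots> = \<pi> n \<rhd> ps_cell h"
    unfolding vinv(4)[OF kap_typing(4)[OF n]] using n by (simp add: t)
  finally show ?thesis .
qed

text \<open>The underlying arrows agree by the limit in \<open>K\<close>. The structure cells agree
  because, by \<open>p_comp_kap\<close>, their whiskerings with the projections are determined by
  the composites.\<close>

lemma lifted_arr_unique:
  assumes h: "h \<in> ps_mor K T i m" "ps_cod h = LA" and k: "k \<in> ps_mor K T i m" "ps_cod k = LA"
    and "ps_dom h = ps_dom k"
    and eq: "\<And>n. n \<in> nodes G \<Longrightarrow> ps_comp K T (p n) h = ps_comp K T (p n) k"
    and eq': "\<And>e. e \<in> edges G \<Longrightarrow> \<pi>' e \<lhd> ps_arr h = \<pi>' e \<lhd> ps_arr k"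
  shows "h = k"
proof -
  note t = vkap_typing tys calc(1-17) ps_typing(3-8)[OF h(1)] alg_typing(1-4)[OF ps_typing(1)[OF h(1)]]
    ps_typing(3-8)[OF k(1)] alg_typing(1-4)[OF ps_typing(1)[OF k(1)]] h(2) k(2) assms(5)
  have a: "ps_arr h = ps_arr k"
  proof (rule UG.glim_arr_eqI[OF lim])
    show "\<pi> n \<cdot> ps_arr h = \<pi> n \<cdot> ps_arr k" if "n \<in> nodes UG" for n
      using arg_cong[OF eq[of n], of ps_arr] that by simp
  qed (simp_all add: t eq')
  have "ps_cell h = ps_cell k"
  proof (rule UG.glim_cell_eqI[OF lim])
    show "\<pi> n \<rhd> ps_cell h = \<pi> n \<rhd> ps_cell k" if "n \<in> nodes UG" for n
      using p_comp_kap[OF _ h, of n] p_comp_kap[OF _ k, of n] eq[of n] that a by simp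
  qed (simp_all add: t a)
  then show ?thesis using a assms by (intro psmor_eqI) simp_all
qed

text \<open>The underlying arrow \<open>h\<close> is the factorisation in \<open>K\<close>. By
  \<open>p_comp_kap\<close> its structure cell \<open>b\<close> must satisfy \<open>\<pi> n \<rhd> b
  = ps_cell (\<psi> n) \<bullet> (kap n \<lhd> T1 h)\<close>; these right-hand sides form a morphism
  of cones, so such a \<open>b\<close> exists. Invertibility and coherence of \<open>b\<close> are
  tested after whiskering with the projections.\<close>

lemma lifted_arr_exists:
  assumes s: "scone Alg G A \<psi> \<psi>'"
  obtains h where "h \<in> ps_mor K T i m" "ps_dom h = A" "ps_cod h = LA"
    "\<And>n. n \<in> nodes G \<Longrightarrow> ps_comp K T (p n) h = \<psi> n"
    "\<And>e. e \<in> edges G \<Longrightarrow> \<pi>' e \<lhd> ps_arr h = ac_cell (\<psi>' e)"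
proof -
  note p = TA.scone_precone[OF s]
  note tp = TA.precone_typing[OF p, simplified]
  let ?f = "\<lambda>n. ps_arr (\<psi> n)" and ?f' = "\<lambda>e. ac_cell (\<psi>' e)"
  let ?E = "fst A" and ?a = "snd A"
  note sK = scone_proj[OF s]
  obtain h where h: "h \<in> arr K" "src K h = ?E" "tgt K h = L" "\<And>n. n \<in> nodes UG \<Longrightarrow> \<pi> n \<cdot> h = ?f n"
    "\<And>e. e \<in> edges UG \<Longrightarrow> \<pi>' e \<lhd> h = ?f' e"
    by (rule UG.glim_obtain_arr[OF lim sK]) (rule that)
  note h = h[simplified]
  note A = alg_typing[OF tp(1)] alg_laws[OF tp(1)]
  have ps: "?f n \<in> arr K" "src K (?f n) = ?E" "tgt K (?f n) = fst (ob G n)" "ps_cell (\<psi> n) \<in> cell K"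
    "vsrc K (ps_cell (\<psi> n)) = dn n \<cdot> T1 (?f n)" "vtgt K (ps_cell (\<psi> n)) = ?f n \<cdot> ?a"
    "invertible_cell K (ps_cell (\<psi> n))" "ps_cell (\<psi> n) \<lhd> i ?E = vide K (?f n)"
    "ps_cell (\<psi> n) \<lhd> m ?E = (ps_cell (\<psi> n) \<lhd> T1 ?a) \<bullet> (dn n \<rhd> T2 (ps_cell (\<psi> n)))"
    if "n \<in> nodes G" for n
    using ps_typing[OF tp(2)[OF that]] tp(3,4)[OF that] by (simp_all add: dn_def)
  have fn: "?f n = \<pi> n \<cdot> h" if "n \<in> nodes G" for n
    using h(4)[OF that] by simp
  note t = vkap_typing tys h A(1-4) calc
  have Th: "T1 h \<in> arr K" "tgt K (T1 h) = T0 L" "src K (T1 h) = T0 ?E" by (simp_all add: t)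
  note pl = UG.scone_precone[OF limit_l_scone] and pf = lift_precone[OF limit_precone]
  note pe = UG.scone_precone[OF sK]
  have g1: "gmor K UG (\<lambda>n. (\<pi> n \<cdot> l) \<cdot> T1 h) (\<lambda>e. (\<pi>' e \<lhd> l) \<lhd> T1 h) (lift ?f) (lift' ?f ?f') (\<lambda>n. kap n \<lhd> T1 h)"
  proof (rule UG.gmor_cong[OF UG.gmor_precomp[OF kap_gmor pl pf Th(1,2)]])
    show "lift \<pi> n \<cdot> T1 h = lift ?f n" if "n \<in> nodes UG" for n
      using that by (simp add: fn lift_def tys h(1-3) calc)
    show "lift' \<pi> \<pi>' e \<lhd> T1 h = lift' ?f ?f' e" if "e \<in> edges UG" for e
      using that lift_precomp(2)[OF limit_precone h(1,3), of e, symmetric] h(4,5)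
      by (simp add: lift'_def tys)
  qed auto
  \<comment> \<open>The restriction of \<open>kap\<close> along \<open>T1 h\<close>, followed by the
    structure cells of the given cone (\<open>structure_gmor\<close>); the target of the first is
    the lift of that cone because its legs are \<open>\<pi> n \<cdot> h\<close>.\<close>
  have g: "gmor K UG (\<lambda>n. \<pi> n \<cdot> (l \<cdot> T1 h)) (\<lambda>e. \<pi>' e \<lhd> (l \<cdot> T1 h)) (\<lambda>n. \<pi> n \<cdot> (h \<cdot> ?a)) (\<lambda>e. \<pi>' e \<lhd> (h \<cdot> ?a))
     (\<lambda>n. ps_cell (\<psi> n) \<bullet> (kap n \<lhd> T1 h))"
  proof (rule UG.gmor_cong[OF UG.gmor_vcomp[OF g1 structure_gmor[OF p]
        UG.precone_precomp[OF pl Th(1,2), unfolded Th(3)] lift_precone[OF pe]]])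
    show "precone K UG (T0 ?E) (\<lambda>n. ?f n \<cdot> ?a) (\<lambda>e. ?f' e \<lhd> ?a)"
      using UG.precone_precomp[OF pe A(2,4)] A(3) by simp
    show "?f n \<cdot> ?a = \<pi> n \<cdot> (h \<cdot> ?a)" if "n \<in> nodes UG" for n
      using that h(4)[of n, symmetric] by (simp add: t(1-29) A h(1-3) tys calc)
    show "?f' e \<lhd> ?a = \<pi>' e \<lhd> (h \<cdot> ?a)" if "e \<in> edges UG" for e
      using that h(5)[of e, symmetric] by (simp add: A h(1-3) tys calc)
  qed (simp_all add: tys h(1-3) calc)
  obtain b where b: "b \<in> cell K" "vsrc K b = l \<cdot> T1 h" "vtgt K b = h \<cdot> ?a"
    "\<And>n. n \<in> nodes G \<Longrightarrow> \<pi> n \<rhd> b = ps_cell (\<psi> n) \<bullet> (kap n \<lhd> T1 h)"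
    by (rule UG.glim_obtain_cell[OF lim _ _ _ _ _ g]) (simp_all add: tys h(1-3) A calc)
  note ht = h(1-3) A(1-4) b(1-3)
  have kT: "\<pi> n \<cdot> (l \<cdot> T1 h) = (\<pi> n \<cdot> l) \<cdot> T1 h" if "n \<in> nodes G" for n
    using that by (simp add: tys ht calc)
  have inv: "invertible_cell K b"
  proof (rule UG.glim_cell_invertible[OF lim])
    show "invertible_cell K (\<pi> n \<rhd> b)" if "n \<in> nodes UG" for n
      using that by (simp add: b, intro invertible_vcomp invertible_whisk_r)
        (simp_all add: tys ht ps fn calc)
  qed (simp_all add: tys ht calc)
  have pb: "\<pi> n \<rhd> (b \<lhd> k) = (ps_cell (\<psi> n) \<lhd> k) \<bullet> (kap n \<lhd> (T1 h \<cdot> k))"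
    if n: "n \<in> nodes G" and k: "k \<in> arr K" "tgt K k = T0 ?E" for n k
  proof -
    have "\<pi> n \<rhd> (b \<lhd> k) = (\<pi> n \<rhd> b) \<lhd> k"
      using n k by (simp add: tys ht calc)
    then show ?thesis using n k by (simp add: b(4) tys ht ps fn calc)
  qed
  have bi: "b \<lhd> i ?E = vide K h"
  proof (rule UG.glim_cell_eqI[OF lim])
    show "\<pi> n \<rhd> (b \<lhd> i ?E) = \<pi> n \<rhd> vide K h" if "n \<in> nodes UG" for n
    proof -
      have n: "n \<in> nodes G" using that by simp
      have "\<pi> n \<rhd> (b \<lhd> i ?E) = vide K (?f n) \<bullet> (kap n \<lhd> (T1 h \<cdot> i ?E))"
        using n by (simp add: pb tys ht ps)
      also have "kap n \<lhd> (T1 h \<cdot> i ?E) = (kap n \<lhd> i L) \<lhd> h"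
        using n by (simp add: tys ht unit_nat calc)
      also have "\<dots> = vide K (\<pi> n \<cdot> h)"
        using n by (simp add: l_unit tys ht calc)
      finally show ?thesis using n by (simp add: h(4) ps tys ht calc)
    qed
    \<comment> \<open>Comparing 2-cells through the projections presupposes equal domains. Here this
      is the unit axiom of \<open>LA\<close>; in the proof of \<open>bm\<close> associativity plays
      the same part.\<close>
    have "l \<cdot> (i L \<cdot> h) = h"
      using comp_assoc[of h "i L" l] l_unit(1) by (simp add: tys ht calc)
    then show "vsrc K (b \<lhd> i ?E) = vsrc K (vide K h)" "tgt K (vsrc K (b \<lhd> i ?E)) = L"
      by (simp_all add: tys ht unit_nat calc)
  qed (simp_all add: tys ht A calc)
  have bm: "b \<lhd> m ?E = (b \<lhd> T1 ?a) \<bullet> (l \<rhd> T2 b)"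
  proof (rule UG.glim_cell_eqI[OF lim])
    show "\<pi> n \<rhd> (b \<lhd> m ?E) = \<pi> n \<rhd> ((b \<lhd> T1 ?a) \<bullet> (l \<rhd> T2 b))" if "n \<in> nodes UG" for n
    proof -
      have n: "n \<in> nodes G" using that by simp
      have "\<pi> n \<rhd> ((b \<lhd> T1 ?a) \<bullet> (l \<rhd> T2 b))
        = (\<pi> n \<rhd> (b \<lhd> T1 ?a)) \<bullet> ((\<pi> n \<cdot> l) \<rhd> T2 b)"
        using n by (simp add: tys ht calc)
      also have "\<dots> = (ps_cell (\<psi> n) \<lhd> T1 ?a) \<bullet> (kap n \<lhd> T1 (h \<cdot> ?a)) \<bullet> ((\<pi> n \<cdot> l) \<rhd> T2 b)"
        using n by (simp add: pb tys ht ps fn calc)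
      also have "(kap n \<lhd> T1 (h \<cdot> ?a)) \<bullet> ((\<pi> n \<cdot> l) \<rhd> T2 b)
        = ((dn n \<cdot> T1 (\<pi> n)) \<rhd> T2 b) \<bullet> (kap n \<lhd> T1 (l \<cdot> T1 h))"
        using whisk_interchange[of "T2 b" "kap n"] n by (simp add: tys ht calc)
      also have "(dn n \<cdot> T1 (\<pi> n)) \<rhd> T2 b = dn n \<rhd> T2 (\<pi> n \<rhd> b)"
        using n by (simp add: tys ht calc)
      also have "\<dots> = (dn n \<rhd> T2 (ps_cell (\<psi> n))) \<bullet> (dn n \<rhd> (T2 (kap n) \<lhd> T1 (T1 h)))"
        using n by (simp add: b(4) tys ht ps fn calc)
      \<comment> \<open>The regrouping separates two factors: coherence of \<open>\<psi> n\<close>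
        with the multiplication rewrites the first, \<open>l_mult\<close> the second.\<close>
      also have "(ps_cell (\<psi> n) \<lhd> T1 ?a) \<bullet> ((dn n \<rhd> T2 (ps_cell (\<psi> n))) \<bullet>
           (dn n \<rhd> (T2 (kap n) \<lhd> T1 (T1 h)))) \<bullet> (kap n \<lhd> T1 (l \<cdot> T1 h))
        = ((ps_cell (\<psi> n) \<lhd> T1 ?a) \<bullet> (dn n \<rhd> T2 (ps_cell (\<psi> n)))) \<bullet>
           (((dn n \<rhd> T2 (kap n)) \<bullet> (kap n \<lhd> T1 l)) \<lhd> T1 (T1 h))"
        using n by (simp add: tys ht ps fn calc)
      also have "\<dots> = (ps_cell (\<psi> n) \<lhd> m ?E) \<bullet> ((kap n \<lhd> m L) \<lhd> T1 (T1 h))"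
        using n by (simp add: ps(9) l_mult(2))
      also have "\<dots> = \<pi> n \<rhd> (b \<lhd> m ?E)"
        using n by (simp add: pb tys ht mult_nat calc)
      finally show ?thesis ..
    qed
    have "l \<cdot> (m L \<cdot> T1 (T1 h)) = l \<cdot> (T1 l \<cdot> T1 (T1 h))"
      using comp_assoc[of "T1 (T1 h)" "m L" l] comp_assoc[of "T1 (T1 h)" "T1 l" l] l_mult(1) by (simp add: tys ht)
    then show "vsrc K (b \<lhd> m ?E) = vsrc K ((b \<lhd> T1 ?a) \<bullet> (l \<rhd> T2 b))"
      "tgt K (vsrc K (b \<lhd> m ?E)) = L"
      by (simp_all add: tys ht mult_nat calc)
  qed (simp_all add: tys ht A calc)
  define hh where "hh = PsMor A LA h b"
  have hh: "ps_dom hh = A" "ps_cod hh = LA" "ps_arr hh = h" "ps_cell hh = b" by (simp_all add: hh_def)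
  have hps: "hh \<in> ps_mor K T i m"
    using lifted_alg tp(1) inv bi bm by (simp add: ps_mor_iff hh ht)
  show ?thesis
  proof (rule that[OF hps hh(1,2)])
    show "\<pi>' e \<lhd> ps_arr hh = ?f' e" if "e \<in> edges G" for e
      using that h(5) by (simp add: hh)
    show "ps_comp K T (p n) hh = \<psi> n" if n: "n \<in> nodes G" for n
    proof (rule psmor_eqI)
      have "ps_cell (ps_comp K T (p n) hh) = ps_cell (\<psi> n)"
      proof (rule cancel_right[of "kap n \<lhd> T1 h"])
        show "invertible_cell K (kap n \<lhd> T1 h)"
          using n by (intro invertible_whisk_r) (simp_all add: tys ht calc)
        show "ps_cell (ps_comp K T (p n) hh) \<bullet> (kap n \<lhd> T1 h) = ps_cell (\<psi> n) \<bullet> (kap n \<lhd> T1 h)"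
          using p_comp_kap[OF n hps hh(2)] n by (simp add: hh b(4))
      qed (use n in \<open>simp_all add: hh tys vkap_typing ht ps fn calc\<close>)
      then show "ps_cell (ps_comp K T (p n) hh) = ps_cell (\<psi> n)" .
    qed (use n in \<open>simp_all add: hh tp h(4)\<close>)
  qed
qed

text \<open>The underlying 2-cell comes from the limit in \<open>K\<close>. Its compatibility with
  the structure cells is tested after whiskering with the projections, where
  \<open>p_comp_kap\<close> reduces it to the compatibility of \<open>\<alpha> n\<close> and an
  interchange with \<open>kap n\<close>. Of the families \<open>\<psi>\<close> and
  \<open>\<psi>'\<close> only the underlying 2-cells matter, so they are kept general.\<close>

lemma lifted_cell_exists:
  assumes h: "h \<in> ps_mor K T i m" "ps_cod h = LA" and k: "k \<in> ps_mor K T i m" "ps_cod k = LA"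
    and hk: "ps_dom h = ps_dom k"
    and a: "gmor Alg G (\<lambda>n. ps_comp K T (p n) h) \<psi> (\<lambda>n. ps_comp K T (p n) k) \<psi>' \<alpha>"
    and \<psi>: "\<And>e. e \<in> edges G \<Longrightarrow> ac_cell (\<psi> e) = \<pi>' e \<lhd> ps_arr h"
      "\<And>e. e \<in> edges G \<Longrightarrow> ac_cell (\<psi>' e) = \<pi>' e \<lhd> ps_arr k"
  obtains \<beta> where "\<beta> \<in> alg_cell K T i m" "ac_src \<beta> = h" "ac_tgt \<beta> = k"
    "\<And>n. n \<in> nodes G \<Longrightarrow> \<pi> n \<rhd> ac_cell \<beta> = ac_cell (\<alpha> n)"
proof -
  note ta = TA.gmor_typing[OF a, simplified]
  let ?A = "ps_dom k" let ?a = "snd ?A"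
  have at: "ac_cell (\<alpha> n) \<in> cell K" "vsrc K (ac_cell (\<alpha> n)) = \<pi> n \<cdot> ps_arr h" "vtgt K (ac_cell (\<alpha> n)) = \<pi> n \<cdot> ps_arr k"
    if "n \<in> nodes G" for n
    using alg_cell_typing(5-7)[OF ta(1)[OF that]] ta(2,3)[OF that] by simp_all
  have nat: "(\<pi>' e \<lhd> ps_arr k) \<bullet> (pP e \<rhd> ac_cell (\<alpha> (es G e)))
      = (pQ e \<rhd> ac_cell (\<alpha> (et G e))) \<bullet> (\<pi>' e \<lhd> ps_arr h)" if e: "e \<in> edges G" for e
    using arg_cong[OF TA.gmor_nat[OF a e], of ac_cell] \<psi> e by simp
  note t = vkap_typing tys calc ps_typing(3-8)[OF h(1)] alg_typing(1-4)[OF ps_typing(1)[OF k(1)]]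
    ps_typing(3-8)[OF k(1)] h(2) k(2) hk
  have g: "gmor K UG (\<lambda>n. \<pi> n \<cdot> ps_arr h) (\<lambda>e. \<pi>' e \<lhd> ps_arr h) (\<lambda>n. \<pi> n \<cdot> ps_arr k) (\<lambda>e. \<pi>' e \<lhd> ps_arr k)
     (\<lambda>n. ac_cell (\<alpha> n))"
    unfolding gmor_def using at nat by simp
  obtain b where b: "b \<in> cell K" "vsrc K b = ps_arr h" "vtgt K b = ps_arr k"
    "\<And>n. n \<in> nodes G \<Longrightarrow> \<pi> n \<rhd> b = ac_cell (\<alpha> n)"
    by (rule UG.glim_obtain_cell[OF lim _ _ _ _ _ g]) (simp_all add: t)
  note t' = t b(1-3)
  have "(b \<lhd> ?a) \<bullet> ps_cell h = ps_cell k \<bullet> (l \<rhd> T2 b)"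
  proof (rule UG.glim_cell_eqI[OF lim])
    show "\<pi> n \<rhd> ((b \<lhd> ?a) \<bullet> ps_cell h) = \<pi> n \<rhd> (ps_cell k \<bullet> (l \<rhd> T2 b))" if "n \<in> nodes UG" for n
    proof -
      have n: "n \<in> nodes G" using that by simp
      let ?ph = "ps_cell (ps_comp K T (p n) h)" and ?pk = "ps_cell (ps_comp K T (p n) k)"
      have pt: "?ph \<in> cell K" "vsrc K ?ph = dn n \<cdot> T1 (\<pi> n) \<cdot> T1 (ps_arr h)" "vtgt K ?ph = \<pi> n \<cdot> ps_arr h \<cdot> ?a"
        "?pk \<in> cell K" "vsrc K ?pk = dn n \<cdot> T1 (\<pi> n) \<cdot> T1 (ps_arr k)" "vtgt K ?pk = \<pi> n \<cdot> ps_arr k \<cdot> ?a"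
        using n by (simp_all add: t)
      have ac: "(ac_cell (\<alpha> n) \<lhd> ?a) \<bullet> ?ph = ?pk \<bullet> (dn n \<rhd> T2 (ac_cell (\<alpha> n)))"
        using alg_cell_typing(8)[OF ta(1)[OF n]] unfolding ta(2,3)[OF n] by (simp add: hk dn_def del: ps_comp_simps(4))
      have "\<pi> n \<rhd> ((b \<lhd> ?a) \<bullet> ps_cell h) = ((\<pi> n \<rhd> b) \<lhd> ?a) \<bullet> (\<pi> n \<rhd> ps_cell h)"
        using n by (simp add: t')
      also have "\<dots> = ((ac_cell (\<alpha> n) \<lhd> ?a) \<bullet> ?ph) \<bullet> (kap n \<lhd> T1 (ps_arr h))"
        unfolding p_comp_kap[OF n h, symmetric] using n pt at by (simp add: b(4) t' del: ps_comp_simps(4))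
      also have "\<dots> = ?pk \<bullet> ((dn n \<rhd> T2 (\<pi> n \<rhd> b)) \<bullet> (kap n \<lhd> T1 (ps_arr h)))"
        unfolding ac using n pt at by (simp add: b(4) t' del: ps_comp_simps(4))
      also have "(dn n \<rhd> T2 (\<pi> n \<rhd> b)) \<bullet> (kap n \<lhd> T1 (ps_arr h))
        = (kap n \<lhd> T1 (ps_arr k)) \<bullet> ((\<pi> n \<cdot> l) \<rhd> T2 b)"
        using whisk_interchange[of "T2 b" "kap n"] n by (simp add: t')
      also have "?pk \<bullet> (kap n \<lhd> T1 (ps_arr k)) \<bullet> ((\<pi> n \<cdot> l) \<rhd> T2 b)
        = (?pk \<bullet> (kap n \<lhd> T1 (ps_arr k))) \<bullet> ((\<pi> n \<cdot> l) \<rhd> T2 b)"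
        using n pt by (simp add: t' del: ps_comp_simps(4))
      also have "\<dots> = \<pi> n \<rhd> (ps_cell k \<bullet> (l \<rhd> T2 b))"
        unfolding p_comp_kap[OF n k] using n by (simp add: t')
      finally show ?thesis .
    qed
  qed (simp_all add: t')
  then show ?thesis
    using h k hk b by (intro that[of "AlgCell h k b"]) (simp_all add: alg_cell_iff)
qed

lemma lifted_glim: "glim Alg G LA p p'"
  unfolding glim_def
proof (intro conjI allI ballI impI)
  show "LA \<in> obj Alg" using lifted_alg by simp
  show "scone Alg G LA p p'" by (rule lifted_scone)
  \<comment> \<open>Equality of 2-cells of algebras means equality of underlying cells and of ends;
    the ends agree by associativity of composition of pseudo morphisms.\<close>
  have p'eq: "p' e \<lhd>\<^bsub>Alg\<^esub> h = \<psi>" if "ac_cell \<psi> = \<pi>' e \<lhd> ps_arr h"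
    "ac_src \<psi> = ps_comp K T (eP G e) (ps_comp K T (p (es G e)) h)"
    "ac_tgt \<psi> = ps_comp K T (eQ G e) (ps_comp K T (p (et G e)) h)"
    "e \<in> edges G" "h \<in> ps_mor K T i m" "ps_cod h = LA" for \<psi> e h
    using TA.comp_assoc[of h "p (es G e)" "eP G e"] TA.comp_assoc[of h "p (et G e)" "eQ G e"] that p_mor edge_ps[of e] tys
    by (intro algcell_eqI) simp_all
  show "\<exists>h \<in> hom Alg A LA. (\<forall>n \<in> nodes G. p n \<cdot>\<^bsub>Alg\<^esub> h = \<psi> n) \<and>
      (\<forall>e \<in> edges G. p' e \<lhd>\<^bsub>Alg\<^esub> h = \<psi>' e)" if s: "scone Alg G A \<psi> \<psi>'" for A \<psi> \<psi>'
  proof -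
    obtain h where h: "h \<in> ps_mor K T i m" "ps_dom h = A" "ps_cod h = LA"
      "\<And>n. n \<in> nodes G \<Longrightarrow> ps_comp K T (p n) h = \<psi> n"
      "\<And>e. e \<in> edges G \<Longrightarrow> \<pi>' e \<lhd> ps_arr h = ac_cell (\<psi>' e)"
      by (rule lifted_arr_exists[OF s]) (rule that)
    note tp = TA.precone_typing[OF TA.scone_precone[OF s], simplified]
    have "p' e \<lhd>\<^bsub>Alg\<^esub> h = \<psi>' e" if e: "e \<in> edges G" for e
      by (rule p'eq) (use h tp(5-7)[OF e] e in \<open>simp_all add: e_typing(1,2)\<close>)
    then show ?thesis using h by (intro bexI[of _ h]) (auto simp: hom_iff)
  qed
  fix A h k assume h: "h \<in> hom Alg A LA" and k: "k \<in> hom Alg A LA"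
  note hk = h[unfolded hom_iff, simplified] k[unfolded hom_iff, simplified]
  show "h = k" if "(\<forall>n \<in> nodes G. p n \<cdot>\<^bsub>Alg\<^esub> h = p n \<cdot>\<^bsub>Alg\<^esub> k) \<and>
      (\<forall>e \<in> edges G. p' e \<lhd>\<^bsub>Alg\<^esub> h = p' e \<lhd>\<^bsub>Alg\<^esub> k)"
    by (rule lifted_arr_unique) (use that hk in auto)
  show "\<exists>\<beta> \<in> cells Alg h k. \<forall>n \<in> nodes G. p n \<rhd>\<^bsub>Alg\<^esub> \<beta> = \<alpha> n"
    if a: "gmor Alg G (\<lambda>n. p n \<cdot>\<^bsub>Alg\<^esub> h) (\<lambda>e. p' e \<lhd>\<^bsub>Alg\<^esub> h)
      (\<lambda>n. p n \<cdot>\<^bsub>Alg\<^esub> k) (\<lambda>e. p' e \<lhd>\<^bsub>Alg\<^esub> k) \<alpha>" for \<alpha>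
  proof -
    obtain \<beta> where b: "\<beta> \<in> alg_cell K T i m" "ac_src \<beta> = h" "ac_tgt \<beta> = k"
      "\<And>n. n \<in> nodes G \<Longrightarrow> \<pi> n \<rhd> ac_cell \<beta> = ac_cell (\<alpha> n)"
      by (rule lifted_cell_exists[of h k _ _ \<alpha>]) (use a hk in auto)
    have "p n \<rhd>\<^bsub>Alg\<^esub> \<beta> = \<alpha> n" if n: "n \<in> nodes G" for n
      using TA.gmor_typing(2,3)[OF a n] b n by (intro algcell_eqI) simp_all
    then show ?thesis using b by (intro bexI[of _ \<beta>]) (auto simp: cells_iff)
  qed
  fix \<beta> \<gamma> assume b: "\<beta> \<in> cells Alg h k" "\<gamma> \<in> cells Alg h k"
    and eq: "\<forall>n \<in> nodes G. p n \<rhd>\<^bsub>Alg\<^esub> \<beta> = p n \<rhd>\<^bsub>Alg\<^esub> \<gamma>"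
  have "ac_cell \<beta> = ac_cell \<gamma>"
  proof (rule UG.glim_cell_eqI[OF lim])
    show "\<pi> n \<rhd> ac_cell \<beta> = \<pi> n \<rhd> ac_cell \<gamma>" if "n \<in> nodes UG" for n
      using eq that by auto
  qed (use b hk alg_cell_typing[of \<beta>] alg_cell_typing[of \<gamma>] ps_typing(5)[of h] in \<open>auto simp: cells_iff\<close>)
  then show "\<beta> = \<gamma>" using b by (intro algcell_eqI) (auto simp: cells_iff)
qed

section \<open>Strictness of the projections at initial objects, and its detection\<close>

lemma strict_p:
  assumes "n \<in> N\<^sub>0"
  shows "vinv K (kap n) = vide K (\<pi> n \<cdot> l)" "strict_mor K (p n)"
proof -
  have n: "n \<in> nodes G" by (rule N0_nodes[OF assms])
  have a: "dn n \<cdot> T1 (\<pi> n) \<in> arr K" using n by (simp add: tys calc)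
  then have "\<pi> n \<cdot> l = dn n \<cdot> T1 (\<pi> n)"
    using kap_typing(2)[OF n] by (simp add: kap_N0[OF assms] calc)
  then show "vinv K (kap n) = vide K (\<pi> n \<cdot> l)" by (simp add: kap_N0[OF assms] vinv_vide a)
  then show "strict_mor K (p n)" using n by (auto simp: strict_mor_def identity_cell_def tys calc)
qed

text \<open>For a morphism \<open>z\<close> into \<open>LA\<close>, the limit cone restricted along
  \<open>?y\<close> is straightened by its identities, and also by the whiskerings of
  \<open>ps_cell z\<close> with the projections. The latter are identities at initial objects
  because the composites there are strict, so uniqueness makes all of them identities, and then
  \<open>ps_cell z\<close> itself.\<close>

lemma detect: "jointly_detect_strictness K T i m LA N\<^sub>0 p"
  unfolding jointly_detect_strictness_def
proof (intro ballI impI)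
  fix z assume "z \<in> arr Alg" and z': "tgt Alg z = LA \<and> (\<forall>s \<in> N\<^sub>0. strict_mor K (p s \<cdot>\<^bsub>Alg\<^esub> z))"
  then have z: "z \<in> ps_mor K T i m" "ps_cod z = LA" "\<And>n. n \<in> N\<^sub>0 \<Longrightarrow> strict_mor K (ps_comp K T (p n) z)" by auto
  let ?A = "ps_dom z" let ?h = "ps_arr z" let ?E = "T0 (fst ?A)"
  note t = tys calc ps_typing(3-9)[OF z(1)] alg_typing(1-4)[OF ps_typing(1)[OF z(1)]] z(2)
  let ?x = "l \<cdot> T1 ?h" and ?y = "?h \<cdot> snd ?A"
  have x: "?x \<in> arr K" "tgt K ?x = L" "src K ?x = ?E" and y: "?y \<in> arr K" "tgt K ?y = L" "src K ?y = ?E"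
    by (simp_all add: t)
  note sx = UG.scone_precomp[OF limit_scone x(1,2), unfolded x(3)] and sy = UG.scone_precomp[OF limit_scone y(1,2), unfolded y(3)]
  have g: "gmor K UG (\<lambda>n. \<pi> n \<cdot> ?x) (\<lambda>e. \<pi>' e \<lhd> ?x) (\<lambda>n. \<pi> n \<cdot> ?y) (\<lambda>e. \<pi>' e \<lhd> ?y) (\<lambda>n. \<pi> n \<rhd> ps_cell z)"
    using UG.gmor_whisk[OF limit_precone, of "ps_cell z"] by (simp add: t)
  have inv: "invertible_cell K (\<pi> n \<rhd> ps_cell z)" if "n \<in> nodes UG" for n
    using that by (intro invertible_whisk_l) (simp_all add: t)
  \<comment> \<open>The projection at \<open>n\<close> is strict, so the structure cell of its
    composite with \<open>z\<close> is just this whiskering.\<close>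
  have 0: "\<pi> n \<rhd> ps_cell z = vide K (\<pi> n \<cdot> ?y)" if "n \<in> N\<^sub>0" for n
  proof -
    have n: "n \<in> nodes G" by (rule N0_nodes[OF that])
    have "ps_cell (ps_comp K T (p n) z) = \<pi> n \<rhd> ps_cell z"
      using n by (simp add: strict_p[OF that] t)
    then have "identity_cell K (\<pi> n \<rhd> ps_cell z)" using z(3)[OF that] by (simp add: strict_mor_def)
    then show ?thesis using identity_cell_iff'[of "\<pi> n \<rhd> ps_cell z"] n by (simp add: t)
  qed
  have iv: "invertible_cell K (vide K (\<pi> n \<cdot> ?y))" if "n \<in> nodes UG" for n
    using that by (intro invertible_vide) (simp add: t)
  note u = UG.straightening_unique[OF rect UG.scone_gcone[OF sy] UG.strict_invertible[OF sy] sx g inv 0 sy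
      UG.gmor_vide[OF UG.scone_precone[OF sy]] iv refl, simplified]
  have xy: "?x = ?y"
  proof (rule UG.glim_arr_eqI[OF lim x(1) y(1)])
    show "\<pi> n \<cdot> ?x = \<pi> n \<cdot> ?y" if "n \<in> nodes UG" for n using that by (intro u(2)) simp
    show "\<pi>' e \<lhd> ?x = \<pi>' e \<lhd> ?y" if "e \<in> edges UG" for e using that by (intro u(3)) simp
  qed (simp_all only: x y)
  have "ps_cell z = vide K ?y"
  proof (rule UG.glim_cell_eqI[OF lim])
    show "\<pi> n \<rhd> ps_cell z = \<pi> n \<rhd> vide K ?y" if "n \<in> nodes UG" for n
      using u(1)[of n] that by (simp add: t)
  qed (use xy in \<open>simp_all add: t\<close>)
  then show "strict_mor K z" using y(1) by (auto simp: strict_mor_def identity_cell_def)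
qed

end

section \<open>Limits up to isomorphism, and preservation by the forgetful 2-functor\<close>

context diagram
begin

lemma glim_cong:
  assumes lim: "glim B G L \<pi> \<pi>'"
    and eq: "\<And>n. n \<in> nodes G \<Longrightarrow> \<pi> n = \<rho> n" "\<And>e. e \<in> edges G \<Longrightarrow> \<pi>' e = \<rho>' e"
  shows "glim B G L \<rho> \<rho>'"
proof -
  have g: "gmor B G (\<lambda>n. \<rho> n \<cdot> h) (\<lambda>e. \<rho>' e \<lhd> h) (\<lambda>n. \<rho> n \<cdot> k) (\<lambda>e. \<rho>' e \<lhd> k) \<alpha>
    \<longleftrightarrow> gmor B G (\<lambda>n. \<pi> n \<cdot> h) (\<lambda>e. \<pi>' e \<lhd> h) (\<lambda>n. \<pi> n \<cdot> k) (\<lambda>e. \<pi>' e \<lhd> k) \<alpha>" for h k \<alpha>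
    by (auto simp: gmor_def eq edge_typing)
  show ?thesis
    using lim scone_cong[OF glim_scone[OF lim] eq] unfolding glim_def g
    by (simp add: eq[symmetric] cong: ball_cong)
qed

text \<open>Composition with \<open>h\<close> is bijective on arrows and 2-cells into the vertex,
  with inverse composition with \<open>k\<close>; each clause of the universal property is moved
  along this bijection.\<close>

lemma glim_iso:
  assumes lim: "glim B G L \<pi> \<pi>'"
    and h: "h \<in> arr B" "src B h = M" "tgt B h = L" and k: "k \<in> arr B" "src B k = L" "tgt B k = M"
    and hk: "h \<cdot> k = ide B L" "k \<cdot> h = ide B M"
  shows "glim B G M (\<lambda>n. \<pi> n \<cdot> h) (\<lambda>e. \<pi>' e \<lhd> h)"
proof -
  note s = glim_scone[OF lim]
  note t = precone_typing[OF scone_precone[OF s]] h k edge_typing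
  have M: "M \<in> obj B" using src_obj[OF h(1)] h(2) by simp
  have hk': "h \<cdot> (k \<cdot> f) = f" if "f \<in> arr B" "tgt B f = L" for f
    using comp_assoc[of f k h] that h k hk(1) by (simp add: ide_cancel)
  have kh': "k \<cdot> (h \<cdot> f) = f" if "f \<in> arr B" "tgt B f = M" for f
    using comp_assoc[of f h k] that h k hk(2) by (simp add: ide_cancel)
  have kh2: "k \<rhd> (h \<rhd> \<beta>) = \<beta>" if "\<beta> \<in> cell B" "tgt B (vsrc B \<beta>) = M" for \<beta>
    using that h k hk(2) by (simp add: calc)
  have pa: "(\<pi> n \<cdot> h) \<cdot> f = \<pi> n \<cdot> (h \<cdot> f)" if "f \<in> arr B" "tgt B f = M" "n \<in> nodes G" for f n
    using that by (simp add: t calc)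
  have pe: "(\<pi>' e \<lhd> h) \<lhd> f = \<pi>' e \<lhd> (h \<cdot> f)" if "f \<in> arr B" "tgt B f = M" "e \<in> edges G" for f e
    using that by (simp add: t calc)
  show ?thesis
    unfolding glim_def
  proof (intro conjI allI ballI impI)
    show "scone B G M (\<lambda>n. \<pi> n \<cdot> h) (\<lambda>e. \<pi>' e \<lhd> h)"
      using scone_precomp[OF s h(1,3)] h(2) by simp
    show "\<exists>f \<in> hom B E M. (\<forall>n \<in> nodes G. (\<pi> n \<cdot> h) \<cdot> f = \<theta> n) \<and> (\<forall>e \<in> edges G. (\<pi>' e \<lhd> h) \<lhd> f = \<theta>' e)"
      if s': "scone B G E \<theta> \<theta>'" for E \<theta> \<theta>'
    proof -
      obtain f where f: "f \<in> arr B" "src B f = E" "tgt B f = L" "\<And>n. n \<in> nodes G \<Longrightarrow> \<pi> n \<cdot> f = \<theta> n"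
        "\<And>e. e \<in> edges G \<Longrightarrow> \<pi>' e \<lhd> f = \<theta>' e"
        by (rule glim_obtain_arr[OF lim s']) (rule that)
      then show ?thesis
        by (intro bexI[of _ "k \<cdot> f"]) (simp_all add: hom_iff pa pe hk' calc(1-3) k)
    qed
    fix E f g assume "f \<in> hom B E M" "g \<in> hom B E M"
    then have fg: "f \<in> arr B" "src B f = E" "tgt B f = M" "g \<in> arr B" "src B g = E" "tgt B g = M"
      by (simp_all add: hom_iff)
    show "f = g" if "(\<forall>n \<in> nodes G. (\<pi> n \<cdot> h) \<cdot> f = (\<pi> n \<cdot> h) \<cdot> g) \<and> (\<forall>e \<in> edges G. (\<pi>' e \<lhd> h) \<lhd> f = (\<pi>' e \<lhd> h) \<lhd> g)"
    proof -
      have "h \<cdot> f = h \<cdot> g"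
        by (rule glim_arr_eqI[OF lim]) (use that in \<open>simp_all add: fg pa pe h calc(1-3)\<close>)
      then show ?thesis using kh'[of f] kh'[of g] fg by metis
    qed
    show "\<exists>\<beta> \<in> cells B f g. \<forall>n \<in> nodes G. (\<pi> n \<cdot> h) \<rhd> \<beta> = \<alpha> n"
      if "gmor B G (\<lambda>n. (\<pi> n \<cdot> h) \<cdot> f) (\<lambda>e. (\<pi>' e \<lhd> h) \<lhd> f) (\<lambda>n. (\<pi> n \<cdot> h) \<cdot> g) (\<lambda>e. (\<pi>' e \<lhd> h) \<lhd> g) \<alpha>" for \<alpha>
    proof -
      have g: "gmor B G (\<lambda>n. \<pi> n \<cdot> (h \<cdot> f)) (\<lambda>e. \<pi>' e \<lhd> (h \<cdot> f)) (\<lambda>n. \<pi> n \<cdot> (h \<cdot> g)) (\<lambda>e. \<pi>' e \<lhd> (h \<cdot> g)) \<alpha>"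
        by (rule gmor_cong[OF that]) (simp_all add: fg pa pe)
      obtain \<beta> where b: "\<beta> \<in> cell B" "vsrc B \<beta> = h \<cdot> f" "vtgt B \<beta> = h \<cdot> g" "\<And>n. n \<in> nodes G \<Longrightarrow> \<pi> n \<rhd> \<beta> = \<alpha> n"
        by (rule glim_obtain_cell[OF lim _ _ _ _ _ g]) (simp_all add: fg h calc(1-3))
      have "(\<pi> n \<cdot> h) \<rhd> (k \<rhd> \<beta>) = \<alpha> n" if "n \<in> nodes G" for n
        using that b hk(1) fg by (simp add: t calc)
      then show ?thesis
        by (intro bexI[of _ "k \<rhd> \<beta>"]) (simp_all add: cells_iff b fg k h calc(1-15) kh')
    qed
    fix \<beta> \<gamma> assume "\<beta> \<in> cells B f g" "\<gamma> \<in> cells B f g"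
    then have bg: "\<beta> \<in> cell B" "vsrc B \<beta> = f" "vtgt B \<beta> = g" "\<gamma> \<in> cell B" "vsrc B \<gamma> = f" "vtgt B \<gamma> = g"
      by (simp_all add: cells_iff)
    assume eq: "\<forall>n \<in> nodes G. (\<pi> n \<cdot> h) \<rhd> \<beta> = (\<pi> n \<cdot> h) \<rhd> \<gamma>"
    have "h \<rhd> \<beta> = h \<rhd> \<gamma>"
      by (rule glim_cell_eqI[OF lim]) (use eq in \<open>simp_all add: bg fg t calc\<close>)
    then show "\<beta> = \<gamma>" using kh2[of \<beta>] kh2[of \<gamma>] bg fg by metis
  qed (rule M)
qed

lemma glim_comparison:
  assumes lim: "glim B G L \<pi> \<pi>'" and lim': "glim B G M \<rho> \<rho>'"
  obtains h k where "h \<in> arr B" "src B h = M" "tgt B h = L" "k \<in> arr B" "src B k = L" "tgt B k = M"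
    "h \<cdot> k = ide B L" "k \<cdot> h = ide B M" "\<And>n. n \<in> nodes G \<Longrightarrow> \<pi> n \<cdot> h = \<rho> n" "\<And>e. e \<in> edges G \<Longrightarrow> \<pi>' e \<lhd> h = \<rho>' e"
proof -
  note t = precone_typing[OF scone_precone[OF glim_scone[OF lim]]] precone_typing[OF scone_precone[OF glim_scone[OF lim']]] edge_typing
  obtain h where h: "h \<in> arr B" "src B h = M" "tgt B h = L" "\<And>n. n \<in> nodes G \<Longrightarrow> \<pi> n \<cdot> h = \<rho> n"
    "\<And>e. e \<in> edges G \<Longrightarrow> \<pi>' e \<lhd> h = \<rho>' e"
    by (rule glim_obtain_arr[OF lim glim_scone[OF lim']]) (rule that)
  obtain k where k: "k \<in> arr B" "src B k = L" "tgt B k = M" "\<And>n. n \<in> nodes G \<Longrightarrow> \<rho> n \<cdot> k = \<pi> n"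
    "\<And>e. e \<in> edges G \<Longrightarrow> \<rho>' e \<lhd> k = \<pi>' e"
    by (rule glim_obtain_arr[OF lim' glim_scone[OF lim]]) (rule that)
  have 1: "h \<cdot> k = ide B L"
  proof (rule glim_arr_eqI[OF lim])
    show "\<pi> n \<cdot> h \<cdot> k = \<pi> n \<cdot> ide B L" if "n \<in> nodes G" for n
      using comp_assoc[of k h "\<pi> n"] that h(1-3) k(1-3) by (simp add: h(4) k(4) t calc)
    show "\<pi>' e \<lhd> (h \<cdot> k) = \<pi>' e \<lhd> ide B L" if "e \<in> edges G" for e
      using whisk_r_comp[of "\<pi>' e" h k] that h(1-3) k(1-3) by (simp add: h(5) k(5) t calc)
  qed (simp_all add: h k t calc(1-6))
  have 2: "k \<cdot> h = ide B M"
  proof (rule glim_arr_eqI[OF lim'])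
    show "\<rho> n \<cdot> k \<cdot> h = \<rho> n \<cdot> ide B M" if "n \<in> nodes G" for n
      using comp_assoc[of h k "\<rho> n"] that h(1-3) k(1-3) by (simp add: h(4) k(4) t calc)
    show "\<rho>' e \<lhd> (k \<cdot> h) = \<rho>' e \<lhd> ide B M" if "e \<in> edges G" for e
      using whisk_r_comp[of "\<rho>' e" k h] that h(1-3) k(1-3) by (simp add: h(5) k(5) t calc)
  qed (simp_all add: h k t calc(1-6))
  show ?thesis by (rule that[OF h(1-3) k(1-3) 1 2 h(4,5)])
qed

end

context alg_diagram
begin

text \<open>Preservation concerns an arbitrary limit of algebras, not just the lifted one. The two
  are isomorphic compatibly with their cones, the isomorphism has an underlying isomorphism in
  \<open>K\<close>, and the lifted limit lies over the given one, so \<open>glim_iso\<close>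
  applies.\<close>

lemma creation:
  assumes rect: "rectifiable K UG N\<^sub>0" and lim: "glim K UG L \<pi> \<pi>'"
  shows "\<exists>L' p p'. glim Alg G L' p p' \<and> fst L' = L \<and> (\<forall>n \<in> nodes G. ps_arr (p n) = \<pi> n) \<and>
      (\<forall>e \<in> edges G. ac_cell (p' e) = \<pi>' e) \<and> (\<forall>n \<in> N\<^sub>0. strict_mor K (p n)) \<and>
      jointly_detect_strictness K T i m L' N\<^sub>0 p"
    "glim Alg G M \<rho> \<rho>' \<Longrightarrow> glim K UG (fst M) (\<lambda>n. ps_arr (\<rho> n)) (\<lambda>e. ac_cell (\<rho>' e))"
proof -
  interpret lifted_limit K T i m G N\<^sub>0 L \<pi> \<pi>'
    by unfold_locales (rule rect, rule lim)
  show "\<exists>L' p p'. glim Alg G L' p p' \<and> fst L' = L \<and> (\<forall>n \<in> nodes G. ps_arr (p n) = \<pi> n) \<and>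
      (\<forall>e \<in> edges G. ac_cell (p' e) = \<pi>' e) \<and> (\<forall>n \<in> N\<^sub>0. strict_mor K (p n)) \<and>
      jointly_detect_strictness K T i m L' N\<^sub>0 p"
    using lifted_glim strict_p detect by (intro exI[of _ LA] exI[of _ p] exI[of _ p']) auto
  assume M: "glim Alg G M \<rho> \<rho>'"
  obtain h k where h: "h \<in> ps_mor K T i m" "ps_dom h = M" "ps_cod h = LA"
    and k: "k \<in> ps_mor K T i m" "ps_dom k = LA" "ps_cod k = M"
    and hk: "ps_comp K T h k = ide Alg LA" "ps_comp K T k h = ide Alg M"
    and eq: "\<And>n. n \<in> nodes G \<Longrightarrow> ps_comp K T (p n) h = \<rho> n"
      "\<And>e. e \<in> edges G \<Longrightarrow> hcomp Alg (p' e) (vide Alg h) = \<rho>' e"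
    using TA.glim_comparison[OF lifted_glim M] by (simp del: TAlg_simps(9,11)) metis
  have "ps_arr h \<cdot> ps_arr k = ide K L" "ps_arr k \<cdot> ps_arr h = ide K (fst M)"
    using arg_cong[OF hk(1), of ps_arr] arg_cong[OF hk(2), of ps_arr] by (simp_all add: TAlg_def split: prod.splits)
  then have "glim K UG (fst M) (\<lambda>n. \<pi> n \<cdot> ps_arr h) (\<lambda>e. \<pi>' e \<lhd> ps_arr h)"
    using ps_typing(3-5)[OF h(1)] ps_typing(3-5)[OF k(1)] h k by (intro UG.glim_iso[OF lim, where k = "ps_arr k"]) simp_all
  then show "glim K UG (fst M) (\<lambda>n. ps_arr (\<rho> n)) (\<lambda>e. ac_cell (\<rho>' e))"
    by (rule UG.glim_cong) (simp_all add: eq[symmetric])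
qed

end

section \<open>Universal cones and isomorphisms of categories\<close>

text \<open>
  The cones and morphisms of cones of the three kinds of limit are extensional families in various shapes, of types
  \<open>'u\<close> and \<open>'v\<close>; \<open>N\<close>, \<open>D\<close> and \<open>V\<close> read them as families indexed by nodes and edges.
\<close>

locale cone_encoding = diagram B G for B :: "('o, 'a, 'c) cat2" (structure) and G :: "('n, 'e, 'o, 'a, 'c) diag" +
  fixes Y :: "'u \<Rightarrow> bool" and N :: "'u \<Rightarrow> 'n \<Rightarrow> 'a" and D :: "'u \<Rightarrow> 'e \<Rightarrow> 'c"
    and X :: "'v \<Rightarrow> bool" and V :: "'v \<Rightarrow> 'n \<Rightarrow> 'c" and idv :: "'u \<Rightarrow> 'v" and compv :: "'v \<Rightarrow> 'v \<Rightarrow> 'v"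
  assumes cone_surj: "scone B G E \<theta> \<theta>' \<Longrightarrow> \<exists>u. Y u \<and> (\<forall>n \<in> nodes G. N u n = \<theta> n) \<and> (\<forall>e \<in> edges G. D u e = \<theta>' e)"
    and cone_inj: "\<lbrakk>Y u; Y u'; \<And>n. n \<in> nodes G \<Longrightarrow> N u n = N u' n; \<And>e. e \<in> edges G \<Longrightarrow> D u e = D u' e\<rbrakk> \<Longrightarrow> u = u'"
    and mor_surj: "\<exists>v. X v \<and> (\<forall>n \<in> nodes G. V v n = \<alpha> n)"
    and mor_inj: "\<lbrakk>X v; X v'; \<And>n. n \<in> nodes G \<Longrightarrow> V v n = V v' n\<rbrakk> \<Longrightarrow> v = v'"
    and idv: "X (idv u)" "n \<in> nodes G \<Longrightarrow> V (idv u) n = vide B (N u n)"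
    and compv: "X (compv v' v)" "n \<in> nodes G \<Longrightarrow> V (compv v' v) n = V v' n \<bullet> V v n"
begin

text \<open>Laid out like \<open>cone_cat\<close> and \<open>cylinder_cat\<close>, so that these
  equal instances of it once their cones and morphisms have been translated.\<close>

definition cones :: "'o \<Rightarrow> ('u, 'u \<times> 'u \<times> 'v) cat" where
  "cones E = \<lparr>obj = {u. Y u \<and> scone B G E (N u) (D u)},
     arr = {(u, u', v). (Y u \<and> scone B G E (N u) (D u)) \<and> (Y u' \<and> scone B G E (N u') (D u')) \<and>
       X v \<and> gmor B G (N u) (D u) (N u') (D u') (V v)},
     src = (\<lambda>(u, u', v). u), tgt = (\<lambda>(u, u', v). u'), ide = (\<lambda>u. (u, u, idv u)),
     comp = (\<lambda>(_, u', v') (u, _, v). (u, u', compv v' v))\<rparr>"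

lemma cones_category: "category (cones E)"
proof (unfold_locales, goal_cases)
  case (3 u)
  then have "precone B G E (N u) (D u)" by (auto simp: cones_def scone_precone)
  then have "gmor B G (N u) (D u) (N u) (D u) (V (idv u))"
    by (rule gmor_cong[OF gmor_vide]) (simp_all add: idv)
  then show ?case using 3 by (auto simp: cones_def idv)
next
  case (4 f g)
  then obtain u1 u2 u3 v w where fg: "f = (u1, u2, v)" "g = (u2, u3, w)" by (auto simp: cones_def)
  with 4 have g: "gmor B G (N u1) (D u1) (N u2) (D u2) (V v)" "gmor B G (N u2) (D u2) (N u3) (D u3) (V w)"
    "precone B G E (N u1) (D u1)" "precone B G E (N u2) (D u2)" "precone B G E (N u3) (D u3)"
    by (auto simp: cones_def scone_precone)
  have "gmor B G (N u1) (D u1) (N u3) (D u3) (V (compv w v))"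
    by (rule gmor_cong[OF gmor_vcomp[OF g]]) (simp_all add: compv)
  then show ?case using 4 by (auto simp: cones_def compv fg)
next
  case (5 f)
  then obtain u1 u2 v where f: "f = (u1, u2, v)" and g: "gmor B G (N u1) (D u1) (N u2) (D u2) (V v)" "X v"
    by (auto simp: cones_def)
  have "compv v (idv u1) = v"
    by (rule mor_inj) (simp_all add: compv idv g gmor_typing[OF g(1)] vide_cancel)
  then show ?case by (simp add: cones_def f)
next
  case (6 f)
  then obtain u1 u2 v where f: "f = (u1, u2, v)" and g: "gmor B G (N u1) (D u1) (N u2) (D u2) (V v)" "X v"
    by (auto simp: cones_def)
  have "compv (idv u2) v = v"
    by (rule mor_inj) (simp_all add: compv idv g gmor_typing[OF g(1)] vide_cancel)
  then show ?case by (simp add: cones_def f)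
next
  case (7 f g h)
  then obtain u1 u2 u3 u4 v w x where f: "f = (u1, u2, v)" "g = (u2, u3, w)" "h = (u3, u4, x)"
    and g: "gmor B G (N u1) (D u1) (N u2) (D u2) (V v)" "gmor B G (N u2) (D u2) (N u3) (D u3) (V w)"
      "gmor B G (N u3) (D u3) (N u4) (D u4) (V x)"
    by (auto simp: cones_def)
  have "compv (compv x w) v = compv x (compv w v)"
    by (rule mor_inj)
      (simp_all add: compv gmor_typing[OF g(1)] gmor_typing[OF g(2)] gmor_typing[OF g(3)] vcomp_assoc)
  then show ?case by (simp add: cones_def f)
qed (auto simp: cones_def)

lemma hom_category: "category (hom_cat B E L)"
  by unfold_locales (auto simp: hom_cat_def hom_iff cells_iff calc vsrc_arr vtgt_arr)

text \<open>Bijectivity of the functor \<open>P\<close> on objects matches the two clauses of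
  \<open>glim\<close> on arrows, and bijectivity on arrows the two clauses on 2-cells. The
  hypotheses say that \<open>P\<close> is composition with the cone \<open>u\<close>, read through
  the encoding.\<close>

lemma iso_iff_glim:
  assumes u: "Y u" and L: "L \<in> obj B" "scone B G L (N u) (D u)"
    and pre: "\<And>h. Y (ob_map P h)"
      "\<And>h n. \<lbrakk>h \<in> arr B; tgt B h = L; n \<in> nodes G\<rbrakk> \<Longrightarrow> N (ob_map P h) n = N u n \<cdot> h"
      "\<And>h e. \<lbrakk>h \<in> arr B; tgt B h = L; e \<in> edges G\<rbrakk> \<Longrightarrow> D (ob_map P h) e = D u e \<lhd> h"
    and pre': "\<And>\<beta>. ar_map P \<beta> = (ob_map P (vsrc B \<beta>), ob_map P (vtgt B \<beta>), w \<beta>)"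
      "\<And>\<beta>. X (w \<beta>)" "\<And>\<beta> n. n \<in> nodes G \<Longrightarrow> V (w \<beta>) n = N u n \<rhd> \<beta>"
  shows "(\<forall>E \<in> obj B. iso_of_categories (hom_cat B E L) (cones E) P) \<longleftrightarrow> glim B G L (N u) (D u)"
proof
  note t = precone_typing[OF scone_precone[OF L(2)]] edge_typing
  have gm: "gmor B G (N (ob_map P h)) (D (ob_map P h)) (N (ob_map P k)) (D (ob_map P k)) \<alpha> \<longleftrightarrow>
    gmor B G (\<lambda>n. N u n \<cdot> h) (\<lambda>e. D u e \<lhd> h) (\<lambda>n. N u n \<cdot> k) (\<lambda>e. D u e \<lhd> k) \<alpha>"
    if "h \<in> arr B" "tgt B h = L" "k \<in> arr B" "tgt B k = L" for h k \<alpha>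
    using that by (auto simp: gmor_def pre edge_typing)
  have sc: "scone B G (src B h) (N (ob_map P h)) (D (ob_map P h))" if "h \<in> arr B" "tgt B h = L" for h
    using that by (intro scone_cong[OF scone_precomp[OF L(2) that]]) (simp_all add: pre)
  {
    assume iso: "\<forall>E \<in> obj B. iso_of_categories (hom_cat B E L) (cones E) P"
    have bij: "bij_betw (ob_map P) (hom B E L) {u. Y u \<and> scone B G E (N u) (D u)}"
      "bij_betw (ar_map P) {\<alpha> \<in> cell B. vsrc B \<alpha> \<in> hom B E L} (arr (cones E))" if "E \<in> obj B" for E
      using iso that unfolding iso_of_categories_def by (auto simp: hom_cat_def cones_def)
    show "glim B G L (N u) (D u)"
      unfolding glim_def
    proof (intro conjI allI impI ballI)
      show "\<exists>h \<in> hom B E L. (\<forall>n \<in> nodes G. N u n \<cdot> h = \<theta> n) \<and> (\<forall>e \<in> edges G. D u e \<lhd> h = \<theta>' e)"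
        if s: "scone B G E \<theta> \<theta>'" for E \<theta> \<theta>'
      proof -
        obtain v where v: "Y v" "\<forall>n \<in> nodes G. N v n = \<theta> n" "\<forall>e \<in> edges G. D v e = \<theta>' e"
          using cone_surj[OF s] by blast
        then have "scone B G E (N v) (D v)" by (intro scone_cong[OF s]) auto
        moreover have "E \<in> obj B" using precone_typing(1)[OF scone_precone[OF s]] .
        ultimately obtain h where h: "h \<in> hom B E L" "v = ob_map P h"
          using v(1) bij(1)[of E] unfolding bij_betw_def by blast
        then show ?thesis using v(2,3) pre(2,3)[of h] by (intro bexI[of _ h]) (auto simp: hom_iff)
      qed
      fix E h k assume hk: "h \<in> hom B E L" "k \<in> hom B E L"
      then have E: "E \<in> obj B" and hk': "h \<in> arr B" "src B h = E" "tgt B h = L" "k \<in> arr B" "src B k = E" "tgt B k = L"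
        using src_obj[of h] by (auto simp: hom_iff)
      show "h = k" if "(\<forall>n \<in> nodes G. N u n \<cdot> h = N u n \<cdot> k) \<and> (\<forall>e \<in> edges G. D u e \<lhd> h = D u e \<lhd> k)"
      proof -
        have "ob_map P h = ob_map P k"
          by (rule cone_inj) (use that hk' in \<open>simp_all add: pre\<close>)
        then show ?thesis by (rule inj_onD[OF bij_betw_imp_inj_on[OF bij(1)[OF E]]]) (rule hk)+
      qed
      show "\<exists>\<beta> \<in> cells B h k. \<forall>n \<in> nodes G. N u n \<rhd> \<beta> = \<alpha> n"
        if a: "gmor B G (\<lambda>n. N u n \<cdot> h) (\<lambda>e. D u e \<lhd> h) (\<lambda>n. N u n \<cdot> k) (\<lambda>e. D u e \<lhd> k) \<alpha>" for \<alpha>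
      proof -
        obtain v where v: "X v" "\<forall>n \<in> nodes G. V v n = \<alpha> n" using mor_surj by blast
        have "gmor B G (N (ob_map P h)) (D (ob_map P h)) (N (ob_map P k)) (D (ob_map P k)) \<alpha>"
          using a hk' by (simp add: gm)
        then have "gmor B G (N (ob_map P h)) (D (ob_map P h)) (N (ob_map P k)) (D (ob_map P k)) (V v)"
          by (rule gmor_cong) (use v in auto)
        \<comment> \<open>Surjectivity on arrows yields a preimage of this triple; injectivity on
          objects then shows that the preimage runs from \<open>h\<close> to
          \<open>k\<close>.\<close>
        then have "(ob_map P h, ob_map P k, v) \<in> arr (cones E)"
          using sc[of h] sc[of k] hk' v(1) by (simp add: cones_def pre(1))
        then have "(ob_map P h, ob_map P k, v) \<in> ar_map P ` {\<alpha> \<in> cell B. vsrc B \<alpha> \<in> hom B E L}"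
          by (simp only: bij_betw_imp_surj_on[OF bij(2)[OF E]])
        then obtain \<beta> where b: "\<beta> \<in> cell B" "vsrc B \<beta> \<in> hom B E L" "ar_map P \<beta> = (ob_map P h, ob_map P k, v)"
          by auto
        have "vtgt B \<beta> \<in> hom B E L" using b cell_parallel_typing[of \<beta>] by (simp add: hom_iff vtgt_arr)
        moreover have eqs: "ob_map P (vsrc B \<beta>) = ob_map P h" "ob_map P (vtgt B \<beta>) = ob_map P k" "w \<beta> = v"
          using b(3) by (simp_all add: pre'(1))
        ultimately have "vsrc B \<beta> = h" "vtgt B \<beta> = k"
          using b(2) hk inj_onD[OF bij_betw_imp_inj_on[OF bij(1)[OF E]]] by blast+
        moreover have "N u n \<rhd> \<beta> = \<alpha> n" if "n \<in> nodes G" for n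
          using pre'(3)[OF that, of \<beta>] eqs(3) v(2) that by simp
        ultimately show ?thesis using b by (intro bexI[of _ \<beta>]) (auto simp: cells_iff)
      qed
      fix \<beta> \<gamma> assume bc: "\<beta> \<in> cells B h k" "\<gamma> \<in> cells B h k" "\<forall>n \<in> nodes G. N u n \<rhd> \<beta> = N u n \<rhd> \<gamma>"
      have "w \<beta> = w \<gamma>" by (rule mor_inj) (use bc in \<open>simp_all add: pre'\<close>)
      then have "ar_map P \<beta> = ar_map P \<gamma>" using bc by (simp add: pre'(1) cells_iff)
      then show "\<beta> = \<gamma>"
        by (rule inj_onD[OF bij_betw_imp_inj_on[OF bij(2)[OF E]]]) (use bc hk in \<open>auto simp: cells_iff\<close>)
    qed (use L in auto)
  }
  assume lim: "glim B G L (N u) (D u)"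
  show "\<forall>E \<in> obj B. iso_of_categories (hom_cat B E L) (cones E) P"
  proof
    fix E assume E: "E \<in> obj B"
    have arr_P: "ar_map P \<beta> \<in> arr (cones E)" if b: "\<beta> \<in> cell B" "vsrc B \<beta> \<in> hom B E L" for \<beta>
    proof -
      have st: "vsrc B \<beta> \<in> arr B" "vtgt B \<beta> \<in> arr B" "src B (vsrc B \<beta>) = E" "src B (vtgt B \<beta>) = E"
        "tgt B (vsrc B \<beta>) = L" "tgt B (vtgt B \<beta>) = L"
        using b cell_parallel_typing[of \<beta>] by (simp_all add: hom_iff vtgt_arr)
      have "gmor B G (N (ob_map P (vsrc B \<beta>))) (D (ob_map P (vsrc B \<beta>))) (N (ob_map P (vtgt B \<beta>))) (D (ob_map P (vtgt B \<beta>))) (V (w \<beta>))"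
        by (rule gmor_cong[OF gmor_whisk[OF scone_precone[OF L(2)] b(1) st(5)]]) (simp_all add: pre pre'(2,3) st)
      then show ?thesis using sc[of "vsrc B \<beta>"] sc[of "vtgt B \<beta>"] st by (simp add: cones_def pre pre')
    qed
    have fun_P: "cat_functor (hom_cat B E L) (cones E) P"
    proof (intro cat_functor.intro hom_category cones_category cat_functor_axioms.intro, goal_cases)
      case (1 h)
      then show ?case using sc[of h] by (auto simp: hom_cat_def cones_def hom_iff pre)
    next
      case (2 \<beta>)
      then show ?case using arr_P[of \<beta>] by (auto simp: hom_cat_def hom_iff pre') (auto simp: cones_def)
    next
      case (3 h)
      then have "w (vide B h) = idv (ob_map P h)"
        by (intro mor_inj) (auto simp: pre pre' idv hom_cat_def hom_iff t hcomp_vide)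
      then show ?case using 3 by (simp add: hom_cat_def cones_def pre' hom_iff vide_typing)
    next
      case (4 \<beta> \<gamma>)
      then have "w (\<gamma> \<bullet> \<beta>) = compv (w \<gamma>) (w \<beta>)"
        by (intro mor_inj) (auto simp: pre' compv hom_cat_def hom_iff t whisk_l_vcomp)
      then show ?case using 4 by (simp add: hom_cat_def cones_def pre' vcomp_typing)
    qed
    have bij_ob: "bij_betw (ob_map P) (obj (hom_cat B E L)) (obj (cones E))"
      unfolding bij_betw_def
    proof
      show "inj_on (ob_map P) (obj (hom_cat B E L))"
      proof (rule inj_onI)
        fix h k assume "h \<in> obj (hom_cat B E L)" "k \<in> obj (hom_cat B E L)" and eq: "ob_map P h = ob_map P k"
        then have hk: "h \<in> arr B" "src B h = E" "tgt B h = L" "k \<in> arr B" "src B k = E" "tgt B k = L"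
          by (auto simp: hom_cat_def hom_iff)
        show "h = k"
          by (rule glim_arr_eqI[OF lim]) (use hk eq pre(2,3)[of h] pre(2,3)[of k] in simp_all)
      qed
      show "ob_map P ` obj (hom_cat B E L) = obj (cones E)"
      proof (intro equalityI subsetI)
        fix v assume "v \<in> ob_map P ` obj (hom_cat B E L)"
        then show "v \<in> obj (cones E)" using cat_functor.ob_map_obj[OF fun_P] by auto
      next
        fix v assume "v \<in> obj (cones E)"
        then have v: "Y v" "scone B G E (N v) (D v)" by (auto simp: cones_def)
        obtain h where h: "h \<in> arr B" "src B h = E" "tgt B h = L" "\<And>n. n \<in> nodes G \<Longrightarrow> N u n \<cdot> h = N v n"
          "\<And>e. e \<in> edges G \<Longrightarrow> D u e \<lhd> h = D v e"
          by (rule glim_obtain_arr[OF lim v(2)]) (rule that)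
        have "v = ob_map P h" by (rule cone_inj) (use v h in \<open>simp_all add: pre\<close>)
        then show "v \<in> ob_map P ` obj (hom_cat B E L)" using h by (auto simp: hom_cat_def hom_iff)
      qed
    qed
    have bij_ar: "bij_betw (ar_map P) (arr (hom_cat B E L)) (arr (cones E))"
      unfolding bij_betw_def
    proof
      show "inj_on (ar_map P) (arr (hom_cat B E L))"
      proof (rule inj_onI)
        fix \<beta> \<gamma> assume "\<beta> \<in> arr (hom_cat B E L)" "\<gamma> \<in> arr (hom_cat B E L)" and eq: "ar_map P \<beta> = ar_map P \<gamma>"
        then have bc: "\<beta> \<in> cell B" "\<gamma> \<in> cell B" "vsrc B \<beta> \<in> hom B E L" "vsrc B \<gamma> \<in> hom B E L"
          by (auto simp: hom_cat_def)
        have tg: "vtgt B \<beta> \<in> hom B E L" "vtgt B \<gamma> \<in> hom B E L"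
          using bc cell_parallel_typing[of \<beta>] cell_parallel_typing[of \<gamma>] by (simp_all add: hom_iff vtgt_arr)
        have "ob_map P (vsrc B \<beta>) = ob_map P (vsrc B \<gamma>)" "ob_map P (vtgt B \<beta>) = ob_map P (vtgt B \<gamma>)" "w \<beta> = w \<gamma>"
          using eq by (simp_all add: pre'(1))
        then have e: "vsrc B \<beta> = vsrc B \<gamma>" "vtgt B \<beta> = vtgt B \<gamma>" "w \<beta> = w \<gamma>"
          using bc tg inj_onD[OF bij_betw_imp_inj_on[OF bij_ob]] by (auto simp: hom_cat_def)
        show "\<beta> = \<gamma>"
        proof (rule glim_cell_eqI[OF lim bc(1,2) e(1,2)])
          show "N u n \<rhd> \<beta> = N u n \<rhd> \<gamma>" if "n \<in> nodes G" for n
            using pre'(3)[OF that, of \<beta>] pre'(3)[OF that, of \<gamma>] e(3) by simp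
        qed (use bc in \<open>simp add: hom_iff\<close>)
      qed
      show "ar_map P ` arr (hom_cat B E L) = arr (cones E)"
      proof (intro equalityI subsetI)
        fix v assume "v \<in> ar_map P ` arr (hom_cat B E L)"
        then show "v \<in> arr (cones E)" using arr_P by (auto simp: hom_cat_def)
      next
        fix x assume x: "x \<in> arr (cones E)"
        then obtain v1 v2 v where v: "x = (v1, v2, v)" "v1 \<in> obj (cones E)" "v2 \<in> obj (cones E)" "X v"
          "gmor B G (N v1) (D v1) (N v2) (D v2) (V v)" by (auto simp: cones_def)
        obtain h k where hk: "h \<in> hom B E L" "v1 = ob_map P h" "k \<in> hom B E L" "v2 = ob_map P k"
          using v(2,3) unfolding bij_betw_imp_surj_on[OF bij_ob, symmetric] by (auto simp: hom_cat_def)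
        have hk': "h \<in> arr B" "src B h = E" "tgt B h = L" "k \<in> arr B" "src B k = E" "tgt B k = L"
          using hk by (auto simp: hom_iff)
        have g: "gmor B G (\<lambda>n. N u n \<cdot> h) (\<lambda>e. D u e \<lhd> h) (\<lambda>n. N u n \<cdot> k) (\<lambda>e. D u e \<lhd> k) (V v)"
          using v(5) hk' unfolding hk(2,4) by (simp add: gm)
        obtain \<beta> where b: "\<beta> \<in> cell B" "vsrc B \<beta> = h" "vtgt B \<beta> = k" "\<And>n. n \<in> nodes G \<Longrightarrow> N u n \<rhd> \<beta> = V v n"
          by (rule glim_obtain_cell[OF lim _ _ _ _ _ g]) (simp_all add: hk')
        have "w \<beta> = v" by (rule mor_inj) (use v b in \<open>simp_all add: pre'\<close>)
        then have "x = ar_map P \<beta>" by (simp add: pre' v hk b)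
        then show "x \<in> ar_map P ` arr (hom_cat B E L)" using b hk by (auto simp: hom_cat_def)
      qed
    qed
    show "iso_of_categories (hom_cat B E L) (cones E) P"
      unfolding iso_of_categories_def using fun_P bij_ob bij_ar by blast
  qed
qed

end

section \<open>PIE indexing\<close>

lemma connected_refl: "x \<in> obj C \<Longrightarrow> connected C x x"
  by (simp add: connected_def)

lemma connected_sym: "connected C x y \<Longrightarrow> connected C y x"
proof -
  let ?R = "\<lambda>u v. hom C u v \<noteq> {} \<or> hom C v u \<noteq> {}"
  assume "connected C x y"
  moreover have "?R\<^sup>*\<^sup>* y x" if "?R\<^sup>*\<^sup>* x y"
    using that
  proof (induction rule: rtranclp_induct)
    case (step y z)
    then have "?R z y" by auto
    then show ?case using step.IH by (rule converse_rtranclp_into_rtranclp)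
  qed simp
  ultimately show ?thesis by (simp add: connected_def)
qed

lemma connected_trans: "\<lbrakk>connected C x y; connected C y z\<rbrakk> \<Longrightarrow> connected C x z"
  by (auto simp: connected_def)

lemma (in category) connected_arr: "f \<in> arr C \<Longrightarrow> connected C (src C f) (tgt C f)"
  by (auto simp: connected_def src_obj tgt_obj hom_def intro!: r_into_rtranclp)

text \<open>Needed for creation, whose statement mentions no choice of initial objects although the
  lifting argument depends on one.\<close>

lemma initial_choice_exists:
  assumes "components_have_initial C"
  shows "\<exists>I\<^sub>0. initial_choice C I\<^sub>0"
proof -
  define r where "r x = (SOME y. connected C x y \<and> initial_in_component C y)" for x
  have r: "connected C x (r x) \<and> initial_in_component C (r x)" if "x \<in> obj C" for x
    unfolding r_def by (rule someI_ex) (use assms that in \<open>auto simp: components_have_initial_def\<close>)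
  \<comment> \<open>Objects of one component are connected to the same objects, so the predicates
    under \<open>SOME\<close> coincide and the chosen object depends on the component only.\<close>
  have same: "r x = r y" if "connected C x y" for x y
  proof -
    have "connected C x w \<longleftrightarrow> connected C y w" for w
      using that connected_sym[of C x y] connected_trans[of C x y w] connected_trans[of C y x w] by blast
    then show ?thesis by (simp add: r_def)
  qed
  have "initial_choice C (r ` obj C)"
    unfolding initial_choice_def
  proof (intro conjI ballI)
    fix x assume x: "x \<in> obj C"
    show "\<exists>!x\<^sub>0. x\<^sub>0 \<in> r ` obj C \<and> connected C x x\<^sub>0"
    proof (rule ex1I[of _ "r x"])
      fix y assume "y \<in> r ` obj C \<and> connected C x y"
      then obtain w where w: "w \<in> obj C" "y = r w" "connected C x (r w)" by auto
      then have "connected C x w" using r[OF w(1)] connected_sym connected_trans by metis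
      then show "y = r x" using same w by metis
    qed (use r x in auto)
  qed (use r in auto)
  then show ?thesis by blast
qed

text \<open>Here \<open>r x\<close> is the chosen object of the component of \<open>x\<close> and
  \<open>z x\<close> the unique arrow from it. As \<open>r\<close> is constant on components,
  initiality gives both the equation for composites and \<open>z x = ide C x\<close> at the chosen
  objects. These arrows provide the edges along which cones are straightened.\<close>

lemma (in category) initial_choice_arrows:
  assumes "initial_choice C I\<^sub>0"
  obtains r z where "\<And>x. x \<in> obj C \<Longrightarrow> r x \<in> I\<^sub>0 \<and> z x \<in> hom C (r x) x"
    "\<And>f. f \<in> arr C \<Longrightarrow> f \<cdot> z (src C f) = z (tgt C f)"
    "\<And>x. x \<in> I\<^sub>0 \<Longrightarrow> x \<in> obj C \<and> z x = ide C x"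
proof -
  have I0: "x \<in> obj C" "\<And>y. connected C x y \<Longrightarrow> \<exists>!f. f \<in> hom C x y" if "x \<in> I\<^sub>0" for x
    using assms that by (auto simp: initial_choice_def initial_in_component_def)
  have uniq: "\<exists>!x\<^sub>0. x\<^sub>0 \<in> I\<^sub>0 \<and> connected C x x\<^sub>0" if "x \<in> obj C" for x
    using assms that by (auto simp: initial_choice_def)
  define r where "r x = (THE x\<^sub>0. x\<^sub>0 \<in> I\<^sub>0 \<and> connected C x x\<^sub>0)" for x
  have r: "r x \<in> I\<^sub>0 \<and> connected C x (r x)" if "x \<in> obj C" for x
    unfolding r_def by (rule theI'[OF uniq[OF that]])
  have r_eq: "r x = x\<^sub>0" if "x \<in> obj C" "x\<^sub>0 \<in> I\<^sub>0" "connected C x x\<^sub>0" for x x\<^sub>0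
    using uniq[OF that(1)] r[OF that(1)] that(2,3) by blast
  define z where "z x = (THE f. f \<in> hom C (r x) x)" for x
  have ex: "\<exists>!f. f \<in> hom C (r x) x" if "x \<in> obj C" for x
    using r[OF that] I0 connected_sym by metis
  have z: "z x \<in> hom C (r x) x" if "x \<in> obj C" for x
    unfolding z_def by (rule theI'[OF ex[OF that]])
  have z_eq: "z x = f" if "f \<in> hom C (r x) x" "x \<in> obj C" for f x
    using ex[OF that(2)] z[OF that(2)] that(1) by blast
  have "f \<cdot> z (src C f) = z (tgt C f)" if f: "f \<in> arr C" for f
  proof -
    have o: "src C f \<in> obj C" "tgt C f \<in> obj C" using f src_obj tgt_obj by auto
    have "r (tgt C f) = r (src C f)"
      using r_eq[OF o(2)] r[OF o(1)] connected_arr[OF f] connected_sym connected_trans by metis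
    then have "f \<cdot> z (src C f) \<in> hom C (r (tgt C f)) (tgt C f)"
      using z[OF o(1)] f comp_arr[of "z (src C f)" f] by (simp add: hom_iff)
    then show ?thesis using z_eq o(2) by metis
  qed
  moreover have "x \<in> obj C \<and> z x = ide C x" if x: "x \<in> I\<^sub>0" for x
  proof -
    have "r x = x" using r_eq[OF I0(1)[OF x] x connected_refl] I0(1)[OF x] by metis
    then have "ide C x \<in> hom C (r x) x" using ide_arr I0(1)[OF x] by (simp add: hom_iff)
    then show ?thesis using z_eq I0(1)[OF x] by metis
  qed
  ultimately show ?thesis using r z by (intro that[of r z]) auto
qed

text \<open>Carries \<open>creation\<close> over to limits encoded by concrete families, with
  \<open>mp\<close> for the action of the forgetful 2-functor on them. Injectivity of the encoding
  in \<open>K\<close> upgrades agreement at nodes and edges to \<open>mp u = v\<close>, so the given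
  cone is lifted on the nose.\<close>

lemma (in alg_diagram) transfer:
  fixes limB :: "'o \<times> 'a \<Rightarrow> 'u \<Rightarrow> bool" and limC :: "'o \<Rightarrow> 'v \<Rightarrow> bool"
  assumes rect: "rectifiable K UG N\<^sub>0"
    and limB: "\<And>L u. limB L u \<longleftrightarrow> YB u \<and> glim Alg G L (NB u) (DB u)"
    and limC: "\<And>L v. limC L v \<longleftrightarrow> YC v \<and> glim K UG L (NC v) (DC v)"
    and surj: "\<And>A \<theta> \<theta>'. scone Alg G A \<theta> \<theta>' \<Longrightarrow>
      \<exists>u. YB u \<and> (\<forall>n \<in> nodes G. NB u n = \<theta> n) \<and> (\<forall>e \<in> edges G. DB u e = \<theta>' e)"
    and inj: "\<And>u u'. \<lbrakk>YC u; YC u'; \<And>n. n \<in> nodes G \<Longrightarrow> NC u n = NC u' n;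
      \<And>e. e \<in> edges G \<Longrightarrow> DC u e = DC u' e\<rbrakk> \<Longrightarrow> u = u'"
    and mp: "\<And>u. YC (mp u)" "\<And>u n. n \<in> nodes G \<Longrightarrow> NC (mp u) n = ps_arr (NB u n)"
      "\<And>L u e. \<lbrakk>limB L u; e \<in> edges G\<rbrakk> \<Longrightarrow> DC (mp u) e = ac_cell (DB u e)"
    and v: "limC L v"
  shows "\<exists>L' u. limB L' u \<and> fst L' = L \<and> mp u = v \<and> (\<forall>n \<in> N\<^sub>0. strict_mor K (NB u n)) \<and>
      jointly_detect_strictness K T i m L' N\<^sub>0 (NB u)"
    and "limB M u \<Longrightarrow> limC (fst M) (mp u)"
proof -
  have Yv: "YC v" and lim: "glim K UG L (NC v) (DC v)" using v limC by auto
  have N0: "N\<^sub>0 \<subseteq> nodes G" using rect by (simp add: rectifiable_def)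
  obtain L' p p' where p: "glim Alg G L' p p'" "fst L' = L" "\<forall>n \<in> nodes G. ps_arr (p n) = NC v n"
    "\<forall>e \<in> edges G. ac_cell (p' e) = DC v e" "\<forall>n \<in> N\<^sub>0. strict_mor K (p n)"
    "jointly_detect_strictness K T i m L' N\<^sub>0 p"
    using creation(1)[OF rect lim] by blast
  obtain w where w: "YB w" "\<forall>n \<in> nodes G. NB w n = p n" "\<forall>e \<in> edges G. DB w e = p' e"
    using surj[OF TA.glim_scone[OF p(1)]] by blast
  have lu: "limB L' w" using w p(1) by (auto simp: limB intro: TA.glim_cong)
  have "mp w = v"
    by (rule inj) (use mp(1) mp(2)[of _ w] mp(3)[OF lu] w p Yv in auto)
  moreover have "jointly_detect_strictness K T i m L' N\<^sub>0 (NB w)"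
    using p(6) w(2) N0 by (auto simp: jointly_detect_strictness_def subset_eq)
  ultimately show "\<exists>L' u. limB L' u \<and> fst L' = L \<and> mp u = v \<and> (\<forall>n \<in> N\<^sub>0. strict_mor K (NB u n)) \<and>
      jointly_detect_strictness K T i m L' N\<^sub>0 (NB u)"
    using lu p w N0 by (intro exI[of _ L'] exI[of _ w]) auto
  assume M: "limB M u"
  have "glim K UG (fst M) (\<lambda>n. ps_arr (NB u n)) (\<lambda>e. ac_cell (DB u e))"
    using creation(2)[OF rect lim] M limB by blast
  then have "glim K UG (fst M) (NC (mp u)) (DC (mp u))"
    by (rule UG.glim_cong) (simp_all add: mp(2) mp(3)[OF M])
  then show "limC (fst M) (mp u)" by (simp add: limC mp)
qed

section \<open>Cones given by two extensional families\<close>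

lemma (in diagram) cone_encoding_ext:
  assumes "nodes G = obj I" "edges G = arr I"
  shows "cone_encoding B G (\<lambda>u. fst u \<in> extensional (obj I) \<and> snd u \<in> extensional (arr I)) fst snd
    (\<lambda>v. v \<in> extensional (obj I)) (\<lambda>v. v) (\<lambda>u. \<lambda>A \<in> obj I. vide B (fst u A)) (\<lambda>\<beta> \<alpha>. \<lambda>A \<in> obj I. \<beta> A \<bullet> \<alpha> A)"
proof (unfold_locales, goal_cases)
  case (1 E \<theta> \<theta>')
  show ?case by (rule exI[of _ "(restrict \<theta> (obj I), restrict \<theta>' (arr I))"]) (simp add: assms)
next
  case (2 u u')
  then show ?case using assms by (intro prod_eqI) (auto intro: extensionalityI)
next
  case (3 \<alpha>)
  show ?case by (rule exI[of _ "restrict \<alpha> (obj I)"]) (simp add: assms)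
next
  case (4 v v')
  then show ?case using assms by (auto intro: extensionalityI)
qed (simp_all add: assms)

text \<open>Covers \<open>is_sigma_limit\<close> and \<open>is_sigma_oplimit\<close> at once, which
  differ only in the predicates \<open>cone\<close> and \<open>mor\<close>.\<close>

lemma (in diagram) cone_limit_iff:
  assumes I: "nodes G = obj I" "edges G = arr I"
    and cone: "\<And>E u. E \<in> obj B \<Longrightarrow>
      cone E u \<longleftrightarrow> (fst u \<in> extensional (obj I) \<and> snd u \<in> extensional (arr I)) \<and> scone B G E (fst u) (snd u)"
    and mor: "\<And>E u u' v. \<lbrakk>scone B G E (fst u) (snd u); scone B G E (fst u') (snd u')\<rbrakk>
      \<Longrightarrow> mor u u' v \<longleftrightarrow> v \<in> extensional (obj I) \<and> gmor B G (fst u) (snd u) (fst u') (snd u') v"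
  shows "(L \<in> obj B \<and> cone L \<pi> \<and> (\<forall>E \<in> obj B. iso_of_categories (hom_cat B E L) (cone_cat I B (cone E) mor)
       (cone_precomp_functor I B \<pi>))) \<longleftrightarrow>
     (fst \<pi> \<in> extensional (obj I) \<and> snd \<pi> \<in> extensional (arr I)) \<and> glim B G L (fst \<pi>) (snd \<pi>)"
proof -
  interpret enc: cone_encoding B G "\<lambda>u. fst u \<in> extensional (obj I) \<and> snd u \<in> extensional (arr I)" fst snd
    "\<lambda>v. v \<in> extensional (obj I)" "\<lambda>v. v" "\<lambda>u. \<lambda>A \<in> obj I. vide B (fst u A)" "\<lambda>\<beta> \<alpha>. \<lambda>A \<in> obj I. \<beta> A \<bullet> \<alpha> A"
    by (rule cone_encoding_ext[OF I])
  have cat: "cone_cat I B (cone E) mor = enc.cones E" if E: "E \<in> obj B" for E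
    unfolding cone_cat_def enc.cones_def using cone[OF E] mor[of E] by (auto 0 3)
  show ?thesis
  proof (cases "L \<in> obj B \<and> cone L \<pi>")
    case True
    then have Y: "fst \<pi> \<in> extensional (obj I) \<and> snd \<pi> \<in> extensional (arr I)" and s: "scone B G L (fst \<pi>) (snd \<pi>)"
      and L: "L \<in> obj B" by (auto simp: cone)
    have "(\<forall>E \<in> obj B. iso_of_categories (hom_cat B E L) (enc.cones E) (cone_precomp_functor I B \<pi>)) \<longleftrightarrow>
        glim B G L (fst \<pi>) (snd \<pi>)"
      by (rule enc.iso_iff_glim[OF Y L s, where w = "\<lambda>\<beta>. \<lambda>A \<in> obj I. fst \<pi> A \<rhd> \<beta>"])
        (simp_all add: cone_precomp_functor_def cone_precomp_def I)
    then show ?thesis using True Y by (simp add: cat)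
  next
    case False
    then show ?thesis by (auto simp: glim_def cone)
  qed
qed

section \<open>Sigma-limits and sigma-oplimits\<close>

text \<open>The 2-cell of a lax cone ends at a bare leg, so \<open>eQ\<close> is an identity arrow.
  The equations are those for identities, composites and 2-cells of the index, and \<open>c\<close>
  supplies the padding cells.\<close>

definition lax_diag :: "('i, 'j, 'k) cat2 \<Rightarrow> 'j set \<Rightarrow> ('o, 'a, 'c) cat2 \<Rightarrow> ('i, 'j, 'k, 'o, 'a, 'c) fun2
    \<Rightarrow> ('i, 'j, 'o, 'a, 'c) diag" where
  "lax_diag I \<Sigma> B F = (let i = (\<lambda>A. ide B (ob_map F A)); c = (\<lambda>A. Cell (vide B (i A)) A) in
     \<lparr>nodes = obj I, edges = arr I, ob = ob_map F, es = src I, et = tgt I,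
      eP = ar_map F, eQ = (\<lambda>f. i (tgt I f)), strict = \<Sigma>,
      eqns = (\<lambda>A. (Edge (i A) (ide I A), c A, c A, c A)) ` obj I \<union>
        (\<lambda>(f, g). (Edge (i (tgt I g)) (g \<cdot>\<^bsub>I\<^esub> f), c (tgt I g), Edge (ar_map F g) f, Edge (i (tgt I g)) g))
          ` {(f, g). f \<in> arr I \<and> g \<in> arr I \<and> tgt I f = src I g} \<union>
        (\<lambda>\<gamma>. let t = tgt I (vsrc I \<gamma>) in
          (Edge (i t) (vsrc I \<gamma>), c t, Cell (cell_map F \<gamma>) (src I (vsrc I \<gamma>)), Edge (i t) (vtgt I \<gamma>))) ` cell I\<rparr>)"

text \<open>Reversing the 2-cells exchanges the ends of each edge: an arrow \<open>f\<close> gives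
  an edge from \<open>tgt I f\<close> to \<open>src I f\<close>, with the identity arrow now in
  \<open>eP\<close>.\<close>

definition oplax_diag :: "('i, 'j, 'k) cat2 \<Rightarrow> 'j set \<Rightarrow> ('o, 'a, 'c) cat2 \<Rightarrow> ('i, 'j, 'k, 'o, 'a, 'c) fun2
    \<Rightarrow> ('i, 'j, 'o, 'a, 'c) diag" where
  "oplax_diag I \<Sigma> B F = (let i = (\<lambda>A. ide B (ob_map F A)); c = (\<lambda>f. Cell (vide B (ar_map F f)) (src I f)) in
     \<lparr>nodes = obj I, edges = arr I, ob = ob_map F, es = tgt I, et = src I,
      eP = (\<lambda>f. i (tgt I f)), eQ = ar_map F, strict = \<Sigma>,
      eqns = (\<lambda>A. (Edge (i A) (ide I A), c (ide I A), Cell (vide B (i A)) A, c (ide I A))) ` obj I \<union>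
        (\<lambda>(f, g). (Edge (i (tgt I g)) (g \<cdot>\<^bsub>I\<^esub> f), c (g \<cdot>\<^bsub>I\<^esub> f), Edge (i (tgt I g)) g, Edge (ar_map F g) f))
          ` {(f, g). f \<in> arr I \<and> g \<in> arr I \<and> tgt I f = src I g} \<union>
        (\<lambda>\<gamma>. let t = tgt I (vsrc I \<gamma>) in
          (Edge (i t) (vtgt I \<gamma>), c (vtgt I \<gamma>), Edge (i t) (vsrc I \<gamma>), Cell (cell_map F \<gamma>) (src I (vsrc I \<gamma>)))) ` cell I\<rparr>)"

lemma ide_TAlg: "ide (TAlg K T i m) A = PsMor A A (ide K (fst A)) (vide K (snd A))"
  by (cases A) (simp add: TAlg_def)

lemma dimage_lax: "dimage forget (lax_diag I \<Sigma> (TAlg K T i m) F) = lax_diag I \<Sigma> K (forget \<circ>\<^sub>2 F)"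
  by (simp add: dimage_def lax_diag_def Let_def comp_fun2_def image_Un image_image o_def split_beta ide_TAlg)

lemma dimage_oplax: "dimage forget (oplax_diag I \<Sigma> (TAlg K T i m) F) = oplax_diag I \<Sigma> K (forget \<circ>\<^sub>2 F)"
  by (simp add: dimage_def oplax_diag_def Let_def comp_fun2_def image_Un image_image o_def split_beta ide_TAlg)

text \<open>Stated for an arbitrary predicate because it unfolds both the typing of the equations
  (\<open>eqn_ok\<close>) and their validity in a cone (\<open>eqn_holds\<close>).\<close>

lemma lax_eqns:
  fixes F :: "('i, 'j, 'k, 'o, 'a, 'c) fun2"
  defines "i \<equiv> \<lambda>B A. ide B (ob_map F A)"
  shows "(\<forall>q \<in> eqns (lax_diag I \<Sigma> B F). P q) \<longleftrightarrow>
    (\<forall>A \<in> obj I. P (Edge (i B A) (ide I A), Cell (vide B (i B A)) A, Cell (vide B (i B A)) A, Cell (vide B (i B A)) A)) \<and>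
    (\<forall>f \<in> arr I. \<forall>g \<in> arr I. tgt I f = src I g \<longrightarrow> P (Edge (i B (tgt I g)) (g \<cdot>\<^bsub>I\<^esub> f),
       Cell (vide B (i B (tgt I g))) (tgt I g), Edge (ar_map F g) f, Edge (i B (tgt I g)) g)) \<and>
    (\<forall>\<gamma> \<in> cell I. P (Edge (i B (tgt I (vsrc I \<gamma>))) (vsrc I \<gamma>), Cell (vide B (i B (tgt I (vsrc I \<gamma>)))) (tgt I (vsrc I \<gamma>)),
       Cell (cell_map F \<gamma>) (src I (vsrc I \<gamma>)), Edge (i B (tgt I (vsrc I \<gamma>))) (vtgt I \<gamma>)))"
  unfolding lax_diag_def Let_def i_def by (simp add: ball_Un) blast

lemma oplax_eqns:
  fixes F :: "('i, 'j, 'k, 'o, 'a, 'c) fun2"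
  defines "i \<equiv> \<lambda>B A. ide B (ob_map F A)" and "c \<equiv> \<lambda>I B f. Cell (vide B (ar_map F f)) (src I f)"
  shows "(\<forall>q \<in> eqns (oplax_diag I \<Sigma> B F). P q) \<longleftrightarrow>
    (\<forall>A \<in> obj I. P (Edge (i B A) (ide I A), c I B (ide I A), Cell (vide B (i B A)) A, c I B (ide I A))) \<and>
    (\<forall>f \<in> arr I. \<forall>g \<in> arr I. tgt I f = src I g \<longrightarrow> P (Edge (i B (tgt I g)) (g \<cdot>\<^bsub>I\<^esub> f),
       c I B (g \<cdot>\<^bsub>I\<^esub> f), Edge (i B (tgt I g)) g, Edge (ar_map F g) f)) \<and>
    (\<forall>\<gamma> \<in> cell I. P (Edge (i B (tgt I (vsrc I \<gamma>))) (vtgt I \<gamma>), c I B (vtgt I \<gamma>),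
       Edge (i B (tgt I (vsrc I \<gamma>))) (vsrc I \<gamma>), Cell (cell_map F \<gamma>) (src I (vsrc I \<gamma>))))"
  unfolding oplax_diag_def Let_def i_def c_def by (simp add: ball_Un) blast

section \<open>Lax and op-lax cones as generalised cones\<close>

context two_functor
begin

lemma map_typing:
  "A \<in> obj C \<Longrightarrow> ob_map F A \<in> obj D"
  "f \<in> arr C \<Longrightarrow> ar_map F f \<in> arr D" "f \<in> arr C \<Longrightarrow> src D (ar_map F f) = ob_map F (src C f)"
  "f \<in> arr C \<Longrightarrow> tgt D (ar_map F f) = ob_map F (tgt C f)"
  "\<gamma> \<in> cell C \<Longrightarrow> cell_map F \<gamma> \<in> cell D" "\<gamma> \<in> cell C \<Longrightarrow> vsrc D (cell_map F \<gamma>) = ar_map F (vsrc C \<gamma>)"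
  "\<gamma> \<in> cell C \<Longrightarrow> vtgt D (cell_map F \<gamma>) = ar_map F (vtgt C \<gamma>)"
  using ob_map_obj ar_map_hom cell_map_cells by (auto simp: hom_iff cells_iff)

lemma lax_diag_ok: "\<Sigma> \<subseteq> arr C \<Longrightarrow> diag_ok D (lax_diag C \<Sigma> D F)"
  unfolding diag_ok_def lax_eqns
  by (simp add: lax_diag_def Let_def eqn_ok_def map_typing ar_map_ide ar_map_comp C.calc D.calc)

lemma oplax_diag_ok: "\<Sigma> \<subseteq> arr C \<Longrightarrow> diag_ok D (oplax_diag C \<Sigma> D F)"
  unfolding diag_ok_def oplax_eqns
  by (simp add: oplax_diag_def Let_def eqn_ok_def map_typing ar_map_ide ar_map_comp C.calc D.calc)

lemma gcone_lax:
  "gcone D (lax_diag C \<Sigma> D F) E \<theta> \<theta>' \<longleftrightarrow> E \<in> obj D \<and>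
     (\<forall>A \<in> obj C. \<theta> A \<in> hom D E (ob_map F A)) \<and>
     (\<forall>f \<in> arr C. \<theta>' f \<in> cells D (ar_map F f \<cdot>\<^bsub>D\<^esub> \<theta> (src C f)) (\<theta> (tgt C f))) \<and>
     (\<forall>A \<in> obj C. \<theta>' (ide C A) = vide D (\<theta> A)) \<and>
     (\<forall>f \<in> arr C. \<forall>g \<in> arr C. tgt C f = src C g \<longrightarrow>
        \<theta>' (g \<cdot>\<^bsub>C\<^esub> f) = \<theta>' g \<bullet>\<^bsub>D\<^esub> (ar_map F g \<rhd>\<^bsub>D\<^esub> \<theta>' f)) \<and>
     (\<forall>\<gamma> \<in> cell C. \<theta>' (vsrc C \<gamma>) =
        \<theta>' (vtgt C \<gamma>) \<bullet>\<^bsub>D\<^esub> (cell_map F \<gamma> \<lhd>\<^bsub>D\<^esub> \<theta> (src C (vsrc C \<gamma>))))" (is "_ \<longleftrightarrow> ?R")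
proof -
  let ?G = "lax_diag C \<Sigma> D F"
  have "precone D ?G E \<theta> \<theta>' \<longleftrightarrow> E \<in> obj D \<and> (\<forall>A \<in> obj C. \<theta> A \<in> hom D E (ob_map F A)) \<and>
     (\<forall>f \<in> arr C. \<theta>' f \<in> cells D (ar_map F f \<cdot>\<^bsub>D\<^esub> \<theta> (src C f)) (\<theta> (tgt C f)))"
    by (auto simp: precone_def lax_diag_def Let_def hom_iff cells_iff D.ide_cancel C.tgt_obj)
  moreover have "(\<forall>q \<in> eqns ?G. eqn_holds D \<theta> \<theta>' q) \<longleftrightarrow> (\<forall>A \<in> obj C. \<theta>' (ide C A) = vide D (\<theta> A)) \<and>
     (\<forall>f \<in> arr C. \<forall>g \<in> arr C. tgt C f = src C g \<longrightarrow>
        \<theta>' (g \<cdot>\<^bsub>C\<^esub> f) = \<theta>' g \<bullet>\<^bsub>D\<^esub> (ar_map F g \<rhd>\<^bsub>D\<^esub> \<theta>' f)) \<and>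
     (\<forall>\<gamma> \<in> cell C. \<theta>' (vsrc C \<gamma>) =
        \<theta>' (vtgt C \<gamma>) \<bullet>\<^bsub>D\<^esub> (cell_map F \<gamma> \<lhd>\<^bsub>D\<^esub> \<theta> (src C (vsrc C \<gamma>))))"
    if p: "E \<in> obj D" "\<forall>A \<in> obj C. \<theta> A \<in> hom D E (ob_map F A)"
     "\<forall>f \<in> arr C. \<theta>' f \<in> cells D (ar_map F f \<cdot>\<^bsub>D\<^esub> \<theta> (src C f)) (\<theta> (tgt C f))"
  proof -
    have t: "\<theta> A \<in> arr D" "src D (\<theta> A) = E" "tgt D (\<theta> A) = ob_map F A" if "A \<in> obj C" for A
      using p(2) that by (auto simp: hom_iff)
    have t': "\<theta>' f \<in> cell D" "vsrc D (\<theta>' f) = ar_map F f \<cdot>\<^bsub>D\<^esub> \<theta> (src C f)" "vtgt D (\<theta>' f) = \<theta> (tgt C f)" if "f \<in> arr C" for f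
      using p(3) that by (auto simp: cells_iff)
    show ?thesis
      unfolding lax_eqns
      by (intro arg_cong2[of _ _ _ _ "(\<and>)"] ball_cong refl imp_cong)
        (simp_all add: eqn_holds_def t t' map_typing ar_map_ide ar_map_comp C.calc D.calc)
  qed
  ultimately show ?thesis unfolding gcone_def by auto
qed

lemma gcone_oplax:
  "gcone D (oplax_diag C \<Sigma> D F) E \<theta> \<theta>' \<longleftrightarrow> E \<in> obj D \<and>
     (\<forall>A \<in> obj C. \<theta> A \<in> hom D E (ob_map F A)) \<and>
     (\<forall>f \<in> arr C. \<theta>' f \<in> cells D (\<theta> (tgt C f)) (ar_map F f \<cdot>\<^bsub>D\<^esub> \<theta> (src C f))) \<and>
     (\<forall>A \<in> obj C. \<theta>' (ide C A) = vide D (\<theta> A)) \<and>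
     (\<forall>f \<in> arr C. \<forall>g \<in> arr C. tgt C f = src C g \<longrightarrow>
        \<theta>' (g \<cdot>\<^bsub>C\<^esub> f) = (ar_map F g \<rhd>\<^bsub>D\<^esub> \<theta>' f) \<bullet>\<^bsub>D\<^esub> \<theta>' g) \<and>
     (\<forall>\<gamma> \<in> cell C. \<theta>' (vtgt C \<gamma>) =
        (cell_map F \<gamma> \<lhd>\<^bsub>D\<^esub> \<theta> (src C (vsrc C \<gamma>))) \<bullet>\<^bsub>D\<^esub> \<theta>' (vsrc C \<gamma>))"
proof -
  let ?G = "oplax_diag C \<Sigma> D F"
  have "precone D ?G E \<theta> \<theta>' \<longleftrightarrow> E \<in> obj D \<and> (\<forall>A \<in> obj C. \<theta> A \<in> hom D E (ob_map F A)) \<and>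
     (\<forall>f \<in> arr C. \<theta>' f \<in> cells D (\<theta> (tgt C f)) (ar_map F f \<cdot>\<^bsub>D\<^esub> \<theta> (src C f)))"
    by (auto simp: precone_def oplax_diag_def Let_def hom_iff cells_iff D.ide_cancel C.tgt_obj)
  moreover have "(\<forall>q \<in> eqns ?G. eqn_holds D \<theta> \<theta>' q) \<longleftrightarrow> (\<forall>A \<in> obj C. \<theta>' (ide C A) = vide D (\<theta> A)) \<and>
     (\<forall>f \<in> arr C. \<forall>g \<in> arr C. tgt C f = src C g \<longrightarrow>
        \<theta>' (g \<cdot>\<^bsub>C\<^esub> f) = (ar_map F g \<rhd>\<^bsub>D\<^esub> \<theta>' f) \<bullet>\<^bsub>D\<^esub> \<theta>' g) \<and>
     (\<forall>\<gamma> \<in> cell C. \<theta>' (vtgt C \<gamma>) =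
        (cell_map F \<gamma> \<lhd>\<^bsub>D\<^esub> \<theta> (src C (vsrc C \<gamma>))) \<bullet>\<^bsub>D\<^esub> \<theta>' (vsrc C \<gamma>))"
    if p: "E \<in> obj D" "\<forall>A \<in> obj C. \<theta> A \<in> hom D E (ob_map F A)"
     "\<forall>f \<in> arr C. \<theta>' f \<in> cells D (\<theta> (tgt C f)) (ar_map F f \<cdot>\<^bsub>D\<^esub> \<theta> (src C f))"
  proof -
    have t: "\<theta> A \<in> arr D" "src D (\<theta> A) = E" "tgt D (\<theta> A) = ob_map F A" if "A \<in> obj C" for A
      using p(2) that by (auto simp: hom_iff)
    have t': "\<theta>' f \<in> cell D" "vsrc D (\<theta>' f) = \<theta> (tgt C f)" "vtgt D (\<theta>' f) = ar_map F f \<cdot>\<^bsub>D\<^esub> \<theta> (src C f)" if "f \<in> arr C" for f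
      using p(3) that by (auto simp: cells_iff)
    show ?thesis
      unfolding oplax_eqns
      by (intro arg_cong2[of _ _ _ _ "(\<and>)"] ball_cong refl imp_cong)
        (simp_all add: eqn_holds_def t t' map_typing ar_map_ide ar_map_comp C.calc D.calc)
  qed
  ultimately show ?thesis unfolding gcone_def by auto
qed


lemma sigma_limit_iff:
  assumes S: "\<Sigma> \<subseteq> arr C"
  shows "is_sigma_limit C \<Sigma> D F L \<pi> \<longleftrightarrow>
    (fst \<pi> \<in> extensional (obj C) \<and> snd \<pi> \<in> extensional (arr C)) \<and> glim D (lax_diag C \<Sigma> D F) L (fst \<pi>) (snd \<pi>)"
proof -
  let ?G = "lax_diag C \<Sigma> D F"
  interpret G: diagram D ?G by unfold_locales (rule lax_diag_ok[OF S])
  have st: "strict ?G = \<Sigma>" by (simp add: lax_diag_def Let_def)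
  show ?thesis
    unfolding is_sigma_limit_def sigma_cone_cat_def
  proof (rule G.cone_limit_iff)
    show "sigma_cone C \<Sigma> D F E u \<longleftrightarrow>
      (fst u \<in> extensional (obj C) \<and> snd u \<in> extensional (arr C)) \<and> scone D ?G E (fst u) (snd u)"
      if "E \<in> obj D" for E u
      using that unfolding sigma_cone_def lax_cone_def scone_def gcone_lax st by (auto simp: split_beta)
    show "lax_cone_mor C D F u u' v \<longleftrightarrow> v \<in> extensional (obj C) \<and> gmor D ?G (fst u) (snd u) (fst u') (snd u') v"
      if "scone D ?G E (fst u) (snd u)" for E u u' v
    proof -
      note t = G.precone_typing[OF G.scone_precone[OF that], simplified lax_diag_def Let_def, simplified]
      have "(ide D (ob_map F (tgt C f)) \<rhd>\<^bsub>D\<^esub> v (tgt C f)) = v (tgt C f)"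
        if "f \<in> arr C" "\<forall>A \<in> obj C. v A \<in> cells D (fst u A) (fst u' A)" for f
        using that t by (intro D.hide_cancel) (auto simp: cells_iff C.tgt_obj)
      then show ?thesis
        unfolding lax_cone_mor_def gmor_def by (auto simp: lax_diag_def Let_def cells_iff)
    qed
  qed (simp_all add: lax_diag_def Let_def)
qed

lemma sigma_oplimit_iff:
  assumes S: "\<Sigma> \<subseteq> arr C"
  shows "is_sigma_oplimit C \<Sigma> D F L \<pi> \<longleftrightarrow>
    (fst \<pi> \<in> extensional (obj C) \<and> snd \<pi> \<in> extensional (arr C)) \<and> glim D (oplax_diag C \<Sigma> D F) L (fst \<pi>) (snd \<pi>)"
proof -
  let ?G = "oplax_diag C \<Sigma> D F"
  interpret G: diagram D ?G by unfold_locales (rule oplax_diag_ok[OF S])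
  have st: "strict ?G = \<Sigma>" by (simp add: oplax_diag_def Let_def)
  show ?thesis
    unfolding is_sigma_oplimit_def sigma_opcone_cat_def
  proof (rule G.cone_limit_iff)
    show "sigma_opcone C \<Sigma> D F E u \<longleftrightarrow>
      (fst u \<in> extensional (obj C) \<and> snd u \<in> extensional (arr C)) \<and> scone D ?G E (fst u) (snd u)"
      if "E \<in> obj D" for E u
      using that unfolding sigma_opcone_def oplax_cone_def scone_def gcone_oplax st by (auto simp: split_beta)
    show "oplax_cone_mor C D F u u' v \<longleftrightarrow> v \<in> extensional (obj C) \<and> gmor D ?G (fst u) (snd u) (fst u') (snd u') v"
      if "scone D ?G E (fst u) (snd u)" for E u u' v
    proof -
      note t = G.precone_typing[OF G.scone_precone[OF that], simplified oplax_diag_def Let_def, simplified]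
      have "(ide D (ob_map F (tgt C f)) \<rhd>\<^bsub>D\<^esub> v (tgt C f)) = v (tgt C f)"
        if "f \<in> arr C" "\<forall>A \<in> obj C. v A \<in> cells D (fst u A) (fst u' A)" for f
        using that t by (intro D.hide_cancel) (auto simp: cells_iff C.tgt_obj)
      then show ?thesis
        unfolding oplax_cone_mor_def gmor_def by (auto simp: oplax_diag_def Let_def cells_iff)
    qed
  qed (simp_all add: oplax_diag_def Let_def)
qed

section \<open>Rectifiability for PIE indexing pairs\<close>

lemma sigma_subcat_category:
  assumes "indexing_pair C \<Sigma>"
  shows "category (sigma_subcat C \<Sigma>)"
proof -
  interpret indexing_pair C \<Sigma> by (rule assms)
  show ?thesis
    by unfold_locales (use sub in \<open>auto simp: sigma_subcat_def subset_eq ide_mem comp_mem C.calc\<close>)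
qed

text \<open>The edges \<open>z A\<close> of \<open>rectifiable_forward\<close> are the unique arrows
  of \<open>\<Sigma>\<close> out of the chosen initial objects. For \<open>f\<close> in
  \<open>\<Sigma>\<close> the composite of \<open>f\<close> with \<open>z (src C f)\<close> is
  \<open>z (tgt C f)\<close>, so the cone equation for composites is the transport condition, and
  the one for identities is the condition at initial objects.\<close>

lemma rectifiable_lax:
  assumes IP: "indexing_pair C \<Sigma>" and I0: "initial_choice (sigma_subcat C \<Sigma>) I\<^sub>0"
  shows "rectifiable D (lax_diag C \<Sigma> D F) I\<^sub>0"
proof -
  have S: "\<Sigma> \<subseteq> arr C" using IP indexing_pair.sub by blast
  let ?G = "lax_diag C \<Sigma> D F"
  interpret G: diagram D ?G by unfold_locales (rule lax_diag_ok[OF S])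
  interpret S: category "sigma_subcat C \<Sigma>" by (rule sigma_subcat_category[OF IP])
  obtain r z where "\<And>A. A \<in> obj (sigma_subcat C \<Sigma>) \<Longrightarrow> r A \<in> I\<^sub>0 \<and> z A \<in> hom (sigma_subcat C \<Sigma>) (r A) A"
    "\<And>f. f \<in> arr (sigma_subcat C \<Sigma>) \<Longrightarrow>
      f \<cdot>\<^bsub>sigma_subcat C \<Sigma>\<^esub> z (src (sigma_subcat C \<Sigma>) f) = z (tgt (sigma_subcat C \<Sigma>) f)"
    "\<And>A. A \<in> I\<^sub>0 \<Longrightarrow> A \<in> obj (sigma_subcat C \<Sigma>) \<and> z A = ide (sigma_subcat C \<Sigma>) A"
    by (rule S.initial_choice_arrows[OF I0]) (rule that)
  note rz = this[unfolded hom_iff, unfolded sigma_subcat_def, simplified]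
  note G = lax_diag_def Let_def
  show ?thesis
  proof (rule G.rectifiable_forward[where r = r and z = z])
    show "I\<^sub>0 \<subseteq> nodes ?G" using rz(3) by (auto simp: G)
    show "r n \<in> I\<^sub>0 \<and> z n \<in> strict ?G \<and> es ?G (z n) = r n \<and> et ?G (z n) = n \<and> eQ ?G (z n) = ide D (ob ?G n)"
      if "n \<in> nodes ?G" for n
      using that rz(1)[of n] by (simp add: G)
    fix E \<phi> \<phi>' assume g: "gcone D ?G E \<phi> \<phi>'"
    note g' = g[unfolded gcone_lax]
    show "\<phi>' (z n) = vide D (\<phi> n)" if "n \<in> I\<^sub>0" for n
      using g' rz(3)[OF that] by auto
    fix f assume "f \<in> strict ?G"
    then have f: "f \<in> \<Sigma>" "f \<in> arr C" using S by (auto simp: G)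
    have z: "z A \<in> arr C" "tgt C (z A) = A" if "A \<in> obj C" for A
      using rz(1)[OF that] S by auto
    have zt: "\<phi>' (z A) \<in> cell D" "vtgt D (\<phi>' (z A)) = \<phi> A" "\<phi> A \<in> hom D E (ob_map F A)" if "A \<in> obj C" for A
      using g' z[OF that] that unfolding cells_iff by auto
    have "ide D (ob_map F (tgt C f)) \<rhd>\<^bsub>D\<^esub> \<phi>' (z (tgt C f)) = \<phi>' (z (tgt C f))"
      using zt[of "tgt C f"] D.cell_parallel_typing[of "\<phi>' (z (tgt C f))"] f
      by (intro D.hide_cancel) (auto simp: hom_iff C.tgt_obj)
    moreover have "\<phi>' (f \<cdot>\<^bsub>C\<^esub> z (src C f)) = \<phi>' f \<bullet>\<^bsub>D\<^esub> (ar_map F f \<rhd>\<^bsub>D\<^esub> \<phi>' (z (src C f)))"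
      using g' z[of "src C f"] f by (auto simp: C.src_obj)
    ultimately show "\<phi>' f \<bullet>\<^bsub>D\<^esub> (eP ?G f \<rhd>\<^bsub>D\<^esub> \<phi>' (z (es ?G f))) = eQ ?G f \<rhd>\<^bsub>D\<^esub> \<phi>' (z (et ?G f))"
      using rz(2)[OF f(1)] by (simp add: G)
  qed
qed

text \<open>The same arrows \<open>z A\<close>, but as edges of the op-lax diagram they lead from
  \<open>A\<close> to its initial object; hence \<open>rectifiable_backward\<close>.\<close>

lemma rectifiable_oplax:
  assumes IP: "indexing_pair C \<Sigma>" and I0: "initial_choice (sigma_subcat C \<Sigma>) I\<^sub>0"
  shows "rectifiable D (oplax_diag C \<Sigma> D F) I\<^sub>0"
proof -
  have S: "\<Sigma> \<subseteq> arr C" using IP indexing_pair.sub by blast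
  let ?G = "oplax_diag C \<Sigma> D F"
  interpret G: diagram D ?G by unfold_locales (rule oplax_diag_ok[OF S])
  interpret S: category "sigma_subcat C \<Sigma>" by (rule sigma_subcat_category[OF IP])
  obtain r z where "\<And>A. A \<in> obj (sigma_subcat C \<Sigma>) \<Longrightarrow> r A \<in> I\<^sub>0 \<and> z A \<in> hom (sigma_subcat C \<Sigma>) (r A) A"
    "\<And>f. f \<in> arr (sigma_subcat C \<Sigma>) \<Longrightarrow>
      f \<cdot>\<^bsub>sigma_subcat C \<Sigma>\<^esub> z (src (sigma_subcat C \<Sigma>) f) = z (tgt (sigma_subcat C \<Sigma>) f)"
    "\<And>A. A \<in> I\<^sub>0 \<Longrightarrow> A \<in> obj (sigma_subcat C \<Sigma>) \<and> z A = ide (sigma_subcat C \<Sigma>) A"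
    by (rule S.initial_choice_arrows[OF I0]) (rule that)
  note rz = this[unfolded hom_iff, unfolded sigma_subcat_def, simplified]
  note G = oplax_diag_def Let_def
  show ?thesis
  proof (rule G.rectifiable_backward[where r = r and z = z])
    show "I\<^sub>0 \<subseteq> nodes ?G" using rz(3) by (auto simp: G)
    show "r n \<in> I\<^sub>0 \<and> z n \<in> strict ?G \<and> es ?G (z n) = n \<and> et ?G (z n) = r n \<and> eP ?G (z n) = ide D (ob ?G n)"
      if "n \<in> nodes ?G" for n
      using that rz(1)[of n] by (simp add: G)
    fix E \<phi> \<phi>' assume g: "gcone D ?G E \<phi> \<phi>'"
    note g' = g[unfolded gcone_oplax]
    show "\<phi>' (z n) = vide D (\<phi> n)" if "n \<in> I\<^sub>0" for n
      using g' rz(3)[OF that] by auto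
    fix f assume "f \<in> strict ?G"
    then have f: "f \<in> \<Sigma>" "f \<in> arr C" using S by (auto simp: G)
    have z: "z A \<in> arr C" "tgt C (z A) = A" if "A \<in> obj C" for A
      using rz(1)[OF that] S by auto
    have zt: "\<phi>' (z A) \<in> cell D" "vsrc D (\<phi>' (z A)) = \<phi> A" "\<phi> A \<in> hom D E (ob_map F A)" if "A \<in> obj C" for A
      using g' z[OF that] that unfolding cells_iff by auto
    have "ide D (ob_map F (tgt C f)) \<rhd>\<^bsub>D\<^esub> \<phi>' (z (tgt C f)) = \<phi>' (z (tgt C f))"
      using zt[of "tgt C f"] f
      by (intro D.hide_cancel) (auto simp: hom_iff C.tgt_obj)
    moreover have "\<phi>' (f \<cdot>\<^bsub>C\<^esub> z (src C f)) = (ar_map F f \<rhd>\<^bsub>D\<^esub> \<phi>' (z (src C f))) \<bullet>\<^bsub>D\<^esub> \<phi>' f"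
      using g' z[of "src C f"] f by (auto simp: C.src_obj)
    ultimately show "(eQ ?G f \<rhd>\<^bsub>D\<^esub> \<phi>' (z (et ?G f))) \<bullet>\<^bsub>D\<^esub> \<phi>' f = eP ?G f \<rhd>\<^bsub>D\<^esub> \<phi>' (z (es ?G f))"
      using rz(2)[OF f(1)] by (simp add: G)
  qed
qed

end

section \<open>Creation of \<open>\<sigma>\<close>-limits and
  \<open>\<sigma>\<close>-oplimits\<close>

context algebras
begin

lemma forget_functor:
  assumes "two_functor I Alg F"
  shows "two_functor I K (forget \<circ>\<^sub>2 F)"
proof -
  interpret F: two_functor I "Alg" F by (rule assms)
  show ?thesis
    by unfold_locales
      (use F.map_typing F.ar_map_ide F.ar_map_comp F.cell_map_vide F.cell_map_vcomp F.cell_map_hcomp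
       in \<open>auto simp: comp_fun2_def hom_iff cells_iff ps_typing alg_typing alg_cell_typing ide_TAlg\<close>)
qed

text \<open>The instance of \<open>transfer\<close> shared by the lax and op-lax cases: cones are
  pairs of extensional families on objects and arrows of the index.\<close>

lemma cone_transfer:
  assumes G: "diag_ok Alg G" "nodes G = obj I" "edges G = arr I" and rect: "rectifiable K (dimage forget G) I\<^sub>0"
    and limB: "\<And>L u. limB L u \<longleftrightarrow>
      (fst u \<in> extensional (obj I) \<and> snd u \<in> extensional (arr I)) \<and> glim Alg G L (fst u) (snd u)"
    and limC: "\<And>L u. limC L u \<longleftrightarrow>
      (fst u \<in> extensional (obj I) \<and> snd u \<in> extensional (arr I)) \<and> glim K (dimage forget G) L (fst u) (snd u)"
    and Alg: "two_category Alg" and lim: "limC L \<pi>"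
  shows "\<exists>L' \<pi>'. limB L' \<pi>' \<and> fst L' = L \<and> map_cone I forget \<pi>' = \<pi> \<and>
     (\<forall>A \<in> I\<^sub>0. strict_mor K (fst \<pi>' A)) \<and> jointly_detect_strictness K T i m L' I\<^sub>0 (fst \<pi>')"
    and "limB M \<rho> \<Longrightarrow> limC (fst M) (map_cone I forget \<rho>)"
proof -
  interpret G: alg_diagram K T i m G
    by (intro alg_diagram.intro algebras_axioms diagram.intro diagram_axioms.intro Alg G)
  note tr = G.transfer[OF rect, of limB "\<lambda>u. fst u \<in> extensional (obj I) \<and> snd u \<in> extensional (arr I)" fst snd
      limC "\<lambda>u. fst u \<in> extensional (obj I) \<and> snd u \<in> extensional (arr I)" fst snd
      "map_cone I forget" L \<pi>, OF limB limC]
  have 1: "\<exists>u. (fst u \<in> extensional (obj I) \<and> snd u \<in> extensional (arr I)) \<and> (\<forall>n \<in> nodes G. fst u n = \<theta> n) \<and>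
      (\<forall>e \<in> edges G. snd u e = \<theta>' e)" for \<theta> :: "_ \<Rightarrow> ('o, 'a, 'c) psmor" and \<theta>' :: "_ \<Rightarrow> ('o, 'a, 'c) algcell"
    by (rule exI[of _ "(restrict \<theta> (obj I), restrict \<theta>' (arr I))"]) (simp add: G)
  have 2: "u = u'" if "fst u \<in> extensional (obj I) \<and> snd u \<in> extensional (arr I)"
    "fst u' \<in> extensional (obj I) \<and> snd u' \<in> extensional (arr I)"
    "\<And>n. n \<in> nodes G \<Longrightarrow> fst u n = fst u' n" "\<And>e. e \<in> edges G \<Longrightarrow> snd u e = snd u' e" for u u' :: "(_ \<Rightarrow> 'a) \<times> (_ \<Rightarrow> 'c)"
    using that by (intro prod_eqI) (auto intro: extensionalityI simp: G)
  show "\<exists>L' \<pi>'. limB L' \<pi>' \<and> fst L' = L \<and> map_cone I forget \<pi>' = \<pi> \<and>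
     (\<forall>A \<in> I\<^sub>0. strict_mor K (fst \<pi>' A)) \<and> jointly_detect_strictness K T i m L' I\<^sub>0 (fst \<pi>')"
    by (rule tr(1)[OF 1 2 _ _ _ lim]) (simp_all add: map_cone_def G)
  show "limB M \<rho> \<Longrightarrow> limC (fst M) (map_cone I forget \<rho>)"
    by (rule tr(2)[OF 1 2 _ _ _ lim]) (simp_all add: map_cone_def G)
qed

lemma sigma_limit_creation:
  assumes F: "two_functor I Alg F" and IP: "indexing_pair I \<Sigma>"
    and I0: "initial_choice (sigma_subcat I \<Sigma>) I\<^sub>0" and lim: "is_sigma_limit I \<Sigma> K (forget \<circ>\<^sub>2 F) L \<pi>"
  shows "\<exists>L' \<pi>'. is_sigma_limit I \<Sigma> Alg F L' \<pi>' \<and> fst L' = L \<and> map_cone I forget \<pi>' = \<pi> \<and>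
     (\<forall>A \<in> I\<^sub>0. strict_mor K (fst \<pi>' A)) \<and> jointly_detect_strictness K T i m L' I\<^sub>0 (fst \<pi>')"
    and "is_sigma_limit I \<Sigma> Alg F M \<rho> \<Longrightarrow>
      is_sigma_limit I \<Sigma> K (forget \<circ>\<^sub>2 F) (fst M) (map_cone I forget \<rho>)"
proof -
  interpret F: two_functor I Alg F by (rule F)
  interpret UF: two_functor I K "forget \<circ>\<^sub>2 F" by (rule forget_functor[OF F])
  have S: "\<Sigma> \<subseteq> arr I" using IP indexing_pair.sub by blast
  let ?G = "lax_diag I \<Sigma> Alg F"
  have G: "nodes ?G = obj I" "edges ?G = arr I" by (simp_all add: lax_diag_def Let_def)
  note tr = cone_transfer[where G = ?G, unfolded dimage_lax, OF F.lax_diag_ok[OF S] G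
      UF.rectifiable_lax[OF IP I0] F.sigma_limit_iff[OF S] UF.sigma_limit_iff[OF S]
      F.D.two_category_axioms lim]
  show "\<exists>L' \<pi>'. is_sigma_limit I \<Sigma> Alg F L' \<pi>' \<and> fst L' = L \<and> map_cone I forget \<pi>' = \<pi> \<and>
     (\<forall>A \<in> I\<^sub>0. strict_mor K (fst \<pi>' A)) \<and> jointly_detect_strictness K T i m L' I\<^sub>0 (fst \<pi>')"
    by (rule tr(1))
  show "is_sigma_limit I \<Sigma> Alg F M \<rho> \<Longrightarrow>
      is_sigma_limit I \<Sigma> K (forget \<circ>\<^sub>2 F) (fst M) (map_cone I forget \<rho>)"
    by (rule tr(2))
qed

lemma sigma_oplimit_creation:
  assumes F: "two_functor I Alg F" and IP: "indexing_pair I \<Sigma>"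
    and I0: "initial_choice (sigma_subcat I \<Sigma>) I\<^sub>0" and lim: "is_sigma_oplimit I \<Sigma> K (forget \<circ>\<^sub>2 F) L \<pi>"
  shows "\<exists>L' \<pi>'. is_sigma_oplimit I \<Sigma> Alg F L' \<pi>' \<and> fst L' = L \<and> map_cone I forget \<pi>' = \<pi> \<and>
     (\<forall>A \<in> I\<^sub>0. strict_mor K (fst \<pi>' A)) \<and> jointly_detect_strictness K T i m L' I\<^sub>0 (fst \<pi>')"
    and "is_sigma_oplimit I \<Sigma> Alg F M \<rho> \<Longrightarrow>
      is_sigma_oplimit I \<Sigma> K (forget \<circ>\<^sub>2 F) (fst M) (map_cone I forget \<rho>)"
proof -
  interpret F: two_functor I Alg F by (rule F)
  interpret UF: two_functor I K "forget \<circ>\<^sub>2 F" by (rule forget_functor[OF F])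
  have S: "\<Sigma> \<subseteq> arr I" using IP indexing_pair.sub by blast
  let ?G = "oplax_diag I \<Sigma> Alg F"
  have G: "nodes ?G = obj I" "edges ?G = arr I" by (simp_all add: oplax_diag_def Let_def)
  note tr = cone_transfer[where G = ?G, unfolded dimage_oplax, OF F.oplax_diag_ok[OF S] G
      UF.rectifiable_oplax[OF IP I0] F.sigma_oplimit_iff[OF S] UF.sigma_oplimit_iff[OF S]
      F.D.two_category_axioms lim]
  show "\<exists>L' \<pi>'. is_sigma_oplimit I \<Sigma> Alg F L' \<pi>' \<and> fst L' = L \<and> map_cone I forget \<pi>' = \<pi> \<and>
     (\<forall>A \<in> I\<^sub>0. strict_mor K (fst \<pi>' A)) \<and> jointly_detect_strictness K T i m L' I\<^sub>0 (fst \<pi>')"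
    by (rule tr(1))
  show "is_sigma_oplimit I \<Sigma> Alg F M \<rho> \<Longrightarrow>
      is_sigma_oplimit I \<Sigma> K (forget \<circ>\<^sub>2 F) (fst M) (map_cone I forget \<rho>)"
    by (rule tr(2))
qed

end

section \<open>Weighted limits\<close>

text \<open>
  The edges \<open>Inl (A, u)\<close> carry the functors \<open>W A \<rightarrow> B(E, F A)\<close>.  The strict edges \<open>Inr (x, f)\<close> carry the equalities
  between \<open>F f \<cdot> \<xi> x\<close> and \<open>\<xi> (W f x)\<close>: applying the 2-monad to a cylinder turns them into invertible 2-cells.
\<close>

definition weighted_diag :: "('i, 'j, 'k) cat2 \<Rightarrow> ('i, 'j, 'k, 'x, 'y) weight \<Rightarrow> ('o, 'a, 'c) cat2
    \<Rightarrow> ('i, 'j, 'k, 'o, 'a, 'c) fun2 \<Rightarrow> ('x \<times> 'i, ('i \<times> 'y) + ('x \<times> 'j), 'o, 'a, 'c) diag" where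
  "weighted_diag I W B F = (let i = (\<lambda>A. ide B (ob_map F A)); c = (\<lambda>n. Cell (vide B (i (snd n))) n);
      w = (\<lambda>f. cf_ob (ar_map W f)) in
     \<lparr>nodes = obj (elements I W),
      edges = Inl ` (SIGMA A:obj I. arr (ob_map W A)) \<union> Inr ` arr (elements I W),
      ob = (\<lambda>n. ob_map F (snd n)),
      es = case_sum (\<lambda>(A, u). (src (ob_map W A) u, A)) (\<lambda>(x, f). (x, src I f)),
      et = case_sum (\<lambda>(A, u). (tgt (ob_map W A) u, A)) (\<lambda>(x, f). (w f x, tgt I f)),
      eP = case_sum (\<lambda>(A, u). i A) (\<lambda>(x, f). ar_map F f),
      eQ = case_sum (\<lambda>(A, u). i A) (\<lambda>(x, f). i (tgt I f)),
      strict = Inr ` arr (elements I W),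
      eqns = (\<lambda>(A, x). (Edge (i A) (Inl (A, ide (ob_map W A) x)), c (x, A), c (x, A), c (x, A)))
          ` (SIGMA A:obj I. obj (ob_map W A)) \<union>
        (\<lambda>(A, u, v). (Edge (i A) (Inl (A, v \<cdot>\<^bsub>ob_map W A\<^esub> u)), c (tgt (ob_map W A) v, A),
            Edge (i A) (Inl (A, u)), Edge (i A) (Inl (A, v))))
          ` (SIGMA A:obj I. {(u, v). u \<in> arr (ob_map W A) \<and> v \<in> arr (ob_map W A) \<and> tgt (ob_map W A) u = src (ob_map W A) v}) \<union>
        (\<lambda>(A, x). (Edge (i A) (Inr (x, ide I A)), c (x, A), c (x, A), c (x, A)))
          ` (SIGMA A:obj I. obj (ob_map W A)) \<union>
        (\<lambda>((f, g), x). (Edge (i (tgt I g)) (Inr (x, g \<cdot>\<^bsub>I\<^esub> f)), c (w g (w f x), tgt I g),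
            Edge (ar_map F g) (Inr (x, f)), Edge (i (tgt I g)) (Inr (w f x, g))))
          ` (SIGMA p:{(f, g). f \<in> arr I \<and> g \<in> arr I \<and> tgt I f = src I g}. obj (ob_map W (src I (fst p)))) \<union>
        (\<lambda>(f, u). (Edge (ar_map F f) (Inl (src I f, u)), Edge (i (tgt I f)) (Inr (tgt (ob_map W (src I f)) u, f)),
            Edge (i (tgt I f)) (Inr (src (ob_map W (src I f)) u, f)), Edge (i (tgt I f)) (Inl (tgt I f, cf_ar (ar_map W f) u))))
          ` (SIGMA f:arr I. arr (ob_map W (src I f))) \<union>
        (\<lambda>(\<gamma>, x). let t = tgt I (vsrc I \<gamma>) in
            (Cell (cell_map F \<gamma>) (x, src I (vsrc I \<gamma>)), Edge (i t) (Inr (x, vtgt I \<gamma>)),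
             Edge (i t) (Inr (x, vsrc I \<gamma>)), Edge (i t) (Inl (t, cn_at (cell_map W \<gamma>) x))))
          ` (SIGMA \<gamma>:cell I. obj (ob_map W (src I (vsrc I \<gamma>))))\<rparr>)"

lemma sum_case_comp: "f (case_sum g h e) = case_sum (\<lambda>x. f (g x)) (\<lambda>x. f (h x)) e"
  by (cases e) auto

lemma dimage_weighted: "dimage forget (weighted_diag I W (TAlg K T i m) F) = weighted_diag I W K (forget \<circ>\<^sub>2 F)"
  by (simp add: dimage_def weighted_diag_def Let_def comp_fun2_def image_Un image_image o_def case_prod_unfold ide_TAlg
      sum_case_comp)
    (auto simp: fun_eq_iff split: sum.splits)

text \<open>The six families in order: identities and composites in each category
  \<open>W A\<close>; identities and composites of the index at strict edges; naturality in arrows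
  of the index on the arrows of \<open>W A\<close>; naturality in 2-cells of the index.\<close>

lemma weighted_eqns:
  fixes F :: "('i, 'j, 'k, 'o, 'a, 'c) fun2" and W :: "('i, 'j, 'k, 'x, 'y) weight"
  defines "i \<equiv> \<lambda>B A. ide B (ob_map F A)" and "c \<equiv> \<lambda>B n. Cell (vide B (ide B (ob_map F (snd n)))) n"
    and "w \<equiv> \<lambda>f. cf_ob (ar_map W f)"
  shows "(\<forall>q \<in> eqns (weighted_diag I W B F). P q) \<longleftrightarrow>
    (\<forall>A \<in> obj I. \<forall>x \<in> obj (ob_map W A). P (Edge (i B A) (Inl (A, ide (ob_map W A) x)), c B (x, A), c B (x, A), c B (x, A))) \<and>
    (\<forall>A \<in> obj I. \<forall>u \<in> arr (ob_map W A). \<forall>v \<in> arr (ob_map W A). tgt (ob_map W A) u = src (ob_map W A) v \<longrightarrow>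
      P (Edge (i B A) (Inl (A, v \<cdot>\<^bsub>ob_map W A\<^esub> u)), c B (tgt (ob_map W A) v, A), Edge (i B A) (Inl (A, u)), Edge (i B A) (Inl (A, v)))) \<and>
    (\<forall>A \<in> obj I. \<forall>x \<in> obj (ob_map W A). P (Edge (i B A) (Inr (x, ide I A)), c B (x, A), c B (x, A), c B (x, A))) \<and>
    (\<forall>f \<in> arr I. \<forall>g \<in> arr I. tgt I f = src I g \<longrightarrow> (\<forall>x \<in> obj (ob_map W (src I f)).
      P (Edge (i B (tgt I g)) (Inr (x, g \<cdot>\<^bsub>I\<^esub> f)), c B (w g (w f x), tgt I g),
            Edge (ar_map F g) (Inr (x, f)), Edge (i B (tgt I g)) (Inr (w f x, g))))) \<and>
    (\<forall>f \<in> arr I. \<forall>u \<in> arr (ob_map W (src I f)).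
      P (Edge (ar_map F f) (Inl (src I f, u)), Edge (i B (tgt I f)) (Inr (tgt (ob_map W (src I f)) u, f)),
            Edge (i B (tgt I f)) (Inr (src (ob_map W (src I f)) u, f)), Edge (i B (tgt I f)) (Inl (tgt I f, cf_ar (ar_map W f) u)))) \<and>
    (\<forall>\<gamma> \<in> cell I. \<forall>x \<in> obj (ob_map W (src I (vsrc I \<gamma>))).
      P (Cell (cell_map F \<gamma>) (x, src I (vsrc I \<gamma>)), Edge (i B (tgt I (vsrc I \<gamma>))) (Inr (x, vtgt I \<gamma>)),
             Edge (i B (tgt I (vsrc I \<gamma>))) (Inr (x, vsrc I \<gamma>)), Edge (i B (tgt I (vsrc I \<gamma>))) (Inl (tgt I (vsrc I \<gamma>), cn_at (cell_map W \<gamma>) x))))"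
  unfolding weighted_diag_def Let_def i_def c_def w_def
  by (simp add: ball_Un) (simp add: Ball_def split_beta; blast)

section \<open>Cylinders as generalised cones\<close>

locale weighted = W: two_functor I CAT W + F: two_functor I B F
  for I :: "('i, 'j, 'k) cat2" and W :: "('i, 'j, 'k, 'x, 'y) weight"
    and B :: "('o, 'a, 'c) cat2" (structure) and F :: "('i, 'j, 'k, 'o, 'a, 'c) fun2"
begin

abbreviation "WG \<equiv> weighted_diag I W B F"

lemma weight_category: "A \<in> obj I \<Longrightarrow> category (ob_map W A)"
  using W.ob_map_obj by (auto simp: CAT_def)

lemma weight_obj_typing:
  assumes "A \<in> obj I"
  shows "x \<in> obj (ob_map W A) \<Longrightarrow> ide (ob_map W A) x \<in> arr (ob_map W A)"
    "x \<in> obj (ob_map W A) \<Longrightarrow> src (ob_map W A) (ide (ob_map W A) x) = x"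
    "x \<in> obj (ob_map W A) \<Longrightarrow> tgt (ob_map W A) (ide (ob_map W A) x) = x"
    "u \<in> arr (ob_map W A) \<Longrightarrow> src (ob_map W A) u \<in> obj (ob_map W A)"
    "u \<in> arr (ob_map W A) \<Longrightarrow> tgt (ob_map W A) u \<in> obj (ob_map W A)"
    "\<lbrakk>u \<in> arr (ob_map W A); v \<in> arr (ob_map W A); tgt (ob_map W A) u = src (ob_map W A) v\<rbrakk>
      \<Longrightarrow> v \<cdot>\<^bsub>ob_map W A\<^esub> u \<in> arr (ob_map W A)"
    "\<lbrakk>u \<in> arr (ob_map W A); v \<in> arr (ob_map W A); tgt (ob_map W A) u = src (ob_map W A) v\<rbrakk>
      \<Longrightarrow> src (ob_map W A) (v \<cdot>\<^bsub>ob_map W A\<^esub> u) = src (ob_map W A) u"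
    "\<lbrakk>u \<in> arr (ob_map W A); v \<in> arr (ob_map W A); tgt (ob_map W A) u = src (ob_map W A) v\<rbrakk>
      \<Longrightarrow> tgt (ob_map W A) (v \<cdot>\<^bsub>ob_map W A\<^esub> u) = tgt (ob_map W A) v"
  using weight_category[OF assms] by (auto simp: category_def)

lemma weight_arr:
  assumes "f \<in> arr I"
  shows "ar_map W f \<in> CAT_arr" "cf_dom (ar_map W f) = ob_map W (src I f)" "cf_cod (ar_map W f) = ob_map W (tgt I f)"
  using W.map_typing(2-4)[OF assms] by (simp_all add: CAT_def)

lemma weight_arr_typing:
  assumes "f \<in> arr I" "A = tgt I f"
  shows "x \<in> obj (ob_map W (src I f)) \<Longrightarrow> cf_ob (ar_map W f) x \<in> obj (ob_map W A)"
    "u \<in> arr (ob_map W (src I f)) \<Longrightarrow> cf_ar (ar_map W f) u \<in> arr (ob_map W A)"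
    "u \<in> arr (ob_map W (src I f)) \<Longrightarrow> src (ob_map W A) (cf_ar (ar_map W f) u) = cf_ob (ar_map W f) (src (ob_map W (src I f)) u)"
    "u \<in> arr (ob_map W (src I f)) \<Longrightarrow> tgt (ob_map W A) (cf_ar (ar_map W f) u) = cf_ob (ar_map W f) (tgt (ob_map W (src I f)) u)"
proof -
  interpret f: cat_functor "ob_map W (src I f)" "ob_map W A" "\<lparr>ob_map = cf_ob (ar_map W f), ar_map = cf_ar (ar_map W f)\<rparr>"
    using weight_arr[OF assms(1)] assms(2) by (auto simp: CAT_arr_def)
  show "x \<in> obj (ob_map W (src I f)) \<Longrightarrow> cf_ob (ar_map W f) x \<in> obj (ob_map W A)"
    using f.ob_map_obj by simp
  show "u \<in> arr (ob_map W (src I f)) \<Longrightarrow> cf_ar (ar_map W f) u \<in> arr (ob_map W A)"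
    "u \<in> arr (ob_map W (src I f)) \<Longrightarrow> src (ob_map W A) (cf_ar (ar_map W f) u) = cf_ob (ar_map W f) (src (ob_map W (src I f)) u)"
    "u \<in> arr (ob_map W (src I f)) \<Longrightarrow> tgt (ob_map W A) (cf_ar (ar_map W f) u) = cf_ob (ar_map W f) (tgt (ob_map W (src I f)) u)"
    using f.ar_map_hom[of u] by (simp_all add: hom_iff)
qed

lemma weight_functorial:
  "\<lbrakk>A \<in> obj I; x \<in> obj (ob_map W A)\<rbrakk> \<Longrightarrow> cf_ob (ar_map W (ide I A)) x = x"
  "\<lbrakk>f \<in> arr I; g \<in> arr I; tgt I f = src I g; x \<in> obj (ob_map W (src I f))\<rbrakk>
    \<Longrightarrow> cf_ob (ar_map W (g \<cdot>\<^bsub>I\<^esub> f)) x = cf_ob (ar_map W g) (cf_ob (ar_map W f) x)"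
  using W.ar_map_ide[of A] W.ar_map_comp[of f g] weight_arr[of f] by (simp_all add: CAT_def CAT_comp_def)

lemma weight_cell_typing:
  assumes "\<gamma> \<in> cell I" "x \<in> obj (ob_map W (src I (vsrc I \<gamma>)))"
  shows "cn_at (cell_map W \<gamma>) x \<in> arr (ob_map W (tgt I (vsrc I \<gamma>)))"
    "src (ob_map W (tgt I (vsrc I \<gamma>))) (cn_at (cell_map W \<gamma>) x) = cf_ob (ar_map W (vsrc I \<gamma>)) x"
    "tgt (ob_map W (tgt I (vsrc I \<gamma>))) (cn_at (cell_map W \<gamma>) x) = cf_ob (ar_map W (vtgt I \<gamma>)) x"
proof -
  have "cell_map W \<gamma> \<in> CAT_cell" "cn_src (cell_map W \<gamma>) = ar_map W (vsrc I \<gamma>)" "cn_tgt (cell_map W \<gamma>) = ar_map W (vtgt I \<gamma>)"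
    using W.map_typing(5-7)[OF assms(1)] by (simp_all add: CAT_def)
  then have "cn_at (cell_map W \<gamma>) x \<in> hom (ob_map W (tgt I (vsrc I \<gamma>))) (cf_ob (ar_map W (vsrc I \<gamma>)) x) (cf_ob (ar_map W (vtgt I \<gamma>)) x)"
    using assms(2) weight_arr[OF W.C.vsrc_arr[OF assms(1)]] by (auto simp: CAT_cell_def Let_def)
  then show "cn_at (cell_map W \<gamma>) x \<in> arr (ob_map W (tgt I (vsrc I \<gamma>)))"
    "src (ob_map W (tgt I (vsrc I \<gamma>))) (cn_at (cell_map W \<gamma>) x) = cf_ob (ar_map W (vsrc I \<gamma>)) x"
    "tgt (ob_map W (tgt I (vsrc I \<gamma>))) (cn_at (cell_map W \<gamma>) x) = cf_ob (ar_map W (vtgt I \<gamma>)) x"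
    by (simp_all add: hom_iff)
qed

lemmas wt = weight_obj_typing weight_arr_typing weight_functorial weight_cell_typing

lemma elements_category: "category (elements I W)"
  by unfold_locales (auto simp: elements_def wt W.C.calc)

lemma elements_simps:
  "(x, A) \<in> obj (elements I W) \<longleftrightarrow> A \<in> obj I \<and> x \<in> obj (ob_map W A)"
  "(x, f) \<in> arr (elements I W) \<longleftrightarrow> f \<in> arr I \<and> x \<in> obj (ob_map W (src I f))"
  by (auto simp: elements_def)

lemma weighted_diag_ok: "diag_ok B WG"
  unfolding diag_ok_def weighted_eqns
  by (auto simp: weighted_diag_def Let_def eqn_ok_def wt elements_def F.map_typing F.ar_map_ide F.ar_map_comp
      W.C.calc F.D.calc)

sublocale WG: diagram B WG
  by unfold_locales (rule weighted_diag_ok)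

definition Y where "Y \<xi> \<longleftrightarrow> fst \<xi> \<in> w_ext (obj I) (\<lambda>A. obj (ob_map W A)) \<and> snd \<xi> \<in> w_ext (obj I) (\<lambda>A. arr (ob_map W A))"
definition N where "N \<xi> = (\<lambda>(x, A). fst \<xi> A x)"
text \<open>A cylinder has no 2-cells at strict edges. Identities are supplied there, which are
  correctly typed exactly when the cylinder is natural on objects.\<close>

definition D where "D \<xi> = case_sum (\<lambda>(A, u). snd \<xi> A u) (\<lambda>(x, f). vide B (ar_map F f \<cdot> fst \<xi> (src I f) x))"

lemma cylinder_functor_iff:
  assumes A: "A \<in> obj I" and E: "E \<in> obj B"
  shows "cat_functor (ob_map W A) (hom_cat B E (ob_map F A)) \<lparr>ob_map = \<xi>, ar_map = \<xi>'\<rparr> \<longleftrightarrow>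
    (\<forall>x \<in> obj (ob_map W A). \<xi> x \<in> hom B E (ob_map F A)) \<and>
    (\<forall>u \<in> arr (ob_map W A). \<xi>' u \<in> cells B (\<xi> (src (ob_map W A) u)) (\<xi> (tgt (ob_map W A) u))) \<and>
    (\<forall>x \<in> obj (ob_map W A). \<xi>' (ide (ob_map W A) x) = vide B (\<xi> x)) \<and>
    (\<forall>u \<in> arr (ob_map W A). \<forall>v \<in> arr (ob_map W A). tgt (ob_map W A) u = src (ob_map W A) v \<longrightarrow>
      \<xi>' (v \<cdot>\<^bsub>ob_map W A\<^esub> u) = \<xi>' v \<bullet> \<xi>' u)"
proof -
  have h: "category (hom_cat B E (ob_map F A))"
    by unfold_locales (auto simp: hom_cat_def hom_iff cells_iff F.D.calc)
  have hh: "\<alpha> \<in> hom (hom_cat B E (ob_map F A)) f g \<longleftrightarrow> \<alpha> \<in> cells B f g \<and> f \<in> hom B E (ob_map F A)" for \<alpha> f g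
    by (auto simp: hom_def cells_def hom_cat_def)
  have p: "obj (hom_cat B E (ob_map F A)) = hom B E (ob_map F A)" "ide (hom_cat B E (ob_map F A)) = vide B"
    "comp (hom_cat B E (ob_map F A)) = vcomp B" by (simp_all add: hom_cat_def)
  show ?thesis
    unfolding cat_functor_def cat_functor_axioms_def hh p fun1.simps using weight_category[OF A] h weight_obj_typing(4)[OF A]
    by blast
qed

text \<open>The last clause, naturality on objects, is the requirement that the identity cell at
  \<open>Inr (x, f)\<close> has the codomain prescribed by the diagram.\<close>

lemma precone_weighted_iff:
  "precone B WG E (N \<xi>) (D \<xi>) \<longleftrightarrow> E \<in> obj B \<and>
    (\<forall>A \<in> obj I. \<forall>x \<in> obj (ob_map W A). fst \<xi> A x \<in> hom B E (ob_map F A)) \<and>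
    (\<forall>A \<in> obj I. \<forall>u \<in> arr (ob_map W A). snd \<xi> A u \<in> cells B (fst \<xi> A (src (ob_map W A) u)) (fst \<xi> A (tgt (ob_map W A) u))) \<and>
    (\<forall>f \<in> arr I. \<forall>x \<in> obj (ob_map W (src I f)). fst \<xi> (tgt I f) (cf_ob (ar_map W f) x) = ar_map F f \<cdot> fst \<xi> (src I f) x)"
proof -
  have n: "(\<forall>n \<in> nodes WG. N \<xi> n \<in> arr B \<and> src B (N \<xi> n) = E \<and> tgt B (N \<xi> n) = ob WG n) \<longleftrightarrow>
     (\<forall>A \<in> obj I. \<forall>x \<in> obj (ob_map W A). fst \<xi> A x \<in> hom B E (ob_map F A))"
    by (auto simp: weighted_diag_def Let_def elements_def N_def hom_iff)
  have e: "(\<forall>e \<in> edges WG. D \<xi> e \<in> cell B \<and> vsrc B (D \<xi> e) = eP WG e \<cdot> N \<xi> (es WG e) \<and>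
        vtgt B (D \<xi> e) = eQ WG e \<cdot> N \<xi> (et WG e)) \<longleftrightarrow>
     (\<forall>A \<in> obj I. \<forall>u \<in> arr (ob_map W A). snd \<xi> A u \<in> cells B (fst \<xi> A (src (ob_map W A) u)) (fst \<xi> A (tgt (ob_map W A) u))) \<and>
     (\<forall>f \<in> arr I. \<forall>x \<in> obj (ob_map W (src I f)). fst \<xi> (tgt I f) (cf_ob (ar_map W f) x) = ar_map F f \<cdot> fst \<xi> (src I f) x)"
    if p: "\<forall>A \<in> obj I. \<forall>x \<in> obj (ob_map W A). fst \<xi> A x \<in> hom B E (ob_map F A)"
  proof -
    have t: "fst \<xi> A x \<in> arr B" "src B (fst \<xi> A x) = E" "tgt B (fst \<xi> A x) = ob_map F A"
      if "A \<in> obj I" "x \<in> obj (ob_map W A)" for A x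
      using p that by (auto simp: hom_iff)
    show ?thesis
      by (simp add: weighted_diag_def Let_def elements_def N_def D_def ball_Un Ball_def[of "SIGMA x:_. _ x"]
          Ball_def[of "Collect _"] cells_iff t wt F.map_typing F.D.calc W.C.src_obj W.C.tgt_obj cong: conj_cong imp_cong)
        (auto simp: t wt F.map_typing F.D.calc W.C.src_obj W.C.tgt_obj)
  qed
  show ?thesis unfolding precone_def n using e by auto
qed

text \<open>Given the typing, four of the six families of equations become functoriality and
  naturality of the cylinder; the remaining two compare identity cells.\<close>

lemma cylinder_iff:
  assumes E: "E \<in> obj B"
  shows "cylinder I W B F E \<xi> \<longleftrightarrow> Y \<xi> \<and> scone B WG E (N \<xi>) (D \<xi>)"
proof -
  let ?nat = "(\<forall>f \<in> arr I. \<forall>u \<in> arr (ob_map W (src I f)).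
      snd \<xi> (tgt I f) (cf_ar (ar_map W f) u) = ar_map F f \<rhd> snd \<xi> (src I f) u)"
  let ?nat2 = "(\<forall>\<gamma> \<in> cell I. \<forall>x \<in> obj (ob_map W (src I (vsrc I \<gamma>))).
      snd \<xi> (tgt I (vsrc I \<gamma>)) (cn_at (cell_map W \<gamma>) x) = cell_map F \<gamma> \<lhd> fst \<xi> (src I (vsrc I \<gamma>)) x)"
  let ?ide = "(\<forall>A \<in> obj I. \<forall>x \<in> obj (ob_map W A). snd \<xi> A (ide (ob_map W A) x) = vide B (fst \<xi> A x))"
  let ?comp = "(\<forall>A \<in> obj I. \<forall>u \<in> arr (ob_map W A). \<forall>v \<in> arr (ob_map W A). tgt (ob_map W A) u = src (ob_map W A) v \<longrightarrow>
      snd \<xi> A (v \<cdot>\<^bsub>ob_map W A\<^esub> u) = snd \<xi> A v \<bullet> snd \<xi> A u)"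
  have eqs: "(\<forall>q \<in> eqns WG. eqn_holds B (N \<xi>) (D \<xi>) q) \<longleftrightarrow> ?ide \<and> ?comp \<and> ?nat \<and> ?nat2"
    and idc: "\<forall>e \<in> strict WG. identity_cell B (D \<xi> e)"
    if p: "precone B WG E (N \<xi>) (D \<xi>)"
  proof -
    note q = p[unfolded precone_weighted_iff]
    have t: "fst \<xi> A x \<in> arr B" "src B (fst \<xi> A x) = E" "tgt B (fst \<xi> A x) = ob_map F A"
      if "A \<in> obj I" "x \<in> obj (ob_map W A)" for A x
      using q that by (auto simp: hom_iff)
    have t': "snd \<xi> A u \<in> cell B" "vsrc B (snd \<xi> A u) = fst \<xi> A (src (ob_map W A) u)" "vtgt B (snd \<xi> A u) = fst \<xi> A (tgt (ob_map W A) u)"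
      if "A \<in> obj I" "u \<in> arr (ob_map W A)" for A u
      using q that by (auto simp: cells_iff)
    have nat: "fst \<xi> (tgt I f) (cf_ob (ar_map W f) x) = ar_map F f \<cdot> fst \<xi> (src I f) x"
      if "f \<in> arr I" "x \<in> obj (ob_map W (src I f))" for f x
      using q that by auto
    note all = t t' wt F.map_typing F.ar_map_ide F.ar_map_comp W.C.calc F.D.calc nat
    have cp: "fst \<xi> (tgt I g) (cf_ob (ar_map W g) (cf_ob (ar_map W f) x)) = ar_map F g \<cdot> (ar_map F f \<cdot> fst \<xi> (src I f) x)"
      if "f \<in> arr I" "g \<in> arr I" "tgt I f = src I g" "x \<in> obj (ob_map W (src I f))" for f g x
      using that nat[of g "cf_ob (ar_map W f) x"] nat[of f x] weight_arr_typing(1)[of f "src I g" x] by simp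
    have m: "fst \<xi> (src I g) (cf_ob (ar_map W f) x) = ar_map F f \<cdot> fst \<xi> (src I f) x"
      if "f \<in> arr I" "tgt I f = src I g" "x \<in> obj (ob_map W (src I f))" for f g x
      using that nat[of f x] by simp
    \<comment> \<open>The equations at strict edges hold here between identity cells
      (\<open>c3\<close>, \<open>c4\<close>). They belong to the diagram for the sake of lifted
      cones, where the cells are only invertible and \<open>rectifiable_weighted\<close> relies on
      them.\<close>
    have c3: "eqn_holds B (N \<xi>) (D \<xi>) (Edge (ide B (ob_map F A)) (Inr (x, ide I A)), Cell (vide B (ide B (ob_map F A))) (x, A),
        Cell (vide B (ide B (ob_map F A))) (x, A), Cell (vide B (ide B (ob_map F A))) (x, A))"
      if "A \<in> obj I" "x \<in> obj (ob_map W A)" for A x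
      using that by (simp add: eqn_holds_def N_def D_def all)
    have c4: "eqn_holds B (N \<xi>) (D \<xi>) (Edge (ide B (ob_map F (tgt I g))) (Inr (x, g \<cdot>\<^bsub>I\<^esub> f)),
        Cell (vide B (ide B (ob_map F (tgt I g)))) (cf_ob (ar_map W g) (cf_ob (ar_map W f) x), tgt I g),
        Edge (ar_map F g) (Inr (x, f)), Edge (ide B (ob_map F (tgt I g))) (Inr (cf_ob (ar_map W f) x, g)))"
      if "f \<in> arr I" "g \<in> arr I" "tgt I f = src I g" "x \<in> obj (ob_map W (src I f))" for f g x
    proof -
      have "cf_ob (ar_map W f) x \<in> obj (ob_map W (src I g))"
        using that weight_arr_typing(1)[of f "src I g" x] by simp
      then show ?thesis using that by (simp add: eqn_holds_def N_def D_def cp m all)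
    qed
    have c5: "eqn_holds B (N \<xi>) (D \<xi>) (Edge (ar_map F f) (Inl (src I f, u)), Edge (ide B (ob_map F (tgt I f))) (Inr (tgt (ob_map W (src I f)) u, f)),
            Edge (ide B (ob_map F (tgt I f))) (Inr (src (ob_map W (src I f)) u, f)), Edge (ide B (ob_map F (tgt I f))) (Inl (tgt I f, cf_ar (ar_map W f) u)))
       \<longleftrightarrow> snd \<xi> (tgt I f) (cf_ar (ar_map W f) u) = ar_map F f \<rhd> snd \<xi> (src I f) u"
      if "f \<in> arr I" "u \<in> arr (ob_map W (src I f))" for f u
      using that by (auto simp: eqn_holds_def N_def D_def all)
    have c6: "eqn_holds B (N \<xi>) (D \<xi>) (Cell (cell_map F \<gamma>) (x, src I (vsrc I \<gamma>)), Edge (ide B (ob_map F (tgt I (vsrc I \<gamma>)))) (Inr (x, vtgt I \<gamma>)),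
         Edge (ide B (ob_map F (tgt I (vsrc I \<gamma>)))) (Inr (x, vsrc I \<gamma>)), Edge (ide B (ob_map F (tgt I (vsrc I \<gamma>)))) (Inl (tgt I (vsrc I \<gamma>), cn_at (cell_map W \<gamma>) x)))
       \<longleftrightarrow> snd \<xi> (tgt I (vsrc I \<gamma>)) (cn_at (cell_map W \<gamma>) x) = cell_map F \<gamma> \<lhd> fst \<xi> (src I (vsrc I \<gamma>)) x"
      if "\<gamma> \<in> cell I" "x \<in> obj (ob_map W (src I (vsrc I \<gamma>)))" for \<gamma> x
      using that by (auto simp: eqn_holds_def N_def D_def all)
    have c1: "eqn_holds B (N \<xi>) (D \<xi>) (Edge (ide B (ob_map F A)) (Inl (A, ide (ob_map W A) x)), Cell (vide B (ide B (ob_map F A))) (x, A),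
        Cell (vide B (ide B (ob_map F A))) (x, A), Cell (vide B (ide B (ob_map F A))) (x, A)) \<longleftrightarrow> snd \<xi> A (ide (ob_map W A) x) = vide B (fst \<xi> A x)"
      if "A \<in> obj I" "x \<in> obj (ob_map W A)" for A x
      using that by (simp add: eqn_holds_def N_def D_def all)
    have c2: "eqn_holds B (N \<xi>) (D \<xi>) (Edge (ide B (ob_map F A)) (Inl (A, v \<cdot>\<^bsub>ob_map W A\<^esub> u)), Cell (vide B (ide B (ob_map F A))) (tgt (ob_map W A) v, A),
        Edge (ide B (ob_map F A)) (Inl (A, u)), Edge (ide B (ob_map F A)) (Inl (A, v))) \<longleftrightarrow> snd \<xi> A (v \<cdot>\<^bsub>ob_map W A\<^esub> u) = snd \<xi> A v \<bullet> snd \<xi> A u"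
      if "A \<in> obj I" "u \<in> arr (ob_map W A)" "v \<in> arr (ob_map W A)" "tgt (ob_map W A) u = src (ob_map W A) v" for A u v
      using that by (simp add: eqn_holds_def N_def D_def all)
    show "(\<forall>q \<in> eqns WG. eqn_holds B (N \<xi>) (D \<xi>) q) \<longleftrightarrow> ?ide \<and> ?comp \<and> ?nat \<and> ?nat2"
      unfolding weighted_eqns snd_conv by (simp add: c1 c2 c3 c4 c5 c6 cong: ball_cong imp_cong)
    show "\<forall>e \<in> strict WG. identity_cell B (D \<xi> e)"
      unfolding identity_cell_def by (auto simp: weighted_diag_def Let_def elements_def D_def all)
  qed
  have "cylinder I W B F E \<xi> \<longleftrightarrow> Y \<xi> \<and> precone B WG E (N \<xi>) (D \<xi>) \<and> ?ide \<and> ?comp \<and> ?nat \<and> ?nat2"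
    unfolding cylinder_def precone_weighted_iff split_beta Y_def by (auto simp: cylinder_functor_iff E)
  then show ?thesis unfolding scone_def gcone_def using eqs idc by blast
qed

end

lemma w_ext_eqI:
  assumes "\<xi> \<in> w_ext S X" "\<zeta> \<in> w_ext S X" "\<And>A x. \<lbrakk>A \<in> S; x \<in> X A\<rbrakk> \<Longrightarrow> \<xi> A x = \<zeta> A x"
  shows "\<xi> = \<zeta>"
proof (rule extensionalityI[of _ S])
  show "\<xi> A = \<zeta> A" if "A \<in> S" for A
    by (rule extensionalityI[of _ "X A"]) (use assms that in \<open>auto simp: w_ext_def\<close>)
qed (use assms in \<open>auto simp: w_ext_def\<close>)

lemma w_ext_restrict: "(\<lambda>A \<in> S. \<lambda>x \<in> X A. f A x) \<in> w_ext S X"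
  by (simp add: w_ext_def)

context weighted
begin

abbreviation "X \<mu> \<equiv> \<mu> \<in> w_ext (obj I) (\<lambda>A. obj (ob_map W A))"

lemma WG_simps:
  "nodes WG = obj (elements I W)" "edges WG = Inl ` (SIGMA A:obj I. arr (ob_map W A)) \<union> Inr ` arr (elements I W)"
  "strict WG = Inr ` arr (elements I W)" "ob WG n = ob_map F (snd n)"
  "es WG (Inl (A, u)) = (src (ob_map W A) u, A)" "et WG (Inl (A, u)) = (tgt (ob_map W A) u, A)"
  "es WG (Inr (x, f)) = (x, src I f)" "et WG (Inr (x, f)) = (cf_ob (ar_map W f) x, tgt I f)"
  "eP WG (Inl (A, u)) = ide B (ob_map F A)" "eQ WG (Inl (A, u)) = ide B (ob_map F A)"
  "eP WG (Inr (x, f)) = ar_map F f" "eQ WG (Inr (x, f)) = ide B (ob_map F (tgt I f))"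
  by (simp_all add: weighted_diag_def Let_def)

lemma ball_edges: "(\<forall>e \<in> edges WG. P e) \<longleftrightarrow> (\<forall>A \<in> obj I. \<forall>u \<in> arr (ob_map W A). P (Inl (A, u))) \<and>
    (\<forall>f \<in> arr I. \<forall>x \<in> obj (ob_map W (src I f)). P (Inr (x, f)))"
  by (auto simp: WG_simps elements_def)

text \<open>A strict cone has identities at the strict edges, so these cells are recovered from the
  arrows at nodes; the other data restrict to a cylinder-shaped pair.\<close>

lemma cone_surj:
  assumes s: "scone B WG E \<theta> \<theta>'"
  shows "\<exists>u. Y u \<and> (\<forall>n \<in> nodes WG. N u n = \<theta> n) \<and> (\<forall>e \<in> edges WG. D u e = \<theta>' e)"
proof -
  note t = WG.precone_typing[OF WG.scone_precone[OF s]]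
  let ?u = "(\<lambda>A \<in> obj I. \<lambda>x \<in> obj (ob_map W A). \<theta> (x, A), \<lambda>A \<in> obj I. \<lambda>u \<in> arr (ob_map W A). \<theta>' (Inl (A, u)))"
  have "\<theta>' (Inr (x, f)) = vide B (ar_map F f \<cdot> \<theta> (x, src I f))" if "f \<in> arr I" "x \<in> obj (ob_map W (src I f))" for x f
  proof -
    have e: "Inr (x, f) \<in> strict WG" "Inr (x, f) \<in> edges WG" using that by (auto simp: WG_simps elements_simps)
    then have "identity_cell B (\<theta>' (Inr (x, f)))" using s by (simp add: scone_def)
    then show ?thesis using F.D.identity_cell_iff[OF t(5)[OF e(2)]] t(6)[OF e(2)] by (simp add: WG_simps)
  qed
  then have "Y ?u \<and> (\<forall>n \<in> nodes WG. N ?u n = \<theta> n) \<and> (\<forall>e \<in> edges WG. D ?u e = \<theta>' e)"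
    by (auto simp: Y_def w_ext_restrict N_def D_def WG_simps elements_simps W.C.src_obj)
  then show ?thesis by blast
qed

lemma cone_inj:
  assumes "Y u" "Y u'" "\<And>n. n \<in> nodes WG \<Longrightarrow> N u n = N u' n" "\<And>e. e \<in> edges WG \<Longrightarrow> D u e = D u' e"
  shows "u = u'"
proof (rule prod_eqI)
  show "fst u = fst u'"
  proof (rule w_ext_eqI)
    show "fst u A x = fst u' A x" if "A \<in> obj I" "x \<in> obj (ob_map W A)" for A x
      using assms(3)[of "(x, A)"] that by (simp add: N_def WG_simps elements_simps)
  qed (use assms in \<open>auto simp: Y_def\<close>)
  show "snd u = snd u'"
  proof (rule w_ext_eqI)
    show "snd u A x = snd u' A x" if "A \<in> obj I" "x \<in> arr (ob_map W A)" for A x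
      using assms(4)[of "Inl (A, x)"] that by (auto simp: D_def WG_simps)
  qed (use assms in \<open>auto simp: Y_def\<close>)
qed

sublocale enc: cone_encoding B WG Y N D X "\<lambda>\<mu> (x, A). \<mu> A x"
  "\<lambda>\<xi>. \<lambda>A \<in> obj I. \<lambda>x \<in> obj (ob_map W A). vide B (fst \<xi> A x)"
  "\<lambda>\<nu> \<mu>. \<lambda>A \<in> obj I. \<lambda>x \<in> obj (ob_map W A). \<nu> A x \<bullet> \<mu> A x"
proof (unfold_locales, goal_cases)
  case (1 E \<theta> \<theta>')
  then show ?case by (rule cone_surj)
next
  case (2 u u')
  then show ?case by (rule cone_inj)
next
  case (3 \<alpha>)
  show ?case
    by (rule exI[of _ "\<lambda>A \<in> obj I. \<lambda>x \<in> obj (ob_map W A). \<alpha> (x, A)"])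
      (auto simp: w_ext_restrict WG_simps elements_simps)
next
  case (4 v v')
  show ?case
  proof (rule w_ext_eqI[OF 4(1,2)])
    show "v A x = v' A x" if "A \<in> obj I" "x \<in> obj (ob_map W A)" for A x
      using 4(3)[of "(x, A)"] that by (simp add: WG_simps elements_simps)
  qed
qed (auto simp: w_ext_restrict WG_simps elements_simps N_def)

text \<open>Naturality at an edge \<open>Inl (A, u)\<close> is naturality of the component at
  \<open>A\<close>. At \<open>Inr (x, f)\<close> both cells of the cones are identities, which
  leaves the compatibility of \<open>\<mu>\<close> with \<open>f\<close>.\<close>

lemma modification_iff:
  assumes s: "scone B WG E (N \<xi>) (D \<xi>)" "scone B WG E (N \<zeta>) (D \<zeta>)"
  shows "modification I W B F \<xi> \<zeta> \<mu> \<longleftrightarrow> X \<mu> \<and> gmor B WG (N \<xi>) (D \<xi>) (N \<zeta>) (D \<zeta>) (\<lambda>(x, A). \<mu> A x)"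
proof -
  note q = WG.scone_precone[OF s(1), unfolded precone_weighted_iff] WG.scone_precone[OF s(2), unfolded precone_weighted_iff]
  let ?t = "\<forall>A \<in> obj I. \<forall>x \<in> obj (ob_map W A). \<mu> A x \<in> cells B (fst \<xi> A x) (fst \<zeta> A x)"
  have n: "(\<forall>n \<in> nodes WG. (case n of (x, A) \<Rightarrow> \<mu> A x) \<in> cell B \<and> vsrc B (case n of (x, A) \<Rightarrow> \<mu> A x) = N \<xi> n \<and>
      vtgt B (case n of (x, A) \<Rightarrow> \<mu> A x) = N \<zeta> n) \<longleftrightarrow> ?t"
    by (auto simp: WG_simps elements_def N_def cells_iff)
  have e: "(\<forall>e \<in> edges WG. D \<zeta> e \<bullet> (eP WG e \<rhd> (case es WG e of (x, A) \<Rightarrow> \<mu> A x)) =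
        (eQ WG e \<rhd> (case et WG e of (x, A) \<Rightarrow> \<mu> A x)) \<bullet> D \<xi> e) \<longleftrightarrow>
     (\<forall>A \<in> obj I. \<forall>u \<in> arr (ob_map W A).
        snd \<zeta> A u \<bullet> \<mu> A (src (ob_map W A) u) = \<mu> A (tgt (ob_map W A) u) \<bullet> snd \<xi> A u) \<and>
     (\<forall>f \<in> arr I. \<forall>x \<in> obj (ob_map W (src I f)).
        \<mu> (tgt I f) (cf_ob (ar_map W f) x) = ar_map F f \<rhd> \<mu> (src I f) x)" if m: ?t
  proof -
    have t: "\<mu> A x \<in> cell B" "vsrc B (\<mu> A x) = fst \<xi> A x" "vtgt B (\<mu> A x) = fst \<zeta> A x"
      "src B (fst \<xi> A x) = E" "tgt B (fst \<xi> A x) = ob_map F A" "fst \<xi> A x \<in> arr B"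
      "src B (fst \<zeta> A x) = E" "tgt B (fst \<zeta> A x) = ob_map F A" "fst \<zeta> A x \<in> arr B"
      if "A \<in> obj I" "x \<in> obj (ob_map W A)" for A x
      using m q that by (auto simp: cells_iff hom_iff)
    have nat: "fst \<xi> (tgt I f) (cf_ob (ar_map W f) x) = ar_map F f \<cdot> fst \<xi> (src I f) x"
      "fst \<zeta> (tgt I f) (cf_ob (ar_map W f) x) = ar_map F f \<cdot> fst \<zeta> (src I f) x"
      if "f \<in> arr I" "x \<in> obj (ob_map W (src I f))" for f x
      using q that by auto
    note all = t nat wt F.map_typing W.C.src_obj W.C.tgt_obj F.D.calc
    have "(\<forall>A \<in> obj I. \<forall>u \<in> arr (ob_map W A). D \<zeta> (Inl (A, u)) \<bullet> (ide B (ob_map F A) \<rhd> \<mu> A (src (ob_map W A) u)) =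
        (ide B (ob_map F A) \<rhd> \<mu> A (tgt (ob_map W A) u)) \<bullet> D \<xi> (Inl (A, u))) \<longleftrightarrow>
      (\<forall>A \<in> obj I. \<forall>u \<in> arr (ob_map W A).
        snd \<zeta> A u \<bullet> \<mu> A (src (ob_map W A) u) = \<mu> A (tgt (ob_map W A) u) \<bullet> snd \<xi> A u)"
      by (intro ball_cong refl) (simp add: D_def all)
    moreover have "(\<forall>f \<in> arr I. \<forall>x \<in> obj (ob_map W (src I f)).
        D \<zeta> (Inr (x, f)) \<bullet> (ar_map F f \<rhd> \<mu> (src I f) x) =
        (ide B (ob_map F (tgt I f)) \<rhd> \<mu> (tgt I f) (cf_ob (ar_map W f) x)) \<bullet> D \<xi> (Inr (x, f))) \<longleftrightarrow>
      (\<forall>f \<in> arr I. \<forall>x \<in> obj (ob_map W (src I f)).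
        \<mu> (tgt I f) (cf_ob (ar_map W f) x) = ar_map F f \<rhd> \<mu> (src I f) x)"
      by (intro ball_cong refl) (auto simp: D_def all)
    ultimately show ?thesis
      unfolding ball_edges WG_simps(5-12) prod.case by simp
  qed
  show ?thesis unfolding modification_def gmor_def n using e by blast
qed

lemma weighted_limit_iff: "is_weighted_limit I W B F L \<xi> \<longleftrightarrow> Y \<xi> \<and> glim B WG L (N \<xi>) (D \<xi>)"
proof (cases "L \<in> obj B \<and> cylinder I W B F L \<xi>")
  case True
  then have L: "L \<in> obj B" and Y: "Y \<xi>" and s: "scone B WG L (N \<xi>) (D \<xi>)"
    using cylinder_iff[of L] by blast+
  have cat: "cylinder_cat I W B F E = enc.cones E" if E: "E \<in> obj B" for E
    unfolding cylinder_cat_def enc.cones_def using cylinder_iff[OF E] modification_iff[of E] by (auto 0 3)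
  note t = WG.scone_precone[OF s, unfolded precone_weighted_iff]
  have "(\<forall>E \<in> obj B. iso_of_categories (hom_cat B E L) (enc.cones E) (cyl_precomp_functor I W B \<xi>)) \<longleftrightarrow> glim B WG L (N \<xi>) (D \<xi>)"
  proof (rule enc.iso_iff_glim[OF Y L s, where w = "\<lambda>\<beta>. \<lambda>A \<in> obj I. \<lambda>x \<in> obj (ob_map W A). fst \<xi> A x \<rhd> \<beta>"])
    show "D (ob_map (cyl_precomp_functor I W B \<xi>) h) e = D \<xi> e \<lhd> h"
      if h: "h \<in> arr B" "tgt B h = L" and e: "e \<in> edges WG" for h e
    proof (cases e)
      case (Inl p)
      then show ?thesis using e by (auto simp: cyl_precomp_functor_def cyl_precomp_def D_def WG_simps)
    next
      case (Inr p)
      obtain x f where p: "p = (x, f)" by (cases p)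
      have f: "f \<in> arr I" "x \<in> obj (ob_map W (src I f))" using e by (auto simp: Inr p WG_simps elements_simps)
      have "fst \<xi> (src I f) x \<in> hom B L (ob_map F (src I f))" using t f W.C.src_obj by blast
      then show ?thesis using h f
        by (simp add: Inr p cyl_precomp_functor_def cyl_precomp_def D_def hom_iff F.map_typing F.D.calc W.C.src_obj)
    qed
  qed (auto simp: cyl_precomp_functor_def cyl_precomp_def Y_def w_ext_restrict N_def WG_simps elements_simps)
  then show ?thesis using True Y by (simp add: is_weighted_limit_def cat)
next
  case False
  then show ?thesis using cylinder_iff[of L \<xi>] by (auto simp: is_weighted_limit_def glim_def)
qed

text \<open>As in the lax case, with the category of elements in place of the subcategory of
  \<open>\<Sigma>\<close>: its arrows are the strict edges, and the third and fourth families of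
  \<open>weighted_eqns\<close> give the conditions of \<open>rectifiable_forward\<close>.\<close>

lemma rectifiable_weighted:
  assumes I0: "initial_choice (elements I W) I\<^sub>0"
  shows "rectifiable B WG I\<^sub>0"
proof -
  interpret E: category "elements I W" by (rule elements_category)
  obtain r z where rz: "\<And>n. n \<in> obj (elements I W) \<Longrightarrow> r n \<in> I\<^sub>0 \<and> z n \<in> hom (elements I W) (r n) n"
    "\<And>f. f \<in> arr (elements I W) \<Longrightarrow> f \<cdot>\<^bsub>elements I W\<^esub> z (src (elements I W) f) = z (tgt (elements I W) f)"
    "\<And>n. n \<in> I\<^sub>0 \<Longrightarrow> n \<in> obj (elements I W) \<and> z n = ide (elements I W) n"
    by (rule E.initial_choice_arrows[OF I0]) (rule that)
  have ends: "es WG (Inr a) = src (elements I W) a" "et WG (Inr a) = tgt (elements I W) a"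
    "eQ WG (Inr a) = ide B (ob_map F (snd (tgt (elements I W) a)))" for a
    by (cases a; simp add: WG_simps elements_def)+
  show ?thesis
  proof (rule WG.rectifiable_forward[where r = r and z = "\<lambda>n. Inr (z n)"])
    show "I\<^sub>0 \<subseteq> nodes WG" using rz(3) by (auto simp: WG_simps)
    show "r n \<in> I\<^sub>0 \<and> Inr (z n) \<in> strict WG \<and> es WG (Inr (z n)) = r n \<and> et WG (Inr (z n)) = n \<and> eQ WG (Inr (z n)) = ide B (ob WG n)"
      if "n \<in> nodes WG" for n
      using that rz(1)[of n] by (simp add: ends hom_iff) (simp add: WG_simps)
    fix E \<phi> \<phi>' assume g: "gcone B WG E \<phi> \<phi>'"
    note t = WG.precone_typing[OF WG.gcone_precone[OF g]]
    have q: "\<forall>q \<in> eqns WG. eqn_holds B \<phi> \<phi>' q" using g by (simp add: gcone_def)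
    have et: "\<phi>' (Inr (x, f)) \<in> cell B \<and> vsrc B (\<phi>' (Inr (x, f))) = ar_map F f \<cdot> \<phi> (x, src I f) \<and>
        vtgt B (\<phi>' (Inr (x, f))) = \<phi> (cf_ob (ar_map W f) x, tgt I f)"
      if "f \<in> arr I" "x \<in> obj (ob_map W (src I f))" for x f
      using t(5-7)[of "Inr (x, f)"] t(2-4)[of "(cf_ob (ar_map W f) x, tgt I f)"] that wt
      by (simp add: WG_simps elements_simps image_iff F.D.ide_cancel W.C.tgt_obj)
    have nt: "\<phi> (x, A) \<in> arr B \<and> src B (\<phi> (x, A)) = E \<and> tgt B (\<phi> (x, A)) = ob_map F A"
      if "A \<in> obj I" "x \<in> obj (ob_map W A)" for x A
      using t(2-4)[of "(x, A)"] that by (simp add: WG_simps elements_simps)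
    show "\<phi>' (Inr (z n)) = vide B (\<phi> n)" if "n \<in> I\<^sub>0" for n
    proof -
      obtain x A where n: "n = (x, A)" by (cases n)
      have A: "A \<in> obj I" "x \<in> obj (ob_map W A)" using rz(3)[OF that] by (auto simp: n elements_simps)
      have "eqn_holds B \<phi> \<phi>' (Edge (ide B (ob_map F A)) (Inr (x, ide I A)), Cell (vide B (ide B (ob_map F A))) (x, A),
          Cell (vide B (ide B (ob_map F A))) (x, A), Cell (vide B (ide B (ob_map F A))) (x, A))"
        using q A unfolding weighted_eqns by simp
      then have "\<phi>' (Inr (x, ide I A)) = vide B (\<phi> (x, A))"
        using et[of "ide I A" x] nt[of A x] A by (simp add: eqn_holds_def wt F.map_typing F.ar_map_ide W.C.calc F.D.calc)
      then show ?thesis using rz(3)[OF that] by (simp add: n elements_def)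
    qed
    fix e assume "e \<in> strict WG"
    then obtain y g where e: "e = Inr (y, g)" and g: "g \<in> arr I" "y \<in> obj (ob_map W (src I g))"
      by (auto simp: WG_simps elements_simps)
    then have yg: "(y, g) \<in> arr (elements I W)" by (simp add: elements_simps)
    have o: "(y, src I g) \<in> obj (elements I W)" using g by (simp add: elements_simps W.C.src_obj)
    \<comment> \<open>The arrow from the initial object to \<open>(y, src I g)\<close> is
      \<open>(x, f)\<close>; composed with \<open>(y, g)\<close> it must be the one to the target of
      \<open>(y, g)\<close>, which is \<open>zg\<close> below.\<close>
    obtain x f where zf: "z (y, src I g) = (x, f)" by (cases "z (y, src I g)")
    have f: "f \<in> arr I" "x \<in> obj (ob_map W (src I f))" "cf_ob (ar_map W f) x = y" "tgt I f = src I g"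
      using rz(1)[OF o] by (auto simp: zf hom_iff elements_def)
    have zg: "z (cf_ob (ar_map W g) y, tgt I g) = (x, g \<cdot>\<^bsub>I\<^esub> f)"
      using rz(2)[OF yg] by (simp add: elements_def zf)
    have gf: "g \<cdot>\<^bsub>I\<^esub> f \<in> arr I" "src I (g \<cdot>\<^bsub>I\<^esub> f) = src I f" "tgt I (g \<cdot>\<^bsub>I\<^esub> f) = tgt I g"
      "cf_ob (ar_map W (g \<cdot>\<^bsub>I\<^esub> f)) x = cf_ob (ar_map W g) y"
      using f g by (simp_all add: W.C.calc wt)
    let ?a = "\<phi>' (Inr (x, f))" and ?b = "\<phi>' (Inr (y, g))" and ?c = "\<phi>' (Inr (x, g \<cdot>\<^bsub>I\<^esub> f))"
      and ?i = "ide B (ob_map F (tgt I g))" and ?n = "(cf_ob (ar_map W g) y, tgt I g)"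
    have n: "\<phi> ?n \<in> arr B" "src B (\<phi> ?n) = E" "tgt B (\<phi> ?n) = ob_map F (tgt I g)"
      using nt[of "tgt I g" "cf_ob (ar_map W g) y"] weight_arr_typing(1)[OF g(1) refl g(2)] W.C.tgt_obj[OF g(1)] by simp_all
    have b: "?b \<in> cell B" "vsrc B ?b = ar_map F g \<cdot> \<phi> (y, src I g)" "vtgt B ?b = \<phi> ?n"
      using et[OF g] by simp_all
    have a: "?a \<in> cell B" "vtgt B ?a = \<phi> (y, src I g)"
      using et[OF f(1,2)] unfolding f(3,4) by simp_all
    have c: "?c \<in> cell B" "vtgt B ?c = \<phi> ?n"
      using et[of "g \<cdot>\<^bsub>I\<^esub> f" x] f(2) unfolding gf by (simp_all add: gf(1))
    have y: "src B (\<phi> (y, src I g)) = E" "tgt B (\<phi> (y, src I g)) = ob_map F (src I g)"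
      using nt[OF W.C.src_obj[OF g(1)] g(2)] by simp_all
    have v: "tgt B (vsrc B ?a) = ob_map F (src I g)" "tgt B (vsrc B ?b) = ob_map F (tgt I g)"
      "tgt B (vsrc B ?c) = ob_map F (tgt I g)"
      using F.D.cell_parallel_typing(2)[OF a(1)] F.D.cell_parallel_typing(2)[OF b(1)]
        F.D.cell_parallel_typing(2)[OF c(1)] unfolding a(2) b(3) c(2) n(3) y(2) by simp_all
    have "eqn_holds B \<phi> \<phi>' (Edge ?i (Inr (x, g \<cdot>\<^bsub>I\<^esub> f)),
        Cell (vide B ?i) (cf_ob (ar_map W g) (cf_ob (ar_map W f) x), tgt I g),
        Edge (ar_map F g) (Inr (x, f)), Edge ?i (Inr (cf_ob (ar_map W f) x, g)))"
      using q f g unfolding weighted_eqns snd_conv by blast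
    then have "(vide B ?i \<lhd> \<phi> ?n) \<bullet> (?i \<rhd> ?c) = (?i \<rhd> ?b) \<bullet> (ar_map F g \<rhd> ?a)"
      by (simp add: eqn_holds_def f(3))
    moreover have "?i \<rhd> ?c = ?c" "?i \<rhd> ?b = ?b"
      using b c v by (simp_all add: F.D.hide_cancel)
    moreover have "vide B ?i \<lhd> \<phi> ?n = vide B (\<phi> ?n)"
      using n F.map_typing(1)[OF W.C.tgt_obj[OF g(1)]] by (simp add: F.D.calc)
    ultimately have "?c = ?b \<bullet> (ar_map F g \<rhd> ?a)"
      using c by (simp add: F.D.vide_cancel)
    then show "\<phi>' e \<bullet> (eP WG e \<rhd> \<phi>' (Inr (z (es WG e)))) = eQ WG e \<rhd> \<phi>' (Inr (z (et WG e)))"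
      using c v by (simp add: e WG_simps zf zg F.D.hide_cancel)
  qed
qed

end

section \<open>Creation of PIE-weighted limits\<close>

context algebras
begin

lemma weighted_limit_creation:
  assumes W: "two_functor I CAT W" and F: "two_functor I Alg F"
    and I0: "initial_choice (elements I W) I\<^sub>0" and lim: "is_weighted_limit I W K (forget \<circ>\<^sub>2 F) L \<xi>"
  shows "\<exists>L' \<xi>'. is_weighted_limit I W Alg F L' \<xi>' \<and> fst L' = L \<and> map_cyl I W forget \<xi>' = \<xi> \<and>
     (\<forall>(x, A) \<in> I\<^sub>0. strict_mor K (fst \<xi>' A x)) \<and> jointly_detect_strictness K T i m L' I\<^sub>0 (\<lambda>(x, A). fst \<xi>' A x)"
    and "is_weighted_limit I W Alg F M \<rho> \<Longrightarrow>
      is_weighted_limit I W K (forget \<circ>\<^sub>2 F) (fst M) (map_cyl I W forget \<rho>)"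
proof -
  interpret WF: weighted I W "Alg" F
    by (intro weighted.intro W F)
  interpret WU: weighted I W K "forget \<circ>\<^sub>2 F"
    by (intro weighted.intro W forget_functor F)
  have G: "alg_diagram K T i m WF.WG"
    by (intro alg_diagram.intro algebras_axioms WF.WG.diagram_axioms)
  have rect: "rectifiable K (dimage forget WF.WG) I\<^sub>0"
    unfolding dimage_weighted by (rule WU.rectifiable_weighted[OF I0])
  note tr = alg_diagram.transfer[OF G rect, of "is_weighted_limit I W Alg F" WF.Y WF.N WF.D
      "is_weighted_limit I W K (forget \<circ>\<^sub>2 F)" WU.Y WU.N WU.D "map_cyl I W forget" L \<xi>,
      unfolded dimage_weighted, OF WF.weighted_limit_iff WU.weighted_limit_iff]
  have 2: "u = u'" if "WU.Y u" "WU.Y u'"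
    "\<And>n. n \<in> nodes WF.WG \<Longrightarrow> WU.N u n = WU.N u' n" "\<And>e. e \<in> edges WF.WG \<Longrightarrow> WU.D u e = WU.D u' e" for u u'
    by (rule WU.cone_inj) (use that in \<open>simp_all add: WF.WG_simps WU.WG_simps\<close>)
  have 3: "WU.Y (map_cyl I W forget u)" for u
    by (simp add: WU.Y_def map_cyl_def w_ext_restrict)
  have 4: "WU.N (map_cyl I W forget u) n = ps_arr (WF.N u n)" if "n \<in> nodes WF.WG" for u n
    using that by (cases n) (simp add: WU.N_def WF.N_def map_cyl_def WF.WG_simps WF.elements_simps)
  \<comment> \<open>At strict edges both sides are identity cells, and the forgetful 2-functor
    preserves the arrows on which they are identities.\<close>
  have 5: "WU.D (map_cyl I W forget u) e = ac_cell (WF.D u e)" if "e \<in> edges WF.WG" for u e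
  proof -
    have "ar_map (forget \<circ>\<^sub>2 F) f = ps_arr (ar_map F f)" for f by (simp add: comp_fun2_def)
    then show ?thesis
      using that WF.W.C.src_obj
      by (cases e) (auto simp: WU.D_def WF.D_def map_cyl_def WF.WG_simps WF.elements_simps)
  qed
  have "\<exists>L' \<xi>'. is_weighted_limit I W Alg F L' \<xi>' \<and> fst L' = L \<and> map_cyl I W forget \<xi>' = \<xi> \<and>
     (\<forall>n \<in> I\<^sub>0. strict_mor K (WF.N \<xi>' n)) \<and> jointly_detect_strictness K T i m L' I\<^sub>0 (WF.N \<xi>')"
    by (rule tr(1)[OF _ _ _ _ _ lim]) (erule WF.cone_surj, (rule 2; simp), rule 3, erule 4, erule 5)
  then show "\<exists>L' \<xi>'. is_weighted_limit I W Alg F L' \<xi>' \<and> fst L' = L \<and> map_cyl I W forget \<xi>' = \<xi> \<and>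
     (\<forall>(x, A) \<in> I\<^sub>0. strict_mor K (fst \<xi>' A x)) \<and> jointly_detect_strictness K T i m L' I\<^sub>0 (\<lambda>(x, A). fst \<xi>' A x)"
    unfolding WF.N_def by (simp only: case_prod_unfold)
  show "is_weighted_limit I W Alg F M \<rho> \<Longrightarrow>
      is_weighted_limit I W K (forget \<circ>\<^sub>2 F) (fst M) (map_cyl I W forget \<rho>)"
    by (rule tr(2)[OF _ _ _ _ _ lim]) (erule WF.cone_surj, (rule 2; simp), rule 3, erule 4, erule 5)
qed

end

theorem corollary3p5:
  fixes K :: "('o, 'a, 'c) cat2"
    and T :: "('o, 'a, 'c, 'o, 'a, 'c) fun2"
    and i m :: "'o \<Rightarrow> 'a"
  assumes "two_category K" and "two_monad K T i m"
  shows
    "(\<forall>(I :: ('i, 'j, 'k) cat2) \<Sigma>. PIE_pair I \<Sigma> \<longrightarrow>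
        creates I (TAlg K T i m) forget
          (is_sigma_limit I \<Sigma> (TAlg K T i m)) (is_sigma_limit I \<Sigma> K) (map_cone I forget) \<and>
        (\<forall>I\<^sub>0 F L \<pi>. initial_choice (sigma_subcat I \<Sigma>) I\<^sub>0 \<and> two_functor I (TAlg K T i m) F \<and>
            is_sigma_limit I \<Sigma> K (forget \<circ>\<^sub>2 F) L \<pi> \<longrightarrow>
          (\<exists>L' \<pi>'. is_sigma_limit I \<Sigma> (TAlg K T i m) F L' \<pi>' \<and>
             ob_map forget L' = L \<and> map_cone I forget \<pi>' = \<pi> \<and>
             (\<forall>A \<in> I\<^sub>0. strict_mor K (fst \<pi>' A)) \<and>
             jointly_detect_strictness K T i m L' I\<^sub>0 (fst \<pi>'))))
   \<and> (\<forall>(I :: ('i, 'j, 'k) cat2) \<Sigma>. PIE_pair I \<Sigma> \<longrightarrow>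
        creates I (TAlg K T i m) forget
          (is_sigma_oplimit I \<Sigma> (TAlg K T i m)) (is_sigma_oplimit I \<Sigma> K) (map_cone I forget) \<and>
        (\<forall>I\<^sub>0 F L \<pi>. initial_choice (sigma_subcat I \<Sigma>) I\<^sub>0 \<and> two_functor I (TAlg K T i m) F \<and>
            is_sigma_oplimit I \<Sigma> K (forget \<circ>\<^sub>2 F) L \<pi> \<longrightarrow>
          (\<exists>L' \<pi>'. is_sigma_oplimit I \<Sigma> (TAlg K T i m) F L' \<pi>' \<and>
             ob_map forget L' = L \<and> map_cone I forget \<pi>' = \<pi> \<and>
             (\<forall>A \<in> I\<^sub>0. strict_mor K (fst \<pi>' A)) \<and>
             jointly_detect_strictness K T i m L' I\<^sub>0 (fst \<pi>'))))
   \<and> (\<forall>(I :: ('i, 'j, 'k) cat2) (W :: ('i, 'j, 'k, 'x, 'y) weight). PIE_weight I W \<longrightarrow>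
        creates I (TAlg K T i m) forget
          (is_weighted_limit I W (TAlg K T i m)) (is_weighted_limit I W K) (map_cyl I W forget) \<and>
        (\<forall>I\<^sub>0 F L \<xi>. initial_choice (elements I W) I\<^sub>0 \<and> two_functor I (TAlg K T i m) F \<and>
            is_weighted_limit I W K (forget \<circ>\<^sub>2 F) L \<xi> \<longrightarrow>
          (\<exists>L' \<xi>'. is_weighted_limit I W (TAlg K T i m) F L' \<xi>' \<and>
             ob_map forget L' = L \<and> map_cyl I W forget \<xi>' = \<xi> \<and>
             (\<forall>(x, A) \<in> I\<^sub>0. strict_mor K (fst \<xi>' A x)) \<and>
             jointly_detect_strictness K T i m L' I\<^sub>0 (\<lambda>(x, A). fst \<xi>' A x))))"
proof -
  interpret algebras K T i m
    by (intro algebras.intro algebras_axioms.intro assms)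
  show ?thesis
  proof (intro conjI allI impI, goal_cases)
    case (1 I \<Sigma>)
    \<comment> \<open>Any choice of initial objects will do here, since creation does not refer to
      it; it makes the diagram rectifiable.\<close>
    then obtain I\<^sub>0 where "indexing_pair I \<Sigma>" "initial_choice (sigma_subcat I \<Sigma>) I\<^sub>0"
      using initial_choice_exists unfolding PIE_pair_def by blast
    then show ?case unfolding creates_def forget_simps using sigma_limit_creation by blast
  next
    case (2 I \<Sigma> I\<^sub>0 F L \<pi>)
    then show ?case unfolding PIE_pair_def forget_simps using sigma_limit_creation(1) by blast
  next
    case (3 I \<Sigma>)
    then obtain I\<^sub>0 where "indexing_pair I \<Sigma>" "initial_choice (sigma_subcat I \<Sigma>) I\<^sub>0"
      using initial_choice_exists unfolding PIE_pair_def by blast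
    then show ?case unfolding creates_def forget_simps using sigma_oplimit_creation by blast
  next
    case (4 I \<Sigma> I\<^sub>0 F L \<pi>)
    then show ?case unfolding PIE_pair_def forget_simps using sigma_oplimit_creation(1) by blast
  next
    case (5 I W)
    then obtain I\<^sub>0 where "two_functor I CAT W" "initial_choice (elements I W) I\<^sub>0"
      using initial_choice_exists unfolding PIE_weight_def by blast
    then show ?case unfolding creates_def forget_simps using weighted_limit_creation by blast
  next
    case (6 I W I\<^sub>0 F L \<xi>)
    then show ?case unfolding PIE_weight_def forget_simps using weighted_limit_creation(1) by blast
  qed
qed

end
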